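(* Let $\mathcal T$ be an Ammann tiling in which the four edge lengths $a,b,d,j$ are pairwise distinct, and let $\mathcal P$ be its underlying Penrose tiling. Let $\mathcal T'$ be the Ammann tiling obtained from $\mathcal T$ by Ammann iteration, let $\mathcal P'$ be the tiling by rhombs produced by applying Penrose composition to $\mathcal P$ twice, and let $\mathcal R$ be the underlying Penrose tiling of $\mathcal T'$. Then $\mathcal P'=\mathcal R$.
   Context: Put $\theta=\pi/5$ and $\phi=\frac{1+\sqrt5}2$. A plane tiling is a countable family of closed topological disks covering the plane with pairwise disjoint interiors; it is admitted by a protoset if the protoset is a set of representatives of the congruence classes of its tiles. Labelled tiles. $A$ is a pentagon with vertices $1,2,3,4,5$ in cyclic order, interior angles $\alpha,\beta,\chi,\delta,\varepsilon$ at these vertices, and edges $a=(5,1)$, $b=(1,2)$, $c=(2,3)$, $d=(3,4)$, $e=(4,5)$. $B$ is a hexagon with vertices $6,7,8,9,10,11$ in cyclic order, interior angles $\gamma,\eta,\iota,\kappa,\lambda,\mu$, and edges $f=(11,6)$, $g=(6,7)$, $h=(7,8)$, $i=(8,9)$, $j=(9,10)$, $k=(10,11)$. $C$ is a pentagon with vertices $12,13,14,15,16$ in cyclic order, interior angles $\nu,\rho,\sigma,\tau,\omega$, and edges $l=(16,12)$, $m=(12,13)$, $n=(13,14)$, $o=(14,15)$, $p=(15,16)$. Edge letters also denote lengths. All three tiles are labelled in the same rotational sense. Ammann tiling. A tiling of the plane admitted by a protoset of three such tiles satisfying the edge relations $a=c=e=f=g=n$; $b=h=i=o$; $j=k=l=m$;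 $d=p$, and the angle relations $\varepsilon=\gamma=\nu=2\theta$; $\iota=\lambda=4\theta$; $\beta+\sigma=6\theta$; $\chi+\rho+\omega=10\theta$; $\delta+\tau+\eta=10\theta$; $\alpha+\kappa+\mu=10\theta$; $\alpha=\eta$; $\mu=\rho$. Underlying Penrose tiling. The Penrose tiling by rhombs from which the Ammann tiling arises by recomposition. Its edges are exactly the following diagonals of the Ammann tiles: $(2,5)$ in each $A$ tile, $(6,8)$ and $(6,10)$ in each $B$ tile, $(12,14)$ in each $C$ tile. (For $\mathcal T'$ use the labelling of its tiles described below.) Its tiles are thin rhombs (angles $\pi/5,4\pi/5$) and thick rhombs (angles $2\pi/5,3\pi/5$) with common side length, satisfying the Penrose matching rules: name the thin rhomb $ABCD$ with acute vertices $A,C$, and the thick rhomb $EFGH$ with acute vertices $E,G$; edges carry arrows of type 1: $A\to B$, $C\to B$, $E\to F$, $E\to H$, and of type 2: $A\to D$, $C\to D$, $F\to G$, $H\to G$, and tiles meet edge-to-edge with arrows of the same type and direction. (In this paragraph and the next, $A,\dots,H$ are rhomb vertices.) Recomposition. In a Penrose tiling label all rhombs so that $ABCD$ and $EFGH$ are all counterclockwise (or all clockwise). Choose a point $Q$ in the triangle $ABD$ of the thin rhomb; in every thin rhomb draw $QA,QB,QD$; in every thick rhomb let $R,S$ be such that orientation-preserving isometries take $(A,B,Q)$ to $(E,F,R)$ and $(D,A,Q)$ to $(G,H,S)$, and draw $RE,RF,RS,SG,SH$; erase the Penrose edges. Penrose composition applied twice. Scale so that $\mathcal P$ has side length $1$.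 Cut each thin rhomb along its short diagonal and each thick rhomb along its long diagonal, obtaining small triangles (sides $1,1,1/\phi$) and large triangles (sides $1,1,\phi$). First composition: amalgamate each small triangle with the unique adjacent large triangle (the one across its type 1 edge) such that erasing their common edge yields a triangle similar to the small one (sides $\phi,\phi,1$). The resulting tiling consists of these new triangles, now the large ones, and the unused triangles with sides $1,1,\phi$, now the small ones (halves of kites and darts). Second composition: amalgamate each now-small triangle with the unique adjacent now-large triangle such that erasing their common edge (of length $1$) yields a triangle similar to the now-small one (sides $\phi,\phi,\phi^2$). The resulting triangles (sides $\phi,\phi,1$ and $\phi,\phi,\phi^2$) pair up along their sides of length $1$, respectively $\phi^2$, to form thin and thick rhombs of side $\phi$; these are the tiles of $\mathcal P'$. Ammann iteration. Call a vertex of $\mathcal T$ exceptional if exactly four tiles meet there: an $A$ tile at its vertex $5$, a $C$ tile at its vertex $14$, an $A$ tile at its vertex $2$, and a $B$ tile at its vertex $6$. The edges of $\mathcal T'$ are the following segments: (1) in each $C$ tile of $\mathcal T$, the segment joining vertices $12$ and $15$; (2) in each $B$ tile, the segment joining vertices $7$ and $10$; (3) for each $A$ tile, its edge $e=(4,5)$, unless its vertex $5$ is exceptional; (4) at each exceptional vertex, the segment joining vertex $7$ of the $B$ tile there to vertex $1$ of the $A$ tile having its vertex $2$ there. All other edges of $\mathcal T$ are erased; the tiles of $\mathcal T'$ are the closed regions bounded by the segments (1)–(4). The tiles of $\mathcal T'$ are labelled $A',B',C'$ (with the same vertex and edge naming scheme as for $A,B,C$) in the rotational sense opposite to that of $\mathcal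 T$, so that segments of kind (1) are the edges $a',c',e',f',g',n'$, those of kind (2) are $b',h',i',o'$, those of kind (3) are $j',k',l',m'$, and those of kind (4) are $d',p'$. *)

theory Defs
  imports "HOL-Analysis.Analysis"
begin

section \<open>Plane tilings\<close>

definition isometry :: "(complex \<Rightarrow> complex) \<Rightarrow> bool" where
  "isometry f \<longleftrightarrow> (\<forall>x y. dist (f x) (f y) = dist x y)"

text \<open>An orientation-preserving isometry of the plane takes the points \<open>xs\<close> to the points \<open>ys\<close>,
  in the given order.\<close>

definition directly_congruent_points :: "complex list \<Rightarrow> complex list \<Rightarrow> bool" where
  "directly_congruent_points xs ys \<longleftrightarrow> (\<exists>u c. norm u = 1 \<and> ys = map (\<lambda>z. u * z + c) xs)"

definition congruent :: "complex set \<Rightarrow> complex set \<Rightarrow> bool" where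
  "congruent X Y \<longleftrightarrow> (\<exists>f. isometry f \<and> Y = f ` X)"

definition plane_tiling :: "complex set set \<Rightarrow> bool" where
  "plane_tiling \<T> \<longleftrightarrow>
     countable \<T> \<and> \<Union>\<T> = UNIV \<and>
     (\<forall>X\<in>\<T>. X homeomorphic (cball 0 1 :: complex set)) \<and>
     (\<forall>X\<in>\<T>. \<forall>Y\<in>\<T>. X \<noteq> Y \<longrightarrow> interior X \<inter> interior Y = {})"

definition admits :: "complex set set \<Rightarrow> complex set set \<Rightarrow> bool" where
  "admits \<S> \<T> \<longleftrightarrow>
     (\<forall>X\<in>\<T>. \<exists>!S. S \<in> \<S> \<and> congruent S X) \<and> (\<forall>S\<in>\<S>. \<exists>X\<in>\<T>. congruent S X)"

text \<open>The closed regions bounded by a family of segments.\<close>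

definition bounded_regions :: "complex set set \<Rightarrow> complex set set" where
  "bounded_regions \<E> = closure ` components (- \<Union>\<E>)"


section \<open>Polygons\<close>

text \<open>A polygon is given by the cyclic list of its vertices; an angle of size \<open>pi\<close> at a vertex
  is allowed.\<close>

fun polyline :: "complex list \<Rightarrow> real \<Rightarrow> complex" where
  "polyline (x # y # z # vs) = linepath x y +++ polyline (y # z # vs)"
| "polyline [x, y] = linepath x y"
| "polyline [x] = linepath x x"
| "polyline [] = linepath 0 0"

definition polygon_path :: "complex list \<Rightarrow> real \<Rightarrow> complex" where
  "polygon_path vs = polyline (vs @ [hd vs])"

definition polygon_region :: "complex list \<Rightarrow> complex set" where
  "polygon_region vs = path_image (polygon_path vs) \<union> inside (path_image (polygon_path vs))"

text \<open>The rotational sense of the vertices is the sign of the signed (shoelace) area.\<close>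

definition counterclockwise :: "complex list \<Rightarrow> bool" where
  "counterclockwise vs \<longleftrightarrow>
     0 < (\<Sum>i<length vs. Im (cnj (vs ! i) * vs ! (Suc i mod length vs)))"

text \<open>Interior angle, in the range from \<open>0\<close> to \<open>2 * pi\<close>, at the vertex \<open>v\<close> with predecessor
  \<open>u\<close> and successor \<open>w\<close>: the interior is swept by rotating counterclockwise from the edge towards
  \<open>w\<close> to the edge towards \<open>u\<close> if the polygon is labelled counterclockwise, and conversely if it is
  labelled clockwise.\<close>

definition interior_angle :: "bool \<Rightarrow> complex \<Rightarrow> complex \<Rightarrow> complex \<Rightarrow> real" where
  "interior_angle ccw u v w =
     (if ccw then Arg2pi ((u - v) / (w - v)) else Arg2pi ((w - v) / (u - v)))"


section \<open>Ammann tilings\<close>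

text \<open>Labelled tiles: the arguments are the vertices \<open>1,...,5\<close> of an \<open>A\<close> tile, \<open>6,...,11\<close> of a
  \<open>B\<close> tile and \<open>12,...,16\<close> of a \<open>C\<close> tile. A tiling is a set of labelled tiles.\<close>

datatype 'v ammann_tile =
    TileA 'v 'v 'v 'v 'v
  | TileB 'v 'v 'v 'v 'v 'v
  | TileC 'v 'v 'v 'v 'v

primrec tile_vertices :: "'v ammann_tile \<Rightarrow> 'v list" where
  "tile_vertices (TileA v1 v2 v3 v4 v5) = [v1, v2, v3, v4, v5]"
| "tile_vertices (TileB v6 v7 v8 v9 v10 v11) = [v6, v7, v8, v9, v10, v11]"
| "tile_vertices (TileC v12 v13 v14 v15 v16) = [v12, v13, v14, v15, v16]"

abbreviation tile_region :: "complex ammann_tile \<Rightarrow> complex set" where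
  "tile_region t \<equiv> polygon_region (tile_vertices t)"

text \<open>The edges \<open>a, c, e, f, g, n\<close>; the edges \<open>b, h, i, o\<close>; the edges \<open>d, p\<close>;
  the edges \<open>j, k, l, m\<close>.\<close>

primrec a_edges :: "complex ammann_tile \<Rightarrow> complex set set" where
  "a_edges (TileA v1 v2 v3 v4 v5) =
     {closed_segment v5 v1, closed_segment v2 v3, closed_segment v4 v5}"
| "a_edges (TileB v6 v7 v8 v9 v10 v11) = {closed_segment v11 v6, closed_segment v6 v7}"
| "a_edges (TileC v12 v13 v14 v15 v16) = {closed_segment v13 v14}"

primrec b_edges :: "complex ammann_tile \<Rightarrow> complex set set" where
  "b_edges (TileA v1 v2 v3 v4 v5) = {closed_segment v1 v2}"
| "b_edges (TileB v6 v7 v8 v9 v10 v11) = {closed_segment v7 v8, closed_segment v8 v9}"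
| "b_edges (TileC v12 v13 v14 v15 v16) = {closed_segment v14 v15}"

primrec d_edges :: "complex ammann_tile \<Rightarrow> complex set set" where
  "d_edges (TileA v1 v2 v3 v4 v5) = {closed_segment v3 v4}"
| "d_edges (TileB v6 v7 v8 v9 v10 v11) = {}"
| "d_edges (TileC v12 v13 v14 v15 v16) = {closed_segment v15 v16}"

primrec j_edges :: "complex ammann_tile \<Rightarrow> complex set set" where
  "j_edges (TileA v1 v2 v3 v4 v5) = {}"
| "j_edges (TileB v6 v7 v8 v9 v10 v11) = {closed_segment v9 v10, closed_segment v10 v11}"
| "j_edges (TileC v12 v13 v14 v15 v16) = {closed_segment v16 v12, closed_segment v12 v13}"

definition tile_edges :: "complex ammann_tile \<Rightarrow> complex set set" where
  "tile_edges t = a_edges t \<union> b_edges t \<union> d_edges t \<union> j_edges t"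

primrec tile_diagonals :: "complex ammann_tile \<Rightarrow> complex set set" where
  "tile_diagonals (TileA v1 v2 v3 v4 v5) = {closed_segment v2 v5}"
| "tile_diagonals (TileB v6 v7 v8 v9 v10 v11) = {closed_segment v6 v8, closed_segment v6 v10}"
| "tile_diagonals (TileC v12 v13 v14 v15 v16) = {closed_segment v12 v14}"

text \<open>Three labelled prototiles satisfying the edge and angle relations; the parameters \<open>a, b, d, j\<close>
  are the four edge lengths.\<close>

definition ammann_prototiles ::
  "real \<Rightarrow> real \<Rightarrow> real \<Rightarrow> real \<Rightarrow> complex ammann_tile set \<Rightarrow> bool" where
  "ammann_prototiles a b d j \<S> \<longleftrightarrow>
     (\<exists>v1 v2 v3 v4 v5 v6 v7 v8 v9 v10 v11 v12 v13 v14 v15 v16 ccw.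
        \<S> = {TileA v1 v2 v3 v4 v5, TileB v6 v7 v8 v9 v10 v11, TileC v12 v13 v14 v15 v16} \<and>
        (\<forall>t\<in>\<S>. simple_path (polygon_path (tile_vertices t)) \<and>
               counterclockwise (tile_vertices t) = ccw) \<and>
        (\<forall>x\<in>{dist v5 v1, dist v2 v3, dist v4 v5, dist v11 v6, dist v6 v7, dist v13 v14}. x = a) \<and>
        (\<forall>x\<in>{dist v1 v2, dist v7 v8, dist v8 v9, dist v14 v15}. x = b) \<and>
        (\<forall>x\<in>{dist v9 v10, dist v10 v11, dist v16 v12, dist v12 v13}. x = j) \<and>
        (\<forall>x\<in>{dist v3 v4, dist v15 v16}. x = d) \<and>
        (let \<theta> = pi / 5;
             \<alpha> = interior_angle ccw v5 v1 v2;
             \<beta> = interior_angle ccw v1 v2 v3;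
             chi = interior_angle ccw v2 v3 v4;
             \<delta> = interior_angle ccw v3 v4 v5;
             \<epsilon> = interior_angle ccw v4 v5 v1;
             \<gamma> = interior_angle ccw v11 v6 v7;
             \<eta> = interior_angle ccw v6 v7 v8;
             \<iota> = interior_angle ccw v7 v8 v9;
             \<kappa> = interior_angle ccw v8 v9 v10;
             lam = interior_angle ccw v9 v10 v11;
             \<mu> = interior_angle ccw v10 v11 v6;
             \<nu> = interior_angle ccw v16 v12 v13;
             \<rho> = interior_angle ccw v12 v13 v14;
             \<sigma> = interior_angle ccw v13 v14 v15;
             \<tau> = interior_angle ccw v14 v15 v16;
             \<omega> = interior_angle ccw v15 v16 v12
         in \<epsilon> = 2 * \<theta> \<and> \<gamma> = 2 * \<theta> \<and> \<nu> = 2 * \<theta> \<and> \<iota> = 4 * \<theta> \<and> lam = 4 * \<theta> \<and>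
            \<beta> + \<sigma> = 6 * \<theta> \<and> chi + \<rho> + \<omega> = 10 * \<theta> \<and> \<delta> + \<tau> + \<eta> = 10 * \<theta> \<and>
            \<alpha> + \<kappa> + \<mu> = 10 * \<theta> \<and> \<alpha> = \<eta> \<and> \<mu> = \<rho>))"

text \<open>As in the definition of a protoset, tiles may be reflected copies of the prototiles.\<close>

definition ammann_tiling ::
  "real \<Rightarrow> real \<Rightarrow> real \<Rightarrow> real \<Rightarrow> complex ammann_tile set \<Rightarrow> bool" where
  "ammann_tiling a b d j T \<longleftrightarrow>
     plane_tiling (tile_region ` T) \<and> inj_on tile_region T \<and>
     (\<exists>\<S>. ammann_prototiles a b d j \<S> \<and> card (tile_region ` \<S>) = 3 \<and>
          admits (tile_region ` \<S>) (tile_region ` T) \<and>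
          (\<forall>t\<in>T. \<exists>s\<in>\<S>. \<exists>f. isometry f \<and> t = map_ammann_tile f s))"


section \<open>Penrose tilings by rhombs\<close>

text \<open>Labelled rhombs \<open>Thin A B C D\<close> and \<open>Thick E F G H\<close>; the labels determine the arrows.\<close>

datatype 'v rhomb = Thin 'v 'v 'v 'v | Thick 'v 'v 'v 'v

primrec rhomb_vertices :: "'v rhomb \<Rightarrow> 'v set" where
  "rhomb_vertices (Thin A B C D) = {A, B, C, D}"
| "rhomb_vertices (Thick E F G H) = {E, F, G, H}"

primrec arrows1 :: "'v rhomb \<Rightarrow> ('v \<times> 'v) set" where
  "arrows1 (Thin A B C D) = {(A, B), (C, B)}"
| "arrows1 (Thick E F G H) = {(E, F), (E, H)}"

primrec arrows2 :: "'v rhomb \<Rightarrow> ('v \<times> 'v) set" where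
  "arrows2 (Thin A B C D) = {(A, D), (C, D)}"
| "arrows2 (Thick E F G H) = {(F, G), (H, G)}"

definition rhomb_region :: "complex rhomb \<Rightarrow> complex set" where
  "rhomb_region r = convex hull (rhomb_vertices r)"

definition rhomb_edges :: "complex rhomb \<Rightarrow> complex set set" where
  "rhomb_edges r = (\<lambda>(x, y). closed_segment x y) ` (arrows1 r \<union> arrows2 r)"

text \<open>A parallelogram with two adjacent sides of length \<open>l\<close> and the acute angle \<open>pi / 5\<close>
  (thin) or \<open>2 * pi / 5\<close> (thick) at \<open>A\<close>, respectively \<open>E\<close>, labelled in the sense \<open>ccw\<close>.\<close>

primrec rhomb_shape :: "bool \<Rightarrow> real \<Rightarrow> complex rhomb \<Rightarrow> bool" where
  "rhomb_shape ccw l (Thin A B C D) \<longleftrightarrow>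
     dist A B = l \<and> D - A = cis (if ccw then pi / 5 else - (pi / 5)) * (B - A) \<and> C = B + D - A"
| "rhomb_shape ccw l (Thick E F G H) \<longleftrightarrow>
     dist E F = l \<and> H - E = cis (if ccw then 2 * pi / 5 else - (2 * pi / 5)) * (F - E) \<and> G = F + H - E"

text \<open>A Penrose tiling with side length \<open>l\<close>, all of whose rhombs are labelled in the same
  rotational sense. This is no restriction: exchanging the two acute vertices of a thin rhomb or
  the two obtuse vertices of a thick rhomb reverses the sense and leaves the arrows unchanged.\<close>

definition penrose_tiling :: "real \<Rightarrow> complex rhomb set \<Rightarrow> bool" where
  "penrose_tiling l P \<longleftrightarrow>
     l > 0 \<and> (\<exists>ccw. \<forall>r\<in>P. rhomb_shape ccw l r) \<and>
     plane_tiling (rhomb_region ` P) \<and> inj_on rhomb_region P \<and>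
     (\<forall>r\<in>P. \<forall>s\<in>P. r \<noteq> s \<longrightarrow>
        rhomb_region r \<inter> rhomb_region s = {} \<or>
        (\<exists>v \<in> rhomb_vertices r \<inter> rhomb_vertices s. rhomb_region r \<inter> rhomb_region s = {v}) \<or>
        (\<exists>(x, y) \<in> (arrows1 r \<inter> arrows1 s) \<union> (arrows2 r \<inter> arrows2 s).
           rhomb_region r \<inter> rhomb_region s = closed_segment x y))"


section \<open>Recomposition\<close>

text \<open>\<open>Q\<^sub>0\<close> is the chosen point in the triangle \<open>A\<^sub>0 B\<^sub>0 D\<^sub>0\<close> of a thin rhomb; the points \<open>Q\<close> in
  the other thin rhombs, and \<open>R\<close> and \<open>S\<close> in the thick rhombs, are obtained from it by
  orientation-preserving isometries.\<close>

definition recomposition_segments ::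
  "complex rhomb set \<Rightarrow> complex \<Rightarrow> complex \<Rightarrow> complex \<Rightarrow> complex \<Rightarrow> complex set set" where
  "recomposition_segments P A\<^sub>0 B\<^sub>0 D\<^sub>0 Q\<^sub>0 =
     \<Union>{{closed_segment Q A, closed_segment Q B, closed_segment Q D} | A B C D Q.
         Thin A B C D \<in> P \<and> directly_congruent_points [A\<^sub>0, B\<^sub>0, D\<^sub>0, Q\<^sub>0] [A, B, D, Q]} \<union>
     \<Union>{{closed_segment R E, closed_segment R F, closed_segment R S,
          closed_segment S G, closed_segment S H} | E F G H R S.
         Thick E F G H \<in> P \<and> directly_congruent_points [A\<^sub>0, B\<^sub>0, Q\<^sub>0] [E, F, R] \<and>
         directly_congruent_points [D\<^sub>0, A\<^sub>0, Q\<^sub>0] [G, H, S]}"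

definition arises_by_recomposition :: "complex rhomb set \<Rightarrow> complex ammann_tile set \<Rightarrow> bool" where
  "arises_by_recomposition P T \<longleftrightarrow>
     (\<exists>A\<^sub>0 B\<^sub>0 C\<^sub>0 D\<^sub>0 Q\<^sub>0.
        Thin A\<^sub>0 B\<^sub>0 C\<^sub>0 D\<^sub>0 \<in> P \<and> Q\<^sub>0 \<in> convex hull {A\<^sub>0, B\<^sub>0, D\<^sub>0} \<and>
        (\<Union>t\<in>T. tile_edges t) = recomposition_segments P A\<^sub>0 B\<^sub>0 D\<^sub>0 Q\<^sub>0 \<and>
        tile_region ` T = bounded_regions (recomposition_segments P A\<^sub>0 B\<^sub>0 D\<^sub>0 Q\<^sub>0))"

text \<open>\<open>P\<close> is the underlying Penrose tiling, of side length \<open>l\<close>, of the Ammann tiling \<open>T\<close>.\<close>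

definition underlying_penrose_tiling ::
  "real \<Rightarrow> complex rhomb set \<Rightarrow> complex ammann_tile set \<Rightarrow> bool" where
  "underlying_penrose_tiling l P T \<longleftrightarrow>
     penrose_tiling l P \<and> arises_by_recomposition P T \<and>
     (\<Union>r\<in>P. rhomb_edges r) = (\<Union>t\<in>T. tile_diagonals t)"


section \<open>Penrose composition\<close>

definition golden :: real where
  "golden = (1 + sqrt 5) / 2"

definition triangle_with_sides :: "real \<Rightarrow> real \<Rightarrow> real \<Rightarrow> complex set \<Rightarrow> bool" where
  "triangle_with_sides p q r X \<longleftrightarrow>
     (\<exists>x y z. X = convex hull {x, y, z} \<and> dist x y = p \<and> dist y z = q \<and> dist z x = r)"

text \<open>The triangles \<open>X\<close> and \<open>Y\<close> are adjacent, with common edge \<open>x y\<close>.\<close>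

definition common_edge :: "complex \<Rightarrow> complex \<Rightarrow> complex set \<Rightarrow> complex set \<Rightarrow> bool" where
  "common_edge x y X Y \<longleftrightarrow>
     (\<exists>z w. X = convex hull {x, y, z} \<and> Y = convex hull {x, y, w}) \<and> X \<inter> Y = closed_segment x y"

text \<open>The two halves of the thin rhombs, each with the endpoints of its type 1 edge.\<close>

definition thin_halves :: "complex rhomb set \<Rightarrow> (complex set \<times> complex \<times> complex) set" where
  "thin_halves P = \<Union>{{(convex hull {A, B, D}, A, B), (convex hull {C, B, D}, C, B)} | A B C D.
                       Thin A B C D \<in> P}"

definition thick_halves :: "complex rhomb set \<Rightarrow> complex set set" where
  "thick_halves P = \<Union>{{convex hull {E, F, G}, convex hull {E, H, G}} | E F G H. Thick E F G H \<in> P}"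

text \<open>All lengths are multiplied by the side length \<open>l\<close> of the Penrose tiling. The relations
  \<open>first_pairs\<close> and \<open>second_pairs\<close> consist of the amalgamated pairs of a small triangle \<open>X\<close> and a
  large triangle \<open>Y\<close>.\<close>

definition first_pairs :: "real \<Rightarrow> complex rhomb set \<Rightarrow> (complex set \<times> complex set) set" where
  "first_pairs l P =
     {(X, Y). \<exists>x y. (X, x, y) \<in> thin_halves P \<and> Y \<in> thick_halves P \<and> common_edge x y X Y \<and>
        triangle_with_sides (l * golden) (l * golden) l (X \<union> Y)}"

definition first_large :: "real \<Rightarrow> complex rhomb set \<Rightarrow> complex set set" where
  "first_large l P = {X \<union> Y | X Y. (X, Y) \<in> first_pairs l P}"

definition first_small :: "real \<Rightarrow> complex rhomb set \<Rightarrow> complex set set" where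
  "first_small l P = {Y \<in> thick_halves P. \<nexists>X. (X, Y) \<in> first_pairs l P}"

definition second_pairs :: "real \<Rightarrow> complex rhomb set \<Rightarrow> (complex set \<times> complex set) set" where
  "second_pairs l P =
     {(X, Y). X \<in> first_small l P \<and> Y \<in> first_large l P \<and>
        (\<exists>x y. dist x y = l \<and> common_edge x y X Y) \<and>
        triangle_with_sides (l * golden) (l * golden) (l * golden\<^sup>2) (X \<union> Y)}"

definition second_large :: "real \<Rightarrow> complex rhomb set \<Rightarrow> complex set set" where
  "second_large l P = {X \<union> Y | X Y. (X, Y) \<in> second_pairs l P}"

definition second_small :: "real \<Rightarrow> complex rhomb set \<Rightarrow> complex set set" where
  "second_small l P = {Y \<in> first_large l P. \<nexists>X. (X, Y) \<in> second_pairs l P}"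

definition penrose_composition_twice :: "real \<Rightarrow> complex rhomb set \<Rightarrow> complex set set" where
  "penrose_composition_twice l P =
     {X \<union> Y | X Y. X \<in> second_small l P \<and> Y \<in> second_small l P \<and>
        (\<exists>x y. dist x y = l \<and> common_edge x y X Y)} \<union>
     {X \<union> Y | X Y. X \<in> second_large l P \<and> Y \<in> second_large l P \<and>
        (\<exists>x y. dist x y = l * golden\<^sup>2 \<and> common_edge x y X Y)}"


section \<open>Ammann iteration\<close>

definition exceptional :: "complex ammann_tile set \<Rightarrow> complex \<Rightarrow> bool" where
  "exceptional T v \<longleftrightarrow>
     (\<exists>u1 u2 u3 u4 w12 w13 w15 w16 x1 x3 x4 x5 y7 y8 y9 y10 y11.
        {t \<in> T. v \<in> tile_region t} =
          {TileA u1 u2 u3 u4 v, TileC w12 w13 v w15 w16,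
           TileA x1 v x3 x4 x5, TileB v y7 y8 y9 y10 y11})"

definition iteration_segments1 :: "complex ammann_tile set \<Rightarrow> complex set set" where
  "iteration_segments1 T =
     {closed_segment v12 v15 | v12 v13 v14 v15 v16. TileC v12 v13 v14 v15 v16 \<in> T}"

definition iteration_segments2 :: "complex ammann_tile set \<Rightarrow> complex set set" where
  "iteration_segments2 T =
     {closed_segment v7 v10 | v6 v7 v8 v9 v10 v11. TileB v6 v7 v8 v9 v10 v11 \<in> T}"

definition iteration_segments3 :: "complex ammann_tile set \<Rightarrow> complex set set" where
  "iteration_segments3 T =
     {closed_segment v4 v5 | v1 v2 v3 v4 v5. TileA v1 v2 v3 v4 v5 \<in> T \<and> \<not> exceptional T v5}"

definition iteration_segments4 :: "complex ammann_tile set \<Rightarrow> complex set set" where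
  "iteration_segments4 T =
     {closed_segment v7 v1 | v v1 v3 v4 v5 v7 v8 v9 v10 v11.
        exceptional T v \<and> TileB v v7 v8 v9 v10 v11 \<in> T \<and> TileA v1 v v3 v4 v5 \<in> T}"

text \<open>\<open>T'\<close> is the labelled tiling obtained from \<open>T\<close>: its tiles are the closed regions bounded by
  the segments, labelled in the opposite sense with the prescribed edges.\<close>

definition ammann_iteration :: "complex ammann_tile set \<Rightarrow> complex ammann_tile set \<Rightarrow> bool" where
  "ammann_iteration T T' \<longleftrightarrow>
     tile_region ` T' = bounded_regions (iteration_segments1 T \<union> iteration_segments2 T \<union>
                                         iteration_segments3 T \<union> iteration_segments4 T) \<and>
     (\<Union>t\<in>T'. a_edges t) = iteration_segments1 T \<and>
     (\<Union>t\<in>T'. b_edges t) = iteration_segments2 T \<and>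
     (\<Union>t\<in>T'. j_edges t) = iteration_segments3 T \<and>
     (\<Union>t\<in>T'. d_edges t) = iteration_segments4 T \<and>
     (\<forall>t\<in>T. \<forall>t'\<in>T'.
        counterclockwise (tile_vertices t') \<noteq> counterclockwise (tile_vertices t))"

end

theory Submission
  imports Defs
begin

text \<open>The Penrose tiling \<open>P\<close> determines four kinds of segments of the recomposition: \<open>QA\<close>, \<open>RE\<close>, \<open>SH\<close>; \<open>QB\<close>, \<open>RF\<close>; \<open>QD\<close>,
  \<open>SG\<close>; and \<open>RS\<close>. They are the edges of \<open>T\<close>, and as \<open>a, b, d, j\<close> are distinct, the way in which the tiles
  arrange edges of equal length identifies the kinds with these lengths (\<open>lengths_identified\<close>) and locates
  the tiles in \<open>P\<close>: the vertices 12 and 15 of a \<open>C\<close> tile are \<open>G\<close> and \<open>R\<close> in a thick rhomb, the vertices 5 and 4 of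
  an \<open>A\<close> tile are \<open>E\<close> and \<open>R\<close>, and the vertices 10 and 7 of a \<open>B\<close> tile are \<open>D\<close> in a thin rhomb and \<open>R\<close> in the thick
  rhomb across its edge \<open>CB\<close> (\<open>C_tile_points\<close>, \<open>A_tile_points\<close>, \<open>B_tile_points\<close>). Hence the edges of kinds (1), (2) and (3)
  of the iterated tiling all start at points \<open>R\<close>. At one point \<open>R\<close> they lead to \<open>G\<close>, \<open>D\<close> and \<open>E\<close>, so the diagonals
  of the iterated tiles, which are the edges of the Penrose tiling underlying \<open>T'\<close>, are segments \<open>DG\<close> or \<open>EG\<close>
  (\<open>iteration_diagonals\<close>). These segments form the set \<open>edge_pool\<close>, and all of them have the length
  \<open>l * golden\<close>, the side length of the composed rhombs.

  Around a vertex of \<open>P\<close> the matching rules leave few possibilities (\<open>after_C\<close>, \<open>thin_mate\<close>, \<open>thick_partner\<close>). This describes the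
  composition explicitly (\<open>penrose_composition_twice_eq\<close>): a composed thin rhomb arises where two thin rhombs share a type 2 edge,
  a composed thick rhomb around each vertex with the corners \<open>C, E, A, F, H\<close>. A composed rhomb is assembled from
  halves of rhombs of \<open>P\<close>. No segment of the pool passes through the interior of a half or through the midpoint of
  an erased edge, apart from long diagonals inside composed thick rhombs. Such a diagonal starts at a vertex
  at which no other segment of the pool ends, and therefore is not an edge of a rhomb tiling with
  edges in the pool. So each composed rhomb lies in a single rhomb of the new tiling; having
  sides of the same length, the two are equal (\<open>rhomb_in_rhomb\<close>, \<open>composition_of_coarser_tiling\<close>).\<close>

section \<open>Parallelograms\<close>

definition cross :: "complex \<Rightarrow> complex \<Rightarrow> real" where
  "cross x y = Im (cnj x * y)"

lemma cross_simps [simp]: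
  "cross x x = 0" "cross x 0 = 0" "cross 0 x = 0"
  "cross (x + y) w = cross x w + cross y w" "cross w (x + y) = cross w x + cross w y"
  "cross (x - y) w = cross x w - cross y w" "cross w (x - y) = cross w x - cross w y"
  "cross (- x) w = - cross x w" "cross w (- x) = - cross w x"
  "cross (of_real t * x) w = t * cross x w" "cross w (of_real t * x) = t * cross w x"
  by (simp_all add: cross_def algebra_simps)

lemma cross_commute: "cross y x = - cross x y"
  by (simp add: cross_def)

lemma coordinates_unique:
  assumes "cross a b \<noteq> 0"
    and "of_real \<alpha> * a + of_real \<beta> * b = of_real \<alpha>' * a + of_real \<beta>' * b"
  shows "\<alpha> = \<alpha>' \<and> \<beta> = \<beta>'"
proof -
  have "cross (of_real \<alpha> * a + of_real \<beta> * b) b = cross (of_real \<alpha>' * a + of_real \<beta>' * b) b"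
    "cross a (of_real \<alpha> * a + of_real \<beta> * b) = cross a (of_real \<alpha>' * a + of_real \<beta>' * b)"
    using assms(2) by simp_all
  with assms(1) show ?thesis by simp
qed

lemma coordinates_exist:
  assumes "cross a b \<noteq> 0"
  shows "x = of_real (cross x b / cross a b) * a + of_real (cross a x / cross a b) * b"
proof -
  have "of_real (cross a b) * x = of_real (cross x b) * a + of_real (cross a x) * b"
    by (simp add: cross_def complex_eq_iff algebra_simps)
  hence "x = (of_real (cross x b) * a + of_real (cross a x) * b) / of_real (cross a b)"
    using assms by (simp add: field_simps)
  thus ?thesis by (simp add: add_divide_distrib)
qed

definition parallelogram :: "complex \<Rightarrow> complex \<Rightarrow> complex \<Rightarrow> complex set" where
  "parallelogram v a b = {v + (of_real \<alpha> * a + of_real \<beta> * b) | \<alpha> \<beta>. 0 \<le> \<alpha> \<and> \<alpha> \<le> 1 \<and> 0 \<le> \<beta> \<and> \<beta> \<le> 1}"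

definition open_parallelogram :: "complex \<Rightarrow> complex \<Rightarrow> complex \<Rightarrow> complex set" where
  "open_parallelogram v a b = {v + (of_real \<alpha> * a + of_real \<beta> * b) | \<alpha> \<beta>. 0 < \<alpha> \<and> \<alpha> < 1 \<and> 0 < \<beta> \<and> \<beta> < 1}"

lemma box_iff:
  assumes "cross a b \<noteq> 0"
  shows "v + (of_real \<alpha> * a + of_real \<beta> * b) \<in> parallelogram v a b \<longleftrightarrow> 0 \<le> \<alpha> \<and> \<alpha> \<le> 1 \<and> 0 \<le> \<beta> \<and> \<beta> \<le> 1"
proof
  assume "v + (of_real \<alpha> * a + of_real \<beta> * b) \<in> parallelogram v a b"
  then obtain \<alpha>' \<beta>' where "of_real \<alpha> * a + of_real \<beta> * b = of_real \<alpha>' * a + of_real \<beta>' * b"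
    "0 \<le> \<alpha>'" "\<alpha>' \<le> 1" "0 \<le> \<beta>'" "\<beta>' \<le> 1"
    unfolding parallelogram_def by auto
  thus "0 \<le> \<alpha> \<and> \<alpha> \<le> 1 \<and> 0 \<le> \<beta> \<and> \<beta> \<le> 1"
    using coordinates_unique[OF assms] by metis
qed (unfold parallelogram_def, blast)

lemma open_box_iff:
  assumes "cross a b \<noteq> 0"
  shows "v + (of_real \<alpha> * a + of_real \<beta> * b) \<in> open_parallelogram v a b \<longleftrightarrow> 0 < \<alpha> \<and> \<alpha> < 1 \<and> 0 < \<beta> \<and> \<beta> < 1"
proof
  assume "v + (of_real \<alpha> * a + of_real \<beta> * b) \<in> open_parallelogram v a b"
  then obtain \<alpha>' \<beta>' where "of_real \<alpha> * a + of_real \<beta> * b = of_real \<alpha>' * a + of_real \<beta>' * b"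
    "0 < \<alpha>'" "\<alpha>' < 1" "0 < \<beta>'" "\<beta>' < 1"
    unfolding open_parallelogram_def by auto
  thus "0 < \<alpha> \<and> \<alpha> < 1 \<and> 0 < \<beta> \<and> \<beta> < 1"
    using coordinates_unique[OF assms] by metis
qed (unfold open_parallelogram_def, blast)

lemma box_commute: "parallelogram v a b = parallelogram v b a" "open_parallelogram v a b = open_parallelogram v b a"
proof -
  have *: "of_real s * a + of_real t * b = of_real t * b + of_real s * a" for s t :: real
    by (rule add.commute)
  show "parallelogram v a b = parallelogram v b a" "open_parallelogram v a b = open_parallelogram v b a"
    unfolding parallelogram_def open_parallelogram_def by (subst *; blast)+
qed

lemma open_box_subset: "open_parallelogram v a b \<subseteq> parallelogram v a b"
  unfolding parallelogram_def open_parallelogram_def by (auto intro: less_imp_le)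

lemma convex_hull_box: "convex hull {v, v + a, v + (a + b), v + b} = parallelogram v a b"
proof
  have "convex (parallelogram v a b)"
  proof (rule convexI)
    fix x y :: complex and s t :: real
    assume "x \<in> parallelogram v a b" "y \<in> parallelogram v a b" and st: "0 \<le> s" "0 \<le> t" "s + t = 1"
    then obtain \<alpha> \<beta> \<alpha>' \<beta>' where
      x: "x = v + (of_real \<alpha> * a + of_real \<beta> * b)" "0 \<le> \<alpha>" "\<alpha> \<le> 1" "0 \<le> \<beta>" "\<beta> \<le> 1" and
      y: "y = v + (of_real \<alpha>' * a + of_real \<beta>' * b)" "0 \<le> \<alpha>'" "\<alpha>' \<le> 1" "0 \<le> \<beta>'" "\<beta>' \<le> 1"
      unfolding parallelogram_def by blast
    have v: "v = of_real s * v + of_real t * v"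
      using st(3) by (metis distrib_right mult_1 of_real_1 of_real_add)
    have "s *\<^sub>R x + t *\<^sub>R y = v + (of_real (s * \<alpha> + t * \<alpha>') * a + of_real (s * \<beta> + t * \<beta>') * b)"
      by (subst v) (simp add: x y scaleR_conv_of_real algebra_simps)
    moreover have "s * \<alpha> + t * \<alpha>' \<le> 1" "s * \<beta> + t * \<beta>' \<le> 1"
      using convex_bound_le[of \<alpha> 1 \<alpha>' s t] convex_bound_le[of \<beta> 1 \<beta>' s t] x y st by auto
    moreover have "0 \<le> s * \<alpha> + t * \<alpha>'" "0 \<le> s * \<beta> + t * \<beta>'"
      using x y st by auto
    ultimately show "s *\<^sub>R x + t *\<^sub>R y \<in> parallelogram v a b" unfolding parallelogram_def by blast
  qed
  moreover have "{v, v + a, v + (a + b), v + b} \<subseteq> parallelogram v a b"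
  proof -
    have "v + (of_real 0 * a + of_real 0 * b) \<in> parallelogram v a b" "v + (of_real 1 * a + of_real 0 * b) \<in> parallelogram v a b"
      "v + (of_real 1 * a + of_real 1 * b) \<in> parallelogram v a b" "v + (of_real 0 * a + of_real 1 * b) \<in> parallelogram v a b"
      unfolding parallelogram_def by (intro CollectI exI conjI, rule refl; simp)+
    thus ?thesis by simp
  qed
  ultimately show "convex hull {v, v + a, v + (a + b), v + b} \<subseteq> parallelogram v a b"
    by (simp add: hull_minimal)
next
  show "parallelogram v a b \<subseteq> convex hull {v, v + a, v + (a + b), v + b}"
  proof
    fix x assume "x \<in> parallelogram v a b"
    then obtain \<alpha> \<beta> where x: "x = v + (of_real \<alpha> * a + of_real \<beta> * b)" "0 \<le> \<alpha>" "\<alpha> \<le> 1" "0 \<le> \<beta>" "\<beta> \<le> 1"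
      unfolding parallelogram_def by blast
    let ?H = "convex hull {v, v + a, v + (a + b), v + b}"
    have 1: "(1 - \<alpha>) *\<^sub>R v + \<alpha> *\<^sub>R (v + a) \<in> ?H"
      using x by (intro convexD[OF convex_convex_hull]) (auto intro: hull_inc)
    have 2: "(1 - \<alpha>) *\<^sub>R (v + b) + \<alpha> *\<^sub>R (v + (a + b)) \<in> ?H"
      using x by (intro convexD[OF convex_convex_hull]) (auto intro: hull_inc)
    have "(1 - \<beta>) *\<^sub>R ((1 - \<alpha>) *\<^sub>R v + \<alpha> *\<^sub>R (v + a)) + \<beta> *\<^sub>R ((1 - \<alpha>) *\<^sub>R (v + b) + \<alpha> *\<^sub>R (v + (a + b))) \<in> ?H"
      using x by (intro convexD[OF convex_convex_hull 1 2]) auto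
    moreover have "(1 - \<beta>) *\<^sub>R ((1 - \<alpha>) *\<^sub>R v + \<alpha> *\<^sub>R (v + a)) + \<beta> *\<^sub>R ((1 - \<alpha>) *\<^sub>R (v + b) + \<alpha> *\<^sub>R (v + (a + b))) = x"
      by (simp add: x scaleR_conv_of_real algebra_simps)
    ultimately show "x \<in> ?H" by simp
  qed
qed

lemma open_box_eq:
  assumes "cross a b \<noteq> 0"
  shows "open_parallelogram v a b = {p. 0 < cross (p - v) b / cross a b \<and> cross (p - v) b / cross a b < 1 \<and>
      0 < cross a (p - v) / cross a b \<and> cross a (p - v) / cross a b < 1}" (is "_ = ?R")
proof (intro set_eqI)
  fix p
  have "p = v + (of_real (cross (p - v) b / cross a b) * a + of_real (cross a (p - v) / cross a b) * b)"
    (is "_ = ?p")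
    using coordinates_exist[OF assms, of "p - v"] by (metis add.commute diff_add_cancel)
  hence "p \<in> open_parallelogram v a b \<longleftrightarrow> ?p \<in> open_parallelogram v a b" by simp
  thus "p \<in> open_parallelogram v a b \<longleftrightarrow> p \<in> ?R" unfolding open_box_iff[OF assms] by simp
qed

lemma open_open_box:
  assumes "cross a b \<noteq> 0"
  shows "open (open_parallelogram v a b)"
  unfolding open_box_eq[OF assms] cross_def
  by (intro open_Collect_conj open_Collect_less continuous_intros) (use assms in \<open>auto simp: cross_def\<close>)

lemma box_subset_closure: "parallelogram v a b \<subseteq> closure (open_parallelogram v a b)"
proof
  fix x assume "x \<in> parallelogram v a b"
  then obtain \<alpha> \<beta> where x: "x = v + (of_real \<alpha> * a + of_real \<beta> * b)" "0 \<le> \<alpha>" "\<alpha> \<le> 1" "0 \<le> \<beta>" "\<beta> \<le> 1"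
    unfolding parallelogram_def by blast
  define s where "s n = 1 / (real n + 2)" for n
  have s: "0 < s n" "s n < 1" for n by (auto simp: s_def)
  define f where "f n = v + (of_real ((1 - s n) * \<alpha> + s n / 2) * a + of_real ((1 - s n) * \<beta> + s n / 2) * b)" for n
  have bound: "0 < (1 - s n) * t + s n / 2 \<and> (1 - s n) * t + s n / 2 < 1" if "0 \<le> t" "t \<le> 1" for t n
  proof -
    have "0 \<le> (1 - s n) * t" using s[of n] that by simp
    moreover have "(1 - s n) * t \<le> 1 - s n" using s[of n] that by (simp add: mult_left_le)
    ultimately show ?thesis using s[of n] by linarith
  qed
  have "f n \<in> open_parallelogram v a b" for n
    unfolding f_def open_parallelogram_def using bound[OF x(2,3)] bound[OF x(4,5)] by blast
  moreover have "s \<longlonglongrightarrow> 0"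
    unfolding s_def using LIMSEQ_ignore_initial_segment[OF lim_1_over_n[where 'a=real], of 2]
    by (simp add: add.commute)
  hence "f \<longlonglongrightarrow> v + (of_real ((1 - 0) * \<alpha> + 0 / 2) * a + of_real ((1 - 0) * \<beta> + 0 / 2) * b)"
    unfolding f_def by (intro tendsto_intros) auto
  ultimately show "x \<in> closure (open_parallelogram v a b)"
    unfolding closure_sequential using x(1) by auto
qed


text \<open>The inclusion bounds both diagonals of the inner rhomb by the long diagonal of the outer one. As the
  sides have the same length, its angle is then at least as far from degenerate and its area at least as
  large as that of the outer rhomb.\<close>

lemma rhomb_in_rhomb:
  assumes sub: "parallelogram p u v \<subseteq> parallelogram q a b"
    and norms: "norm u = r" "norm v = r" "norm a = r" "norm b = r"
    and nz: "cross a b \<noteq> 0"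
  shows "parallelogram p u v = parallelogram q a b"
proof -
  obtain p1 p2 where p: "p = q + (of_real p1 * a + of_real p2 * b)"
    using coordinates_exist[OF nz, of "p - q"] by (metis add.commute diff_add_cancel)
  obtain ux uy where u: "u = of_real ux * a + of_real uy * b"
    using coordinates_exist[OF nz, of u] by blast
  obtain vx vy where v: "v = of_real vx * a + of_real vy * b"
    using coordinates_exist[OF nz, of v] by blast
  have corner: "0 \<le> p1 + (s * ux + t * vx) \<and> p1 + (s * ux + t * vx) \<le> 1 \<and>
      0 \<le> p2 + (s * uy + t * vy) \<and> p2 + (s * uy + t * vy) \<le> 1"
    if "0 \<le> s" "s \<le> 1" "0 \<le> t" "t \<le> 1" for s t
  proof -
    have "p + (of_real s * u + of_real t * v) \<in> parallelogram p u v"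
      unfolding parallelogram_def using that by blast
    hence "p + (of_real s * u + of_real t * v) \<in> parallelogram q a b" using sub by blast
    moreover have "p + (of_real s * u + of_real t * v) = q + (of_real (p1 + (s * ux + t * vx)) * a
        + of_real (p2 + (s * uy + t * vy)) * b)"
      by (simp add: p u v algebra_simps)
    ultimately show ?thesis using box_iff[OF nz] by metis
  qed
  note c = corner[of 0 0] corner[of 1 0] corner[of 0 1] corner[of 1 1]
  have wx: "\<bar>ux\<bar> + \<bar>vx\<bar> \<le> 1" and wy: "\<bar>uy\<bar> + \<bar>vy\<bar> \<le> 1"
    using c by auto
  define dot where "dot x y = Re (cnj x * y)" for x y
  have lag: "(dot x y)\<^sup>2 + (cross x y)\<^sup>2 = r^4" if "norm x = r" "norm y = r" for x y
  proof -
    have "(dot x y)\<^sup>2 + (cross x y)\<^sup>2 = (norm (cnj x * y))\<^sup>2"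
      unfolding dot_def cross_def cmod_power2 by simp
    thus ?thesis using that by (simp add: norm_mult power_mult_distrib flip: power_add)
  qed
  have sq: "(norm (of_real \<alpha> * a + of_real \<beta> * b))\<^sup>2 = (\<alpha>\<^sup>2 + \<beta>\<^sup>2) * r\<^sup>2 + 2 * \<alpha> * \<beta> * dot a b" for \<alpha> \<beta>
  proof -
    have "(norm (of_real \<alpha> * a + of_real \<beta> * b))\<^sup>2 = \<alpha>\<^sup>2 * (norm a)\<^sup>2 + \<beta>\<^sup>2 * (norm b)\<^sup>2 + 2 * \<alpha> * \<beta> * dot a b"
      unfolding dot_def cmod_power2 by (simp add: algebra_simps power2_eq_square)
    thus ?thesis using norms by (simp add: algebra_simps)
  qed
  \<comment> \<open>A diagonal of the inner rhomb is at most as long as the long diagonal of the outer one.\<close>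
  have diag: "(norm (of_real \<alpha> * a + of_real \<beta> * b))\<^sup>2 \<le> 2 * r\<^sup>2 + 2 * \<bar>dot a b\<bar>"
    if "\<bar>\<alpha>\<bar> \<le> 1" "\<bar>\<beta>\<bar> \<le> 1" for \<alpha> \<beta>
  proof -
    have "\<alpha>\<^sup>2 \<le> 1" "\<beta>\<^sup>2 \<le> 1" using that by (simp_all add: abs_square_le_1)
    hence "(\<alpha>\<^sup>2 + \<beta>\<^sup>2) * r\<^sup>2 \<le> 2 * r\<^sup>2" by (intro mult_right_mono) auto
    moreover have "\<bar>\<alpha> * \<beta>\<bar> \<le> 1" using that by (simp add: abs_mult mult_le_one)
    hence "\<bar>\<alpha> * \<beta>\<bar> * \<bar>dot a b\<bar> \<le> 1 * \<bar>dot a b\<bar>" by (intro mult_right_mono) auto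
    hence "\<alpha> * \<beta> * dot a b \<le> \<bar>dot a b\<bar>" by (simp flip: abs_mult)
    ultimately show ?thesis unfolding sq by linarith
  qed
  have "(norm (u + v))\<^sup>2 = 2 * r\<^sup>2 + 2 * dot u v" "(norm (u - v))\<^sup>2 = 2 * r\<^sup>2 - 2 * dot u v"
    using norms(1,2)[symmetric] unfolding dot_def cmod_power2
    by (simp_all add: algebra_simps power2_eq_square flip: cmod_power2)
       (simp_all add: cmod_def algebra_simps power2_eq_square)
  moreover have "(norm (u + v))\<^sup>2 \<le> 2 * r\<^sup>2 + 2 * \<bar>dot a b\<bar>"
    using diag[of "ux + vx" "uy + vy"] wx wy by (simp add: u v algebra_simps)
  moreover have "(norm (u - v))\<^sup>2 \<le> 2 * r\<^sup>2 + 2 * \<bar>dot a b\<bar>"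
    using diag[of "ux - vx" "uy - vy"] wx wy by (simp add: u v algebra_simps)
  ultimately have "\<bar>dot u v\<bar> \<le> \<bar>dot a b\<bar>" by linarith
  hence "(dot u v)\<^sup>2 \<le> (dot a b)\<^sup>2" by (simp add: abs_le_square_iff)
  hence "(cross a b)\<^sup>2 \<le> (cross u v)\<^sup>2"
    using lag[OF norms(1,2)] lag[OF norms(3,4)] by linarith
  hence "\<bar>cross a b\<bar> \<le> \<bar>cross u v\<bar>" by (simp add: abs_le_square_iff)
  moreover have "cross u v = (ux * vy - uy * vx) * cross a b"
    unfolding u v cross_simps cross_commute[of b a] by (simp add: algebra_simps)
  ultimately have "1 \<le> \<bar>ux * vy - uy * vx\<bar>"
    using nz by (simp add: abs_mult)
  hence det: "1 \<le> \<bar>ux\<bar> * \<bar>vy\<bar> + \<bar>uy\<bar> * \<bar>vx\<bar>"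
    using abs_triangle_ineq4[of "ux * vy" "uy * vx"] unfolding abs_mult by linarith
  have "\<bar>ux\<bar> * \<bar>vy\<bar> \<le> \<bar>ux\<bar> * (1 - \<bar>uy\<bar>)" "\<bar>uy\<bar> * \<bar>vx\<bar> \<le> \<bar>uy\<bar> * (1 - \<bar>ux\<bar>)"
    using wx wy by (auto intro!: mult_left_mono)
  hence "(1 - \<bar>ux\<bar>) * (1 - \<bar>uy\<bar>) + \<bar>ux\<bar> * \<bar>uy\<bar> \<le> 0"
    using det by (simp add: algebra_simps)
  moreover have "0 \<le> (1 - \<bar>ux\<bar>) * (1 - \<bar>uy\<bar>)" "0 \<le> \<bar>ux\<bar> * \<bar>uy\<bar>"
    using wx wy by auto
  ultimately have "(1 - \<bar>ux\<bar>) * (1 - \<bar>uy\<bar>) = 0" "\<bar>ux\<bar> * \<bar>uy\<bar> = 0" by linarith+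
  hence cases: "\<bar>ux\<bar> = 1 \<and> uy = 0 \<or> ux = 0 \<and> \<bar>uy\<bar> = 1" by auto
  have fits: "0 \<le> (t - x) * s \<and> (t - x) * s \<le> 1 \<and> x + (t - x) * s * s = t"
    if "\<bar>s\<bar> = 1" "0 \<le> x + s" "x + s \<le> 1" "0 \<le> x" "x \<le> 1" "0 \<le> t" "t \<le> 1" for s t x :: real
  proof -
    consider "s = 1" | "s = -1" using \<open>\<bar>s\<bar> = 1\<close> by linarith
    thus ?thesis using that by cases auto
  qed
  have "parallelogram q a b \<subseteq> parallelogram p u v"
  proof
    fix x assume "x \<in> parallelogram q a b"
    then obtain \<alpha> \<beta> where x: "x = q + (of_real \<alpha> * a + of_real \<beta> * b)" "0 \<le> \<alpha>" "\<alpha> \<le> 1" "0 \<le> \<beta>" "\<beta> \<le> 1"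
      unfolding parallelogram_def by blast
    from cases show "x \<in> parallelogram p u v"
    proof
      assume "\<bar>ux\<bar> = 1 \<and> uy = 0"
      moreover from this have "vx = 0" "\<bar>vy\<bar> = 1" using wx wy det by auto
      ultimately have 1: "\<bar>ux\<bar> = 1" "uy = 0" "vx = 0" "\<bar>vy\<bar> = 1" by auto
      note f = fits[OF 1(1), of p1 \<alpha>] fits[OF 1(4), of p2 \<beta>]
      have "x = p + (of_real ((\<alpha> - p1) * ux) * u + of_real ((\<beta> - p2) * vy) * v)"
      proof -
        have "p + (of_real ((\<alpha> - p1) * ux) * u + of_real ((\<beta> - p2) * vy) * v) =
           q + (of_real (p1 + (\<alpha> - p1) * ux * ux) * a + of_real (p2 + (\<beta> - p2) * vy * vy) * b)"
          by (simp add: p u v 1 algebra_simps)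
        moreover have "p1 + (\<alpha> - p1) * ux * ux = \<alpha>" "p2 + (\<beta> - p2) * vy * vy = \<beta>"
          using f c x 1 by auto
        ultimately show ?thesis using x(1) by (simp only:)
      qed
      moreover have "0 \<le> (\<alpha> - p1) * ux" "(\<alpha> - p1) * ux \<le> 1" "0 \<le> (\<beta> - p2) * vy" "(\<beta> - p2) * vy \<le> 1"
        using f c x 1 by auto
      ultimately show ?thesis unfolding parallelogram_def by blast
    next
      assume "ux = 0 \<and> \<bar>uy\<bar> = 1"
      moreover from this have "vy = 0" "\<bar>vx\<bar> = 1" using wx wy det by auto
      ultimately have 1: "\<bar>uy\<bar> = 1" "ux = 0" "vy = 0" "\<bar>vx\<bar> = 1" by auto
      note f = fits[OF 1(1), of p2 \<beta>] fits[OF 1(4), of p1 \<alpha>]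
      have "x = p + (of_real ((\<beta> - p2) * uy) * u + of_real ((\<alpha> - p1) * vx) * v)"
      proof -
        have "p + (of_real ((\<beta> - p2) * uy) * u + of_real ((\<alpha> - p1) * vx) * v) =
           q + (of_real (p1 + (\<alpha> - p1) * vx * vx) * a + of_real (p2 + (\<beta> - p2) * uy * uy) * b)"
          by (simp add: p u v 1 algebra_simps)
        moreover have "p1 + (\<alpha> - p1) * vx * vx = \<alpha>" "p2 + (\<beta> - p2) * uy * uy = \<beta>"
          using f c x 1 by auto
        ultimately show ?thesis using x(1) by (simp only:)
      qed
      moreover have "0 \<le> (\<alpha> - p1) * vx" "(\<alpha> - p1) * vx \<le> 1" "0 \<le> (\<beta> - p2) * uy" "(\<beta> - p2) * uy \<le> 1"
        using f c x 1 by auto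
      ultimately show ?thesis unfolding parallelogram_def by blast
    qed
  qed
  with sub show ?thesis by blast
qed

section \<open>Triangles\<close>

definition open_triangle :: "complex \<Rightarrow> complex \<Rightarrow> complex \<Rightarrow> complex set" where
  "open_triangle v a b = {v + (of_real \<alpha> * a + of_real \<beta> * b) | \<alpha> \<beta>. 0 < \<alpha> \<and> 0 < \<beta> \<and> \<alpha> + \<beta> < 1}"

lemma triangle_eq:
  "convex hull {v, v + a, v + b} =
     {v + (of_real \<alpha> * a + of_real \<beta> * b) | \<alpha> \<beta>. 0 \<le> \<alpha> \<and> 0 \<le> \<beta> \<and> \<alpha> + \<beta> \<le> 1}"
  unfolding convex_hull_3_alt by (simp add: scaleR_conv_of_real add.assoc)

lemma triangle_iff:
  assumes "cross a b \<noteq> 0"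
  shows "v + (of_real \<alpha> * a + of_real \<beta> * b) \<in> convex hull {v, v + a, v + b} \<longleftrightarrow> 0 \<le> \<alpha> \<and> 0 \<le> \<beta> \<and> \<alpha> + \<beta> \<le> 1"
proof
  assume "v + (of_real \<alpha> * a + of_real \<beta> * b) \<in> convex hull {v, v + a, v + b}"
  then obtain \<alpha>' \<beta>' where "of_real \<alpha> * a + of_real \<beta> * b = of_real \<alpha>' * a + of_real \<beta>' * b"
    "0 \<le> \<alpha>'" "0 \<le> \<beta>'" "\<alpha>' + \<beta>' \<le> 1"
    unfolding triangle_eq by auto
  thus "0 \<le> \<alpha> \<and> 0 \<le> \<beta> \<and> \<alpha> + \<beta> \<le> 1"
    using coordinates_unique[OF assms] by metis
qed (unfold triangle_eq, blast)

lemma convex_open_triangle: "convex (open_triangle v a b)"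
proof (rule convexI)
  fix x y :: complex and s t :: real
  assume "x \<in> open_triangle v a b" "y \<in> open_triangle v a b" and st: "0 \<le> s" "0 \<le> t" "s + t = 1"
  then obtain \<alpha> \<beta> \<alpha>' \<beta>' where
    x: "x = v + (of_real \<alpha> * a + of_real \<beta> * b)" "0 < \<alpha>" "0 < \<beta>" "\<alpha> + \<beta> < 1" and
    y: "y = v + (of_real \<alpha>' * a + of_real \<beta>' * b)" "0 < \<alpha>'" "0 < \<beta>'" "\<alpha>' + \<beta>' < 1"
    unfolding open_triangle_def by blast
  have v: "v = of_real s * v + of_real t * v"
    using st(3) by (metis distrib_right mult_1 of_real_1 of_real_add)
  have "s *\<^sub>R x + t *\<^sub>R y = v + (of_real (s * \<alpha> + t * \<alpha>') * a + of_real (s * \<beta> + t * \<beta>') * b)"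
    by (subst v) (simp add: x y scaleR_conv_of_real algebra_simps)
  moreover have "s * (\<alpha> + \<beta>) + t * (\<alpha>' + \<beta>') < 1"
    using convex_bound_lt[of "\<alpha> + \<beta>" 1 "\<alpha>' + \<beta>'" s t] x y st by auto
  moreover have pos: "0 < s * c + t * e" if "0 < c" "0 < e" for c e
  proof (cases "s = 0")
    case False
    hence "0 < s * c" using st that by simp
    moreover have "0 \<le> t * e" using st that by simp
    ultimately show ?thesis by linarith
  qed (use st that in simp)
  have "0 < s * \<alpha> + t * \<alpha>'" "0 < s * \<beta> + t * \<beta>'"
    using x y by (auto intro!: pos)
  moreover have "(s * \<alpha> + t * \<alpha>') + (s * \<beta> + t * \<beta>') = s * (\<alpha> + \<beta>) + t * (\<alpha>' + \<beta>')"
    by (simp add: algebra_simps)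
  ultimately show "s *\<^sub>R x + t *\<^sub>R y \<in> open_triangle v a b"
    unfolding open_triangle_def mem_Collect_eq
    by (rule_tac x = "s * \<alpha> + t * \<alpha>'" in exI, rule_tac x = "s * \<beta> + t * \<beta>'" in exI) (intro conjI, assumption+, linarith)
qed

lemma triangle_subset_closure: "convex hull {v, v + a, v + b} \<subseteq> closure (open_triangle v a b)"
proof
  fix x assume "x \<in> convex hull {v, v + a, v + b}"
  then obtain \<alpha> \<beta> where x: "x = v + (of_real \<alpha> * a + of_real \<beta> * b)" "0 \<le> \<alpha>" "0 \<le> \<beta>" "\<alpha> + \<beta> \<le> 1"
    unfolding triangle_eq by blast
  define s where "s n = 1 / (real n + 2)" for n
  have s: "0 < s n" "s n < 1" for n by (auto simp: s_def)
  define f where "f n = v + (of_real ((1 - s n) * \<alpha> + s n / 3) * a + of_real ((1 - s n) * \<beta> + s n / 3) * b)" for n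
  have "f n \<in> open_triangle v a b" for n
  proof -
    have "0 \<le> (1 - s n) * \<alpha>" "0 \<le> (1 - s n) * \<beta>" using s[of n] x by auto
    moreover have "(1 - s n) * (\<alpha> + \<beta>) \<le> 1 - s n" using s[of n] x by (simp add: mult_left_le)
    hence "(1 - s n) * \<alpha> + (1 - s n) * \<beta> \<le> 1 - s n" by (simp add: distrib_left)
    ultimately have "0 < (1 - s n) * \<alpha> + s n / 3 \<and> 0 < (1 - s n) * \<beta> + s n / 3 \<and>
      ((1 - s n) * \<alpha> + s n / 3) + ((1 - s n) * \<beta> + s n / 3) < 1" using s[of n] by linarith
    thus ?thesis unfolding f_def open_triangle_def by blast
  qed
  moreover have "s \<longlonglongrightarrow> 0"
    unfolding s_def using LIMSEQ_ignore_initial_segment[OF lim_1_over_n[where 'a=real], of 2]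
    by (simp add: add.commute)
  hence "f \<longlonglongrightarrow> v + (of_real ((1 - 0) * \<alpha> + 0 / 3) * a + of_real ((1 - 0) * \<beta> + 0 / 3) * b)"
    unfolding f_def by (intro tendsto_intros) auto
  ultimately show "x \<in> closure (open_triangle v a b)"
    unfolding closure_sequential using x(1) by auto
qed

text \<open>The third vertices lie on different sides of the line through \<open>x\<close> and \<open>y\<close>.\<close>

lemma triangle_Int:
  assumes "cross (y - x) (z - x) * cross (y - x) (w - x) < 0"
  shows "convex hull {x, y, z} \<inter> convex hull {x, y, w} = closed_segment x y"
proof
  show "closed_segment x y \<subseteq> convex hull {x, y, z} \<inter> convex hull {x, y, w}"
    unfolding segment_convex_hull by (intro Int_greatest hull_mono) auto
next
  show "convex hull {x, y, z} \<inter> convex hull {x, y, w} \<subseteq> closed_segment x y"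
  proof
    fix p assume p: "p \<in> convex hull {x, y, z} \<inter> convex hull {x, y, w}"
    then obtain \<alpha> \<beta> where 1: "p = x + \<alpha> *\<^sub>R (y - x) + \<beta> *\<^sub>R (z - x)" "0 \<le> \<alpha>" "0 \<le> \<beta>" "\<alpha> + \<beta> \<le> 1"
      unfolding convex_hull_3_alt by blast
    obtain \<alpha>' \<beta>' where 2: "p = x + \<alpha>' *\<^sub>R (y - x) + \<beta>' *\<^sub>R (w - x)" "0 \<le> \<alpha>'" "0 \<le> \<beta>'" "\<alpha>' + \<beta>' \<le> 1"
      using p unfolding convex_hull_3_alt by blast
    have 3: "cross (y - x) (p - x) = \<beta> * cross (y - x) (z - x)"
      by (simp add: 1 scaleR_conv_of_real cross_def algebra_simps)
    have 4: "cross (y - x) (p - x) = \<beta>' * cross (y - x) (w - x)"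
      by (simp add: 2 scaleR_conv_of_real cross_def algebra_simps)
    have "\<beta> = 0"
    proof (rule ccontr)
      assume "\<beta> \<noteq> 0"
      hence "0 < \<beta> * \<beta>" by (simp add: zero_less_mult_iff) (use 1 in linarith)
      have "\<beta> * \<beta> * (cross (y - x) (z - x) * cross (y - x) (w - x)) = \<beta> * cross (y - x) (p - x) * cross (y - x) (w - x)"
        unfolding 3 by (simp del: cross_simps)
      also have "\<dots> = (\<beta> * \<beta>') * (cross (y - x) (w - x))\<^sup>2" unfolding 4 by (simp add: power2_eq_square del: cross_simps)
      also have "\<dots> \<ge> 0" using 1 2 by simp
      finally show False using mult_pos_neg[OF \<open>0 < \<beta> * \<beta>\<close> assms] by linarith
    qed
    thus "p \<in> closed_segment x y" using 1
      by (auto simp: closed_segment_def algebra_simps intro!: exI[of _ \<alpha>])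
  qed
qed

lemma triangle_Un:
  assumes "0 < t" "t < 1" and m: "m = of_real (1 - t) * z + of_real t * w"
  shows "convex hull {x, m, z} \<union> convex hull {x, m, w} = convex hull {x, z, w}"
proof
  have "m \<in> convex hull {x, z, w}"
    unfolding convex_hull_3 m
    by (rule CollectI, rule exI[of _ 0], rule exI[of _ "1 - t"], rule exI[of _ t])
       (use assms in \<open>simp add: scaleR_conv_of_real\<close>)
  thus "convex hull {x, m, z} \<union> convex hull {x, m, w} \<subseteq> convex hull {x, z, w}"
    by (intro Un_least hull_minimal) (auto intro: hull_inc)
next
  show "convex hull {x, z, w} \<subseteq> convex hull {x, m, z} \<union> convex hull {x, m, w}"
  proof
    fix p assume "p \<in> convex hull {x, z, w}"
    then obtain \<alpha> \<beta> \<gamma> where p: "p = \<alpha> *\<^sub>R x + \<beta> *\<^sub>R z + \<gamma> *\<^sub>R w" "0 \<le> \<alpha>" "0 \<le> \<beta>" "0 \<le> \<gamma>" "\<alpha> + \<beta> + \<gamma> = 1"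
      unfolding convex_hull_3 by blast
    show "p \<in> convex hull {x, m, z} \<union> convex hull {x, m, w}"
    proof (cases "\<gamma> * (1 - t) \<le> \<beta> * t")
      case True
      define k where "k = \<gamma> / t"
      have k: "\<gamma> = k * t" "0 \<le> k" using assms p by (auto simp: k_def)
      have "(k * (1 - t)) * t \<le> \<beta> * t" using True by (simp add: k algebra_simps)
      hence "0 \<le> \<beta> - k * (1 - t)" using assms(1) by simp
      moreover have "p = \<alpha> *\<^sub>R x + k *\<^sub>R m + (\<beta> - k * (1 - t)) *\<^sub>R z"
        by (simp add: p(1) m k(1) scaleR_conv_of_real algebra_simps)
      moreover have "\<alpha> + k + (\<beta> - k * (1 - t)) = 1" using p(5) by (simp add: k(1) algebra_simps)
      ultimately have "p \<in> convex hull {x, m, z}"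
        unfolding convex_hull_3 using p(2) k(2) by blast
      thus ?thesis by blast
    next
      case False
      define k where "k = \<beta> / (1 - t)"
      have k: "\<beta> = k * (1 - t)" "0 \<le> k" using assms p by (auto simp: k_def)
      have "(k * t) * (1 - t) \<le> \<gamma> * (1 - t)" using False by (simp add: k algebra_simps)
      hence "0 \<le> \<gamma> - k * t" using assms(2) by simp
      moreover have "p = \<alpha> *\<^sub>R x + k *\<^sub>R m + (\<gamma> - k * t) *\<^sub>R w"
        by (simp add: p(1) m k(1) scaleR_conv_of_real algebra_simps)
      moreover have "\<alpha> + k + (\<gamma> - k * t) = 1" using p(5) by (simp add: k(1) algebra_simps)
      ultimately have "p \<in> convex hull {x, m, w}"
        unfolding convex_hull_3 using p(2) k(2) by blast
      thus ?thesis by blast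
    qed
  qed
qed

lemma not_collinear_cross:
  assumes "cross (b - a) (c - a) \<noteq> 0"
  shows "a \<noteq> b" "a \<noteq> c" "b \<noteq> c" "\<not> collinear {a, b, c}"
proof -
  show "a \<noteq> b" "a \<noteq> c" "b \<noteq> c" using assms by (metis cross_simps(1-3) diff_self)+
  show "\<not> collinear {a, b, c}"
  proof
    assume "collinear {a, b, c}"
    then obtain u where "\<forall>x\<in>{a, b, c}. \<forall>y\<in>{a, b, c}. \<exists>t. x - y = t *\<^sub>R u"
      unfolding collinear_def by blast
    then obtain s t where "b - a = s *\<^sub>R u" "c - a = t *\<^sub>R u" by blast
    hence "cross (b - a) (c - a) = 0" by (simp add: scaleR_conv_of_real del: cross_simps(6,7))
    thus False using assms by contradiction
  qed
qed

text \<open>The vertices of a nondegenerate triangle are its extreme points.\<close>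

lemma triangle_vertices:
  assumes "cross (b - a) (c - a) \<noteq> 0" and eq: "convex hull {a, b, c} = convex hull {x, y, z}"
  shows "{x, y, z} = {a, b, c}"
proof -
  note n = not_collinear_cross[OF assms(1)]
  hence "\<not> affine_dependent {a, b, c}" by (simp add: collinear_3_eq_affine_dependent)
  hence "p extreme_point_of (convex hull {a, b, c}) \<longleftrightarrow> p \<in> {a, b, c}" for p
    by (rule extreme_point_of_convex_hull_affine_independent)
  hence "{a, b, c} \<subseteq> {x, y, z}"
    unfolding eq using extreme_point_of_convex_hull by blast
  moreover have "card {a, b, c} = 3" using n by simp
  moreover have "card {x, y, z} \<le> 3" by (simp add: card_insert_if)
  ultimately show ?thesis by (metis card_seteq finite.emptyI finite.insertI)
qed

section \<open>The fifth root of -1 and the golden ratio\<close>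

lemma golden_gt_1: "1 < golden" and golden_square: "golden * golden = golden + 1"
proof -
  have "2 < sqrt 5" by (rule real_less_rsqrt) simp
  thus "1 < golden" by (simp add: golden_def)
  show "golden * golden = golden + 1" by (simp add: golden_def field_simps)
qed

lemma golden_complex_square: "complex_of_real golden * complex_of_real golden = complex_of_real golden + 1"
  by (metis golden_square of_real_1 of_real_add of_real_mult)

definition decagonal :: "complex \<Rightarrow> bool" where
  "decagonal z \<longleftrightarrow> z = cis (pi / 5) \<or> z = cis (- (pi / 5))"

lemma decagonal_cnj: "decagonal z \<Longrightarrow> decagonal (cnj z)"
  by (auto simp: decagonal_def cis_cnj)

context
  fixes z :: complex
  assumes z: "decagonal z"
begin

lemma z_norm: "norm z = 1" using z by (auto simp: decagonal_def)

lemma z_nonzero: "z \<noteq> 0" using z_norm by auto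

lemma z_Im: "Im z \<noteq> 0"
proof -
  have "0 < sin (pi / 5)" by (intro sin_gt_zero) auto
  thus ?thesis using z by (auto simp: decagonal_def)
qed

lemma z_cnj: "cnj z * z = 1" "z * cnj z = 1"
  using z_norm complex_norm_square[of z] by (simp_all add: mult.commute)

lemma z_pow5: "z ^ 5 = -1"
proof -
  have "cis (pi / 5) ^ 5 = -1" "cis (- (pi / 5)) ^ 5 = -1"
    unfolding Complex.DeMoivre by (simp_all add: cis_def complex_eq_iff)
  thus ?thesis using z by (auto simp: decagonal_def)
qed

lemma z_Re: "2 * Re z = golden"
proof -
  have "z ^ 5 + 1 = (z + 1) * (z ^ 4 - z ^ 3 + z\<^sup>2 - z + 1)" by (simp add: eval_nat_numeral algebra_simps)
  moreover have "z + 1 \<noteq> 0" using z_Im by (metis add.inverse_neutral add_eq_0_iff2 uminus_complex.sel(2) one_complex.sel(2))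
  ultimately have "z ^ 4 - z ^ 3 + z\<^sup>2 - z + 1 = 0" using z_pow5 by simp
  hence "(cnj z)\<^sup>2 * (z ^ 4 - z ^ 3 + z\<^sup>2 - z + 1) = 0" by simp
  moreover have "(cnj z)\<^sup>2 * (z ^ 4 - z ^ 3 + z\<^sup>2 - z + 1) = z\<^sup>2 - z + 1 - cnj z + (cnj z)\<^sup>2"
  proof -
    have a: "cnj z * (z * x) = x" for x using z_cnj by (simp flip: mult.assoc)
    show ?thesis by (simp add: eval_nat_numeral algebra_simps a z_cnj)
  qed
  moreover have "z\<^sup>2 - z + 1 - cnj z + (cnj z)\<^sup>2 = (z + cnj z)\<^sup>2 - (z + cnj z) - 1"
    by (simp add: power2_eq_square algebra_simps z_cnj)
  ultimately have "(z + cnj z)\<^sup>2 - (z + cnj z) - 1 = 0" by simp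
  hence "complex_of_real ((2 * Re z)\<^sup>2 - 2 * Re z - 1) = 0"
    by (simp add: complex_add_cnj)
  hence quad: "(2 * Re z)\<^sup>2 - 2 * Re z - 1 = 0" by (simp only: of_real_eq_0_iff)
  have "0 < cos (pi / 5)" by (intro cos_gt_zero) auto
  hence "0 < Re z" using z by (auto simp: decagonal_def)
  moreover have "(2 * Re z - golden) * (2 * Re z + golden - 1) = 0"
    using quad golden_square by (simp add: power2_eq_square algebra_simps)
  ultimately show ?thesis using golden_gt_1 by simp
qed

lemma z_cnj_eq: "cnj z = of_real golden - z"
  unfolding z_Re[symmetric] using complex_add_cnj[of z] by (simp add: algebra_simps)

text \<open>These express every direction that occurs in the tilings in the basis \<open>1\<close>, \<open>z\<close> over the reals.\<close>

lemma z_pow: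
  "z\<^sup>2 = of_real golden * z - 1"
  "z ^ 3 = of_real golden * z - of_real golden"
  "z ^ 4 = z - of_real golden"
proof -
  show 2: "z\<^sup>2 = of_real golden * z - 1"
    using z_cnj(1) unfolding z_cnj_eq by (auto simp: power2_eq_square algebra_simps)
  have "z ^ 3 = z * z\<^sup>2" by (simp add: eval_nat_numeral)
  also have "\<dots> = of_real golden * z\<^sup>2 - z" by (subst 2) (simp add: algebra_simps power2_eq_square)
  also have "\<dots> = (of_real golden * of_real golden) * z - of_real golden - z" unfolding 2 by (simp add: algebra_simps)
  finally show 3: "z ^ 3 = of_real golden * z - of_real golden" unfolding golden_complex_square by (simp add: algebra_simps)
  have "z ^ 4 = z * z ^ 3" by (simp add: eval_nat_numeral)
  also have "\<dots> = of_real golden * z\<^sup>2 - of_real golden * z" unfolding 3 by (simp add: algebra_simps power2_eq_square)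
  also have "\<dots> = (of_real golden * of_real golden) * z - of_real golden - of_real golden * z" unfolding 2 by (simp add: algebra_simps)
  finally show "z ^ 4 = z - of_real golden" unfolding golden_complex_square by (simp add: algebra_simps)
qed

lemma z_pow_Im:
  "Im (z\<^sup>2) \<noteq> 0" "Im (z ^ 3) \<noteq> 0" "Im (z ^ 4) \<noteq> 0"
  unfolding z_pow using z_Im golden_gt_1 by auto

lemma z_pow_Im': assumes "1 \<le> n" "n \<le> 4" shows "Im (z ^ n) \<noteq> 0"
proof -
  have "n = 1 \<or> n = 2 \<or> n = 3 \<or> n = 4" using assms by linarith
  thus ?thesis using z_Im z_pow_Im by auto
qed

lemma z_pow10: "z ^ 10 = 1"
  using z_pow5 power_add[of z 5 5] by simp

lemma z_pow_mod: "z ^ (n mod 10) = z ^ n"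
proof -
  have "z ^ n = z ^ (10 * (n div 10) + n mod 10)" by simp
  also have "\<dots> = z ^ (n mod 10)" unfolding power_add power_mult z_pow10 by simp
  finally show ?thesis by simp
qed

lemma z_pow_eq_1: "z ^ n = 1 \<Longrightarrow> n mod 10 = 0"
proof (rule ccontr)
  assume "z ^ n = 1" and n0: "n mod 10 \<noteq> 0"
  hence 1: "z ^ (n mod 10) = 1" by (simp add: z_pow_mod)
  define m where "m = n mod 10"
  have "1 \<le> m" "m < 10" using n0 by (auto simp: m_def)
  then consider "m \<le> 4" | "m = 5" | "6 \<le> m" by linarith
  thus False
  proof cases
    case 1 thus False using z_pow_Im'[of m] \<open>1 \<le> m\<close> \<open>z ^ (n mod 10) = 1\<close> by (simp add: m_def)
  next
    case 2 thus False using z_pow5 1 by (simp add: m_def)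
  next
    case 3
    have "z ^ m = z ^ (5 + (m - 5))" using 3 by simp
    also have "\<dots> = - (z ^ (m - 5))" unfolding power_add z_pow5 by simp
    finally have "z ^ (m - 5) = - (z ^ m)" by simp
    hence "z ^ (m - 5) = - 1" using 1 by (simp add: m_def)
    hence "Im (z ^ (m - 5)) = 0" by simp
    thus False using z_pow_Im'[of "m - 5"] 3 \<open>m < 10\<close> by simp
  qed
qed

lemma z_pow_inj:
  assumes "z ^ m = z ^ n" shows "m mod 10 = n mod 10"
proof -
  have *: "m mod 10 = n mod 10" if "z ^ m = z ^ n" "m \<le> n" for m n
  proof -
    have "z ^ n = z ^ m * z ^ (n - m)" using that(2) by (simp flip: power_add)
    hence "z ^ (n - m) = 1" using that(1) z_nonzero by simp
    hence "(n - m) mod 10 = 0" by (rule z_pow_eq_1)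
    then obtain q where "n - m = 10 * q" by auto
    hence "n = m + 10 * q" using that(2) by simp
    thus ?thesis by simp
  qed
  show ?thesis using *[of m n] *[of n m] assms by (metis nat_le_linear)
qed

lemma z_pow_cross:
  assumes "1 \<le> k" "k \<le> 4" "u \<noteq> 0"
  shows "cross u (z ^ k * u) \<noteq> 0"
proof -
  have "cross u (z ^ k * u) = (norm u)\<^sup>2 * Im (z ^ k)"
    unfolding cross_def cmod_power2 by (simp add: algebra_simps power2_eq_square)
  thus ?thesis using z_pow_Im'[OF assms(1,2)] assms(3) by simp
qed

text \<open>The bisector of the \<open>i\<close>-th of the \<open>k\<close> sectors of angle \<open>pi / 5\<close> that make up the angle between
  the directions \<open>1\<close> and \<open>z ^ k\<close>.\<close>

lemma sector_bisector:
  assumes "i < k" "k \<le> 4"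
  shows "\<exists>c1 c2. 0 < c1 \<and> 0 < c2 \<and> z ^ i + z ^ (i + 1) = of_real c1 + of_real c2 * z ^ k"
proof -
  note g = golden_gt_1 golden_complex_square
  have g2: "complex_of_real golden * (complex_of_real golden * x) = (of_real golden + 1) * x" for x
    by (simp flip: mult.assoc golden_complex_square)
  have ex: "\<exists>c1 c2. 0 < c1 \<and> 0 < c2 \<and> z ^ i + z ^ (i + 1) = of_real c1 + of_real c2 * z ^ k"
    if "0 < c1" "0 < c2" "z ^ i + w = of_real c1 + of_real c2 * z ^ k" "z ^ (i + 1) = w" for c1 c2 w
    using that by blast
  have "k = 1 \<or> k = 2 \<or> k = 3 \<or> k = 4" using assms by linarith
  hence "k = 1 \<and> i = 0 \<or> k = 2 \<and> (i = 0 \<or> i = 1) \<or> k = 3 \<and> (i = 0 \<or> i = 1 \<or> i = 2) \<or>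
    k = 4 \<and> (i = 0 \<or> i = 1 \<or> i = 2 \<or> i = 3)"
    using assms(1) by auto
  then consider "k = 1" "i = 0" | "k = 2" "i = 0" | "k = 2" "i = 1" | "k = 3" "i = 0" | "k = 3" "i = 1"
    | "k = 3" "i = 2" | "k = 4" "i = 0" | "k = 4" "i = 1" | "k = 4" "i = 2" | "k = 4" "i = 3"
    by blast
  thus ?thesis
  proof cases
    case 1 show ?thesis by (rule ex[of 1 1]) (simp_all add: 1)
  next
    case 2
    have e: "z ^ (i + 1) = z ^ 1" by (simp add: 2)
    show ?thesis by (rule ex[OF _ _ _ e, of "golden" "golden - 1"]) (use g in \<open>simp_all add: 2 z_pow algebra_simps g2\<close>)
  next
    case 3
    have e: "z ^ (i + 1) = z ^ 2" by (simp add: 3 power2_eq_square)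
    show ?thesis by (rule ex[OF _ _ _ e, of "golden - 1" "golden"]) (use g in \<open>simp_all add: 3 z_pow algebra_simps g2\<close>)
  next
    case 4
    have e: "z ^ (i + 1) = z ^ 1" by (simp add: 4)
    show ?thesis by (rule ex[OF _ _ _ e, of "2" "golden - 1"]) (use g in \<open>simp_all add: 4 z_pow algebra_simps g2\<close>)
  next
    case 5
    have e: "z ^ (i + 1) = z ^ 2" by (simp add: 5 power2_eq_square)
    show ?thesis by (rule ex[OF _ _ _ e, of "golden" "golden"]) (use g in \<open>simp_all add: 5 z_pow algebra_simps g2\<close>)
  next
    case 6
    have e: "z ^ (i + 1) = z ^ 3" by (simp add: 6)
    show ?thesis by (rule ex[OF _ _ _ e, of "golden - 1" "2"]) (use g in \<open>simp_all add: 6 z_pow algebra_simps g2\<close>)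
  next
    case 7
    have e: "z ^ (i + 1) = z ^ 1" by (simp add: 7)
    show ?thesis by (rule ex[OF _ _ _ e, of "golden + 1" "1"]) (use g in \<open>simp_all add: 7 z_pow algebra_simps g2\<close>)
  next
    case 8
    have e: "z ^ (i + 1) = z ^ 2" by (simp add: 8 power2_eq_square)
    show ?thesis by (rule ex[OF _ _ _ e, of "2 * golden" "golden + 1"]) (use g in \<open>simp_all add: 8 z_pow algebra_simps g2\<close>)
  next
    case 9
    have e: "z ^ (i + 1) = z ^ 3" by (simp add: 9)
    show ?thesis by (rule ex[OF _ _ _ e, of "golden + 1" "2 * golden"]) (use g in \<open>simp_all add: 9 z_pow algebra_simps g2\<close>)
  next
    case 10
    have e: "z ^ (i + 1) = z ^ 4" by (simp add: 10)
    show ?thesis by (rule ex[OF _ _ _ e, of "1" "golden + 1"]) (use g in \<open>simp_all add: 10 z_pow algebra_simps g2\<close>)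
  qed
qed

end

section \<open>Rhombs seen from a corner\<close>

lemma box_turn: "parallelogram (v + a) b (- a) = parallelogram v a b" "open_parallelogram (v + a) b (- a) = open_parallelogram v a b"
proof -
  have 1: "{v + a + (of_real \<alpha> * b + of_real \<beta> * - a) | \<alpha> \<beta>. P \<alpha> \<beta>} =
    {v + (of_real \<alpha> * a + of_real \<beta> * b) | \<alpha> \<beta>. P \<beta> (1 - \<alpha>)}" for P
  proof (intro set_eqI iffI)
    fix x assume "x \<in> {v + a + (of_real \<alpha> * b + of_real \<beta> * - a) | \<alpha> \<beta>. P \<alpha> \<beta>}"
    then obtain \<alpha> \<beta> where "x = v + a + (of_real \<alpha> * b + of_real \<beta> * - a)" "P \<alpha> \<beta>" by blast
    hence "x = v + (of_real (1 - \<beta>) * a + of_real \<alpha> * b)" "P \<alpha> (1 - (1 - \<beta>))" by (auto simp: algebra_simps)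
    thus "x \<in> {v + (of_real \<alpha> * a + of_real \<beta> * b) | \<alpha> \<beta>. P \<beta> (1 - \<alpha>)}" by blast
  next
    fix x assume "x \<in> {v + (of_real \<alpha> * a + of_real \<beta> * b) | \<alpha> \<beta>. P \<beta> (1 - \<alpha>)}"
    then obtain \<alpha> \<beta> where "x = v + (of_real \<alpha> * a + of_real \<beta> * b)" "P \<beta> (1 - \<alpha>)" by blast
    hence "x = v + a + (of_real \<beta> * b + of_real (1 - \<alpha>) * - a)" "P \<beta> (1 - \<alpha>)" by (auto simp: algebra_simps)
    thus "x \<in> {v + a + (of_real \<alpha> * b + of_real \<beta> * - a) | \<alpha> \<beta>. P \<alpha> \<beta>}" by blast
  qed
  show "parallelogram (v + a) b (- a) = parallelogram v a b"
    unfolding parallelogram_def 1 by (intro Collect_cong ex_cong1) auto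
  show "open_parallelogram (v + a) b (- a) = open_parallelogram v a b"
    unfolding open_parallelogram_def 1 by (intro Collect_cong ex_cong1) auto
qed


text \<open>A corner of a rhomb at a vertex \<open>v\<close> is given by the label of \<open>v\<close> and by the direction \<open>u\<close> of its first edge
  in the sense of \<open>z\<close>; its last edge has the direction \<open>z ^ width \<kappa> * u\<close>, so that the angle is
  \<open>width \<kappa> * pi / 5\<close>.\<close>

datatype corner = kA | kB | kC | kD | kE | kF | kG | kH

primrec width :: "corner \<Rightarrow> nat" where
  "width kA = 1" | "width kB = 4" | "width kC = 1" | "width kD = 4"
| "width kE = 2" | "width kF = 3" | "width kG = 2" | "width kH = 3"

text \<open>The first and the last edge at a corner, in the sense given by \<open>z\<close>: whether its arrow has
  type 1, and whether it points away from the corner.\<close>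

primrec first_arrow :: "corner \<Rightarrow> bool \<times> bool" where
  "first_arrow kA = (True, True)" | "first_arrow kB = (True, False)"
| "first_arrow kC = (False, True)" | "first_arrow kD = (False, False)"
| "first_arrow kE = (True, True)" | "first_arrow kF = (False, True)"
| "first_arrow kG = (False, False)" | "first_arrow kH = (True, False)"

primrec last_arrow :: "corner \<Rightarrow> bool \<times> bool" where
  "last_arrow kA = (False, True)" | "last_arrow kB = (True, False)"
| "last_arrow kC = (True, True)" | "last_arrow kD = (False, False)"
| "last_arrow kE = (True, True)" | "last_arrow kF = (True, False)"
| "last_arrow kG = (False, False)" | "last_arrow kH = (False, True)"

primrec rhomb_at :: "complex \<Rightarrow> corner \<Rightarrow> complex \<Rightarrow> complex \<Rightarrow> complex rhomb" where
  "rhomb_at z kA v u = Thin v (v + u) (v + (u + z * u)) (v + z * u)"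
| "rhomb_at z kB v u = Thin (v + z ^ 4 * u) v (v + u) (v + (u + z ^ 4 * u))"
| "rhomb_at z kC v u = Thin (v + (u + z * u)) (v + z * u) v (v + u)"
| "rhomb_at z kD v u = Thin (v + u) (v + (u + z ^ 4 * u)) (v + z ^ 4 * u) v"
| "rhomb_at z kE v u = Thick v (v + u) (v + (u + z\<^sup>2 * u)) (v + z\<^sup>2 * u)"
| "rhomb_at z kF v u = Thick (v + z ^ 3 * u) v (v + u) (v + (u + z ^ 3 * u))"
| "rhomb_at z kG v u = Thick (v + (u + z\<^sup>2 * u)) (v + z\<^sup>2 * u) v (v + u)"
| "rhomb_at z kH v u = Thick (v + u) (v + (u + z ^ 3 * u)) (v + z ^ 3 * u) v"

definition arrow :: "complex rhomb \<Rightarrow> bool \<Rightarrow> complex \<Rightarrow> complex \<Rightarrow> bool" where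
  "arrow r e x y \<longleftrightarrow> (x, y) \<in> (if e then arrows1 r else arrows2 r)"

definition directed_arrow :: "complex rhomb \<Rightarrow> bool \<times> bool \<Rightarrow> complex \<Rightarrow> complex \<Rightarrow> bool" where
  "directed_arrow r e x y \<longleftrightarrow> (if snd e then arrow r (fst e) x y else arrow r (fst e) y x)"

primrec inner :: "complex rhomb \<Rightarrow> complex set" where
  "inner (Thin A B C D) = open_parallelogram A (B - A) (D - A)"
| "inner (Thick E F G H) = open_parallelogram E (F - E) (H - E)"

lemma width_bounds: "1 \<le> width \<kappa>" "width \<kappa> \<le> 4"
  by (cases \<kappa>; simp)+

lemma rhomb_region_at: "rhomb_region (rhomb_at z \<kappa> v u) = parallelogram v u (z ^ width \<kappa> * u)"
  unfolding convex_hull_box[symmetric] rhomb_region_def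
  by (cases \<kappa>; simp; intro arg_cong[of _ _ "\<lambda>X. convex hull X"]; auto)

lemma inner_rhomb_at: "inner (rhomb_at z \<kappa> v u) = open_parallelogram v u (z ^ width \<kappa> * u)"
proof -
  have *: "open_parallelogram (v + a + b) (- a) (- b) = open_parallelogram v a b" "open_parallelogram (v + b) (- b) a = open_parallelogram v a b"
    "open_parallelogram (v + b) a (- b) = open_parallelogram v a b" for a b
    using box_turn(2)[of "v + a" b "- a"] box_turn(2)[of v a b]
      box_turn(2)[of v b a] box_commute(2)[of v a b] box_commute(2)[of "v + b" a "- b"] by simp_all
  show ?thesis
    using *[where a = u and b = "z ^ width \<kappa> * u"] box_turn(2)[of v u "z ^ width \<kappa> * u"]
    by (cases \<kappa>) (simp_all add: algebra_simps)
qed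

lemma directed_arrow_first: "directed_arrow (rhomb_at z \<kappa> v u) (first_arrow \<kappa>) v (v + u)"
  by (cases \<kappa>; simp add: directed_arrow_def arrow_def)

lemma directed_arrow_last: "directed_arrow (rhomb_at z \<kappa> v u) (last_arrow \<kappa>) v (v + z ^ width \<kappa> * u)"
  by (cases \<kappa>; simp add: directed_arrow_def arrow_def)

lemma rhomb_at_inj:
  assumes z: "decagonal z" and "u \<noteq> 0" "u' \<noteq> 0" and eq: "rhomb_at z \<kappa> v u = rhomb_at z \<kappa>' v u'"
  shows "\<kappa> = \<kappa>'" "u = u'"
proof -
  have nz: "w + z ^ k * w \<noteq> 0" if "1 \<le> k" "k \<le> 4" "w \<noteq> 0" for w k
  proof
    assume "w + z ^ k * w = 0"
    hence "(1 + z ^ k) * w = 0" by (simp add: algebra_simps)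
    hence "z ^ k + 1 = 0" using that(3) by (simp add: add.commute)
    hence "z ^ k = - 1" by (simp only: eq_neg_iff_add_eq_0)
    hence "Im (z ^ k) = 0" by simp
    thus False using z_pow_Im'[OF z that(1,2)] by simp
  qed
  note n = nz[of 1 u] nz[of 2 u] nz[of 3 u] nz[of 4 u] nz[of 1 u'] nz[of 2 u'] nz[of 3 u'] nz[of 4 u']
  show "\<kappa> = \<kappa>'" using eq assms(2,3) n z_nonzero[OF z] by (cases \<kappa>; cases \<kappa>'; simp)
  thus "u = u'" using eq by (cases \<kappa>) auto
qed

section \<open>Edge-to-edge rhomb tilings\<close>

text \<open>Counterclockwise and clockwise labelling are the two choices of \<open>z\<close>, which makes one treatment serve both.\<close>

locale rhomb_tiling =
  fixes P :: "complex rhomb set" and z :: complex and l :: real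
  assumes z: "decagonal z" and l_pos: "0 < l"
    and thin_shape: "Thin A B C D \<in> P \<Longrightarrow> dist A B = l \<and> D - A = z * (B - A) \<and> C = B + D - A"
    and thick_shape: "Thick E F G H \<in> P \<Longrightarrow> dist E F = l \<and> H - E = z\<^sup>2 * (F - E) \<and> G = F + H - E"
    and cover: "\<exists>r\<in>P. p \<in> rhomb_region r"
    and disjoint: "r \<in> P \<Longrightarrow> s \<in> P \<Longrightarrow> r \<noteq> s \<Longrightarrow> interior (rhomb_region r) \<inter> interior (rhomb_region s) = {}"
    and meet: "r \<in> P \<Longrightarrow> s \<in> P \<Longrightarrow> r \<noteq> s \<Longrightarrow>
        rhomb_region r \<inter> rhomb_region s = {} \<or>
        (\<exists>v \<in> rhomb_vertices r \<inter> rhomb_vertices s. rhomb_region r \<inter> rhomb_region s = {v}) \<or>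
        (\<exists>(x, y) \<in> (arrows1 r \<inter> arrows1 s) \<union> (arrows2 r \<inter> arrows2 s).
           rhomb_region r \<inter> rhomb_region s = closed_segment x y)"

lemma penrose_tiling_imp_rhomb_tiling:
  assumes "penrose_tiling l P"
  shows "\<exists>z. rhomb_tiling P z l"
proof -
  from assms obtain ccw where ccw: "\<forall>r\<in>P. rhomb_shape ccw l r" unfolding penrose_tiling_def by blast
  define z where "z = cis (if ccw then pi / 5 else - (pi / 5))"
  have z2: "z\<^sup>2 = cis (if ccw then 2 * pi / 5 else - (2 * pi / 5))"
    unfolding z_def Complex.DeMoivre by simp
  have "rhomb_tiling P z l"
  proof
    show "decagonal z" by (simp add: decagonal_def z_def)
    show "0 < l" using assms by (simp add: penrose_tiling_def)
    show "dist A B = l \<and> D - A = z * (B - A) \<and> C = B + D - A" if "Thin A B C D \<in> P" for A B C D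
      using bspec[OF ccw that] by (simp add: z_def)
    show "dist E F = l \<and> H - E = z\<^sup>2 * (F - E) \<and> G = F + H - E" if "Thick E F G H \<in> P" for E F G H
      using bspec[OF ccw that] unfolding z2 by simp
    have tiling: "plane_tiling (rhomb_region ` P)" using assms by (simp add: penrose_tiling_def)
    show "\<exists>r\<in>P. p \<in> rhomb_region r" for p
    proof -
      have "p \<in> \<Union>(rhomb_region ` P)" using tiling unfolding plane_tiling_def by simp
      thus ?thesis by simp
    qed
    fix r s assume rs: "r \<in> P" "s \<in> P" "r \<noteq> s"
    hence "rhomb_region r \<noteq> rhomb_region s" using assms by (auto simp: penrose_tiling_def inj_on_def)
    moreover have "\<forall>X\<in>rhomb_region ` P. \<forall>Y\<in>rhomb_region ` P. X \<noteq> Y \<longrightarrow> interior X \<inter> interior Y = {}"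
      using tiling unfolding plane_tiling_def by simp
    ultimately show "interior (rhomb_region r) \<inter> interior (rhomb_region s) = {}"
      using rs by simp
    have M: "\<forall>r\<in>P. \<forall>s\<in>P. r \<noteq> s \<longrightarrow>
        rhomb_region r \<inter> rhomb_region s = {} \<or>
        (\<exists>v \<in> rhomb_vertices r \<inter> rhomb_vertices s. rhomb_region r \<inter> rhomb_region s = {v}) \<or>
        (\<exists>(x, y) \<in> (arrows1 r \<inter> arrows1 s) \<union> (arrows2 r \<inter> arrows2 s).
           rhomb_region r \<inter> rhomb_region s = closed_segment x y)"
      using assms unfolding penrose_tiling_def by (elim conjE)
    show "rhomb_region r \<inter> rhomb_region s = {} \<or>
        (\<exists>v \<in> rhomb_vertices r \<inter> rhomb_vertices s. rhomb_region r \<inter> rhomb_region s = {v}) \<or>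
        (\<exists>(x, y) \<in> (arrows1 r \<inter> arrows1 s) \<union> (arrows2 r \<inter> arrows2 s).
           rhomb_region r \<inter> rhomb_region s = closed_segment x y)"
      by (rule M[THEN bspec, OF rs(1), THEN bspec, OF rs(2), THEN mp, OF rs(3)])
  qed
  thus ?thesis by blast
qed

context rhomb_tiling
begin

definition has_corner :: "corner \<Rightarrow> complex \<Rightarrow> complex \<Rightarrow> bool" where
  "has_corner \<kappa> v u \<longleftrightarrow> rhomb_at z \<kappa> v u \<in> P"

lemma opposite_direction:
  "z * (z ^ 4 * x) = - x" "z ^ 4 * (z * x) = - x" "z\<^sup>2 * (z ^ 3 * x) = - x" "z ^ 3 * (z\<^sup>2 * x) = - x"
  using z_pow5[OF z] by (simp_all add: eval_nat_numeral flip: mult.assoc)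

lemma thin_corners:
  "Thin A B C D \<in> P \<longleftrightarrow> has_corner kA A (B - A) \<and> C = B + D - A \<and> D - A = z * (B - A)"
proof -
  have "has_corner kA A (B - A) \<longleftrightarrow> Thin A B C D \<in> P" if "C = B + D - A" "D - A = z * (B - A)"
    using that(2)[symmetric] by (simp add: has_corner_def that(1))
  thus ?thesis using thin_shape by blast
qed

lemma thick_corners:
  "Thick E F G H \<in> P \<longleftrightarrow> has_corner kE E (F - E) \<and> G = F + H - E \<and> H - E = z\<^sup>2 * (F - E)"
proof -
  have "has_corner kE E (F - E) \<longleftrightarrow> Thick E F G H \<in> P" if "G = F + H - E" "H - E = z\<^sup>2 * (F - E)"
    using that(2)[symmetric] by (simp add: has_corner_def that(1))
  thus ?thesis using thick_shape by blast
qed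

lemma rhomb_at_turn:
  "rhomb_at z kB v u = rhomb_at z kA (v + z ^ 4 * u) (- (z ^ 4 * u))"
  "rhomb_at z kC v u = rhomb_at z kA (v + (u + z * u)) (- u)"
  "rhomb_at z kD v u = rhomb_at z kA (v + u) (z ^ 4 * u)"
  "rhomb_at z kF v u = rhomb_at z kE (v + z ^ 3 * u) (- (z ^ 3 * u))"
  "rhomb_at z kG v u = rhomb_at z kE (v + (u + z\<^sup>2 * u)) (- u)"
  "rhomb_at z kH v u = rhomb_at z kE (v + u) (z ^ 3 * u)"
  by (simp_all only: rhomb_at.simps mult_minus_right opposite_direction rhomb.inject) (simp_all add: algebra_simps)?

lemma corner_length:
  assumes "has_corner \<kappa> v u"
  shows "norm u = l"
proof -
  have A: "norm w = l" if "rhomb_at z kA v' w \<in> P" for v' w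
    using thin_shape[OF that[unfolded rhomb_at.simps]] by (simp add: dist_norm)
  have E: "norm w = l" if "rhomb_at z kE v' w \<in> P" for v' w
    using thick_shape[OF that[unfolded rhomb_at.simps]] by (simp add: dist_norm)
  have n: "norm (- (z ^ k * w)) = norm w" "norm (z ^ k * w) = norm w" for k and w :: complex
    using z_norm[OF z] by (simp_all add: norm_mult norm_power)
  show ?thesis
  proof (cases \<kappa>)
    case kA
    thus ?thesis using A assms unfolding has_corner_def by blast
  next
    case kB
    have "norm (- (z ^ 4 * u)) = l" using assms unfolding has_corner_def kB rhomb_at_turn by (rule A)
    thus ?thesis unfolding n .
  next
    case kC
    have "norm (- u) = l" using assms unfolding has_corner_def kC rhomb_at_turn by (rule A)
    thus ?thesis by simp
  next
    case kD
    have "norm (z ^ 4 * u) = l" using assms unfolding has_corner_def kD rhomb_at_turn by (rule A)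
    thus ?thesis unfolding n .
  next
    case kE
    thus ?thesis using E assms unfolding has_corner_def by blast
  next
    case kF
    have "norm (- (z ^ 3 * u)) = l" using assms unfolding has_corner_def kF rhomb_at_turn by (rule E)
    thus ?thesis unfolding n .
  next
    case kG
    have "norm (- u) = l" using assms unfolding has_corner_def kG rhomb_at_turn by (rule E)
    thus ?thesis by simp
  next
    case kH
    have "norm (z ^ 3 * u) = l" using assms unfolding has_corner_def kH rhomb_at_turn by (rule E)
    thus ?thesis unfolding n .
  qed
qed

lemma corner_nonzero: "has_corner \<kappa> v u \<Longrightarrow> u \<noteq> 0"
  using corner_length l_pos by fastforce

lemma rhomb_corner_E: assumes "r \<in> P" obtains v u where "r = rhomb_at z kA v u" | v u where "r = rhomb_at z kE v u"
proof (cases r)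
  case (Thin A B C D)
  hence "D = A + z * (B - A)" and "C = B + D - A"
    using thin_shape[of A B C D] assms by (simp_all add: diff_eq_eq add.commute)
  hence "r = rhomb_at z kA A (B - A)" using Thin by simp
  thus ?thesis using that by blast
next
  case (Thick E F G H)
  hence "H = E + z\<^sup>2 * (F - E)" and "G = F + H - E"
    using thick_shape[of E F G H] assms by (simp_all add: diff_eq_eq add.commute)
  hence "r = rhomb_at z kE E (F - E)" using Thick by simp
  thus ?thesis using that by blast
qed

lemma rhomb_at_turn':
  "rhomb_at z kA v u = rhomb_at z kB (v + u) (z * u)"
  "rhomb_at z kA v u = rhomb_at z kC (v + (u + z * u)) (- u)"
  "rhomb_at z kA v u = rhomb_at z kD (v + z * u) (- (z * u))"
  "rhomb_at z kE v u = rhomb_at z kF (v + u) (z\<^sup>2 * u)"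
  "rhomb_at z kE v u = rhomb_at z kG (v + (u + z\<^sup>2 * u)) (- u)"
  "rhomb_at z kE v u = rhomb_at z kH (v + z\<^sup>2 * u) (- (z\<^sup>2 * u))"
  by (simp_all only: rhomb_at.simps mult_minus_right opposite_direction rhomb.inject) (simp_all add: algebra_simps)?

lemma vertex_corner:
  assumes "r \<in> P" "v \<in> rhomb_vertices r"
  shows "\<exists>\<kappa> u. has_corner \<kappa> v u \<and> r = rhomb_at z \<kappa> v u"
  using assms(1)
proof (cases rule: rhomb_corner_E)
  case (1 w u)
  hence "v = w \<or> v = w + u \<or> v = w + (u + z * u) \<or> v = w + z * u" using assms(2) by simp
  thus ?thesis using 1 assms(1) unfolding has_corner_def by (metis rhomb_at_turn'(1-3))
next
  case (2 w u)
  hence "v = w \<or> v = w + u \<or> v = w + (u + z\<^sup>2 * u) \<or> v = w + z\<^sup>2 * u" using assms(2) by simp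
  thus ?thesis using 2 assms(1) unfolding has_corner_def by (metis rhomb_at_turn'(4-6))
qed

lemma arrow_vertices: "arrow r e x y \<Longrightarrow> x \<in> rhomb_vertices r \<and> y \<in> rhomb_vertices r"
  by (cases r; cases e; auto simp: arrow_def)

lemma corner_cross: "has_corner \<kappa> v u \<Longrightarrow> cross u (z ^ width \<kappa> * u) \<noteq> 0"
  using z_pow_cross[OF z] width_bounds corner_nonzero by blast

lemma distinct_corner_points:
  assumes "has_corner \<kappa> v u"
  shows "u \<noteq> 0" "z ^ width \<kappa> * u \<noteq> 0" "u \<noteq> z ^ width \<kappa> * u" "u + z ^ width \<kappa> * u \<noteq> 0"
proof -
  note c = corner_cross[OF assms]
  show "u \<noteq> 0" "z ^ width \<kappa> * u \<noteq> 0" using c z_nonzero[OF z] by auto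
  show "u \<noteq> z ^ width \<kappa> * u" using c by (metis cross_simps(1))
  show "u + z ^ width \<kappa> * u \<noteq> 0" using c by (metis add_eq_0_iff2 cross_simps(1,8) neg_equal_0_iff_equal)
qed

lemma directed_arrow_corner:
  assumes "r \<in> P" "directed_arrow r e v w"
  shows "\<exists>\<kappa> u. r = rhomb_at z \<kappa> v u \<and> has_corner \<kappa> v u \<and>
    (w = v + u \<and> first_arrow \<kappa> = e \<or> w = v + z ^ width \<kappa> * u \<and> last_arrow \<kappa> = e)"
proof -
  have "v \<in> rhomb_vertices r" using assms(2) arrow_vertices unfolding directed_arrow_def by (metis (full_types))
  then obtain \<kappa> u where k: "has_corner \<kappa> v u" "r = rhomb_at z \<kappa> v u" using vertex_corner[OF assms(1)] by blast
  moreover have "w = v + u \<and> first_arrow \<kappa> = e \<or> w = v + z ^ width \<kappa> * u \<and> last_arrow \<kappa> = e"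
    using assms(2) distinct_corner_points[OF k(1)] unfolding k(2) directed_arrow_def arrow_def
    by (cases \<kappa>; cases e; auto split: if_splits simp: add_eq_0_iff2 add_eq_0_iff)
  ultimately show ?thesis by blast
qed


subsection \<open>Interiors\<close>

lemma open_inner: "r \<in> P \<Longrightarrow> open (inner r)"
  and inner_subset: "r \<in> P \<Longrightarrow> inner r \<subseteq> rhomb_region r"
  and region_subset_closure: "r \<in> P \<Longrightarrow> rhomb_region r \<subseteq> closure (inner r)"
proof -
  assume r: "r \<in> P"
  then obtain \<kappa> v u where k: "r = rhomb_at z \<kappa> v u" by (meson rhomb_corner_E)
  hence "cross u (z ^ width \<kappa> * u) \<noteq> 0" using r corner_cross unfolding has_corner_def by blast
  thus "open (inner r)" "inner r \<subseteq> rhomb_region r" "rhomb_region r \<subseteq> closure (inner r)"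
    unfolding k inner_rhomb_at rhomb_region_at
    using open_open_box open_box_subset box_subset_closure by auto
qed

lemma inner_region_eq:
  assumes "r \<in> P" "s \<in> P" "p \<in> inner r" "p \<in> rhomb_region s"
  shows "r = s"
proof (rule ccontr)
  assume "r \<noteq> s"
  have "p \<in> closure (inner s)" using assms region_subset_closure by blast
  then obtain q where "q \<in> inner r" "q \<in> inner s"
    using open_inner[OF assms(1)] assms(3) unfolding closure_iff_nhds_not_empty by blast
  hence "q \<in> interior (rhomb_region r) \<inter> interior (rhomb_region s)"
    using assms(1,2) by (meson IntI interiorI inner_subset open_inner)
  thus False using disjoint[OF assms(1,2) \<open>r \<noteq> s\<close>] by blast
qed

lemma edge_point_not_inner:
  assumes "r \<in> P" "arrow r e x y" "p \<in> closed_segment x y"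
  shows "p \<notin> inner r"
proof -
  define w where "w = (if e then y else x)"
  obtain d where d: "directed_arrow r d x y"
    using assms(2) by (metis directed_arrow_def fst_conv snd_conv)
  obtain \<kappa> u where k: "r = rhomb_at z \<kappa> x u" "has_corner \<kappa> x u" and
    y: "y = x + u \<or> y = x + z ^ width \<kappa> * u"
    using directed_arrow_corner[OF assms(1) d] by blast
  note c = corner_cross[OF k(2)]
  obtain t where t: "p = x + of_real t * (y - x)"
    using assms(3) by (auto simp: closed_segment_def scaleR_conv_of_real algebra_simps)
  from y have "p = x + (of_real t * u + of_real 0 * (z ^ width \<kappa> * u)) \<or>
     p = x + (of_real 0 * u + of_real t * (z ^ width \<kappa> * u))"
    unfolding t by auto
  thus ?thesis unfolding k(1) inner_rhomb_at using open_box_iff[OF c] by (metis order_less_irrefl)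
qed

text \<open>Around a vertex, a corner of angle \<open>k * pi / 5\<close> occupies \<open>k\<close> consecutive sectors of angle
  \<open>pi / 5\<close>; a sector belongs to one rhomb only.\<close>

lemma common_sector:
  assumes "has_corner \<kappa> v u" "has_corner \<kappa>' v u'"
    and "i < width \<kappa>" "j < width \<kappa>'" "z ^ i * u = z ^ j * u'"
  shows "\<kappa> = \<kappa>'" "u = u'"
proof -
  obtain c1 c2 where c: "0 < c1" "0 < c2" "z ^ i + z ^ (i + 1) = of_real c1 + of_real c2 * z ^ width \<kappa>"
    using sector_bisector[OF z assms(3) width_bounds(2)] by blast
  obtain d1 d2 where d: "0 < d1" "0 < d2" "z ^ j + z ^ (j + 1) = of_real d1 + of_real d2 * z ^ width \<kappa>'"
    using sector_bisector[OF z assms(4) width_bounds(2)] by blast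
  define \<epsilon> where "\<epsilon> = 1 / (1 + c1 + c2 + d1 + d2)"
  have e: "0 < \<epsilon>" "\<epsilon> * c1 < 1" "\<epsilon> * c2 < 1" "\<epsilon> * d1 < 1" "\<epsilon> * d2 < 1"
    using c d by (auto simp: \<epsilon>_def)
  define p where "p = v + of_real \<epsilon> * ((z ^ i + z ^ (i + 1)) * u)"
  have "p = v + (of_real (\<epsilon> * c1) * u + of_real (\<epsilon> * c2) * (z ^ width \<kappa> * u))"
    unfolding p_def c(3) by (simp add: algebra_simps)
  hence 1: "p \<in> inner (rhomb_at z \<kappa> v u)"
    unfolding inner_rhomb_at by (simp only: open_box_iff[OF corner_cross[OF assms(1)]]) (use c e in simp)
  have "(z ^ i + z ^ (i + 1)) * u = (z ^ j + z ^ (j + 1)) * u'"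
    using assms(5) by (simp add: algebra_simps)
  hence "p = v + (of_real (\<epsilon> * d1) * u' + of_real (\<epsilon> * d2) * (z ^ width \<kappa>' * u'))"
    unfolding p_def d(3) by (simp add: algebra_simps)
  hence 2: "p \<in> inner (rhomb_at z \<kappa>' v u')"
    unfolding inner_rhomb_at by (simp only: open_box_iff[OF corner_cross[OF assms(2)]]) (use d e in simp)
  have "rhomb_at z \<kappa> v u = rhomb_at z \<kappa>' v u'"
    using inner_region_eq[OF _ _ 1] inner_subset 2 assms(1,2) unfolding has_corner_def by blast
  thus "\<kappa> = \<kappa>'" "u = u'"
    using rhomb_at_inj[OF z] corner_nonzero assms(1,2) by blast+
qed

lemma common_sector_mod:
  assumes "has_corner \<kappa> v (z ^ m * u)" "has_corner \<kappa>' v (z ^ n * u)"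
    and "i < width \<kappa>" "j < width \<kappa>'" "(i + m) mod 10 = (j + n) mod 10"
  shows "\<kappa> = \<kappa>'" "m mod 10 = n mod 10"
proof -
  have "z ^ (i + m) = z ^ (j + n)" using assms(5) z_pow_mod[OF z] by metis
  hence eq: "z ^ i * (z ^ m * u) = z ^ j * (z ^ n * u)" by (simp add: power_add mult.assoc)
  show "\<kappa> = \<kappa>'" by (rule common_sector[OF assms(1-4) eq])
  have "z ^ m * u = z ^ n * u" by (rule common_sector[OF assms(1-4) eq])
  hence "z ^ m = z ^ n" using corner_nonzero[OF assms(1)] by auto
  thus "m mod 10 = n mod 10" by (rule z_pow_inj[OF z])
qed

subsection \<open>Edges and vertices\<close>

lemma closed_segment_iff:
  assumes "cross a b \<noteq> 0"
  shows "v + (of_real \<alpha> * a + of_real \<beta> * b) \<in> closed_segment (v + (of_real x1 * a + of_real y1 * b)) (v + (of_real x2 * a + of_real y2 * b))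
    \<longleftrightarrow> (\<exists>t. 0 \<le> t \<and> t \<le> 1 \<and> \<alpha> = (1 - t) * x1 + t * x2 \<and> \<beta> = (1 - t) * y1 + t * y2)"
proof -
  have "v + (of_real \<alpha> * a + of_real \<beta> * b) = (1 - t) *\<^sub>R (v + (of_real x1 * a + of_real y1 * b)) + t *\<^sub>R (v + (of_real x2 * a + of_real y2 * b))
    \<longleftrightarrow> \<alpha> = (1 - t) * x1 + t * x2 \<and> \<beta> = (1 - t) * y1 + t * y2" (is "?l = ?r \<longleftrightarrow> _") for t
  proof -
    have "?r = v + (of_real ((1 - t) * x1 + t * x2) * a + of_real ((1 - t) * y1 + t * y2) * b)"
      by (simp add: scaleR_conv_of_real algebra_simps)
    thus ?thesis by (metis add_left_cancel coordinates_unique[OF assms])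
  qed
  thus ?thesis unfolding closed_segment_def by blast
qed

lemma arrow_coordinates:
  assumes "arrow (rhomb_at z \<kappa> v u) e x y"
  defines "w \<equiv> z ^ width \<kappa> * u"
  shows "{x, y} \<in> {{v + (of_real 0 * u + of_real 0 * w), v + (of_real 1 * u + of_real 0 * w)},
    {v + (of_real 1 * u + of_real 0 * w), v + (of_real 1 * u + of_real 1 * w)},
    {v + (of_real 0 * u + of_real 0 * w), v + (of_real 0 * u + of_real 1 * w)},
    {v + (of_real 0 * u + of_real 1 * w), v + (of_real 1 * u + of_real 1 * w)}}"
  using assms(1) unfolding w_def arrow_def
  by (cases \<kappa>; cases e; auto simp: insert_commute)

text \<open>In the coordinates of a corner the four edges are the four sides of the unit square.\<close>

lemma edge_containing_point:
  assumes "arrow (rhomb_at z \<kappa> v u) e x y" and w: "w = z ^ width \<kappa> * u" and c: "cross u w \<noteq> 0"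
    and p: "v + (of_real \<alpha> * u + of_real \<beta> * w) \<in> closed_segment x y"
  shows "{x, y} = {v, v + u} \<and> \<beta> = 0 \<or> {x, y} = {v + u, v + u + w} \<and> \<alpha> = 1 \<or>
    {x, y} = {v, v + w} \<and> \<alpha> = 0 \<or> {x, y} = {v + w, v + u + w} \<and> \<beta> = 1"
proof -
  let ?p = "\<lambda>\<alpha> \<beta>. v + (of_real \<alpha> * u + of_real \<beta> * w)"
  have seg: "?p \<alpha> \<beta> \<in> closed_segment p q" if "{x, y} = {p, q}" for p q
    using that closed_segment_commute p by (metis doubleton_eq_iff)
  have "{x, y} = {?p 0 0, ?p 1 0} \<or> {x, y} = {?p 1 0, ?p 1 1} \<or> {x, y} = {?p 0 0, ?p 0 1} \<or> {x, y} = {?p 0 1, ?p 1 1}"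
    using arrow_coordinates[OF assms(1), folded w] by blast
  then consider "{x, y} = {?p 0 0, ?p 1 0}" | "{x, y} = {?p 1 0, ?p 1 1}" | "{x, y} = {?p 0 0, ?p 0 1}"
    | "{x, y} = {?p 0 1, ?p 1 1}" by blast
  thus ?thesis
  proof cases
    case 1
    from seg[OF this] have "\<beta> = 0" unfolding closed_segment_iff[OF c] by auto
    thus ?thesis using 1 by simp
  next
    case 2
    from seg[OF this] have "\<alpha> = 1" unfolding closed_segment_iff[OF c] by auto
    thus ?thesis using 2 by (simp add: add.assoc)
  next
    case 3
    from seg[OF this] have "\<alpha> = 0" unfolding closed_segment_iff[OF c] by auto
    thus ?thesis using 3 by simp
  next
    case 4
    from seg[OF this] have "\<beta> = 1" unfolding closed_segment_iff[OF c] by auto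
    thus ?thesis using 4 by (simp add: add.assoc)
  qed
qed

lemma midpoint_on_edge:
  assumes "r \<in> P" "arrow r e x y" "arrow r e' x' y'" "midpoint x y \<in> closed_segment x' y'"
  shows "{x, y} = {x', y'}"
proof -
  obtain d where d: "directed_arrow r d x y"
    using assms(2) by (metis directed_arrow_def fst_conv snd_conv)
  obtain \<kappa> u where k: "r = rhomb_at z \<kappa> x u" "has_corner \<kappa> x u" and
    y: "y = x + u \<or> y = x + z ^ width \<kappa> * u"
    using directed_arrow_corner[OF assms(1) d] by blast
  define w where "w = z ^ width \<kappa> * u"
  have c: "cross u w \<noteq> 0" using corner_cross[OF k(2)] by (simp add: w_def)
  have mid: "midpoint x (x + t) = x + of_real (1 / 2) * t" for t
    by (simp add: midpoint_def scaleR_conv_of_real field_simps)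
  have edge: "{x', y'} = {x, x + u} \<and> \<beta> = 0 \<or> {x', y'} = {x + u, x + u + w} \<and> \<alpha> = 1 \<or>
    {x', y'} = {x, x + w} \<and> \<alpha> = 0 \<or> {x', y'} = {x + w, x + u + w} \<and> \<beta> = 1"
    if "midpoint x y = x + (of_real \<alpha> * u + of_real \<beta> * w)" for \<alpha> \<beta>
    using edge_containing_point[OF assms(3)[unfolded k(1)] w_def c] assms(4) unfolding that by blast
  from y show ?thesis
  proof
    assume y: "y = x + u"
    have "midpoint x y = x + (of_real (1/2) * u + of_real 0 * w)" unfolding y mid by simp
    from edge[OF this] show ?thesis unfolding y by auto
  next
    assume y: "y = x + z ^ width \<kappa> * u"
    have "midpoint x y = x + (of_real 0 * u + of_real (1/2) * w)" unfolding y mid w_def by simp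
    from edge[OF this] show ?thesis unfolding y w_def by auto
  qed
qed

lemma arrow_antisym:
  assumes "r \<in> P" "arrow r e x y" "arrow r e' x' y'" "{x, y} = {x', y'}"
  shows "e = e'" "x = x'" "y = y'"
proof -
  have *: "e = e' \<and> x = x' \<and> y = y'"
    using assms(1)
  proof (cases rule: rhomb_corner_E)
    case (1 v u)
    hence "has_corner kA v u" using assms(1) by (simp add: has_corner_def)
    note distinct_corner_points[OF this]
    thus ?thesis using assms(2-4) unfolding 1 arrow_def by (auto split: if_splits simp: doubleton_eq_iff)
  next
    case (2 v u)
    hence "has_corner kE v u" using assms(1) by (simp add: has_corner_def)
    note distinct_corner_points[OF this]
    thus ?thesis using assms(2-4) unfolding 2 arrow_def by (auto split: if_splits simp: doubleton_eq_iff)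
  qed
  thus "e = e'" "x = x'" "y = y'" by auto
qed

end

context rhomb_tiling
begin

lemma rhomb_vertices_at: "rhomb_vertices (rhomb_at z \<kappa> v u) = {v, v + u, v + (u + z ^ width \<kappa> * u), v + z ^ width \<kappa> * u}"
  by (cases \<kappa>) auto

lemma vertex_in_own_region: "v \<in> rhomb_vertices r \<Longrightarrow> v \<in> rhomb_region r"
  unfolding rhomb_region_def by (rule hull_inc)

lemma directed_arrowI: "arrow r e x y \<Longrightarrow> directed_arrow r (e, True) x y"
  by (simp add: directed_arrow_def)

lemma arrow_corner:
  assumes "r \<in> P" "arrow r e x y"
  obtains \<kappa> u where "r = rhomb_at z \<kappa> x u" "has_corner \<kappa> x u" "y = x + u \<or> y = x + z ^ width \<kappa> * u"
  using directed_arrow_corner[OF assms(1) directed_arrowI[OF assms(2)]] by blast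

lemma vertex_on_edge:
  assumes "r \<in> P" "v \<in> rhomb_vertices r" "arrow r e x y" "v \<in> closed_segment x y"
  shows "v = x \<or> v = y"
proof -
  obtain \<kappa> u where k: "has_corner \<kappa> v u" "r = rhomb_at z \<kappa> v u"
    using vertex_corner[OF assms(1,2)] by blast
  define w where "w = z ^ width \<kappa> * u"
  have c: "cross u w \<noteq> 0" using corner_cross[OF k(1)] by (simp add: w_def)
  have "v + (of_real 0 * u + of_real 0 * w) \<in> closed_segment x y" using assms(4) by simp
  from edge_containing_point[OF assms(3)[unfolded k(2)] w_def c this] show ?thesis by auto
qed

lemma arrow_meet:
  assumes "r \<in> P" "s \<in> P" "r \<noteq> s" "p \<in> rhomb_region r" "p \<in> rhomb_region s"
  shows "p \<in> rhomb_vertices r \<inter> rhomb_vertices s \<or> (\<exists>e x y. arrow r e x y \<and> arrow s e x y \<and> p \<in> closed_segment x y)"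
proof -
  have p: "p \<in> rhomb_region r \<inter> rhomb_region s" using assms by blast
  from meet[OF assms(1-3)] show ?thesis
  proof (elim disjE)
    assume "\<exists>v \<in> rhomb_vertices r \<inter> rhomb_vertices s. rhomb_region r \<inter> rhomb_region s = {v}"
    then obtain v where "v \<in> rhomb_vertices r \<inter> rhomb_vertices s" "rhomb_region r \<inter> rhomb_region s = {v}" by blast
    moreover from this have "p = v" using p by blast
    ultimately show ?thesis by blast
  next
    assume "\<exists>(x, y) \<in> (arrows1 r \<inter> arrows1 s) \<union> (arrows2 r \<inter> arrows2 s).
       rhomb_region r \<inter> rhomb_region s = closed_segment x y"
    then obtain x y where "(x, y) \<in> (arrows1 r \<inter> arrows1 s) \<union> (arrows2 r \<inter> arrows2 s)"
      and seg: "rhomb_region r \<inter> rhomb_region s = closed_segment x y" by blast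
    hence "arrow r True x y \<and> arrow s True x y \<or> arrow r False x y \<and> arrow s False x y"
      by (auto simp: arrow_def)
    thus ?thesis using p unfolding seg by blast
  qed (use p in blast)
qed

lemma vertex_in_region:
  assumes "r \<in> P" "s \<in> P" "v \<in> rhomb_vertices s" "v \<in> rhomb_region r"
  shows "v \<in> rhomb_vertices r"
proof (cases "r = s")
  case False
  from arrow_meet[OF assms(1,2) False assms(4) vertex_in_own_region[OF assms(3)]] show ?thesis
  proof
    assume "\<exists>e x y. arrow r e x y \<and> arrow s e x y \<and> v \<in> closed_segment x y"
    then obtain e x y where a: "arrow r e x y" "arrow s e x y" "v \<in> closed_segment x y" by blast
    thus ?thesis using vertex_on_edge[OF assms(2,3) a(2,3)] arrow_vertices[OF a(1)] by blast
  qed blast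
qed (use assms in simp)

lemma midpoint_not_vertex:
  assumes "r \<in> P" "arrow r e x y"
  shows "midpoint x y \<notin> rhomb_vertices r"
proof -
  obtain \<kappa> u where k: "r = rhomb_at z \<kappa> x u" "has_corner \<kappa> x u" and
    y: "y = x + u \<or> y = x + z ^ width \<kappa> * u"
    using arrow_corner[OF assms] by blast
  define w where "w = z ^ width \<kappa> * u"
  have c: "cross u w \<noteq> 0" using corner_cross[OF k(2)] by (simp add: w_def)
  have no_vertex: "x + (of_real \<alpha> * u + of_real \<beta> * w) \<notin> rhomb_vertices r" if "\<alpha> = 1/2 \<or> \<beta> = 1/2" for \<alpha> \<beta>
  proof
    assume "x + (of_real \<alpha> * u + of_real \<beta> * w) \<in> rhomb_vertices r"
    hence "of_real \<alpha> * u + of_real \<beta> * w = of_real 0 * u + of_real 0 * w \<or>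
      of_real \<alpha> * u + of_real \<beta> * w = of_real 1 * u + of_real 0 * w \<or>
      of_real \<alpha> * u + of_real \<beta> * w = of_real 1 * u + of_real 1 * w \<or>
      of_real \<alpha> * u + of_real \<beta> * w = of_real 0 * u + of_real 1 * w"
      unfolding k(1) rhomb_vertices_at w_def by simp
    thus False by (elim disjE) (drule coordinates_unique[OF c], use that in simp)+
  qed
  have mid: "midpoint x (x + t) = x + of_real (1 / 2) * t" for t
    by (simp add: midpoint_def scaleR_conv_of_real field_simps)
  from y show ?thesis
  proof
    assume "y = x + u"
    hence "midpoint x y = x + (of_real (1/2) * u + of_real 0 * w)" by (simp add: mid)
    thus ?thesis using no_vertex[of "1/2" 0] by simp
  next
    assume "y = x + z ^ width \<kappa> * u"
    hence "midpoint x y = x + (of_real 0 * u + of_real (1/2) * w)" by (simp add: mid w_def)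
    thus ?thesis using no_vertex[of 0 "1/2"] by simp
  qed
qed

lemma midpoint_in_own_region:
  assumes "r \<in> P" "arrow r e x y"
  shows "midpoint x y \<in> rhomb_region r"
proof -
  have "closed_segment x y \<subseteq> rhomb_region r"
    unfolding rhomb_region_def segment_convex_hull using arrow_vertices[OF assms(2)] by (intro hull_mono) auto
  thus ?thesis by auto
qed

lemma midpoint_arrow:
  assumes "r \<in> P" "s \<in> P" "arrow r e x y" "midpoint x y \<in> rhomb_region s"
  shows "arrow s e x y"
proof (cases "r = s")
  case False
  from arrow_meet[OF assms(1,2) False midpoint_in_own_region[OF assms(1,3)] assms(4)] show ?thesis
  proof
    assume "midpoint x y \<in> rhomb_vertices r \<inter> rhomb_vertices s"
    thus ?thesis using midpoint_not_vertex[OF assms(1,3)] by blast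
  next
    assume "\<exists>e' x' y'. arrow r e' x' y' \<and> arrow s e' x' y' \<and> midpoint x y \<in> closed_segment x' y'"
    then obtain e' x' y' where a: "arrow r e' x' y'" "arrow s e' x' y'" "midpoint x y \<in> closed_segment x' y'" by blast
    have "{x, y} = {x', y'}" by (rule midpoint_on_edge[OF assms(1,3) a(1,3)])
    from arrow_antisym[OF assms(1,3) a(1) this] show ?thesis using a by simp
  qed
qed (use assms in simp)

lemma midpoint_edge_unique:
  assumes "r \<in> P" "s \<in> P" "arrow r e x y" "arrow s e' x' y'" "midpoint x y \<in> closed_segment x' y'"
  shows "e = e'" "x = x'" "y = y'"
proof -
  have "closed_segment x' y' \<subseteq> rhomb_region s"
    unfolding rhomb_region_def segment_convex_hull using arrow_vertices[OF assms(4)] by (intro hull_mono) auto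
  hence "arrow s e x y" using midpoint_arrow[OF assms(1-3)] assms(5) by blast
  from arrow_antisym[OF assms(2) this assms(4) midpoint_on_edge[OF assms(2) this assms(4,5)]]
  show "e = e'" "x = x'" "y = y'" .
qed

lemma arrows_consistent:
  assumes "r \<in> P" "s \<in> P" "arrow r e x y" "arrow s e' x' y'" "{x, y} = {x', y'}"
  shows "e = e'" "x = x'" "y = y'"
proof -
  have "midpoint x y \<in> closed_segment x y" by simp
  hence "midpoint x y \<in> closed_segment x' y'" using assms(5) closed_segment_commute by (metis doubleton_eq_iff)
  from midpoint_edge_unique[OF assms(1-4) this] show "e = e'" "x = x'" "y = y'" .
qed

subsection \<open>Local finiteness and neighbours\<close>

text \<open>Up to similarity there are two shapes of rhombs, whence the packing argument for local finiteness.\<close>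

lemma uniform_ball: "\<exists>\<rho>>0. \<forall>r\<in>P. \<exists>c. ball c \<rho> \<subseteq> inner r \<and> rhomb_region r \<subseteq> cball c (2 * l)"
proof -
  define m where "m k = (1 / 2) * (1 + z ^ k)" for k
  have ex: "\<exists>\<rho>>0. ball (m k) \<rho> \<subseteq> open_parallelogram 0 1 (z ^ k)" if "1 \<le> k" "k \<le> 4" for k
  proof -
    have c: "cross 1 (z ^ k) \<noteq> 0" using z_pow_cross[OF z that, of 1] by simp
    have "m k = 0 + (of_real (1 / 2) * 1 + of_real (1 / 2) * z ^ k)" by (simp add: m_def algebra_simps)
    hence "m k \<in> open_parallelogram 0 1 (z ^ k)" by (simp only: open_box_iff[OF c]) simp
    thus ?thesis using open_open_box[OF c] open_contains_ball by blast
  qed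
  have "(1::nat) \<le> 4" "(1::nat) \<le> 2" "(2::nat) \<le> 4" by simp_all
  from ex[OF order.refl this(1)] ex[OF this(2,3)] obtain \<rho>1 \<rho>2 where
    \<rho>: "\<rho>1 > 0" "ball (m 1) \<rho>1 \<subseteq> open_parallelogram 0 1 (z ^ 1)" "\<rho>2 > 0" "ball (m 2) \<rho>2 \<subseteq> open_parallelogram 0 1 (z ^ 2)" by blast
  define \<rho> where "\<rho> = min \<rho>1 \<rho>2"
  have ball: "ball (m k) \<rho> \<subseteq> open_parallelogram 0 1 (z ^ k)" if "k = 1 \<or> k = 2" for k
  proof -
    have "ball (m k) \<rho> \<subseteq> ball (m k) \<rho>1" "ball (m k) \<rho> \<subseteq> ball (m k) \<rho>2" by (auto simp: \<rho>_def)
    thus ?thesis using \<rho>(2,4) that by blast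
  qed
  have "\<exists>c. ball c (\<rho> * l) \<subseteq> inner r \<and> rhomb_region r \<subseteq> cball c (2 * l)" if "r \<in> P" for r
  proof -
    obtain \<kappa> v u where k: "r = rhomb_at z \<kappa> v u" "width \<kappa> = 1 \<or> width \<kappa> = 2"
    proof -
      note r = \<open>r \<in> P\<close>
      have "\<exists>\<kappa> v u. r = rhomb_at z \<kappa> v u \<and> (width \<kappa> = 1 \<or> width \<kappa> = 2)"
        using r
      proof (cases rule: rhomb_corner_E)
        case (1 v u) thus ?thesis by (metis width.simps(1))
      next
        case (2 v u) thus ?thesis by (metis width.simps(5))
      qed
      thus thesis using that by blast
    qed
    have corner: "has_corner \<kappa> v u" using that k by (simp add: has_corner_def)
    have nu: "norm u = l" by (rule corner_length[OF corner])
    define c where "c = v + m (width \<kappa>) * u"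
    have "ball c (\<rho> * l) \<subseteq> inner r"
    proof
      fix p assume p: "p \<in> ball c (\<rho> * l)"
      define q where "q = (p - v) / u"
      have pq: "p = v + q * u" using corner_nonzero[OF corner] by (simp add: q_def)
      have "c - p = (m (width \<kappa>) - q) * u" unfolding c_def pq by (simp add: algebra_simps)
      hence "dist c p = dist (m (width \<kappa>)) q * l" unfolding dist_norm nu[symmetric] by (simp add: norm_mult)
      hence "q \<in> ball (m (width \<kappa>)) \<rho>" using p l_pos by simp
      then obtain \<alpha> \<beta> where "q = 0 + (of_real \<alpha> * 1 + of_real \<beta> * z ^ width \<kappa>)" "0 < \<alpha>" "\<alpha> < 1" "0 < \<beta>" "\<beta> < 1"
        using ball[OF k(2)] unfolding open_parallelogram_def by blast
      hence "p = v + (of_real \<alpha> * u + of_real \<beta> * (z ^ width \<kappa> * u))" "0 < \<alpha>" "\<alpha> < 1" "0 < \<beta>" "\<beta> < 1"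
        unfolding pq by (simp_all add: algebra_simps)
      thus "p \<in> inner r" unfolding k(1) inner_rhomb_at open_parallelogram_def mem_Collect_eq by blast
    qed
    moreover have "rhomb_region r \<subseteq> cball c (2 * l)"
    proof
      fix p assume "p \<in> rhomb_region r"
      then obtain \<alpha> \<beta> where p: "p = v + (of_real \<alpha> * u + of_real \<beta> * (z ^ width \<kappa> * u))" and
        ab: "0 \<le> \<alpha>" "\<alpha> \<le> 1" "0 \<le> \<beta>" "\<beta> \<le> 1"
        unfolding k(1) rhomb_region_at parallelogram_def mem_Collect_eq by blast
      have "p - c = of_real (\<alpha> - 1/2) * u + of_real (\<beta> - 1/2) * (z ^ width \<kappa> * u)"
        by (simp add: p c_def m_def algebra_simps)
      hence "norm (p - c) \<le> norm (of_real (\<alpha> - 1/2) * u) + norm (of_real (\<beta> - 1/2) * (z ^ width \<kappa> * u))"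
        by (metis norm_triangle_ineq)
      also have "\<dots> = \<bar>\<alpha> - 1/2\<bar> * l + \<bar>\<beta> - 1/2\<bar> * l"
        unfolding norm_mult norm_of_real norm_power z_norm[OF z] nu by simp
      also have "\<dots> \<le> 1 * l + 1 * l" using ab l_pos by (intro add_mono mult_right_mono) auto
      finally show "p \<in> cball c (2 * l)" by (simp add: dist_norm norm_minus_commute)
    qed
    ultimately show ?thesis by blast
  qed
  moreover have "0 < \<rho> * l" using \<rho> l_pos by (simp add: \<rho>_def)
  ultimately show ?thesis by blast
qed

lemma locally_finite: "finite {r \<in> P. rhomb_region r \<inter> cball p R \<noteq> {}}"
proof -
  obtain \<rho> where \<rho>: "\<rho> > 0" "\<forall>r\<in>P. \<exists>c. ball c \<rho> \<subseteq> inner r \<and> rhomb_region r \<subseteq> cball c (2 * l)"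
    using uniform_ball by blast
  then obtain c where c: "\<And>r. r \<in> P \<Longrightarrow> ball (c r) \<rho> \<subseteq> inner r \<and> rhomb_region r \<subseteq> cball (c r) (2 * l)"
    by metis
  define F where "F = {r \<in> P. rhomb_region r \<inter> cball p R \<noteq> {}}"
  have same: "r = s" if "r \<in> P" "s \<in> P" "dist (c r) (c s) < \<rho>" for r s
  proof -
    have "c s \<in> ball (c r) \<rho>" "c s \<in> ball (c s) \<rho>" using that \<rho> by (auto simp: dist_commute)
    hence "c s \<in> inner r" "c s \<in> rhomb_region s" using c that inner_subset by blast+
    thus ?thesis using inner_region_eq that by blast
  qed
  have inj: "inj_on c F"
    by (rule inj_onI) (use same \<rho> in \<open>auto simp: F_def\<close>)
  have "c ` F \<subseteq> cball p (R + 2 * l)"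
  proof
    fix q assume "q \<in> c ` F"
    then obtain r x where r: "r \<in> P" "q = c r" "x \<in> rhomb_region r" "x \<in> cball p R"
      unfolding F_def by blast
    hence "x \<in> cball q (2 * l)" using c by blast
    hence "dist q x \<le> 2 * l" "dist p x \<le> R" using r(4) by auto
    thus "q \<in> cball p (R + 2 * l)" using dist_triangle2[of p q x] by simp
  qed
  hence bdd: "bounded (c ` F)" using bounded_cball bounded_subset by blast
  have "finite (c ` F)"
  proof (rule ccontr)
    assume inf: "infinite (c ` F)"
    then obtain x where x: "x islimpt (c ` F)"
      using bounded_infinite_imp_islimpt[OF order.refl bdd] by blast
    hence "infinite (c ` F \<inter> ball x (\<rho> / 2))" using \<rho> by (simp add: islimpt_eq_infinite_ball)
    then obtain q where q: "q \<in> c ` F \<inter> ball x (\<rho> / 2)" by (metis ex_in_conv finite.emptyI)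
    hence "infinite (c ` F \<inter> ball x (\<rho> / 2) - {q})" using \<open>infinite (c ` F \<inter> ball x (\<rho> / 2))\<close> by simp
    then obtain q' where q': "q' \<in> c ` F \<inter> ball x (\<rho> / 2) - {q}" by (metis ex_in_conv finite.emptyI)
    from q q' obtain r s where rs: "r \<in> P" "s \<in> P" "q = c r" "q' = c s" by (auto simp: F_def)
    have "dist q q' < \<rho>" using q q' dist_triangle_half_r[of x q \<rho> q'] by auto
    hence "r = s" using same rs by blast
    thus False using q' rs by simp
  qed
  thus ?thesis using inj unfolding F_def[symmetric] by (metis finite_imageD)
qed

lemma closed_region: "closed (rhomb_region r)"
  unfolding rhomb_region_def by (intro compact_imp_closed finite_imp_compact_convex_hull) (cases r; simp)

text \<open>Points close to the midpoint of the edge and outside \<open>r\<close> are covered by finitely many other rhombs; by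
  closedness one of these contains the midpoint, and two rhombs that share it share the edge with its arrow.\<close>

lemma neighbour:
  assumes "r \<in> P" "arrow r e x y"
  shows "\<exists>s\<in>P. s \<noteq> r \<and> arrow s e x y"
proof -
  obtain \<kappa> u where k: "r = rhomb_at z \<kappa> x u" "has_corner \<kappa> x u" and
    y: "y = x + u \<or> y = x + z ^ width \<kappa> * u"
    using arrow_corner[OF assms] by blast
  define m where "m = midpoint x y"
  define w where "w = (if y = x + u then z ^ width \<kappa> * u else u)"
  have xy: "y - x = (if y = x + u then u else z ^ width \<kappa> * u)" using y by auto
  have parallelogram: "rhomb_region r = parallelogram x (y - x) w" and c: "cross (y - x) w \<noteq> 0"
    unfolding k(1) rhomb_region_at w_def xy
    using corner_cross[OF k(2)] cross_commute[of u "z ^ width \<kappa> * u"] box_commute(1)[of x u] by auto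
  \<comment> \<open>Points that approach the midpoint of the edge from the other side.\<close>
  define f where "f n = x + (of_real (1 / 2) * (y - x) + of_real (- (1 / (real n + 1))) * w)" for n
  have fn: "f n \<notin> rhomb_region r" for n
  proof -
    have "\<not> 0 \<le> - (1 / (real n + 1))" by (simp add: field_simps)
    thus ?thesis unfolding parallelogram f_def using box_iff[OF c, of x "1/2"] by blast
  qed
  have "(\<lambda>n. 1 / (real n + 1)) \<longlonglongrightarrow> 0"
    using LIMSEQ_ignore_initial_segment[OF lim_1_over_n[where 'a=real], of 1] by (simp add: add.commute)
  hence "f \<longlonglongrightarrow> x + (of_real (1 / 2) * (y - x) + of_real (- 0) * w)"
    unfolding f_def by (intro tendsto_intros)
  moreover have "m = x + (of_real (1 / 2) * (y - x) + of_real (- 0) * w)"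
    by (simp add: m_def midpoint_def scaleR_conv_of_real field_simps)
  ultimately have lim: "f \<longlonglongrightarrow> m" by simp
  define F where "F = {s \<in> P. rhomb_region s \<inter> cball m 1 \<noteq> {}} - {r}"
  have "finite F" unfolding F_def using locally_finite by blast
  hence "closed (\<Union>s\<in>F. rhomb_region s)" using closed_region by (intro closed_UN) auto
  moreover have "eventually (\<lambda>n. f n \<in> (\<Union>s\<in>F. rhomb_region s)) sequentially"
  proof -
    have "eventually (\<lambda>n. dist (f n) m < 1) sequentially" using lim tendstoD[of f m sequentially 1] by simp
    thus ?thesis
    proof eventually_elim
      case (elim n)
      obtain s where "s \<in> P" "f n \<in> rhomb_region s" using cover by blast
      moreover have "s \<noteq> r" using calculation fn by blast
      moreover have "f n \<in> cball m 1" using elim by (simp add: dist_commute)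
      ultimately have "s \<in> F" "f n \<in> rhomb_region s" unfolding F_def by blast+
      thus ?case by blast
    qed
  qed
  ultimately have "m \<in> (\<Union>s\<in>F. rhomb_region s)"
    using lim Lim_in_closed_set by (metis sequentially_bot)
  then obtain s where "s \<in> P" "s \<noteq> r" "m \<in> rhomb_region s" by (auto simp: F_def)
  thus ?thesis using midpoint_arrow[OF assms(1) _ assms(2)] by (auto simp: m_def)
qed

lemma directed_neighbour:
  assumes "r \<in> P" "directed_arrow r e x y"
  shows "\<exists>s\<in>P. s \<noteq> r \<and> directed_arrow s e x y"
  using neighbour[OF assms(1)] assms(2) unfolding directed_arrow_def by (cases "snd e") simp_all

subsection \<open>Corners around a vertex\<close>

text \<open>The rhomb across the last edge of a corner has the same arrow on that edge, and it lies on the other side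
  because a sector at \<open>v\<close> belongs to one rhomb only.\<close>

lemma corner_next:
  assumes "has_corner \<kappa> v u"
  shows "\<exists>\<kappa>'. has_corner \<kappa>' v (z ^ width \<kappa> * u) \<and> first_arrow \<kappa>' = last_arrow \<kappa>"
proof -
  define r where "r = rhomb_at z \<kappa> v u"
  have r: "r \<in> P" using assms by (simp add: r_def has_corner_def)
  obtain s where s: "s \<in> P" "s \<noteq> r" "directed_arrow s (last_arrow \<kappa>) v (v + z ^ width \<kappa> * u)"
    using directed_neighbour[OF r] directed_arrow_last unfolding r_def by blast
  obtain \<kappa>' u' where k: "s = rhomb_at z \<kappa>' v u'" "has_corner \<kappa>' v u'" and
    e: "v + z ^ width \<kappa> * u = v + u' \<and> first_arrow \<kappa>' = last_arrow \<kappa> \<or>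
      v + z ^ width \<kappa> * u = v + z ^ width \<kappa>' * u' \<and> last_arrow \<kappa>' = last_arrow \<kappa>"
    using directed_arrow_corner[OF s(1,3)] by blast
  from e show ?thesis
  proof
    assume *: "v + z ^ width \<kappa> * u = v + z ^ width \<kappa>' * u' \<and> last_arrow \<kappa>' = last_arrow \<kappa>"
    have "z ^ n = z * z ^ (n - 1)" if "1 \<le> n" for n using that by (simp flip: power_Suc)
    hence "z ^ (width \<kappa> - 1) * u = z ^ (width \<kappa>' - 1) * u'"
      using * width_bounds z_nonzero[OF z] by (metis add_left_cancel mult.assoc mult_left_cancel)
    moreover have "width \<kappa> - 1 < width \<kappa>" "width \<kappa>' - 1 < width \<kappa>'" using width_bounds by (cases \<kappa>; cases \<kappa>'; simp)+
    ultimately have "\<kappa> = \<kappa>'" "u = u'" using common_sector[OF assms k(2)] by blast+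
    thus ?thesis using s(2) k(1) r_def by simp
  qed (use k in auto)
qed

lemma corner_prev:
  assumes "has_corner \<kappa> v u"
  shows "\<exists>\<kappa>'. has_corner \<kappa>' v (z ^ (10 - width \<kappa>') * u) \<and> last_arrow \<kappa>' = first_arrow \<kappa>"
proof -
  define r where "r = rhomb_at z \<kappa> v u"
  have r: "r \<in> P" using assms by (simp add: r_def has_corner_def)
  obtain s where s: "s \<in> P" "s \<noteq> r" "directed_arrow s (first_arrow \<kappa>) v (v + u)"
    using directed_neighbour[OF r] directed_arrow_first unfolding r_def by blast
  obtain \<kappa>' u' where k: "s = rhomb_at z \<kappa>' v u'" "has_corner \<kappa>' v u'" and
    e: "v + u = v + u' \<and> first_arrow \<kappa>' = first_arrow \<kappa> \<or>
      v + u = v + z ^ width \<kappa>' * u' \<and> last_arrow \<kappa>' = first_arrow \<kappa>"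
    using directed_arrow_corner[OF s(1,3)] by blast
  from e show ?thesis
  proof
    assume "v + u = v + u' \<and> first_arrow \<kappa>' = first_arrow \<kappa>"
    hence "z ^ 0 * u = z ^ 0 * u'" by simp
    moreover have "0 < width \<kappa>" "0 < width \<kappa>'" using width_bounds by (cases \<kappa>; cases \<kappa>'; simp)+
    ultimately have "\<kappa> = \<kappa>'" "u = u'" using common_sector[OF assms k(2)] by blast+
    thus ?thesis using s(2) k(1) r_def by simp
  next
    assume *: "v + u = v + z ^ width \<kappa>' * u' \<and> last_arrow \<kappa>' = first_arrow \<kappa>"
    have "z ^ (10 - width \<kappa>') * z ^ width \<kappa>' = 1"
      using width_bounds[of \<kappa>'] z_pow10[OF z] by (simp flip: power_add)
    hence "z ^ (10 - width \<kappa>') * u = u'" using * by (simp flip: mult.assoc)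
    hence "has_corner \<kappa>' v (z ^ (10 - width \<kappa>') * u)" using k(2) by (simp only:)
    thus ?thesis using * by blast
  qed
qed


lemma corner_next_pow:
  assumes "has_corner \<kappa> v (z ^ n * u)"
  shows "\<exists>\<kappa>'. has_corner \<kappa>' v (z ^ (n + width \<kappa>) * u) \<and> first_arrow \<kappa>' = last_arrow \<kappa>"
  using corner_next[OF assms] by (simp add: power_add mult_ac)

lemma corner_prev_pow:
  assumes "has_corner \<kappa> v (z ^ n * u)"
  shows "\<exists>\<kappa>'. has_corner \<kappa>' v (z ^ (n + 10 - width \<kappa>') * u) \<and> last_arrow \<kappa>' = first_arrow \<kappa>"
proof -
  obtain \<kappa>' where k: "has_corner \<kappa>' v (z ^ (10 - width \<kappa>') * (z ^ n * u))" "last_arrow \<kappa>' = first_arrow \<kappa>"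
    using corner_prev[OF assms] by blast
  have "n + 10 - width \<kappa>' = (10 - width \<kappa>') + n" using width_bounds[of \<kappa>'] by simp
  hence "z ^ (n + 10 - width \<kappa>') * u = z ^ (10 - width \<kappa>') * (z ^ n * u)" by (simp add: power_add mult.assoc)
  thus ?thesis using k by metis
qed

lemma z_pow_6_7: "z ^ 5 * w = - w" "z ^ 6 * w = - (z * w)" "z ^ 7 * w = - (z\<^sup>2 * w)"
proof -
  have 5: "z ^ 5 * x = - x" for x using z_pow5[OF z] by simp
  have "z ^ 6 * w = z ^ 5 * (z * w)" by (simp add: eval_nat_numeral)
  thus "z ^ 6 * w = - (z * w)" using 5 by (simp only:)
  have "z ^ 7 * w = z ^ 5 * (z\<^sup>2 * w)" by (simp add: eval_nat_numeral)
  thus "z ^ 7 * w = - (z\<^sup>2 * w)" using 5 by (simp only:)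
  show "z ^ 5 * w = - w" by (rule 5)
qed

lemma corner_shift:
  "has_corner kA v u \<longleftrightarrow> has_corner kB (v + u) (z * u)"
  "has_corner kA v u \<longleftrightarrow> has_corner kD (v + z * u) (z ^ 6 * u)"
  "has_corner kC v u \<longleftrightarrow> has_corner kB (v + z * u) (z ^ 6 * u)"
  "has_corner kC v u \<longleftrightarrow> has_corner kD (v + u) (z * u)"
  "has_corner kE v u \<longleftrightarrow> has_corner kF (v + u) (z\<^sup>2 * u)"
  "has_corner kE v u \<longleftrightarrow> has_corner kG (v + (u + z\<^sup>2 * u)) (z ^ 5 * u)"
  "has_corner kE v u \<longleftrightarrow> has_corner kH (v + z\<^sup>2 * u) (z ^ 7 * u)"
  unfolding has_corner_def z_pow_6_7
  by (simp_all only: rhomb_at.simps mult_minus_right opposite_direction) (simp_all add: add_ac)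

lemma first_arrow_cases:
  "first_arrow \<kappa> = (True, True) \<longleftrightarrow> \<kappa> = kA \<or> \<kappa> = kE"
  "first_arrow \<kappa> = (True, False) \<longleftrightarrow> \<kappa> = kB \<or> \<kappa> = kH"
  "first_arrow \<kappa> = (False, True) \<longleftrightarrow> \<kappa> = kC \<or> \<kappa> = kF"
  by (cases \<kappa>; simp)+

lemma last_arrow_cases:
  "last_arrow \<kappa> = (True, True) \<longleftrightarrow> \<kappa> = kC \<or> \<kappa> = kE"
  "last_arrow \<kappa> = (True, False) \<longleftrightarrow> \<kappa> = kB \<or> \<kappa> = kF"
  "last_arrow \<kappa> = (False, True) \<longleftrightarrow> \<kappa> = kA \<or> \<kappa> = kH"
  by (cases \<kappa>; simp)+

lemma z_pow_mult: "z ^ m * (z ^ n * u) = z ^ ((m + n) mod 10) * u" "z * (z ^ n * u) = z ^ ((1 + n) mod 10) * u"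
  unfolding z_pow_mod[OF z] by (simp_all add: power_add mult.assoc)

text \<open>Two consecutive corners \<open>B\<close> occupy eight of the ten sectors; the corner before them, \<open>B\<close> or \<open>F\<close>, needs at
  least three.\<close>

lemma after_B:
  assumes B: "has_corner kB v u"
  shows "has_corner kH v (z ^ 4 * u)"
proof -
  have B0: "has_corner kB v (z ^ 0 * u)" using B by simp
  obtain \<kappa> where k: "has_corner \<kappa> v (z ^ 4 * u)" "\<kappa> = kB \<or> \<kappa> = kH"
    using corner_next_pow[OF B0] by (auto simp: first_arrow_cases)
  obtain \<kappa>' where k': "has_corner \<kappa>' v (z ^ (0 + 10 - width \<kappa>') * u)" "\<kappa>' = kB \<or> \<kappa>' = kF"
    using corner_prev_pow[OF B0] by (auto simp: last_arrow_cases)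
  have "\<kappa> \<noteq> kB"
  proof
    assume "\<kappa> = kB"
    with k have B: "has_corner kB v (z ^ 4 * u)" by simp
    from k'(2) show False
    proof
      assume "\<kappa>' = kB"
      with k' have "has_corner kB v (z ^ 6 * u)" by simp
      from common_sector_mod(2)[OF B this, of 3 1] show False by simp
    next
      assume "\<kappa>' = kF"
      with k' have "has_corner kF v (z ^ 7 * u)" by simp
      from common_sector_mod(1)[OF B this, of 3 0] show False by simp
    qed
  qed
  thus ?thesis using k by blast
qed

lemma before_B:
  assumes B: "has_corner kB v u"
  shows "has_corner kF v (z ^ 7 * u)"
proof -
  have B0: "has_corner kB v (z ^ 0 * u)" using B by simp
  obtain \<kappa>' where k': "has_corner \<kappa>' v (z ^ (0 + 10 - width \<kappa>') * u)" "\<kappa>' = kB \<or> \<kappa>' = kF"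
    using corner_prev_pow[OF B0] by (auto simp: last_arrow_cases)
  have "\<kappa>' \<noteq> kB"
  proof
    assume "\<kappa>' = kB"
    with k' have "has_corner kB v (z ^ 6 * u)" by simp
    from after_B[OF this, unfolded z_pow_mult] have "has_corner kH v (z ^ 0 * u)" by simp
    from common_sector_mod(1)[OF B0 this, of 0 0] show False by simp
  qed
  hence "\<kappa>' = kF" using k'(2) by blast
  thus ?thesis using k'(1) by simp
qed

text \<open>The corner at the other end \<open>B\<close> of the edge \<open>CB\<close> is preceded by a corner \<open>F\<close>. So across each type 1 edge of a
  thin rhomb there is a thick rhomb.\<close>

lemma after_C:
  assumes "has_corner kC v u"
  shows "has_corner kE v (z * u)"
proof -
  have "has_corner kB (v + z * u) (z ^ 6 * u)" using assms corner_shift(3) by simp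
  hence "has_corner kF (v + z * u) (z ^ 7 * (z ^ 6 * u))" by (rule before_B)
  moreover have "z ^ 7 * (z ^ 6 * u) = z\<^sup>2 * (z * u)"
    unfolding z_pow_mult by (simp add: power3_eq_cube power2_eq_square)
  ultimately show ?thesis using corner_shift(5) by (simp only:)
qed

lemma before_A:
  assumes "has_corner kA v u"
  shows "has_corner kE v (z ^ 8 * u)"
proof -
  have "has_corner kB (v + u) (z * u)" using assms corner_shift(1) by simp
  hence "has_corner kH (v + u) (z ^ 4 * (z ^ 1 * u))" using after_B by simp
  moreover have "z\<^sup>2 * (z ^ 8 * u) = u" "z ^ 7 * (z ^ 8 * u) = z ^ 4 * (z ^ 1 * u)"
    unfolding z_pow_mult by simp_all
  ultimately show ?thesis unfolding corner_shift(7) by (simp only:)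
qed

text \<open>The widths 1, 2, 1, 3, 3 of these corners add up to ten sectors, so nothing else meets \<open>v\<close>. Composed thick
  rhombs are assembled around such vertices.\<close>

definition full_turn :: "complex \<Rightarrow> complex \<Rightarrow> bool" where
  "full_turn v u \<longleftrightarrow> has_corner kC v u \<and> has_corner kE v (z * u) \<and> has_corner kA v (z ^ 3 * u) \<and>
     has_corner kF v (z ^ 4 * u) \<and> has_corner kH v (z ^ 7 * u)"

text \<open>The last arrow of \<open>H\<close> and the first of \<open>F\<close> are of type 2 and point away from \<open>v\<close>; the remaining four sectors
  can only be filled by \<open>C, E, A\<close>.\<close>

lemma full_turn_FH:
  assumes F: "has_corner kF v u" and H: "has_corner kH v (z ^ 3 * u)"
  shows "full_turn v (z ^ 6 * u)"
proof -
  have F0: "has_corner kF v (z ^ 0 * u)" using F by simp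
  obtain \<kappa> where k: "has_corner \<kappa> v (z ^ 6 * u)" "\<kappa> = kC \<or> \<kappa> = kF"
    using corner_next_pow[OF H] by (auto simp: first_arrow_cases)
  have "\<kappa> \<noteq> kF"
  proof
    assume "\<kappa> = kF"
    hence F': "has_corner kF v (z ^ 6 * u)" using k by simp
    obtain \<kappa>' where k': "has_corner \<kappa>' v (z ^ 9 * u)" "\<kappa>' = kB \<or> \<kappa>' = kH"
      using corner_next_pow[OF F'] by (auto simp: first_arrow_cases)
    hence "1 < width \<kappa>'" by auto
    from common_sector_mod(1)[OF k'(1) F0 this, of 0] k'(2) show False by simp
  qed
  hence C: "has_corner kC v (z ^ 6 * u)" using k by blast
  have E: "has_corner kE v (z ^ 7 * u)" using after_C[OF C] by (simp add: z_pow_mult)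
  obtain \<kappa>' where k': "has_corner \<kappa>' v (z ^ 9 * u)" "\<kappa>' = kA \<or> \<kappa>' = kE"
    using corner_next_pow[OF E] by (auto simp: first_arrow_cases)
  have "\<kappa>' \<noteq> kE"
  proof
    assume "\<kappa>' = kE"
    hence "1 < width \<kappa>'" by simp
    from common_sector_mod(1)[OF k'(1) F0 this, of 0] show False using \<open>\<kappa>' = kE\<close> by simp
  qed
  hence A: "has_corner kA v (z ^ 9 * u)" using k' by blast
  show ?thesis unfolding full_turn_def z_pow_mult using A C E F H by simp
qed

lemma full_turn_CH:
  assumes C: "has_corner kC v u" and H: "has_corner kH v (z ^ 7 * u)"
  shows "full_turn v u"
proof -
  have E: "has_corner kE v (z ^ 1 * u)" using after_C C by simp
  have "(1::nat) + 2 = 3" by simp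
  then obtain \<kappa> where k: "has_corner \<kappa> v (z ^ 3 * u)" "\<kappa> = kA \<or> \<kappa> = kE"
    using corner_next_pow[OF E] unfolding width.simps last_arrow.simps first_arrow_cases by metis
  obtain \<kappa>' where k': "has_corner \<kappa>' v (z ^ (7 + 10 - width \<kappa>') * u)" "\<kappa>' = kB \<or> \<kappa>' = kF"
    using corner_prev_pow[OF H] by (auto simp: last_arrow_cases)
  have "\<kappa>' \<noteq> kB"
  proof
    assume "\<kappa>' = kB"
    hence B: "has_corner kB v (z ^ 13 * u)" using k' by simp
    have "0 < width \<kappa>" using k by auto
    from common_sector_mod(1)[OF B k(1) _ this, of 0] k(2) show False by simp
  qed
  hence "\<kappa>' = kF" using k'(2) by blast
  hence "has_corner kF v (z ^ 14 * u)" using k'(1) by simp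
  hence F: "has_corner kF v (z ^ 4 * u)" using z_pow_mod[OF z, of 14] by simp
  have "full_turn v (z ^ 6 * (z ^ 4 * u))" by (rule full_turn_FH[OF F]) (use H in \<open>simp add: z_pow_mult\<close>)
  thus ?thesis unfolding z_pow_mult by simp
qed

lemma full_turn_AF:
  assumes A: "has_corner kA v u" and F: "has_corner kF v (z * u)"
  shows "full_turn v (z ^ 7 * u)"
proof -
  have E: "has_corner kE v (z ^ 8 * u)" by (rule before_A[OF A])
  have F1: "has_corner kF v (z ^ 1 * u)" using F by simp
  obtain \<kappa> where k: "has_corner \<kappa> v (z ^ 4 * u)" "\<kappa> = kB \<or> \<kappa> = kH"
    using corner_next_pow[OF F1] by (auto simp: first_arrow_cases)
  have "\<kappa> \<noteq> kB"
  proof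
    assume "\<kappa> = kB"
    hence "has_corner kB v (z ^ 4 * u)" using k by simp
    from after_B[OF this, unfolded z_pow_mult] have "has_corner kH v (z ^ 8 * u)" by simp
    from common_sector_mod(1)[OF this E, of 0 0] show False by simp
  qed
  hence "has_corner kH v (z ^ 4 * u)" using k by blast
  hence "has_corner kH v (z ^ 3 * (z ^ 1 * u))" unfolding z_pow_mult by simp
  from full_turn_FH[OF F1 this, unfolded z_pow_mult] show ?thesis by simp
qed

lemma full_turn_corners:
  assumes "full_turn v u" "has_corner \<kappa> v (z ^ n * u)"
  shows "(\<kappa>, n mod 10) \<in> {(kC, 0), (kE, 1), (kA, 3), (kF, 4), (kH, 7)}"
proof -
  have c: "has_corner kC v (z ^ 0 * u)" "has_corner kE v (z ^ 1 * u)" "has_corner kA v (z ^ 3 * u)"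
    "has_corner kF v (z ^ 4 * u)" "has_corner kH v (z ^ 7 * u)"
    using assms(1) by (simp_all add: full_turn_def)
  have w: "0 < width \<kappa>" using width_bounds(1)[of \<kappa>] by simp
  have hit: "(\<kappa>, n mod 10) = (\<kappa>', m mod 10)" if "has_corner \<kappa>' v (z ^ m * u)" "i < width \<kappa>'" "n mod 10 = (i + m) mod 10" for \<kappa>' m i
    using common_sector_mod[OF assms(2) that(1) w that(2)] that(3) by simp
  have "m = 0 \<or> (m = 1 \<or> m = 2) \<or> m = 3 \<or> (m = 4 \<or> m = 5 \<or> m = 6) \<or> (m = 7 \<or> m = 8 \<or> m = 9)"
    if "m < 10" for m :: nat
    using that by presburger
  from this[of "n mod 10"] consider "n mod 10 = 0" | "n mod 10 = 1 \<or> n mod 10 = 2" | "n mod 10 = 3" |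
    "n mod 10 = 4 \<or> n mod 10 = 5 \<or> n mod 10 = 6" | "n mod 10 = 7 \<or> n mod 10 = 8 \<or> n mod 10 = 9" by force
  thus ?thesis
  proof cases
    case 1 thus ?thesis using hit[OF c(1), of 0] by simp
  next
    case 2 thus ?thesis using hit[OF c(2), of 0] hit[OF c(2), of 1] by auto
  next
    case 3 thus ?thesis using hit[OF c(3), of 0] by simp
  next
    case 4 thus ?thesis using hit[OF c(4), of 0] hit[OF c(4), of 1] hit[OF c(4), of 2] by auto
  next
    case 5 thus ?thesis using hit[OF c(5), of 0] hit[OF c(5), of 1] hit[OF c(5), of 2] by auto
  qed
qed

end

context
  fixes s :: complex
  assumes s: "decagonal s"
begin

lemma cross_coordinates:
  "cross ((of_real a + of_real b * s) * d) ((of_real a' + of_real b' * s) * d) = (a * b' - b * a') * (Im s * (norm d)\<^sup>2)"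
  unfolding cross_def cmod_power2 by (simp add: algebra_simps power2_eq_square)

lemma cross_side: "cross d (s * d) = Im s * (norm d)\<^sup>2"
  using cross_coordinates[of 1 0 d 0 1] by simp

lemma sum_side: "d + s\<^sup>2 * d = of_real golden * (s * d)"
  unfolding z_pow[OF s] by (simp add: algebra_simps)

lemma golden_side: "of_real golden * (s\<^sup>2 * d) - d = of_real golden * (s ^ 3 * d)"
proof -
  have g2: "complex_of_real golden * (complex_of_real golden * x) = (of_real golden + 1) * x" for x
    by (simp only: mult.assoc[symmetric] golden_complex_square)
  show ?thesis unfolding z_pow[OF s] by (simp add: algebra_simps g2 golden_complex_square)
qed

lemma norm_pow_mult: "norm (s ^ n * d) = norm d"
  using z_norm[OF s] by (simp add: norm_mult norm_power)

end

section \<open>Composition\<close>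

text \<open>All statements about half rhombs depend on a sense \<open>s\<close>, which is \<open>z\<close> or \<open>cnj z\<close>: reflection exchanges the two,
  and with them the labels \<open>A\<close> and \<open>C\<close> of a thin and \<open>F\<close> and \<open>H\<close> of a thick rhomb. The half of a thin rhomb
  has an acute vertex \<open>v\<close> and the type 2 edge \<open>d\<close> there, the half of a thick rhomb has its vertex \<open>E\<close> at \<open>v\<close>
  and the type 1 edge \<open>k\<close> there. The other three triangles arise by composition: \<open>large1\<close> and \<open>small1\<close> are
  the triangles of the first composition, and \<open>large2\<close> is amalgamated in the second one.\<close>

definition thin_half :: "complex \<Rightarrow> complex \<Rightarrow> complex \<Rightarrow> complex set" where
  "thin_half s v d = convex hull {v, v + s * d, v + d}"

definition thick_half :: "complex \<Rightarrow> complex \<Rightarrow> complex \<Rightarrow> complex set" where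
  "thick_half s v k = convex hull {v, v + k, v + (k + s\<^sup>2 * k)}"

definition large1 :: "complex \<Rightarrow> complex \<Rightarrow> complex \<Rightarrow> complex set" where
  "large1 s v d = convex hull {v, v + d, v + of_real golden * (s\<^sup>2 * d)}"

definition small1 :: "complex \<Rightarrow> complex \<Rightarrow> complex \<Rightarrow> complex set" where
  "small1 s v d = convex hull {v - s\<^sup>2 * d, v, v + d}"

definition large2 :: "complex \<Rightarrow> complex \<Rightarrow> complex \<Rightarrow> complex set" where
  "large2 s v d = convex hull {v - s\<^sup>2 * d, v + d, v + of_real golden * (s\<^sup>2 * d)}"

context rhomb_tiling
begin

definition thin_at :: "complex \<Rightarrow> complex \<Rightarrow> complex \<Rightarrow> bool" where
  "thin_at s v d \<longleftrightarrow> s = z \<and> has_corner kC v d \<or> s = cnj z \<and> has_corner kA v (cnj z * d)"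

definition thick_at :: "complex \<Rightarrow> complex \<Rightarrow> complex \<Rightarrow> bool" where
  "thick_at s v k \<longleftrightarrow> s = z \<and> has_corner kE v k \<or> s = cnj z \<and> has_corner kE v ((cnj z)\<^sup>2 * k)"

definition turn_at :: "complex \<Rightarrow> complex \<Rightarrow> complex \<Rightarrow> bool" where
  "turn_at s v d \<longleftrightarrow> s = z \<and> full_turn v d \<or> s = cnj z \<and> full_turn v ((cnj z) ^ 4 * d)"

lemma cnj_z: "cnj z = z ^ 9"
proof -
  have "z * z ^ 9 = 1" using z_pow10[OF z] power_add[of z 1 9] by simp
  hence "cnj z * (z * z ^ 9) = cnj z" by simp
  thus ?thesis using z_cnj(1)[OF z] by (simp flip: mult.assoc)
qed

lemma cnj_z_pow: "cnj z ^ n = z ^ ((9 * n) mod 10)"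
  unfolding cnj_z z_pow_mod[OF z] by (simp only: power_mult)

lemma z_neq_cnj: "z \<noteq> cnj z"
  using z_Im[OF z] by (auto simp: complex_eq_iff)

lemma pow_identities:
  "cnj z * u = z ^ 9 * u" "(cnj z)\<^sup>2 * u = z ^ 8 * u" "(cnj z) ^ 4 * u = z ^ 6 * u"
  unfolding cnj_z_pow using cnj_z by simp_all

lemma sense_cases:
  assumes "thin_at s v d \<or> thick_at s v d \<or> turn_at s v d"
  shows "s = z \<or> s = cnj z" "decagonal s"
proof -
  show "s = z \<or> s = cnj z" using assms by (auto simp: thin_at_def thick_at_def turn_at_def)
  thus "decagonal s" using z decagonal_cnj by blast
qed

lemma thin_at_z: "thin_at z v d \<longleftrightarrow> has_corner kC v d"
  and thin_at_cnj: "thin_at (cnj z) v d \<longleftrightarrow> has_corner kA v (z ^ 9 * d)"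
  and thick_at_z: "thick_at z v k \<longleftrightarrow> has_corner kE v k"
  and thick_at_cnj: "thick_at (cnj z) v k \<longleftrightarrow> has_corner kE v (z ^ 8 * k)"
  and turn_at_z: "turn_at z v d \<longleftrightarrow> full_turn v d"
  and turn_at_cnj: "turn_at (cnj z) v d \<longleftrightarrow> full_turn v (z ^ 6 * d)"
  using z_neq_cnj unfolding thin_at_def thick_at_def turn_at_def pow_identities by auto

lemma thin_imp_thick: assumes "thin_at s v d" shows "thick_at s v (s * d)"
  using sense_cases(1)[OF disjI1[OF assms]]
proof (elim disjE)
  assume s: "s = z"
  show ?thesis using assms after_C unfolding s thin_at_z thick_at_z by blast
next
  assume s: "s = cnj z"
  have "has_corner kE v (z ^ 8 * (z ^ 9 * d))" using assms before_A unfolding s thin_at_cnj by blast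
  thus ?thesis unfolding s thick_at_cnj pow_identities .
qed

lemma turn_at_sym: assumes "turn_at s v d" shows "turn_at (cnj s) v (s ^ 4 * d)"
  using sense_cases(1)[OF disjI2[OF disjI2[OF assms]]]
proof (elim disjE)
  assume s: "s = z"
  show ?thesis using assms unfolding s turn_at_z turn_at_cnj z_pow_mult by simp
next
  assume s: "s = cnj z"
  show ?thesis using assms unfolding s turn_at_cnj pow_identities complex_cnj_cnj turn_at_z .
qed

lemma turn_imp: assumes "turn_at s v d"
  shows "thin_at s v d" "thick_at (cnj s) (v - s\<^sup>2 * d) (s\<^sup>2 * d)"
proof -
  from sense_cases(1)[of s v d] assms have "s = z \<or> s = cnj z" by blast
  hence "thin_at s v d \<and> thick_at (cnj s) (v - s\<^sup>2 * d) (s\<^sup>2 * d)"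
  proof
    assume s: "s = z"
    have ft: "full_turn v d" using assms unfolding s turn_at_z .
    have "has_corner kH v (z ^ 7 * d)" using ft by (simp add: full_turn_def)
    hence "has_corner kH ((v - z\<^sup>2 * d) + z\<^sup>2 * d) (z ^ 7 * d)" by simp
    hence E: "has_corner kE (v - z\<^sup>2 * d) d" by (simp only: corner_shift(7))
    have d: "z ^ 8 * (z\<^sup>2 * d) = d" unfolding z_pow_mult by simp
    thus ?thesis using ft E unfolding s thin_at_z thick_at_cnj d full_turn_def by blast
  next
    assume s: "s = cnj z"
    have ft: "full_turn v (z ^ 6 * d)" using assms unfolding s turn_at_cnj .
    hence A: "has_corner kA v (z ^ 9 * d)" unfolding full_turn_def z_pow_mult by simp
    have "has_corner kF v (z ^ 4 * (z ^ 6 * d))" using ft unfolding full_turn_def by blast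
    hence "has_corner kF v (z\<^sup>2 * (z ^ 8 * d))" unfolding z_pow_mult by simp
    hence "has_corner kF ((v - z ^ 8 * d) + z ^ 8 * d) (z\<^sup>2 * (z ^ 8 * d))" by simp
    hence "has_corner kE (v - z ^ 8 * d) (z ^ 8 * d)" by (simp only: corner_shift(5))
    thus ?thesis using A unfolding s thin_at_cnj pow_identities complex_cnj_cnj thick_at_z by blast
  qed
  thus "thin_at s v d" "thick_at (cnj s) (v - s\<^sup>2 * d) (s\<^sup>2 * d)" by blast+
qed

text \<open>Across the type 2 edge \<open>d\<close> there is a second thin rhomb with the same acute vertex, or else a thick rhomb with
  its vertex \<open>F\<close> or \<open>H\<close> at \<open>v\<close>, and then the corners \<open>C, H\<close> or \<open>A, F\<close> determine all others around \<open>v\<close>.\<close>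

lemma thin_mate: assumes "thin_at s v d" shows "thin_at (cnj s) v d \<or> turn_at s v d"
  using sense_cases(1)[OF disjI1[OF assms]]
proof (elim disjE)
  assume s: "s = z"
  have "has_corner kC v (z ^ 0 * d)" using assms unfolding s thin_at_z by simp
  then obtain \<kappa> where k: "has_corner \<kappa> v (z ^ (0 + 10 - width \<kappa>) * d)" "\<kappa> = kA \<or> \<kappa> = kH"
    using corner_prev_pow[of kC v 0 d] by (auto simp: last_arrow_cases)
  from k(2) show ?thesis
  proof
    assume "\<kappa> = kA"
    thus ?thesis using k(1) unfolding s thin_at_cnj by simp
  next
    assume "\<kappa> = kH"
    hence "has_corner kH v (z ^ 7 * d)" using k(1) by simp
    thus ?thesis using full_turn_CH assms unfolding s thin_at_z turn_at_z by blast
  qed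
next
  assume s: "s = cnj z"
  have A: "has_corner kA v (z ^ 9 * d)" using assms unfolding s thin_at_cnj .
  obtain \<kappa> where k: "has_corner \<kappa> v (z ^ (9 + 1) * d)" "\<kappa> = kC \<or> \<kappa> = kF"
    using corner_next_pow[OF A] unfolding width.simps last_arrow.simps first_arrow_cases by blast
  from k(2) show ?thesis
  proof
    assume "\<kappa> = kC"
    thus ?thesis using k(1) z_pow10[OF z] unfolding s complex_cnj_cnj thin_at_z by simp
  next
    assume "\<kappa> = kF"
    hence "has_corner kF v (z * (z ^ 9 * d))" using k(1) unfolding z_pow_mult using z_pow10[OF z] by simp
    from full_turn_AF[OF A this] have "full_turn v (z ^ 7 * (z ^ 9 * d))" .
    thus ?thesis unfolding s turn_at_cnj z_pow_mult by simp
  qed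
qed

lemma thin_mate_no_turn: assumes "thin_at (cnj s) v d" shows "\<not> turn_at s v d"
proof
  assume t: "turn_at s v d"
  from sense_cases(1)[of s v d] t have "s = z \<or> s = cnj z" by blast
  thus False
  proof
    assume s: "s = z"
    from full_turn_corners[of v d kA 9] show False using assms t unfolding s turn_at_z thin_at_cnj by simp
  next
    assume s: "s = cnj z"
    have "has_corner kC v (z ^ 4 * (z ^ 6 * d))"
      using assms unfolding s complex_cnj_cnj thin_at_z z_pow_mult by simp
    from full_turn_corners[OF _ this] show False using t unfolding s turn_at_cnj by simp
  qed
qed

text \<open>Across the type 1 edge \<open>k\<close> there is a thin rhomb, or else another thick rhomb, and then the corners \<open>F\<close> and \<open>H\<close>
  at the end of the edge determine all others around it.\<close>

lemma thick_partner: assumes "thick_at s v k" shows "thin_at s v (cnj s * k) \<or> turn_at s (v + k) ((cnj s)\<^sup>2 * k)"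
  using sense_cases(1)[OF disjI2[OF disjI1[OF assms]]]
proof (elim disjE)
  assume s: "s = z"
  have F: "has_corner kF (v + k) (z\<^sup>2 * k)" using assms unfolding s thick_at_z corner_shift(5) .
  have "(2::nat) + 3 = 5" by simp
  then obtain \<kappa> where k: "has_corner \<kappa> (v + k) (z ^ 5 * k)" "\<kappa> = kB \<or> \<kappa> = kH"
    using corner_next_pow[OF F] unfolding width.simps last_arrow.simps first_arrow_cases by metis
  from k(2) show ?thesis
  proof
    assume "\<kappa> = kB"
    moreover have "z * (z ^ 9 * k) = k" "z ^ 6 * (z ^ 9 * k) = z ^ 5 * k" unfolding z_pow_mult by simp_all
    ultimately have "has_corner kC v (z ^ 9 * k)" using k(1) by (simp only: corner_shift(3))
    thus ?thesis unfolding s thin_at_z pow_identities by blast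
  next
    assume "\<kappa> = kH"
    hence "has_corner kH (v + k) (z ^ 3 * (z\<^sup>2 * k))" using k(1) unfolding z_pow_mult by simp
    from full_turn_FH[OF F this] have "full_turn (v + k) (z ^ 8 * k)" unfolding z_pow_mult by simp
    thus ?thesis unfolding s turn_at_z pow_identities by blast
  qed
next
  assume s: "s = cnj z"
  have "has_corner kE v (z ^ 8 * k)" using assms unfolding s thick_at_cnj .
  moreover have "z\<^sup>2 * (z ^ 8 * k) = k" "z ^ 7 * (z ^ 8 * k) = z ^ 5 * k" unfolding z_pow_mult by simp_all
  ultimately have H: "has_corner kH (v + k) (z ^ 5 * k)" by (simp only: corner_shift(7))
  obtain \<kappa> where k: "has_corner \<kappa> (v + k) (z ^ (5 + 10 - width \<kappa>) * k)" "\<kappa> = kB \<or> \<kappa> = kF"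
    using corner_prev_pow[OF H] unfolding first_arrow.simps last_arrow_cases by blast
  from k(2) show ?thesis
  proof
    assume "\<kappa> = kB"
    hence "has_corner kB (v + k) (z * k)" using k(1) z_pow_mod[OF z, of 11] by simp
    hence "has_corner kA v k" unfolding corner_shift(1) .
    moreover have e: "z ^ 9 * (z * k) = k" using z_pow10[OF z] power_add[of z 9 1] by (simp flip: mult.assoc)
    ultimately show ?thesis unfolding s complex_cnj_cnj thin_at_cnj e by blast
  next
    assume "\<kappa> = kF"
    hence F: "has_corner kF (v + k) (z\<^sup>2 * k)" using k(1) z_pow_mod[OF z, of 12] by simp
    have "has_corner kH (v + k) (z ^ 3 * (z\<^sup>2 * k))" using H unfolding z_pow_mult by simp
    from full_turn_FH[OF F this] show ?thesis unfolding s complex_cnj_cnj turn_at_cnj by blast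
  qed
qed

lemma thick_partner_no_turn: assumes "thin_at s v (cnj s * k)" shows "\<not> turn_at s (v + k) ((cnj s)\<^sup>2 * k)"
proof
  assume t: "turn_at s (v + k) ((cnj s)\<^sup>2 * k)"
  from sense_cases(1) t have "s = z \<or> s = cnj z" by blast
  thus False
  proof
    assume s: "s = z"
    have "has_corner kC v (z ^ 9 * k)" using assms unfolding s thin_at_z pow_identities .
    moreover have "z * (z ^ 9 * k) = k" "z ^ 6 * (z ^ 9 * k) = z ^ 7 * (z ^ 8 * k)" unfolding z_pow_mult by simp_all
    ultimately have B: "has_corner kB (v + k) (z ^ 7 * (z ^ 8 * k))" by (simp only: corner_shift(3))
    have "full_turn (v + k) (z ^ 8 * k)" using t unfolding s turn_at_z pow_identities .
    from full_turn_corners[OF this B] show False by simp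
  next
    assume s: "s = cnj z"
    have "has_corner kA v (z ^ 9 * (z * k))" using assms unfolding s complex_cnj_cnj thin_at_cnj .
    moreover have "z ^ 9 * (z * k) = k" using z_pow10[OF z] power_add[of z 9 1] by (simp flip: mult.assoc)
    ultimately have "has_corner kB (v + k) (z ^ 1 * k)" by (simp add: corner_shift(1))
    moreover have "z ^ 3 * (z ^ 8 * k) = z ^ 1 * k" unfolding z_pow_mult by simp
    ultimately have B: "has_corner kB (v + k) (z ^ 3 * (z ^ 8 * k))" by (simp only:)
    have "full_turn (v + k) (z ^ 6 * (z\<^sup>2 * k))" using t unfolding s complex_cnj_cnj turn_at_cnj .
    hence "full_turn (v + k) (z ^ 8 * k)" unfolding z_pow_mult by simp
    from full_turn_corners[OF this B] show False by simp
  qed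
qed

lemma thin_no_thick: assumes "thin_at s v d" shows "\<not> thick_at (cnj s) v (s * d)"
proof
  assume t: "thick_at (cnj s) v (s * d)"
  from sense_cases(1) assms have "s = z \<or> s = cnj z" by blast
  thus False
  proof
    assume s: "s = z"
    have C: "has_corner kC v (z ^ 0 * d)" using assms unfolding s thin_at_z by simp
    have "has_corner kE v (z ^ 8 * (z ^ 1 * d))" using t unfolding s thick_at_cnj by simp
    hence E: "has_corner kE v (z ^ 9 * d)" unfolding z_pow_mult by simp
    from common_sector_mod(1)[OF C E, of 0 1] show False by simp
  next
    assume s: "s = cnj z"
    have A: "has_corner kA v (z ^ 9 * d)" using assms unfolding s thin_at_cnj .
    have E: "has_corner kE v (z ^ 9 * d)" using t unfolding s complex_cnj_cnj thick_at_z pow_identities .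
    from common_sector_mod(1)[OF A E, of 0 0] show False by simp
  qed
qed

end

lemma golden_less_2: "golden < 2"
proof -
  have "sqrt 5 < 3" by (rule real_less_lsqrt) auto
  thus ?thesis by (simp add: golden_def)
qed

lemma golden_reciprocal: "(2 - golden) * golden = golden - 1" "(golden - 1) * golden = 1"
  using golden_square by (simp_all add: algebra_simps)

lemma golden_complex_reciprocal:
  "(2 - of_real golden) * (of_real golden * x) = (of_real golden - 1) * (x :: complex)"
  "(of_real golden - 1) * (of_real golden * x) = (x :: complex)"
proof -
  have "complex_of_real ((2 - golden) * golden) = of_real (golden - 1)" "complex_of_real ((golden - 1) * golden) = of_real 1"
    unfolding golden_reciprocal by simp_all
  thus "(2 - of_real golden) * (of_real golden * x) = (of_real golden - 1) * x"
    "(of_real golden - 1) * (of_real golden * x) = x"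
    by (simp_all flip: mult.assoc)
qed

lemma triangle_not_segment:
  assumes "cross (b - a) (c - a) \<noteq> 0"
  shows "convex hull {a, b, c} \<noteq> closed_segment x y"
proof
  assume "convex hull {a, b, c} = closed_segment x y"
  hence "convex hull {a, b, c} = convex hull {x, y, y}" by (simp add: segment_convex_hull)
  from triangle_vertices[OF assms this] have "{x, y} = {a, b, c}" by simp
  moreover have "card {a, b, c} = 3" using not_collinear_cross[OF assms] by simp
  moreover have "card {x, y} \<le> 2" by (simp add: card_insert_if)
  ultimately show False by simp
qed

lemma opposite_signs:
  fixes c :: real assumes "c \<noteq> 0" "0 < p" "0 < q"
  shows "- (p * c) * (q * c) < 0" "p * c * - (q * c) < 0"
proof -
  have "0 < c * c" using assms(1) not_real_square_gt_zero by blast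
  hence "0 < (p * q) * (c * c)" using assms by simp
  moreover have "(p * q) * (c * c) = p * c * (q * c)" by (simp add: mult_ac)
  ultimately show "- (p * c) * (q * c) < 0" "p * c * - (q * c) < 0" by simp_all
qed

context
  fixes s :: complex
  assumes s: "decagonal s"
begin

lemma cross_pos_form:
  assumes "d \<noteq> 0" shows "cross d (s * d) \<noteq> 0" "cross d (s\<^sup>2 * d) = golden * cross d (s * d)"
    "cross (s * d) d = - cross d (s * d)" "cross (s * d) (s\<^sup>2 * d) = cross d (s * d)"
    "cross (s\<^sup>2 * d) d = - (golden * cross d (s * d))" "cross (s\<^sup>2 * d) (s ^ 4 * d) = golden * cross d (s * d)"
proof -
  show "cross d (s * d) \<noteq> 0" using cross_side[OF s] z_Im[OF s] assms by simp
  have c: "cross (p * d) (q * d) = Im (cnj p * q) * (norm d)\<^sup>2" for p q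
    unfolding cross_def cmod_power2 by (simp add: algebra_simps power2_eq_square)
  have a: "cnj s * (s * x) = x" for x using z_cnj[OF s] by (simp flip: mult.assoc)
  have s2: "Im (s\<^sup>2) = golden * Im s" unfolding z_pow[OF s] by simp
  show "cross d (s\<^sup>2 * d) = golden * cross d (s * d)" using c[of 1 "s\<^sup>2"] c[of 1 s] s2 by simp
  show "cross (s * d) d = - cross d (s * d)" using c[of s 1] c[of 1 s] by simp
  show "cross (s * d) (s\<^sup>2 * d) = cross d (s * d)" using c[of s "s\<^sup>2"] c[of 1 s] a by (simp add: power2_eq_square)
  have "Im ((cnj s)\<^sup>2) = - (golden * Im s)" using s2 by (simp flip: complex_cnj_power)
  thus "cross (s\<^sup>2 * d) d = - (golden * cross d (s * d))" using c[of "s\<^sup>2" 1] c[of 1 s] by simp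
  have "cnj (s\<^sup>2) * s ^ 4 = cnj s * (cnj s * (s * (s * (s * s))))"
    by (simp add: power4_eq_xxxx power2_eq_square mult.assoc)
  hence "cnj (s\<^sup>2) * s ^ 4 = s\<^sup>2" unfolding a by (simp add: power2_eq_square)
  thus "cross (s\<^sup>2 * d) (s ^ 4 * d) = golden * cross d (s * d)" using c[of "s\<^sup>2" "s ^ 4"] c[of 1 s] s2 by simp
qed

lemma cnj_cancel: "cnj s * (s * x) = x" "s * (cnj s * x) = x" "(cnj s)\<^sup>2 * (s\<^sup>2 * x) = x" "s\<^sup>2 * ((cnj s)\<^sup>2 * x) = x"
  "(cnj s)\<^sup>2 * (s ^ 4 * x) = s\<^sup>2 * x" "s ^ 4 * ((cnj s)\<^sup>2 * x) = s\<^sup>2 * x" "(cnj s) ^ 4 * (s ^ 4 * x) = x"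
proof -
  have 1: "cnj s * (s * y) = y" "s * (cnj s * y) = y" for y using z_cnj[OF s] by (simp_all flip: mult.assoc)
  have p: "a ^ 4 * y = a * (a * (a * (a * y)))" "a\<^sup>2 * y = a * (a * y)" for a y :: complex
    by (simp_all add: power4_eq_xxxx power2_eq_square mult.assoc)
  show "cnj s * (s * x) = x" "s * (cnj s * x) = x" "(cnj s)\<^sup>2 * (s\<^sup>2 * x) = x" "s\<^sup>2 * ((cnj s)\<^sup>2 * x) = x"
    "(cnj s)\<^sup>2 * (s ^ 4 * x) = s\<^sup>2 * x" "s ^ 4 * ((cnj s)\<^sup>2 * x) = s\<^sup>2 * x" "(cnj s) ^ 4 * (s ^ 4 * x) = x"
    unfolding p by (simp_all only: 1)
qed

text \<open>The end of the edge shared by the two amalgamated triangles divides a side of the large triangle in the golden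
  ratio; hence their union is a triangle.\<close>

lemma side_between:
  "v + s * d = of_real (1 - (2 - golden)) * (v + d) + of_real (2 - golden) * (v + of_real golden * (s\<^sup>2 * d))"
proof -
  have "of_real (1 - (2 - golden)) * (v + d) + of_real (2 - golden) * (v + of_real golden * (s\<^sup>2 * d)) =
    v + ((of_real golden - 1) * d + (2 - of_real golden) * (of_real golden * (s\<^sup>2 * d)))" by (simp add: algebra_simps)
  also have "\<dots> = v + (of_real golden - 1) * (d + s\<^sup>2 * d)"
    unfolding golden_complex_reciprocal by (simp add: algebra_simps)
  also have "\<dots> = v + s * d" unfolding sum_side[OF s] golden_complex_reciprocal ..
  finally show ?thesis by simp
qed

lemma first_union: "thin_half s v d \<union> thick_half s v (s * d) = large1 s v d"
proof -
  have w: "s * d + s\<^sup>2 * (s * d) = of_real golden * (s\<^sup>2 * d)"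
    using sum_side[OF s, of "s * d"] by (simp add: power2_eq_square mult.assoc)
  show ?thesis unfolding thin_half_def thick_half_def large1_def w
    by (rule triangle_Un[OF _ _ side_between]) (use golden_gt_1 golden_less_2 in auto)
qed

lemma first_Int:
  assumes "d \<noteq> 0" shows "thin_half s v d \<inter> thick_half s v (s * d) = closed_segment v (v + s * d)"
proof -
  have w: "s * d + s\<^sup>2 * (s * d) = of_real golden * (s\<^sup>2 * d)"
    using sum_side[OF s, of "s * d"] by (simp add: power2_eq_square mult.assoc)
  have "cross (v + s * d - v) (v + d - v) * cross (v + s * d - v) (v + of_real golden * (s\<^sup>2 * d) - v) =
    - (1 * cross d (s * d)) * (golden * cross d (s * d))" by (simp add: cross_pos_form[OF assms])
  also have "\<dots> < 0" by (rule opposite_signs) (use cross_pos_form(1)[OF assms] golden_gt_1 in auto)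
  finally show ?thesis unfolding thin_half_def thick_half_def w by (rule triangle_Int)
qed

lemma second_union: "small1 s v d \<union> large1 s v d = large2 s v d"
proof -
  have m: "v = of_real (1 - (2 - golden)) * (v - s\<^sup>2 * d) + of_real (2 - golden) * (v + of_real golden * (s\<^sup>2 * d))"
  proof -
    have "of_real (1 - (2 - golden)) * (v - s\<^sup>2 * d) + of_real (2 - golden) * (v + of_real golden * (s\<^sup>2 * d)) =
      v + ((2 - of_real golden) * (of_real golden * (s\<^sup>2 * d)) - (of_real golden - 1) * (s\<^sup>2 * d))" by (simp add: algebra_simps)
    also have "\<dots> = v" unfolding golden_complex_reciprocal by simp
    finally show ?thesis by simp
  qed
  have "convex hull {v + d, v, v - s\<^sup>2 * d} \<union> convex hull {v + d, v, v + of_real golden * (s\<^sup>2 * d)} =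
    convex hull {v + d, v - s\<^sup>2 * d, v + of_real golden * (s\<^sup>2 * d)}"
    by (rule triangle_Un[OF _ _ m]) (use golden_gt_1 golden_less_2 in auto)
  thus ?thesis unfolding small1_def large1_def large2_def by (simp add: insert_commute)
qed

lemma second_Int:
  assumes "d \<noteq> 0" shows "small1 s v d \<inter> large1 s v d = closed_segment v (v + d)"
proof -
  have "cross (v + d - v) (v - s\<^sup>2 * d - v) * cross (v + d - v) (v + of_real golden * (s\<^sup>2 * d) - v) =
    - (golden * cross d (s * d)) * ((golden * golden) * cross d (s * d))" by (simp add: cross_pos_form[OF assms])
  also have "\<dots> < 0" by (rule opposite_signs) (use cross_pos_form(1)[OF assms] golden_gt_1 in auto)
  finally have "convex hull {v, v + d, v - s\<^sup>2 * d} \<inter> convex hull {v, v + d, v + of_real golden * (s\<^sup>2 * d)} = closed_segment v (v + d)"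
    by (rule triangle_Int)
  thus ?thesis unfolding small1_def large1_def by (simp add: insert_commute)
qed

lemma thin_base_Int:
  assumes "d \<noteq> 0" shows "large1 s v d \<inter> large1 (cnj s) v d = closed_segment v (v + d)"
proof -
  have *: "cross d ((cnj s)\<^sup>2 * d) = - cross d (s\<^sup>2 * d)"
    unfolding cross_def by (simp add: algebra_simps power2_eq_square)
  have "cross (v + d - v) (v + of_real golden * (s\<^sup>2 * d) - v) * cross (v + d - v) (v + of_real golden * ((cnj s)\<^sup>2 * d) - v) =
    (golden * golden) * cross d (s * d) * - ((golden * golden) * cross d (s * d))" by (simp add: * cross_pos_form[OF assms])
  also have "\<dots> < 0" by (rule opposite_signs) (use cross_pos_form(1)[OF assms] golden_gt_1 in auto)
  finally show ?thesis unfolding large1_def by (rule triangle_Int)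
qed

lemma thick_base_Int:
  assumes "d \<noteq> 0"
  shows "large2 s v d \<inter> large2 (cnj s) v (s ^ 4 * d) = closed_segment (v - s\<^sup>2 * d) (v + of_real golden * (s\<^sup>2 * d))"
proof -
  define x where "x = v - s\<^sup>2 * d"
  define y where "y = v + of_real golden * (s\<^sup>2 * d)"
  have yx: "y - x = of_real (golden + 1) * (s\<^sup>2 * d)" by (simp add: x_def y_def algebra_simps)
  have 1: "cross (y - x) (v + d - x) = - ((golden + 1) * golden * cross d (s * d))"
    unfolding yx by (simp add: x_def cross_pos_form[OF assms] del: of_real_add)
  have 2: "cross (y - x) (v + s ^ 4 * d - x) = (golden + 1) * golden * cross d (s * d)"
    unfolding yx by (simp add: x_def cross_pos_form[OF assms] del: of_real_add)
  have "cross (y - x) (v + d - x) * cross (y - x) (v + s ^ 4 * d - x) < 0"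
    unfolding 1 2 by (rule opposite_signs) (use cross_pos_form(1)[OF assms] golden_gt_1 in auto)
  hence "convex hull {x, y, v + d} \<inter> convex hull {x, y, v + s ^ 4 * d} = closed_segment x y"
    by (rule triangle_Int)
  thus ?thesis unfolding large2_def cnj_cancel x_def y_def by (simp add: insert_commute)
qed

end

context
  fixes s :: complex
  assumes s: "decagonal s"
begin

lemma golden_dists:
  fixes d :: complex and l :: real
  assumes l: "norm d = l"
  shows "dist v (v + d) = l" "dist (v + d) v = l" "dist v (v + of_real golden * (s\<^sup>2 * d)) = l * golden"
    "dist (v + of_real golden * (s\<^sup>2 * d)) (v + d) = l * golden" "dist (v + d) (v + of_real golden * (s\<^sup>2 * d)) = l * golden"
    "dist (v - s\<^sup>2 * d) v = l" "dist v (v - s\<^sup>2 * d) = l" "dist (v - s\<^sup>2 * d) (v + d) = l * golden" "dist (v + d) (v - s\<^sup>2 * d) = l * golden"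
    "dist (v - s\<^sup>2 * d) (v + of_real golden * (s\<^sup>2 * d)) = l * golden\<^sup>2"
    "dist (v + of_real golden * (s\<^sup>2 * d)) (v - s\<^sup>2 * d) = l * golden\<^sup>2"
proof -
  have g: "norm (of_real golden * (s ^ n * d)) = l * golden" for n
    unfolding norm_mult[of "of_real golden"] norm_pow_mult[OF s] using golden_gt_1 l by simp
  show 1: "dist v (v + d) = l" and "dist (v + d) v = l" using l by (simp_all add: dist_norm)
  show "dist v (v + of_real golden * (s\<^sup>2 * d)) = l * golden" using g[of 2] by (simp add: dist_norm)
  have "(v + of_real golden * (s\<^sup>2 * d)) - (v + d) = of_real golden * (s ^ 3 * d)" using golden_side[OF s] by simp
  thus 2: "dist (v + of_real golden * (s\<^sup>2 * d)) (v + d) = l * golden" using g[of 3] by (simp only: dist_norm)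
  thus "dist (v + d) (v + of_real golden * (s\<^sup>2 * d)) = l * golden" by (simp only: dist_commute)
  show "dist (v - s\<^sup>2 * d) v = l" "dist v (v - s\<^sup>2 * d) = l" using norm_pow_mult[OF s, of 2 d] l by (simp_all add: dist_norm)
  have "(v + d) - (v - s\<^sup>2 * d) = of_real golden * (s ^ 1 * d)" using sum_side[OF s] by simp
  thus 3: "dist (v + d) (v - s\<^sup>2 * d) = l * golden" using g[of 1] by (simp only: dist_norm)
  thus "dist (v - s\<^sup>2 * d) (v + d) = l * golden" by (simp only: dist_commute)
  have "(v + of_real golden * (s\<^sup>2 * d)) - (v - s\<^sup>2 * d) = of_real (golden + 1) * (s\<^sup>2 * d)" by (simp add: algebra_simps)
  moreover have "norm (of_real (golden + 1) * (s\<^sup>2 * d)) = l * golden\<^sup>2"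
    unfolding norm_mult[of "of_real (golden + 1)"] norm_pow_mult[OF s] norm_of_real
    using golden_gt_1 l golden_square by (simp add: power2_eq_square)
  ultimately show 4: "dist (v + of_real golden * (s\<^sup>2 * d)) (v - s\<^sup>2 * d) = l * golden\<^sup>2" by (simp only: dist_norm)
  thus "dist (v - s\<^sup>2 * d) (v + of_real golden * (s\<^sup>2 * d)) = l * golden\<^sup>2" by (simp only: dist_commute)
qed

lemma scaled_neq: "(0::real) < l \<Longrightarrow> l * golden \<noteq> l \<and> l \<noteq> l * golden \<and> l * golden \<noteq> l * golden\<^sup>2 \<and> l * golden\<^sup>2 \<noteq> l * golden"
  using golden_gt_1 by (simp add: power2_eq_square)

text \<open>Only the base has this length, so that the base can be recognised in any representation of the triangle.\<close>

lemma large1_short_edge: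
  assumes "norm d = l" "0 < l" "large1 s v d = convex hull {x, y, w}" "dist x y = l"
  shows "{x, y} = {v, v + d}"
proof -
  have "d \<noteq> 0" using assms by auto
  hence "cross (v + d - v) (v + of_real golden * (s\<^sup>2 * d) - v) \<noteq> 0" using cross_pos_form[OF s, of d] golden_gt_1 by simp
  from triangle_vertices[OF this assms(3)[unfolded large1_def]]
  have "x \<in> {v, v + d, v + of_real golden * (s\<^sup>2 * d)}" "y \<in> {v, v + d, v + of_real golden * (s\<^sup>2 * d)}" by blast+
  moreover note golden_dists[OF assms(1), of v] scaled_neq[OF assms(2)]
  moreover have "x \<noteq> y" using assms by auto
  ultimately show ?thesis using assms(4) by (auto simp: dist_commute)
qed

lemma small1_short_edge:
  assumes "norm d = l" "0 < l" "small1 s v d = convex hull {x, y, w}" "dist x y = l"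
  shows "{x, y} = {v - s\<^sup>2 * d, v} \<or> {x, y} = {v, v + d}"
proof -
  have "d \<noteq> 0" using assms by auto
  hence "cross (v - (v - s\<^sup>2 * d)) (v + d - (v - s\<^sup>2 * d)) \<noteq> 0" using cross_pos_form[OF s, of d] golden_gt_1 by simp
  from triangle_vertices[OF this assms(3)[unfolded small1_def]]
  have "x \<in> {v - s\<^sup>2 * d, v, v + d}" "y \<in> {v - s\<^sup>2 * d, v, v + d}" by blast+
  moreover note golden_dists[OF assms(1), of v] scaled_neq[OF assms(2)]
  moreover have "x \<noteq> y" using assms by auto
  ultimately show ?thesis using assms(4) by (auto simp: dist_commute)
qed

lemma large2_long_edge:
  assumes "norm d = l" "0 < l" "large2 s v d = convex hull {x, y, w}" "dist x y = l * golden\<^sup>2"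
  shows "{x, y} = {v - s\<^sup>2 * d, v + of_real golden * (s\<^sup>2 * d)}"
proof -
  have d: "d \<noteq> 0" using assms by auto
  have "cross (v + d - (v - s\<^sup>2 * d)) (v + of_real golden * (s\<^sup>2 * d) - (v - s\<^sup>2 * d)) = (golden + 1) * golden * cross d (s * d)"
    by (simp add: cross_pos_form[OF s d]) (simp add: algebra_simps)
  hence "cross (v + d - (v - s\<^sup>2 * d)) (v + of_real golden * (s\<^sup>2 * d) - (v - s\<^sup>2 * d)) \<noteq> 0"
    using cross_pos_form(1)[OF s d] golden_gt_1 by simp
  from triangle_vertices[OF this assms(3)[unfolded large2_def]]
  have "x \<in> {v - s\<^sup>2 * d, v + d, v + of_real golden * (s\<^sup>2 * d)}" "y \<in> {v - s\<^sup>2 * d, v + d, v + of_real golden * (s\<^sup>2 * d)}" by blast+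
  moreover note golden_dists[OF assms(1), of v] scaled_neq[OF assms(2)]
  moreover have "x \<noteq> y" using assms golden_gt_1 by auto
  ultimately show ?thesis using assms(4) by (auto simp: dist_commute)
qed

lemma triangles_with_sides:
  assumes "norm d = l"
  shows "triangle_with_sides (l * golden) (l * golden) l (large1 s v d)"
    "triangle_with_sides (l * golden) (l * golden) (l * golden\<^sup>2) (large2 s v d)"
proof -
  note g = golden_dists[OF assms, of v]
  have "large1 s v d = convex hull {v, v + of_real golden * (s\<^sup>2 * d), v + d}"
    by (simp add: large1_def insert_commute)
  thus "triangle_with_sides (l * golden) (l * golden) l (large1 s v d)"
    unfolding triangle_with_sides_def using g(2,3,4) by blast
  show "triangle_with_sides (l * golden) (l * golden) (l * golden\<^sup>2) (large2 s v d)"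
    unfolding triangle_with_sides_def large2_def using g(5,8,11) by blast
qed

end

lemma third_vertex_eq:
  assumes "{a, b, c} = {a, b, c'}" "a \<noteq> c'" "b \<noteq> c'"
  shows "c = c'"
proof -
  have "c' \<in> {a, b, c}" unfolding assms(1) by simp
  thus ?thesis using assms(2,3) by simp
qed

context rhomb_tiling
begin

lemma thin_at_rhomb:
  assumes "thin_at s v d"
  obtains A B C D where "Thin A B C D \<in> P" "rhomb_region (Thin A B C D) = parallelogram v d (s * d)"
    "inner (Thin A B C D) = open_parallelogram v d (s * d)" "s = z \<and> C = v \<or> s = cnj z \<and> A = v"
    "B = v + s * d" "D = v + d" "norm d = l"
proof -
  from sense_cases(1)[OF disjI1[OF assms]] show ?thesis
  proof
    assume s: "s = z"
    have c: "has_corner kC v d" using assms unfolding s thin_at_z .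
    have "rhomb_region (rhomb_at z kC v d) = parallelogram v d (z * d)" "inner (rhomb_at z kC v d) = open_parallelogram v d (z * d)"
      unfolding rhomb_region_at inner_rhomb_at by simp_all
    thus ?thesis using that c corner_length[OF c] unfolding has_corner_def s by simp
  next
    assume s: "s = cnj z"
    define u where "u = cnj z * d"
    have d: "z * u = d" by (simp add: u_def z_cnj[OF z] flip: mult.assoc)
    have c: "has_corner kA v u" using assms unfolding s thin_at_cnj u_def pow_identities .
    have "rhomb_region (rhomb_at z kA v u) = parallelogram v d u" "inner (rhomb_at z kA v u) = open_parallelogram v d u"
      unfolding rhomb_region_at inner_rhomb_at by (simp_all add: d box_commute[of v u])
    moreover have "norm d = l" using corner_length[OF c] norm_pow_mult[OF z, of 1 u] d by simp
    ultimately show ?thesis using that c unfolding has_corner_def s by (simp add: d u_def[symmetric])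
  qed
qed

lemma thick_at_rhomb:
  assumes "thick_at s v k"
  obtains F G H where "Thick v F G H \<in> P" "rhomb_region (Thick v F G H) = parallelogram v k (s\<^sup>2 * k)"
    "inner (Thick v F G H) = open_parallelogram v k (s\<^sup>2 * k)" "{F, H} = {v + k, v + s\<^sup>2 * k}" "G = v + (k + s\<^sup>2 * k)"
    "s = z \<and> F = v + k \<or> s = cnj z \<and> H = v + k" "norm k = l"
proof -
  from sense_cases(1)[OF disjI2[OF disjI1[OF assms]]] show ?thesis
  proof
    assume s: "s = z"
    have c: "has_corner kE v k" using assms unfolding s thick_at_z .
    have "rhomb_region (rhomb_at z kE v k) = parallelogram v k (z\<^sup>2 * k)" "inner (rhomb_at z kE v k) = open_parallelogram v k (z\<^sup>2 * k)"
      unfolding rhomb_region_at inner_rhomb_at by simp_all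
    thus ?thesis using that c corner_length[OF c] unfolding has_corner_def s by simp
  next
    assume s: "s = cnj z"
    define u where "u = (cnj z)\<^sup>2 * k"
    have k: "z\<^sup>2 * u = k" unfolding u_def by (rule cnj_cancel(4)[OF z])
    have c: "has_corner kE v u" using assms unfolding s thick_at_cnj u_def pow_identities .
    have "rhomb_region (rhomb_at z kE v u) = parallelogram v k u" "inner (rhomb_at z kE v u) = open_parallelogram v k u"
      unfolding rhomb_region_at inner_rhomb_at by (simp_all add: k box_commute[of v u])
    moreover have "norm k = l" using corner_length[OF c] norm_pow_mult[OF z, of 2 u] k by simp
    ultimately show ?thesis using that c unfolding has_corner_def s
      by (simp add: k u_def[symmetric] insert_commute add.commute)
  qed
qed

lemma thin_at_arrows:
  assumes "thin_at s v d"
  shows "\<exists>r\<in>P. rhomb_region r = parallelogram v d (s * d) \<and> inner r = open_parallelogram v d (s * d) \<and> arrow r True v (v + s * d) \<and> arrow r False v (v + d)"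
  using assms
proof (rule thin_at_rhomb)
  fix A B C D
  assume *: "Thin A B C D \<in> P" "rhomb_region (Thin A B C D) = parallelogram v d (s * d)"
    "inner (Thin A B C D) = open_parallelogram v d (s * d)" "s = z \<and> C = v \<or> s = cnj z \<and> A = v" "B = v + s * d" "D = v + d"
  hence "arrow (Thin A B C D) True v (v + s * d) \<and> arrow (Thin A B C D) False v (v + d)"
    by (auto simp: arrow_def)
  thus ?thesis using *(1-3) by blast
qed

lemma thick_at_arrows:
  assumes "thick_at s v k"
  shows "\<exists>r\<in>P. rhomb_region r = parallelogram v k (s\<^sup>2 * k) \<and> inner r = open_parallelogram v k (s\<^sup>2 * k) \<and> arrow r True v (v + k) \<and>
    arrow r False (v + k) (v + (k + s\<^sup>2 * k)) \<and>
    (\<forall>x y. arrow r True x y \<longrightarrow> x = v \<and> (y = v + k \<or> y = v + s\<^sup>2 * k))"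
  using assms
proof (rule thick_at_rhomb)
  fix F G H
  assume *: "Thick v F G H \<in> P" "rhomb_region (Thick v F G H) = parallelogram v k (s\<^sup>2 * k)"
    "inner (Thick v F G H) = open_parallelogram v k (s\<^sup>2 * k)" "{F, H} = {v + k, v + s\<^sup>2 * k}" "G = v + (k + s\<^sup>2 * k)"
    "s = z \<and> F = v + k \<or> s = cnj z \<and> H = v + k"
  hence "F = v + k \<and> H = v + s\<^sup>2 * k \<or> H = v + k \<and> F = v + s\<^sup>2 * k" by (auto simp: doubleton_eq_iff)
  hence "arrow (Thick v F G H) True v (v + k) \<and> arrow (Thick v F G H) False (v + k) (v + (k + s\<^sup>2 * k)) \<and>
    (\<forall>x y. arrow (Thick v F G H) True x y \<longrightarrow> x = v \<and> (y = v + k \<or> y = v + s\<^sup>2 * k))"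
    using *(5) by (auto simp: arrow_def)
  thus ?thesis using *(1-3) by blast
qed

lemma thin_at_norm: "thin_at s v d \<Longrightarrow> norm d = l \<and> d \<noteq> 0"
  and thick_at_norm: "thick_at s v k \<Longrightarrow> norm k = l \<and> k \<noteq> 0"
  using l_pos by (auto elim!: thin_at_rhomb thick_at_rhomb)

lemma senses_eq:
  assumes "s = z \<or> s = cnj z" "s' = z \<or> s' = cnj z"
  shows "s' = s \<or> s' = cnj s"
  using assms by auto

lemma square_cnj_neq: assumes "decagonal s" "d \<noteq> 0" shows "s\<^sup>2 * d \<noteq> (cnj s)\<^sup>2 * d"
proof
  assume "s\<^sup>2 * d = (cnj s)\<^sup>2 * d"
  hence "s\<^sup>2 = cnj (s\<^sup>2)" using assms(2) by simp
  hence "Im (s\<^sup>2) = 0" by (metis Im_complex_of_real Reals_cases Reals_cnj_iff)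
  thus False using z_pow_Im(1)[OF assms(1)] by blast
qed

subsection \<open>The amalgamated triangles\<close>

lemma thin_halves_eq: "thin_halves P = {(thin_half s v d, v, v + s * d) | s v d. thin_at s v d}"
proof (intro set_eqI iffI)
  fix X assume "X \<in> thin_halves P"
  then obtain A B C D where t: "Thin A B C D \<in> P" and
    X: "X = (convex hull {A, B, D}, A, B) \<or> X = (convex hull {C, B, D}, C, B)"
    unfolding thin_halves_def by blast
  define u where "u = B - A"
  have c: "has_corner kA A u" and D: "D = A + z * u" and C: "C = A + (u + z * u)" and B: "B = A + u"
  proof -
    have t': "has_corner kA A (B - A)" "C = B + D - A" "D - A = z * (B - A)" using t[unfolded thin_corners] by blast+
    show "has_corner kA A u" "B = A + u" using t' by (simp_all add: u_def)
    show D: "D = A + z * u" using t'(3) by (simp add: u_def diff_eq_eq add.commute)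
    show "C = A + (u + z * u)" unfolding t'(2) D by (simp add: u_def)
  qed
  have "z ^ 9 * (z * u) = u" using z_pow10[OF z] power_add[of z 9 1] by (simp flip: mult.assoc)
  hence 1: "thin_at (cnj z) A (z * u)" unfolding thin_at_cnj using c by (simp only:)
  have "has_corner kC C (- u)"
    using c unfolding has_corner_def rhomb_at_turn'(2)[of A u] C .
  hence 2: "thin_at z C (- u)" unfolding thin_at_z .
  from X show "X \<in> {(thin_half s v d, v, v + s * d) | s v d. thin_at s v d}"
  proof
    assume X: "X = (convex hull {A, B, D}, A, B)"
    have "X = (thin_half (cnj z) A (z * u), A, A + cnj z * (z * u))"
      unfolding X thin_half_def cnj_cancel[OF z] B D by simp
    thus ?thesis using 1 by blast
  next
    assume X: "X = (convex hull {C, B, D}, C, B)"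
    have "X = (thin_half z C (- u), C, C + z * (- u))"
      unfolding X thin_half_def B D C by simp
    thus ?thesis using 2 by blast
  qed
next
  fix X assume "X \<in> {(thin_half s v d, v, v + s * d) | s v d. thin_at s v d}"
  then obtain s v d where X: "X = (thin_half s v d, v, v + s * d)" "thin_at s v d" by blast
  from X(2) show "X \<in> thin_halves P"
  proof (rule thin_at_rhomb)
    fix A B C D
    assume "Thin A B C D \<in> P" "s = z \<and> C = v \<or> s = cnj z \<and> A = v" "B = v + s * d" "D = v + d"
    thus ?thesis unfolding X thin_half_def thin_halves_def by blast
  qed
qed

lemma thick_halves_eq: "thick_halves P = {thick_half s v k | s v k. thick_at s v k}"
proof (intro set_eqI iffI)
  fix X assume "X \<in> thick_halves P"
  then obtain E F G H where t: "Thick E F G H \<in> P" and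
    X: "X = convex hull {E, F, G} \<or> X = convex hull {E, H, G}"
    unfolding thick_halves_def by blast
  define u where "u = F - E"
  have c: "has_corner kE E u" and H: "H = E + z\<^sup>2 * u" and G: "G = E + (u + z\<^sup>2 * u)" and F: "F = E + u"
  proof -
    have t': "has_corner kE E (F - E)" "G = F + H - E" "H - E = z\<^sup>2 * (F - E)" using t[unfolded thick_corners] by blast+
    show "has_corner kE E u" "F = E + u" using t' by (simp_all add: u_def)
    show H: "H = E + z\<^sup>2 * u" using t'(3) by (simp add: u_def diff_eq_eq add.commute)
    show "G = E + (u + z\<^sup>2 * u)" unfolding t'(2) H by (simp add: u_def)
  qed
  have 1: "thick_at z E u" using c unfolding thick_at_z .
  have "z ^ 8 * (z\<^sup>2 * u) = u" unfolding z_pow_mult by simp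
  hence 2: "thick_at (cnj z) E (z\<^sup>2 * u)" using c unfolding thick_at_cnj by (simp only:)
  from X show "X \<in> {thick_half s v k | s v k. thick_at s v k}"
  proof
    assume X: "X = convex hull {E, F, G}"
    have "X = thick_half z E u" unfolding X thick_half_def F G ..
    thus ?thesis using 1 by blast
  next
    assume X: "X = convex hull {E, H, G}"
    have "X = thick_half (cnj z) E (z\<^sup>2 * u)" unfolding X thick_half_def cnj_cancel[OF z] H G by (simp add: add.commute)
    thus ?thesis using 2 by blast
  qed
next
  fix X assume "X \<in> {thick_half s v k | s v k. thick_at s v k}"
  then obtain s v k where X: "X = thick_half s v k" "thick_at s v k" by blast
  from X(2) show "X \<in> thick_halves P"
  proof (rule thick_at_rhomb)
    fix F G H
    assume *: "Thick v F G H \<in> P" "s = z \<and> F = v + k \<or> s = cnj z \<and> H = v + k" "G = v + (k + s\<^sup>2 * k)"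
    hence "X \<in> {convex hull {v, F, G}, convex hull {v, H, G}}" unfolding X(1) thick_half_def by auto
    thus ?thesis using *(1) unfolding thick_halves_def by blast
  qed
qed

lemma thick_half_subset:
  assumes "thick_at s v k" shows "\<exists>r\<in>P. thick_half s v k \<subseteq> rhomb_region r \<and> (\<forall>x y. arrow r True x y \<longrightarrow> x = v \<and> (y = v + k \<or> y = v + s\<^sup>2 * k))"
proof -
  obtain r where r: "r \<in> P" "rhomb_region r = parallelogram v k (s\<^sup>2 * k)" "\<forall>x y. arrow r True x y \<longrightarrow> x = v \<and> (y = v + k \<or> y = v + s\<^sup>2 * k)"
    using thick_at_arrows[OF assms] by blast
  have "thick_half s v k \<subseteq> rhomb_region r"
    unfolding r(2) thick_half_def convex_hull_box[symmetric] by (intro hull_mono) auto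
  thus ?thesis using r by blast
qed

lemma far_corner_notin_thick_half:
  assumes "decagonal s" "k \<noteq> 0"
  shows "v + s\<^sup>2 * k \<notin> thick_half s v k"
proof
  assume "v + s\<^sup>2 * k \<in> thick_half s v k"
  hence 1: "v + (of_real (- 1) * k + of_real 1 * (k + s\<^sup>2 * k)) \<in> convex hull {v, v + k, v + (k + s\<^sup>2 * k)}"
    by (simp add: thick_half_def)
  have "cross k (k + s\<^sup>2 * k) \<noteq> 0" using cross_pos_form[OF assms] golden_gt_1 by simp
  from 1[unfolded triangle_iff[OF this]] show False by simp
qed

text \<open>The common edge is of type 1, so it starts at the vertex \<open>E\<close> of the thick rhomb, and a thick half contains only
  one of the two type 1 edges there. On the side of the edge where the thin rhomb lies, a thick rhomb would
  overlap it.\<close>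

lemma first_pairs_eq: "first_pairs l P = {(thin_half s v d, thick_half s v (s * d)) | s v d. thin_at s v d}"
proof (intro set_eqI iffI)
  fix p assume "p \<in> first_pairs l P"
  then obtain X Y x y where p: "p = (X, Y)" and XY: "(X, x, y) \<in> thin_halves P" "Y \<in> thick_halves P" "common_edge x y X Y"
    unfolding first_pairs_def by blast
  obtain s v d where X: "X = thin_half s v d" "x = v" "y = v + s * d" and td: "thin_at s v d"
    using XY(1) unfolding thin_halves_eq by blast
  obtain s' v' k where Y: "Y = thick_half s' v' k" and tk: "thick_at s' v' k"
    using XY(2) unfolding thick_halves_eq by blast
  have int: "X \<inter> Y = closed_segment x y" using XY(3) by (simp add: common_edge_def)
  obtain r where r: "r \<in> P" "arrow r True x y" using thin_at_arrows[OF td] X by blast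
  obtain t where t: "t \<in> P" "Y \<subseteq> rhomb_region t" "\<forall>x y. arrow t True x y \<longrightarrow> x = v' \<and> (y = v' + k \<or> y = v' + s'\<^sup>2 * k)"
    using thick_half_subset[OF tk] Y by blast
  have "midpoint x y \<in> X \<inter> Y" unfolding int by simp
  hence "midpoint x y \<in> rhomb_region t" using t(2) by blast
  hence "arrow t True x y" by (rule midpoint_arrow[OF r(1) t(1) r(2)])
  hence xy: "x = v'" "y = v' + k \<or> y = v' + s'\<^sup>2 * k" using t(3) by blast+
  have "y \<in> X \<inter> Y" unfolding int by simp
  hence "y \<in> Y" by blast
  hence "y \<noteq> v' + s'\<^sup>2 * k" unfolding Y
    using far_corner_notin_thick_half thick_at_norm[OF tk] sense_cases(2)[OF disjI2[OF disjI1[OF tk]]] by blast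
  hence k: "v' = v" "k = s * d" using xy X by auto
  have "s' = s \<or> s' = cnj s" by (rule senses_eq[OF sense_cases(1)[OF disjI1[OF td]] sense_cases(1)[OF disjI2[OF disjI1[OF tk]]]])
  moreover have "s' \<noteq> cnj s" using thin_no_thick[OF td] tk unfolding k by blast
  ultimately have "s' = s" by blast
  thus "p \<in> {(thin_half s v d, thick_half s v (s * d)) | s v d. thin_at s v d}"
    unfolding p X(1) Y k using td by blast
next
  fix p assume "p \<in> {(thin_half s v d, thick_half s v (s * d)) | s v d. thin_at s v d}"
  then obtain s v d where p: "p = (thin_half s v d, thick_half s v (s * d))" and td: "thin_at s v d" by blast
  note s = sense_cases(2)[OF disjI1[OF td]]
  have "common_edge v (v + s * d) (thin_half s v d) (thick_half s v (s * d))"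
    unfolding common_edge_def first_Int[OF s thin_at_norm[OF td, THEN conjunct2]]
    unfolding thin_half_def thick_half_def by blast
  moreover have "triangle_with_sides (l * golden) (l * golden) l (thin_half s v d \<union> thick_half s v (s * d))"
    unfolding first_union[OF s] using triangles_with_sides(1)[OF s] thin_at_norm[OF td] by blast
  moreover have "(thin_half s v d, v, v + s * d) \<in> thin_halves P" unfolding thin_halves_eq using td by blast
  moreover have "thick_half s v (s * d) \<in> thick_halves P" unfolding thick_halves_eq using thin_imp_thick[OF td] by blast
  ultimately show "p \<in> first_pairs l P" unfolding p first_pairs_def by blast
qed

lemma first_large_eq: "first_large l P = {large1 s v d | s v d. thin_at s v d}"
proof -
  have u: "thin_half s v d \<union> thick_half s v (s * d) = large1 s v d" if "thin_at s v d" for s v d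
    by (rule first_union[OF sense_cases(2)[OF disjI1[OF that]]])
  show ?thesis
  proof (intro set_eqI iffI)
    fix W assume "W \<in> first_large l P"
    then obtain s v d where t: "W = thin_half s v d \<union> thick_half s v (s * d)" "thin_at s v d"
      unfolding first_large_def first_pairs_eq by blast
    have "W = large1 s v d" unfolding t(1) by (rule u[OF t(2)])
    thus "W \<in> {large1 s v d | s v d. thin_at s v d}" using t(2) by blast
  next
    fix W assume "W \<in> {large1 s v d | s v d. thin_at s v d}"
    then obtain s v d where t: "W = large1 s v d" "thin_at s v d" by blast
    have "W = thin_half s v d \<union> thick_half s v (s * d)" unfolding t(1) by (rule u[OF t(2), symmetric])
    thus "W \<in> first_large l P" unfolding first_large_def first_pairs_eq using t(2) by blast
  qed
qed

lemma thick_half_short_edge: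
  assumes "thick_at s v k" "thick_half s v k = convex hull {x, y, w}" "dist x y = l"
  shows "{x, y} = {v, v + k} \<or> {x, y} = {v + k, v + (k + s\<^sup>2 * k)}"
proof -
  note s = sense_cases(2)[OF disjI2[OF disjI1[OF assms(1)]]]
  have "small1 (cnj s) (v + k) (s\<^sup>2 * k) = thick_half s v k"
    unfolding small1_def thick_half_def cnj_cancel[OF s] by (simp add: add.assoc)
  moreover have "norm (s\<^sup>2 * k) = l" using norm_pow_mult[OF s] thick_at_norm[OF assms(1)] by simp
  ultimately show ?thesis
    using small1_short_edge[OF decagonal_cnj[OF s], of "s\<^sup>2 * k" l "v + k" x y w] assms(2,3) l_pos
    unfolding cnj_cancel[OF s] by (simp add: add.assoc)
qed

lemma thick_half_inj:
  assumes "thick_at s v k" "thick_at s' v' k'" "thick_half s v k = thick_half s' v' k'"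
  shows "s = s'" "v = v'" "k = k'"
proof -
  note s = sense_cases(2)[OF disjI2[OF disjI1[OF assms(1)]]]
  obtain r where r: "r \<in> P" "arrow r True v (v + k)" "arrow r False (v + k) (v + (k + s\<^sup>2 * k))"
    using thick_at_arrows[OF assms(1)] by blast
  obtain t where t: "t \<in> P" "arrow t True v' (v' + k')"
    using thick_at_arrows[OF assms(2)] by blast
  have "dist v' (v' + k') = l" using thick_at_norm[OF assms(2)] by (simp add: dist_norm)
  hence "{v', v' + k'} = {v, v + k} \<or> {v', v' + k'} = {v + k, v + (k + s\<^sup>2 * k)}"
    using thick_half_short_edge[OF assms(1)] assms(3)[unfolded thick_half_def[of s']] by blast
  moreover have "{v', v' + k'} \<noteq> {v + k, v + (k + s\<^sup>2 * k)}"
    using arrows_consistent(1)[OF t(1) r(1) t(2) r(3)] by blast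
  ultimately have eq: "{v, v + k} = {v', v' + k'}" by blast
  show v: "v = v'" by (rule arrows_consistent(2)[OF r(1) t(1) r(2) t(2) eq])
  show k: "k = k'" using arrows_consistent(3)[OF r(1) t(1) r(2) t(2) eq] v by simp
  have kn: "k \<noteq> 0" using thick_at_norm[OF assms(1)] by blast
  have "cross (v + k - v) (v + (k + s\<^sup>2 * k) - v) \<noteq> 0" using cross_pos_form[OF s kn] golden_gt_1 by simp
  from third_vertex_eq[OF triangle_vertices[OF this assms(3)[unfolded thick_half_def], folded v k] not_collinear_cross(2,3)[OF this]]
  have "v + (k + s'\<^sup>2 * k) = v + (k + s\<^sup>2 * k)" .
  hence "s' \<noteq> cnj s" using square_cnj_neq[OF s kn] by auto
  thus "s = s'" using senses_eq[OF sense_cases(1)[OF disjI2[OF disjI1[OF assms(1)]]] sense_cases(1)[OF disjI2[OF disjI1[OF assms(2)]]]] by blast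
qed

text \<open>A thick half without a partner is one across whose type 1 edge lies another thick rhomb.\<close>

lemma first_small_eq: "first_small l P = {small1 s v d | s v d. turn_at s v d}"
proof (intro set_eqI iffI)
  fix Y assume "Y \<in> first_small l P"
  hence Y: "Y \<in> thick_halves P" "\<nexists>X. (X, Y) \<in> first_pairs l P" by (auto simp: first_small_def)
  obtain s v k where k: "Y = thick_half s v k" "thick_at s v k" using Y(1) unfolding thick_halves_eq by blast
  note s = sense_cases(2)[OF disjI2[OF disjI1[OF k(2)]]]
  have "\<not> thin_at s v (cnj s * k)"
  proof
    assume t: "thin_at s v (cnj s * k)"
    have "(thin_half s v (cnj s * k), thick_half s v (s * (cnj s * k))) \<in> first_pairs l P"
      unfolding first_pairs_eq using t by blast
    hence "(thin_half s v (cnj s * k), Y) \<in> first_pairs l P" unfolding k cnj_cancel(2)[OF s] .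
    thus False using Y(2) by blast
  qed
  hence "turn_at s (v + k) ((cnj s)\<^sup>2 * k)" using thick_partner[OF k(2)] by blast
  hence t: "turn_at (cnj s) (v + k) (s\<^sup>2 * k)" using turn_at_sym cnj_cancel(6)[OF s] by metis
  have "small1 (cnj s) (v + k) (s\<^sup>2 * k) = Y"
    unfolding k small1_def thick_half_def cnj_cancel[OF s] by (simp add: add.assoc)
  thus "Y \<in> {small1 s v d | s v d. turn_at s v d}" using t by blast
next
  fix Y assume "Y \<in> {small1 s v d | s v d. turn_at s v d}"
  then obtain s v d where Y: "Y = small1 s v d" and t: "turn_at s v d" by blast
  note s = sense_cases(2)[OF disjI2[OF disjI2[OF t]]]
  define e where "e = v - s\<^sup>2 * d"
  have ke: "thick_at (cnj s) e (s\<^sup>2 * d)" using turn_imp(2)[OF t] by (simp add: e_def)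
  have Ye: "Y = thick_half (cnj s) e (s\<^sup>2 * d)"
    unfolding Y small1_def thick_half_def cnj_cancel[OF s] by (simp add: e_def)
  have "(X, Y) \<notin> first_pairs l P" for X
  proof
    assume "(X, Y) \<in> first_pairs l P"
    then obtain s' v' d' where t': "thin_at s' v' d'" "Y = thick_half s' v' (s' * d')"
      unfolding first_pairs_eq by blast
    note i = thick_half_inj[OF ke thin_imp_thick[OF t'(1)] t'(2)[unfolded Ye]]
    have d': "d' = cnj (cnj s) * (s\<^sup>2 * d)" unfolding i(3) i(1)[symmetric] complex_cnj_cnj by (rule cnj_cancel(2)[OF s, symmetric])
    have "thin_at (cnj s) e d'" using t'(1) unfolding i(1,2) .
    hence "thin_at (cnj s) e (cnj (cnj s) * (s\<^sup>2 * d))" unfolding d' .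
    from thick_partner_no_turn[OF this] have "\<not> turn_at (cnj s) v (s\<^sup>2 * (s\<^sup>2 * d))" by (simp add: e_def)
    moreover have "s\<^sup>2 * (s\<^sup>2 * d) = s ^ 4 * d" by (simp flip: mult.assoc power_add)
    ultimately show False using turn_at_sym[OF t] by simp
  qed
  moreover have "Y \<in> thick_halves P" unfolding thick_halves_eq Ye using ke by blast
  ultimately show "Y \<in> first_small l P" by (simp add: first_small_def)
qed

lemma base_edges_eq:
  assumes "thin_at s v d" "thin_at s' v' d'" "{v, v + d} = {v', v' + d'}"
  shows "v = v'" "d = d'"
proof -
  obtain r where r: "r \<in> P" "arrow r False v (v + d)" using thin_at_arrows[OF assms(1)] by blast
  obtain t where t: "t \<in> P" "arrow t False v' (v' + d')" using thin_at_arrows[OF assms(2)] by blast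
  show "v = v'" by (rule arrows_consistent(2)[OF r(1) t(1) r(2) t(2) assms(3)])
  thus "d = d'" using arrows_consistent(3)[OF r(1) t(1) r(2) t(2) assms(3)] by simp
qed

lemma large1_base:
  assumes "thin_at s v d" "large1 s v d = convex hull {x, y, w}" "dist x y = l"
  shows "{x, y} = {v, v + d}"
  using large1_short_edge[OF sense_cases(2)[OF disjI1[OF assms(1)]] _ l_pos assms(2,3)] thin_at_norm[OF assms(1)] by blast

lemma large1_inj:
  assumes "thin_at s v d" "thin_at s' v' d'" "large1 s v d = large1 s' v' d'"
  shows "s = s'" "v = v'" "d = d'"
proof -
  note s = sense_cases(2)[OF disjI1[OF assms(1)]]
  have "dist v' (v' + d') = l" using thin_at_norm[OF assms(2)] by (simp add: dist_norm)
  hence eq: "{v, v + d} = {v', v' + d'}"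
    using large1_base[OF assms(1)] assms(3)[unfolded large1_def[of s']] by metis
  show v: "v = v'" "d = d'" by (rule base_edges_eq[OF assms(1,2) eq])+
  have dn: "d \<noteq> 0" using thin_at_norm[OF assms(1)] by blast
  have c: "cross (v + d - v) (v + of_real golden * (s\<^sup>2 * d) - v) \<noteq> 0" using cross_pos_form[OF s dn] golden_gt_1 by simp
  from third_vertex_eq[OF triangle_vertices[OF this assms(3)[unfolded large1_def], folded v] not_collinear_cross(2,3)[OF this]]
  have "v + of_real golden * (s'\<^sup>2 * d) = v + of_real golden * (s\<^sup>2 * d)" .
  hence "of_real golden * (s'\<^sup>2 * d) = of_real golden * (s\<^sup>2 * d)" by simp
  hence "s'\<^sup>2 * d = s\<^sup>2 * d" using golden_gt_1 by simp
  hence "s' \<noteq> cnj s" using square_cnj_neq[OF s dn] by auto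
  thus "s = s'" using senses_eq[OF sense_cases(1)[OF disjI1[OF assms(1)]] sense_cases(1)[OF disjI1[OF assms(2)]]] by blast
qed

text \<open>The common edge of length \<open>l\<close> is the base of the large triangle and of type 2. The small triangle has two sides
  of this length, one of each type. The two large triangles that could have its type 2 side as their base
  would lie on different sides of it, and the vertex being a full turn leaves room for one of them only.\<close>

lemma second_pairs_eq: "second_pairs l P = {(small1 s v d, large1 s v d) | s v d. turn_at s v d}"
proof (intro set_eqI iffI)
  fix p assume "p \<in> second_pairs l P"
  then obtain X Y x y where p: "p = (X, Y)" and XY: "X \<in> first_small l P" "Y \<in> first_large l P" "dist x y = l" "common_edge x y X Y"
    unfolding second_pairs_def by blast
  obtain s v d where X: "X = small1 s v d" "turn_at s v d" using XY(1) unfolding first_small_eq by blast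
  obtain s' v' d' where Y: "Y = large1 s' v' d'" "thin_at s' v' d'" using XY(2) unfolding first_large_eq by blast
  note s = sense_cases(2)[OF disjI2[OF disjI2[OF X(2)]]]
  have td: "thin_at s v d" by (rule turn_imp(1)[OF X(2)])
  obtain z' w' where e: "X = convex hull {x, y, z'}" "Y = convex hull {x, y, w'}"
    using XY(4) unfolding common_edge_def by blast
  have 1: "{x, y} = {v', v' + d'}" by (rule large1_base[OF Y(2) e(2)[unfolded Y(1)] XY(3)])
  have "{x, y} = {v - s\<^sup>2 * d, v} \<or> {x, y} = {v, v + d}"
    using small1_short_edge[OF s _ l_pos e(1)[unfolded X(1)] XY(3)] thin_at_norm[OF td] by blast
  moreover have "{x, y} \<noteq> {v - s\<^sup>2 * d, v}"
  proof
    assume "{x, y} = {v - s\<^sup>2 * d, v}"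
    hence 2: "{v', v' + d'} = {v - s\<^sup>2 * d, v - s\<^sup>2 * d + s\<^sup>2 * d}" using 1 by simp
    obtain r where r: "r \<in> P" "arrow r False v' (v' + d')" using thin_at_arrows[OF Y(2)] by blast
    obtain t where t: "t \<in> P" "arrow t True (v - s\<^sup>2 * d) (v - s\<^sup>2 * d + s\<^sup>2 * d)" using thick_at_arrows[OF turn_imp(2)[OF X(2)]] by blast
    show False using arrows_consistent(1)[OF r(1) t(1) r(2) t(2) 2] by simp
  qed
  ultimately have "{v, v + d} = {v', v' + d'}" using 1 by simp
  note vd = base_edges_eq[OF td Y(2) this]
  have "s' \<noteq> cnj s" using thin_mate_no_turn X(2) Y(2) vd by blast
  hence "s' = s" using senses_eq[OF sense_cases(1)[OF disjI1[OF td]] sense_cases(1)[OF disjI1[OF Y(2)]]] by blast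
  thus "p \<in> {(small1 s v d, large1 s v d) | s v d. turn_at s v d}" unfolding p X(1) Y(1) using X(2) vd by blast
next
  fix p assume "p \<in> {(small1 s v d, large1 s v d) | s v d. turn_at s v d}"
  then obtain s v d where p: "p = (small1 s v d, large1 s v d)" and t: "turn_at s v d" by blast
  note s = sense_cases(2)[OF disjI2[OF disjI2[OF t]]]
  have td: "thin_at s v d" by (rule turn_imp(1)[OF t])
  have "\<exists>z w. small1 s v d = convex hull {v, v + d, z} \<and> large1 s v d = convex hull {v, v + d, w}"
    unfolding small1_def large1_def by (metis insert_commute)
  hence "common_edge v (v + d) (small1 s v d) (large1 s v d)"
    unfolding common_edge_def second_Int[OF s thin_at_norm[OF td, THEN conjunct2]] by blast
  moreover have "dist v (v + d) = l" using thin_at_norm[OF td] by (simp add: dist_norm)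
  moreover have "triangle_with_sides (l * golden) (l * golden) (l * golden\<^sup>2) (small1 s v d \<union> large1 s v d)"
    unfolding second_union[OF s] using triangles_with_sides(2)[OF s] thin_at_norm[OF td] by blast
  moreover have "small1 s v d \<in> first_small l P" "large1 s v d \<in> first_large l P"
    unfolding first_small_eq first_large_eq using t td by blast+
  ultimately show "p \<in> second_pairs l P" unfolding p second_pairs_def by blast
qed

lemma second_large_eq: "second_large l P = {large2 s v d | s v d. turn_at s v d}"
proof -
  have u: "small1 s v d \<union> large1 s v d = large2 s v d" if "turn_at s v d" for s v d
    by (rule second_union[OF sense_cases(2)[OF disjI2[OF disjI2[OF that]]]])
  show ?thesis
  proof (intro set_eqI iffI)
    fix W assume "W \<in> second_large l P"
    then obtain s v d where t: "W = small1 s v d \<union> large1 s v d" "turn_at s v d"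
      unfolding second_large_def second_pairs_eq by blast
    have "W = large2 s v d" unfolding t(1) by (rule u[OF t(2)])
    thus "W \<in> {large2 s v d | s v d. turn_at s v d}" using t(2) by blast
  next
    fix W assume "W \<in> {large2 s v d | s v d. turn_at s v d}"
    then obtain s v d where t: "W = large2 s v d" "turn_at s v d" by blast
    have "W = small1 s v d \<union> large1 s v d" unfolding t(1) by (rule u[OF t(2), symmetric])
    thus "W \<in> second_large l P" unfolding second_large_def second_pairs_eq using t(2) by blast
  qed
qed

lemma second_small_eq: "second_small l P = {large1 s v d | s v d. thin_at s v d \<and> thin_at (cnj s) v d}"
proof (intro set_eqI iffI)
  fix Y assume "Y \<in> second_small l P"
  hence Y: "Y \<in> first_large l P" "\<nexists>X. (X, Y) \<in> second_pairs l P" by (auto simp: second_small_def)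
  obtain s v d where t: "Y = large1 s v d" "thin_at s v d" using Y(1) unfolding first_large_eq by blast
  have "\<not> turn_at s v d" using Y(2) unfolding second_pairs_eq t(1) by blast
  thus "Y \<in> {large1 s v d | s v d. thin_at s v d \<and> thin_at (cnj s) v d}" using thin_mate[OF t(2)] t by blast
next
  fix Y assume "Y \<in> {large1 s v d | s v d. thin_at s v d \<and> thin_at (cnj s) v d}"
  then obtain s v d where t: "Y = large1 s v d" "thin_at s v d" "thin_at (cnj s) v d" by blast
  have "(X, Y) \<notin> second_pairs l P" for X
  proof
    assume "(X, Y) \<in> second_pairs l P"
    then obtain s' v' d' where t': "Y = large1 s' v' d'" "turn_at s' v' d'" unfolding second_pairs_eq by blast
    from large1_inj[OF t(2) turn_imp(1)[OF t'(2)] t'(1)[unfolded t(1)]] show False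
      using thin_mate_no_turn[OF t(3)] t'(2) by blast
  qed
  moreover have "Y \<in> first_large l P" unfolding first_large_eq using t by blast
  ultimately show "Y \<in> second_small l P" by (simp add: second_small_def)
qed

end

section \<open>The composed rhombs\<close>

lemma box_short_halves:
  "parallelogram v a b \<subseteq> convex hull {v, v + a, v + b} \<union> convex hull {v + (a + b), v + a, v + b}"
proof
  fix x assume "x \<in> parallelogram v a b"
  then obtain \<alpha> \<beta> where x: "x = v + (of_real \<alpha> * a + of_real \<beta> * b)" "0 \<le> \<alpha>" "\<alpha> \<le> 1" "0 \<le> \<beta>" "\<beta> \<le> 1"
    unfolding parallelogram_def by blast
  show "x \<in> convex hull {v, v + a, v + b} \<union> convex hull {v + (a + b), v + a, v + b}"
  proof (cases "\<alpha> + \<beta> \<le> 1")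
    case True
    hence "x \<in> convex hull {v, v + a, v + b}" unfolding triangle_eq x(1) using x by blast
    thus ?thesis by blast
  next
    case False
    have "x = v + (a + b) + (of_real (1 - \<beta>) * - b + of_real (1 - \<alpha>) * - a)" unfolding x(1) by (simp add: algebra_simps)
    moreover have "0 \<le> 1 - \<beta>" "0 \<le> 1 - \<alpha>" "(1 - \<beta>) + (1 - \<alpha>) \<le> 1" using x False by auto
    ultimately have "x \<in> convex hull {v + (a + b), v + (a + b) + - b, v + (a + b) + - a}"
      unfolding triangle_eq by blast
    thus ?thesis by (simp add: algebra_simps)
  qed
qed

lemma box_diagonal:
  "convex hull {v, v + (a + b), v + a} \<union> convex hull {v, v + (a + b), v + b} = parallelogram v a b"
proof
  show "convex hull {v, v + (a + b), v + a} \<union> convex hull {v, v + (a + b), v + b} \<subseteq> parallelogram v a b"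
    unfolding convex_hull_box[symmetric] by (intro Un_least hull_mono) auto
next
  show "parallelogram v a b \<subseteq> convex hull {v, v + (a + b), v + a} \<union> convex hull {v, v + (a + b), v + b}"
  proof
    fix x assume "x \<in> parallelogram v a b"
    then obtain \<alpha> \<beta> where x: "x = v + (of_real \<alpha> * a + of_real \<beta> * b)" "0 \<le> \<alpha>" "\<alpha> \<le> 1" "0 \<le> \<beta>" "\<beta> \<le> 1"
      unfolding parallelogram_def by blast
    show "x \<in> convex hull {v, v + (a + b), v + a} \<union> convex hull {v, v + (a + b), v + b}"
    proof (cases "\<beta> \<le> \<alpha>")
      case True
      have "x = v + (of_real \<beta> * (a + b) + of_real (\<alpha> - \<beta>) * a)" unfolding x(1) by (simp add: algebra_simps)
      moreover have "0 \<le> \<beta>" "0 \<le> \<alpha> - \<beta>" "\<beta> + (\<alpha> - \<beta>) \<le> 1" using x True by auto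
      ultimately have "x \<in> convex hull {v, v + (a + b), v + a}" unfolding triangle_eq by blast
      thus ?thesis by blast
    next
      case False
      have "x = v + (of_real \<alpha> * (a + b) + of_real (\<beta> - \<alpha>) * b)" unfolding x(1) by (simp add: algebra_simps)
      moreover have "0 \<le> \<alpha>" "0 \<le> \<beta> - \<alpha>" "\<alpha> + (\<beta> - \<alpha>) \<le> 1" using x False by auto
      ultimately have "x \<in> convex hull {v, v + (a + b), v + b}" unfolding triangle_eq by blast
      thus ?thesis by blast
    qed
  qed
qed

text \<open>Two mirror images of the large triangle form a thin rhomb with sides \<open>l * golden\<close>.\<close>

lemma large1_pair_box:
  assumes s: "decagonal s"
  shows "large1 s v d \<union> large1 (cnj s) v d = parallelogram v (of_real golden * (s\<^sup>2 * d)) (of_real golden * ((cnj s)\<^sup>2 * d))"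
proof -
  have "cnj s = of_real golden - s" by (rule z_cnj_eq[OF s])
  have "(cnj s)\<^sup>2 = of_real golden * cnj s - 1" by (rule z_pow(1)[OF decagonal_cnj[OF s]])
  hence "s\<^sup>2 + (cnj s)\<^sup>2 = of_real golden * (s + cnj s) - 2" unfolding z_pow(1)[OF s] by (simp add: algebra_simps)
  also have "s + cnj s = of_real golden" using z_cnj_eq[OF s] by simp
  finally have "s\<^sup>2 + (cnj s)\<^sup>2 = of_real golden - 1" unfolding golden_complex_square by simp
  hence "s\<^sup>2 * d + (cnj s)\<^sup>2 * d = (of_real golden - 1) * d" by (simp flip: distrib_right)
  hence "of_real golden * (s\<^sup>2 * d) + of_real golden * ((cnj s)\<^sup>2 * d) = (of_real golden - 1) * (of_real golden * d)"
    by (simp add: mult.left_commute flip: distrib_left)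
  hence "of_real golden * (s\<^sup>2 * d) + of_real golden * ((cnj s)\<^sup>2 * d) = d"
    unfolding golden_complex_reciprocal .
  thus ?thesis using box_diagonal[of v "of_real golden * (s\<^sup>2 * d)" "of_real golden * ((cnj s)\<^sup>2 * d)"]
    unfolding large1_def by simp
qed

text \<open>Two mirror images of the amalgamated triangle form a thick rhomb with sides \<open>l * golden\<close>.\<close>

lemma large2_pair_box:
  assumes s: "decagonal s"
  shows "large2 s v d \<union> large2 (cnj s) v (s ^ 4 * d) = parallelogram (v - s\<^sup>2 * d) (of_real golden * (s * d)) (of_real golden * (s ^ 3 * d))"
proof -
  have 1: "v - s\<^sup>2 * d + of_real golden * (s * d) = v + d"
    unfolding sum_side[OF s, symmetric] by simp
  have p: "s ^ 3 * d = s * (s\<^sup>2 * d)" "s ^ 4 * d = s\<^sup>2 * (s\<^sup>2 * d)"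
    by (simp_all add: power2_eq_square power3_eq_cube power4_eq_xxxx mult.assoc)
  have 2: "v - s\<^sup>2 * d + of_real golden * (s ^ 3 * d) = v + s ^ 4 * d"
    unfolding p sum_side[OF s, symmetric] by simp
  have "of_real golden * (s * d) + of_real golden * (s ^ 3 * d) = of_real golden * (s * (d + s\<^sup>2 * d))"
    unfolding p by (simp add: distrib_left)
  also have "\<dots> = of_real golden * (of_real golden * (s\<^sup>2 * d))" unfolding sum_side[OF s] by (simp add: power2_eq_square mult_ac)
  also have "\<dots> = (of_real golden + 1) * (s\<^sup>2 * d)" unfolding golden_complex_square[symmetric] by (simp add: mult.assoc)
  finally have 3: "v - s\<^sup>2 * d + (of_real golden * (s * d) + of_real golden * (s ^ 3 * d)) = v + of_real golden * (s\<^sup>2 * d)"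
    by (simp add: distrib_right)
  show ?thesis using box_diagonal[of "v - s\<^sup>2 * d" "of_real golden * (s * d)" "of_real golden * (s ^ 3 * d)"]
    unfolding large2_def cnj_cancel[OF s] 1 2 3 by (simp add: insert_commute)
qed

context rhomb_tiling
begin

lemma thick_diagonals_meet:
  assumes "thick_at s v k" "thick_at s' v' k'" "0 < c" "c < 1" "0 < c'" "c' < 1"
    "v + of_real c * (k + s\<^sup>2 * k) = v' + of_real c' * (k' + s'\<^sup>2 * k')"
  shows "v = v'"
proof -
  define p where "p = v + of_real c * (k + s\<^sup>2 * k)"
  obtain F G H where t: "Thick v F G H \<in> P" "inner (Thick v F G H) = open_parallelogram v k (s\<^sup>2 * k)"
    using assms(1) by (rule thick_at_rhomb)
  obtain F' G' H' where t': "Thick v' F' G' H' \<in> P" "inner (Thick v' F' G' H') = open_parallelogram v' k' (s'\<^sup>2 * k')"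
    using assms(2) by (rule thick_at_rhomb)
  have "p = v + (of_real c * k + of_real c * (s\<^sup>2 * k))" by (simp add: p_def distrib_left)
  hence 1: "p \<in> inner (Thick v F G H)" unfolding t(2) open_parallelogram_def using assms by blast
  have "p = v' + (of_real c' * k' + of_real c' * (s'\<^sup>2 * k'))" using assms(7) by (simp add: p_def distrib_left)
  hence "p \<in> inner (Thick v' F' G' H')" unfolding t'(2) open_parallelogram_def using assms by blast
  hence "Thick v F G H = Thick v' F' G' H'"
    using inner_region_eq[OF t(1) t'(1) 1] inner_subset[OF t'(1)] by blast
  thus ?thesis by simp
qed

lemma large2_partner:
  assumes "turn_at s v d" "turn_at s' v' d'"
    "{v - s\<^sup>2 * d, v + of_real golden * (s\<^sup>2 * d)} = {v' - s'\<^sup>2 * d', v' + of_real golden * (s'\<^sup>2 * d')}"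
  shows "v' = v \<and> (s' = s \<and> d' = d \<or> s' = cnj s \<and> d' = s ^ 4 * d)"
proof -
  note s = sense_cases(2)[OF disjI2[OF disjI2[OF assms(1)]]]
  note s' = sense_cases(2)[OF disjI2[OF disjI2[OF assms(2)]]]
  have td: "thin_at s v d" "thin_at s' v' d'" using assms turn_imp(1) by blast+
  define p where "p = s\<^sup>2 * d"
  define p' where "p' = s'\<^sup>2 * d'"
  have p0: "p \<noteq> 0" using norm_pow_mult[OF s, of 2 d] thin_at_norm[OF td(1)] l_pos by (auto simp: p_def)
  have diag: "s * d + s\<^sup>2 * (s * d) = of_real golden * p" "s' * d' + s'\<^sup>2 * (s' * d') = of_real golden * p'"
    using sum_side[OF s, of "s * d"] sum_side[OF s', of "s' * d'"] by (simp_all add: p_def p'_def power2_eq_square mult.assoc)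
  have g1: "of_real (golden + 1) \<noteq> (0 :: complex)" using golden_gt_1 by (subst of_real_eq_0_iff) simp
  from assms(3) consider
    "v - p = v' - p'" "v + of_real golden * p = v' + of_real golden * p'" |
    "v - p = v' + of_real golden * p'" "v + of_real golden * p = v' - p'"
    unfolding p_def p'_def doubleton_eq_iff by blast
  thus ?thesis
  proof cases
    case 1
    have "of_real (golden + 1) * p = (v + of_real golden * p) - (v - p)" by (simp add: algebra_simps)
    also have "\<dots> = of_real (golden + 1) * p'" unfolding 1 by (simp add: algebra_simps)
    finally have "of_real (golden + 1) * p = of_real (golden + 1) * p'" .
    hence "p = p'" using g1 by simp
    moreover from this 1(1) have "v = v'" by simp
    moreover have "s' = s \<or> s' = cnj s"
      by (rule senses_eq[OF sense_cases(1)[OF disjI1[OF td(1)]] sense_cases(1)[OF disjI1[OF td(2)]]])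
    moreover have "d' = d" if "s' = s" "p = p'"
      using that z_nonzero[OF s] by (simp add: p_def p'_def)
    moreover have "d' = s ^ 4 * d" if "s' = cnj s" "p = p'"
    proof -
      have "d' = s\<^sup>2 * p'" unfolding p'_def that(1) by (rule cnj_cancel(4)[OF s, symmetric])
      also have "\<dots> = s ^ 4 * d" unfolding that(2)[symmetric] p_def by (simp flip: mult.assoc power_add)
      finally show ?thesis .
    qed
    ultimately show ?thesis by blast
  next
    case 2
    have "of_real (golden + 1) * p = (v + of_real golden * p) - (v - p)" by (simp add: algebra_simps)
    also have "\<dots> = of_real (golden + 1) * - p'" unfolding 2 by (simp add: algebra_simps)
    finally have "p = - p'" using g1 mult_cancel_left by blast
    hence p': "p' = - p" by simp
    hence v': "v' = v + (of_real golden - 1) * p" using 2(1) by (simp add: algebra_simps)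
    define c where "c = (golden - 1) / (2 * golden)"
    have c: "0 < c" "c < 1" "c * golden = (golden - 1) / 2" using golden_gt_1 by (auto simp: c_def field_simps)
    have "complex_of_real c * of_real golden = (of_real golden - 1) / 2" using arg_cong[OF c(3), of complex_of_real] by simp
    hence "complex_of_real c * (of_real golden * p) = (of_real golden - 1) / 2 * p" by (simp flip: mult.assoc)
    hence two: "2 * (complex_of_real c * (of_real golden * p)) = (of_real golden - 1) * p" by (simp add: mult_ac)
    have "v + complex_of_real c * (of_real golden * p) = v' - complex_of_real c * (of_real golden * p)"
      unfolding v' two[symmetric] by simp
    hence "v + of_real c * (of_real golden * p) = v' + of_real c * (of_real golden * p')" unfolding p' by simp
    hence "v = v'"
      using thick_diagonals_meet[OF thin_imp_thick[OF td(1)] thin_imp_thick[OF td(2)] c(1,2) c(1,2)] unfolding diag by blast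
    hence "(of_real golden - 1) * p = 0" unfolding v' by simp
    thus ?thesis using p0 golden_gt_1 by simp
  qed
qed

lemma large1_not_segment: "thin_at s v d \<Longrightarrow> large1 s v d \<noteq> closed_segment x y"
  unfolding large1_def
  by (rule triangle_not_segment)
     (use cross_pos_form[OF sense_cases(2)[OF disjI1]] thin_at_norm golden_gt_1 in simp)

lemma large2_not_segment:
  assumes "turn_at s v d" shows "large2 s v d \<noteq> closed_segment x y"
proof -
  note s = sense_cases(2)[OF disjI2[OF disjI2[OF assms]]]
  have d: "d \<noteq> 0" using thin_at_norm[OF turn_imp(1)[OF assms]] by blast
  have "cross (v + d - (v - s\<^sup>2 * d)) (v + of_real golden * (s\<^sup>2 * d) - (v - s\<^sup>2 * d)) = (golden + 1) * golden * cross d (s * d)"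
    by (simp add: cross_pos_form[OF s d]) (simp add: algebra_simps)
  thus ?thesis unfolding large2_def
    by (intro triangle_not_segment) (use cross_pos_form(1)[OF s d] golden_gt_1 in simp)
qed

text \<open>Thin composed rhombs belong to the type 2 edges along which two thin rhombs meet, thick composed rhombs to the
  full turns.\<close>

lemma penrose_composition_twice_eq:
  "penrose_composition_twice l P =
     {large1 s v d \<union> large1 (cnj s) v d | s v d. thin_at s v d \<and> thin_at (cnj s) v d} \<union>
     {large2 s v d \<union> large2 (cnj s) v (s ^ 4 * d) | s v d. turn_at s v d}" (is "_ = ?A \<union> ?B")
proof -
  have 1: "{X \<union> Y | X Y. X \<in> second_small l P \<and> Y \<in> second_small l P \<and> (\<exists>x y. dist x y = l \<and> common_edge x y X Y)} = ?A"
    (is "?L = _")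
  proof (intro set_eqI iffI)
    fix W assume "W \<in> ?L"
    then obtain X Y x y where W: "W = X \<union> Y" "X \<in> second_small l P" "Y \<in> second_small l P" "dist x y = l" "common_edge x y X Y"
      by blast
    obtain s v d where X: "X = large1 s v d" "thin_at s v d" "thin_at (cnj s) v d" using W(2) unfolding second_small_eq by blast
    obtain s' v' d' where Y: "Y = large1 s' v' d'" "thin_at s' v' d'" using W(3) unfolding second_small_eq by blast
    obtain z' w' where e: "X = convex hull {x, y, z'}" "Y = convex hull {x, y, w'}" and int: "X \<inter> Y = closed_segment x y"
      using W(5) unfolding common_edge_def by blast
    have "{v, v + d} = {v', v' + d'}"
      using large1_base[OF X(2) e(1)[unfolded X(1)] W(4)] large1_base[OF Y(2) e(2)[unfolded Y(1)] W(4)] by simp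
    note vd = base_edges_eq[OF X(2) Y(2) this]
    have "s' \<noteq> s"
    proof
      assume "s' = s"
      hence "X = Y" using X Y vd by simp
      hence "large1 s v d = closed_segment x y" using int X(1) by simp
      thus False using large1_not_segment[OF X(2)] by blast
    qed
    hence "s' = cnj s" using senses_eq[OF sense_cases(1)[OF disjI1[OF X(2)]] sense_cases(1)[OF disjI1[OF Y(2)]]] by blast
    thus "W \<in> ?A" unfolding W(1) X(1) Y(1) using X(2,3) vd by blast
  next
    fix W assume "W \<in> ?A"
    then obtain s v d where t: "W = large1 s v d \<union> large1 (cnj s) v d" "thin_at s v d" "thin_at (cnj s) v d" by blast
    note s = sense_cases(2)[OF disjI1[OF t(2)]]
    have n: "norm d = l" "d \<noteq> 0" using thin_at_norm[OF t(2)] by blast+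
    have "common_edge v (v + d) (large1 s v d) (large1 (cnj s) v d)"
      unfolding common_edge_def thin_base_Int[OF s n(2)] unfolding large1_def by blast
    moreover have "dist v (v + d) = l" using n by (simp add: dist_norm)
    moreover have "large1 s v d \<in> second_small l P" unfolding second_small_eq using t by blast
    moreover have "thin_at (cnj s) v d \<and> thin_at (cnj (cnj s)) v d" using t by simp
    hence "large1 (cnj s) v d \<in> second_small l P" unfolding second_small_eq by blast
    ultimately show "W \<in> ?L" unfolding t(1) by blast
  qed
  have 2: "{X \<union> Y | X Y. X \<in> second_large l P \<and> Y \<in> second_large l P \<and> (\<exists>x y. dist x y = l * golden\<^sup>2 \<and> common_edge x y X Y)} = ?B"
    (is "?L = _")
  proof (intro set_eqI iffI)
    fix W assume "W \<in> ?L"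
    then obtain X Y x y where W: "W = X \<union> Y" "X \<in> second_large l P" "Y \<in> second_large l P" "dist x y = l * golden\<^sup>2" "common_edge x y X Y"
      by blast
    obtain s v d where X: "X = large2 s v d" "turn_at s v d" using W(2) unfolding second_large_eq by blast
    obtain s' v' d' where Y: "Y = large2 s' v' d'" "turn_at s' v' d'" using W(3) unfolding second_large_eq by blast
    note s = sense_cases(2)[OF disjI2[OF disjI2[OF X(2)]]]
    note s' = sense_cases(2)[OF disjI2[OF disjI2[OF Y(2)]]]
    have n: "norm d = l" "norm d' = l" using thin_at_norm turn_imp(1) X(2) Y(2) by blast+
    obtain z' w' where e: "X = convex hull {x, y, z'}" "Y = convex hull {x, y, w'}" and int: "X \<inter> Y = closed_segment x y"
      using W(5) unfolding common_edge_def by blast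
    have "{v - s\<^sup>2 * d, v + of_real golden * (s\<^sup>2 * d)} = {v' - s'\<^sup>2 * d', v' + of_real golden * (s'\<^sup>2 * d')}"
      using large2_long_edge[OF s n(1) l_pos e(1)[unfolded X(1)] W(4)] large2_long_edge[OF s' n(2) l_pos e(2)[unfolded Y(1)] W(4)] by simp
    note vd = large2_partner[OF X(2) Y(2) this]
    have "\<not> (s' = s \<and> d' = d)"
    proof
      assume "s' = s \<and> d' = d"
      hence "X = Y" using X Y vd by simp
      hence "large2 s v d = closed_segment x y" using int X(1) by simp
      thus False using large2_not_segment[OF X(2)] by blast
    qed
    hence "Y = large2 (cnj s) v (s ^ 4 * d)" using vd Y(1) by blast
    thus "W \<in> ?B" unfolding W(1) X(1) using X(2) by blast
  next
    fix W assume "W \<in> ?B"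
    then obtain s v d where t: "W = large2 s v d \<union> large2 (cnj s) v (s ^ 4 * d)" "turn_at s v d" by blast
    note s = sense_cases(2)[OF disjI2[OF disjI2[OF t(2)]]]
    have n: "norm d = l" "d \<noteq> 0" using thin_at_norm[OF turn_imp(1)[OF t(2)]] by blast+
    have "\<exists>z w. large2 s v d = convex hull {v - s\<^sup>2 * d, v + of_real golden * (s\<^sup>2 * d), z} \<and>
        large2 (cnj s) v (s ^ 4 * d) = convex hull {v - s\<^sup>2 * d, v + of_real golden * (s\<^sup>2 * d), w}"
      unfolding large2_def cnj_cancel[OF s]
      by (intro exI[of _ "v + d"] exI[of _ "v + s ^ 4 * d"]) (simp add: insert_commute)
    hence "common_edge (v - s\<^sup>2 * d) (v + of_real golden * (s\<^sup>2 * d)) (large2 s v d) (large2 (cnj s) v (s ^ 4 * d))"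
      unfolding common_edge_def thick_base_Int[OF s n(2)] by blast
    moreover have "dist (v - s\<^sup>2 * d) (v + of_real golden * (s\<^sup>2 * d)) = l * golden\<^sup>2" by (rule golden_dists(10)[OF s n(1)])
    moreover have "large2 s v d \<in> second_large l P" "large2 (cnj s) v (s ^ 4 * d) \<in> second_large l P"
      unfolding second_large_eq using t(2) turn_at_sym[OF t(2)] by blast+
    ultimately show "W \<in> ?L" unfolding t(1) by blast
  qed
  show ?thesis unfolding penrose_composition_twice_def 1 2 ..
qed

lemma halves_cover: "(\<exists>s v d. thin_at s v d \<and> p \<in> thin_half s v d) \<or> (\<exists>s v k. thick_at s v k \<and> p \<in> thick_half s v k)"
proof -
  obtain r where r: "r \<in> P" "p \<in> rhomb_region r" using cover by blast
  show ?thesis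
  proof (cases r)
    case (Thin A B C D)
    have B: "C = A + ((B - A) + (D - A))" using thin_shape[OF r(1)[unfolded Thin]] by simp
    have "rhomb_region r = parallelogram A (B - A) (D - A)"
      unfolding Thin rhomb_region_def convex_hull_box[symmetric] using B by simp
    moreover have "parallelogram A (B - A) (D - A) \<subseteq> convex hull {A, B, D} \<union> convex hull {C, B, D}"
      using box_short_halves[of A "B - A" "D - A"] unfolding B[symmetric] by simp
    ultimately have "p \<in> convex hull {A, B, D} \<union> convex hull {C, B, D}" using r(2) by blast
    moreover have "(convex hull {A, B, D}, A, B) \<in> thin_halves P" "(convex hull {C, B, D}, C, B) \<in> thin_halves P"
      using r(1) unfolding Thin thin_halves_def by blast+
    ultimately obtain X x y where "(X, x, y) \<in> thin_halves P" "p \<in> X" by blast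
    thus ?thesis unfolding thin_halves_eq by blast
  next
    case (Thick E F G H)
    have G: "G = E + ((F - E) + (H - E))" using thick_shape[OF r(1)[unfolded Thick]] by simp
    have "rhomb_region r = parallelogram E (F - E) (H - E)"
      unfolding Thick rhomb_region_def convex_hull_box[symmetric] using G by simp
    moreover have "convex hull {E, G, F} \<union> convex hull {E, G, H} = parallelogram E (F - E) (H - E)"
      using box_diagonal[of E "F - E" "H - E"] unfolding G[symmetric] by simp
    ultimately have "p \<in> convex hull {E, G, F} \<union> convex hull {E, G, H}" using r(2) by blast
    hence "p \<in> convex hull {E, F, G} \<union> convex hull {E, H, G}" by (simp add: insert_commute)
    moreover have "convex hull {E, F, G} \<in> thick_halves P" "convex hull {E, H, G} \<in> thick_halves P"
      using r(1) unfolding Thick thick_halves_def by blast+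
    ultimately obtain X where "X \<in> thick_halves P" "p \<in> X" by blast
    thus ?thesis unfolding thick_halves_eq by blast
  qed
qed

lemma composition_members:
  "thin_at s v d \<Longrightarrow> thin_at (cnj s) v d \<Longrightarrow> large1 s v d \<union> large1 (cnj s) v d \<in> penrose_composition_twice l P"
  "turn_at s v d \<Longrightarrow> large2 s v d \<union> large2 (cnj s) v (s ^ 4 * d) \<in> penrose_composition_twice l P"
  unfolding penrose_composition_twice_eq by blast+

lemma large2_covered: "turn_at s v d \<Longrightarrow> p \<in> large2 s v d \<Longrightarrow> \<exists>W\<in>penrose_composition_twice l P. p \<in> W"
  by (blast dest: composition_members(2))

lemma large1_covered:
  assumes "thin_at s v d" "p \<in> large1 s v d"
  shows "\<exists>W\<in>penrose_composition_twice l P. p \<in> W"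
  using thin_mate[OF assms(1)]
proof
  assume "thin_at (cnj s) v d"
  from composition_members(1)[OF assms(1) this] show ?thesis using assms(2) by blast
next
  assume t: "turn_at s v d"
  have "p \<in> large2 s v d" using assms(2) second_union[OF sense_cases(2)[OF disjI1[OF assms(1)]]] by blast
  thus ?thesis by (rule large2_covered[OF t])
qed

lemma thick_half_small1:
  assumes "turn_at s (v + k) ((cnj s)\<^sup>2 * k)"
  shows "turn_at (cnj s) (v + k) (s\<^sup>2 * k)" "thick_half s v k = small1 (cnj s) (v + k) (s\<^sup>2 * k)"
proof -
  note s = sense_cases(2)[OF disjI2[OF disjI2[OF assms]]]
  show "turn_at (cnj s) (v + k) (s\<^sup>2 * k)" using turn_at_sym[OF assms] unfolding cnj_cancel[OF s] .
  show "thick_half s v k = small1 (cnj s) (v + k) (s\<^sup>2 * k)"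
    unfolding small1_def thick_half_def cnj_cancel[OF s] by (simp add: add.assoc)
qed

text \<open>Every half rhomb is contained in a triangle of the second composition, and these pair up completely.\<close>

lemma composition_covers: "\<exists>W\<in>penrose_composition_twice l P. p \<in> W"
  using halves_cover[of p]
proof
  assume "\<exists>s v d. thin_at s v d \<and> p \<in> thin_half s v d"
  then obtain s v d where t: "thin_at s v d" "p \<in> thin_half s v d" by blast
  have "p \<in> large1 s v d" using t(2) first_union[OF sense_cases(2)[OF disjI1[OF t(1)]]] by blast
  thus ?thesis by (rule large1_covered[OF t(1)])
next
  assume "\<exists>s v k. thick_at s v k \<and> p \<in> thick_half s v k"
  then obtain s v k where t: "thick_at s v k" "p \<in> thick_half s v k" by blast
  note s = sense_cases(2)[OF disjI2[OF disjI1[OF t(1)]]]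
  from thick_partner[OF t(1)] show ?thesis
  proof
    assume h: "thin_at s v (cnj s * k)"
    have "p \<in> large1 s v (cnj s * k)" using t(2) first_union[OF s, of v "cnj s * k"] unfolding cnj_cancel[OF s] by blast
    thus ?thesis by (rule large1_covered[OF h])
  next
    assume "turn_at s (v + k) ((cnj s)\<^sup>2 * k)"
    note h = thick_half_small1[OF this]
    have "p \<in> large2 (cnj s) (v + k) (s\<^sup>2 * k)"
      using t(2) second_union[OF decagonal_cnj[OF s]] unfolding h(2) by blast
    thus ?thesis by (rule large2_covered[OF h(1)])
  qed
qed

end

section \<open>Tilings with edges along the composition\<close>

lemma boxI: "0 \<le> \<alpha> \<Longrightarrow> \<alpha> \<le> 1 \<Longrightarrow> 0 \<le> \<beta> \<Longrightarrow> \<beta> \<le> 1 \<Longrightarrow> v + (of_real \<alpha> * a + of_real \<beta> * b) \<in> parallelogram v a b"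
  unfolding parallelogram_def by blast

lemma open_boxI: "0 < \<alpha> \<Longrightarrow> \<alpha> < 1 \<Longrightarrow> 0 < \<beta> \<Longrightarrow> \<beta> < 1 \<Longrightarrow> v + (of_real \<alpha> * a + of_real \<beta> * b) \<in> open_parallelogram v a b"
  unfolding open_parallelogram_def by blast

context rhomb_tiling
begin

subsection \<open>Points on edges\<close>

lemma boundary_on_edge:
  assumes "r \<in> P" "p \<in> rhomb_region r" "p \<notin> inner r"
  shows "\<exists>e x y. arrow r e x y \<and> p \<in> closed_segment x y"
proof -
  have key: "(\<exists>e x y. arrow r e x y \<and> p \<in> closed_segment x y)"
    if k: "r = rhomb_at z \<kappa> v u" and \<kappa>: "\<kappa> = kA \<or> \<kappa> = kE" for \<kappa> v u
  proof -
    define w where "w = z ^ width \<kappa> * u"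
    have c: "cross u w \<noteq> 0" unfolding w_def using corner_cross assms(1) k has_corner_def by blast
    obtain \<alpha> \<beta> where p: "p = v + (of_real \<alpha> * u + of_real \<beta> * w)" and ab: "0 \<le> \<alpha>" "\<alpha> \<le> 1" "0 \<le> \<beta>" "\<beta> \<le> 1"
      using assms(2) unfolding k rhomb_region_at parallelogram_def w_def by blast
    have "\<not> (0 < \<alpha> \<and> \<alpha> < 1 \<and> 0 < \<beta> \<and> \<beta> < 1)"
      using assms(3) unfolding k inner_rhomb_at p w_def[symmetric] open_box_iff[OF c] .
    hence edge: "\<alpha> = 0 \<or> \<alpha> = 1 \<or> \<beta> = 0 \<or> \<beta> = 1" using ab by linarith
    have seg: "p \<in> closed_segment (v + (of_real x1 * u + of_real y1 * w)) (v + (of_real x2 * u + of_real y2 * w))"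
      if "0 \<le> t" "t \<le> 1" "\<alpha> = (1 - t) * x1 + t * x2" "\<beta> = (1 - t) * y1 + t * y2" for x1 y1 x2 y2 t
      unfolding p closed_segment_iff[OF c] using that by blast
    have "p \<in> closed_segment v (v + u) \<or> p \<in> closed_segment v (v + w) \<or>
      p \<in> closed_segment (v + u) (v + (u + w)) \<or> p \<in> closed_segment (v + w) (v + (u + w))"
      using edge seg[of \<alpha> 0 1 0 0] seg[of \<beta> 0 0 0 1] seg[of \<beta> 1 1 0 1] seg[of \<alpha> 0 1 1 1] ab by fastforce
    hence seg': "(p \<in> closed_segment v (v + u) \<or> p \<in> closed_segment v (v + w) \<or>
      p \<in> closed_segment (v + u) (v + (u + w)) \<or> p \<in> closed_segment (v + w) (v + (u + w))) \<and>
      (p \<in> closed_segment v (v + u) \<or> p \<in> closed_segment v (v + w) \<or>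
      p \<in> closed_segment (v + (u + w)) (v + u) \<or> p \<in> closed_segment (v + (u + w)) (v + w))"
      using closed_segment_commute by metis
    from \<kappa> show ?thesis
    proof
      assume "\<kappa> = kA"
      hence "arrow r True v (v + u)" "arrow r False v (v + w)" "arrow r True (v + (u + w)) (v + u)" "arrow r False (v + (u + w)) (v + w)"
        by (simp_all add: k w_def arrow_def)
      thus ?thesis using seg' by blast
    next
      assume "\<kappa> = kE"
      hence "arrow r True v (v + u)" "arrow r True v (v + w)" "arrow r False (v + u) (v + (u + w))" "arrow r False (v + w) (v + (u + w))"
        by (simp_all add: k w_def arrow_def)
      thus ?thesis using seg' by blast
    qed
  qed
  from assms(1) show ?thesis
    by (cases rule: rhomb_corner_E) (use key in blast)+
qed

text \<open>The interiors of the rhombs are disjoint open sets covering the complement of the edges.\<close>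

lemma connected_in_one_rhomb:
  assumes "connected K" "K \<noteq> {}"
    and avoid: "\<And>r e x y. r \<in> P \<Longrightarrow> arrow r e x y \<Longrightarrow> K \<inter> closed_segment x y = {}"
  shows "\<exists>r\<in>P. K \<subseteq> inner r"
proof -
  have inner: "\<exists>r\<in>P. p \<in> inner r" if "p \<in> K" for p
  proof -
    obtain r where r: "r \<in> P" "p \<in> rhomb_region r" using cover by blast
    thus ?thesis using boundary_on_edge[OF r] avoid[OF r(1)] that by blast
  qed
  obtain p0 where p0: "p0 \<in> K" using assms(2) by blast
  obtain r0 where r0: "r0 \<in> P" "p0 \<in> inner r0" using inner[OF p0] by blast
  define V where "V = (\<Union>r\<in>P - {r0}. inner r)"
  have "open (inner r0)" "open V" unfolding V_def using open_inner r0 by auto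
  moreover have "inner r0 \<inter> V = {}"
  proof -
    have "r = r0" if "r \<in> P" "p \<in> inner r0" "p \<in> inner r" for r p
      using inner_region_eq[OF r0(1) that(1,2)] inner_subset[OF that(1)] that(3) by blast
    thus ?thesis unfolding V_def by blast
  qed
  moreover have "K \<subseteq> inner r0 \<union> V" using inner unfolding V_def by blast
  ultimately have "inner r0 \<inter> K = {} \<or> V \<inter> K = {}" using connectedD[OF assms(1)] by blast
  hence "V \<inter> K = {}" using p0 r0 by blast
  hence "K \<subseteq> inner r0" using \<open>K \<subseteq> inner r0 \<union> V\<close> by blast
  thus ?thesis using r0 by blast
qed

subsection \<open>The segments that can be edges of the composition\<close>

text \<open>With \<open>C, D\<close> vertices of a thin rhomb and \<open>E, F, G\<close> vertices of the thick rhomb across its edge \<open>CB = EF\<close>, the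
  segments \<open>DG\<close>, which consist of the short diagonal \<open>DB\<close> and the edge \<open>FG\<close>; and the long diagonals \<open>EG\<close> of
  all thick rhombs.\<close>

definition edge_pool :: "complex set set" where
  "edge_pool = {closed_segment (v + d) (v + of_real golden * (z\<^sup>2 * d)) | v d. thin_at z v d} \<union>
     {closed_segment v (v + (k + z\<^sup>2 * k)) | v k. thick_at z v k}"

lemma edge_pool_cases:
  assumes "S \<in> edge_pool" "p \<in> S"
  obtains (short) v d c where "thin_at z v d" "0 \<le> c" "c \<le> 1" "p = v + (of_real (1 - c) * d + of_real c * (z * d))"
  | (side) v d where "thin_at z v d" "p \<in> closed_segment (v + z * d) (v + (z * d + z\<^sup>2 * (z * d)))"
      "v + (z * d + z\<^sup>2 * (z * d)) = v + of_real golden * (z\<^sup>2 * d)"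
  | (long) v k c where "thick_at z v k" "S = closed_segment v (v + (k + z\<^sup>2 * k))" "0 \<le> c" "c \<le> 1"
      "p = v + (of_real c * k + of_real c * (z\<^sup>2 * k))"
proof -
  from assms(1) consider
    v d where "thin_at z v d" "S = closed_segment (v + d) (v + of_real golden * (z\<^sup>2 * d))" |
    v k where "thick_at z v k" "S = closed_segment v (v + (k + z\<^sup>2 * k))"
    unfolding edge_pool_def by blast
  thus ?thesis
  proof cases
    case (1 v d)
    have w: "z * d + z\<^sup>2 * (z * d) = of_real golden * (z\<^sup>2 * d)"
      using sum_side[OF z, of "z * d"] by (simp add: power2_eq_square mult.assoc)
    have "v + z * d \<in> closed_segment (v + d) (v + of_real golden * (z\<^sup>2 * d))"
      unfolding closed_segment_def mem_Collect_eq
      using side_between[OF z, of v d] golden_gt_1 golden_less_2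
      by (intro exI[of _ "2 - golden"]) (simp add: scaleR_conv_of_real)
    hence "S = closed_segment (v + d) (v + z * d) \<union> closed_segment (v + z * d) (v + of_real golden * (z\<^sup>2 * d))"
      unfolding 1(2) by (simp add: Un_closed_segment)
    with assms(2) consider "p \<in> closed_segment (v + d) (v + z * d)" | "p \<in> closed_segment (v + z * d) (v + of_real golden * (z\<^sup>2 * d))" by blast
    thus ?thesis
    proof cases
      case 1
      then obtain c where c: "0 \<le> c" "c \<le> 1" "p = (1 - c) *\<^sub>R (v + d) + c *\<^sub>R (v + z * d)" unfolding closed_segment_def by blast
      have "p = v + (of_real (1 - c) * d + of_real c * (z * d))" unfolding c(3) by (simp add: scaleR_conv_of_real algebra_simps)
      thus ?thesis using short \<open>thin_at z v d\<close> c by blast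
    next
      case 2
      thus ?thesis using side \<open>thin_at z v d\<close> w by metis
    qed
  next
    case (2 v k)
    then obtain c where c: "0 \<le> c" "c \<le> 1" "p = (1 - c) *\<^sub>R v + c *\<^sub>R (v + (k + z\<^sup>2 * k))"
      using assms(2) unfolding closed_segment_def by blast
    have "p = v + (of_real c * k + of_real c * (z\<^sup>2 * k))" unfolding c(3) by (simp add: scaleR_conv_of_real algebra_simps)
    thus ?thesis using long 2 c by blast
  qed
qed

lemma thick_side_edge:
  assumes "thin_at z v d"
  obtains F G H where "Thick v F G H \<in> P" "arrow (Thick v F G H) False (v + z * d) (v + (z * d + z\<^sup>2 * (z * d)))"
proof -
  have "thick_at z v (z * d)" by (rule thin_imp_thick[OF assms])
  then show ?thesis
  proof (rule thick_at_rhomb)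
    fix F G H assume *: "Thick v F G H \<in> P" "G = v + (z * d + z\<^sup>2 * (z * d))" "z = z \<and> F = v + z * d \<or> z = cnj z \<and> H = v + z * d"
    hence "F = v + z * d" using z_neq_cnj by blast
    hence "arrow (Thick v F G H) False (v + z * d) (v + (z * d + z\<^sup>2 * (z * d)))" using * by (simp add: arrow_def)
    thus ?thesis using that * by blast
  qed
qed

lemma closed_segment_in_region: "arrow r e x y \<Longrightarrow> closed_segment x y \<subseteq> rhomb_region r"
  unfolding rhomb_region_def segment_convex_hull using arrow_vertices by (intro hull_mono) blast

lemma open_thin_half_avoids_pool:
  assumes "thin_at s v d" "p \<in> open_triangle v (s * d) d" "S \<in> edge_pool"
  shows "p \<notin> S"
proof
  assume "p \<in> S"
  obtain \<alpha> \<beta> where p: "p = v + (of_real \<alpha> * (s * d) + of_real \<beta> * d)" and ab: "0 < \<alpha>" "0 < \<beta>" "\<alpha> + \<beta> < 1"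
    using assms(2) unfolding open_triangle_def by blast
  obtain A B C D where r: "Thin A B C D \<in> P" "inner (Thin A B C D) = open_parallelogram v d (s * d)" "B = v + s * d" "D = v + d"
    using assms(1) by (rule thin_at_rhomb)
  have p2: "p = v + (of_real \<beta> * d + of_real \<alpha> * (s * d))" by (simp add: p)
  have inn: "p \<in> inner (Thin A B C D)" unfolding r(2) p2 by (rule open_boxI) (use ab in auto)
  note same = inner_region_eq[OF r(1) _ inn]
  from assms(3) \<open>p \<in> S\<close> show False
  proof (cases rule: edge_pool_cases)
    case (short v' d' c)
    obtain A' B' C' D' where r': "Thin A' B' C' D' \<in> P" "rhomb_region (Thin A' B' C' D') = parallelogram v' d' (z * d')" "B' = v' + z * d'" "D' = v' + d'"
      using short(1) by (rule thin_at_rhomb)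
    have "p \<in> rhomb_region (Thin A' B' C' D')" unfolding r'(2) short(4) by (rule boxI) (use short(2,3) in auto)
    from same[OF r'(1) this] have eq: "v' + d' = v + d" "v' + z * d' = v + s * d" using r r' by simp_all
    have "p = of_real (1 - c) * (v' + d') + of_real c * (v' + z * d')" unfolding short(4) by (simp add: algebra_simps)
    also have "\<dots> = v + (of_real c * (s * d) + of_real (1 - c) * d)" unfolding eq by (simp add: algebra_simps)
    finally have "of_real \<alpha> * (s * d) + of_real \<beta> * d = of_real c * (s * d) + of_real (1 - c) * d" unfolding p by simp
    moreover have "cross (s * d) d \<noteq> 0"
      using cross_pos_form[OF sense_cases(2)[OF disjI1[OF assms(1)]]] thin_at_norm[OF assms(1)] by simp
    ultimately have "\<alpha> = c \<and> \<beta> = 1 - c" by (rule coordinates_unique[rotated])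
    thus False using ab by simp
  next
    case (side v' d')
    obtain F G H where t: "Thick v' F G H \<in> P" "arrow (Thick v' F G H) False (v' + z * d') (v' + (z * d' + z\<^sup>2 * (z * d')))"
      using side(1) by (rule thick_side_edge)
    have "p \<in> rhomb_region (Thick v' F G H)" using closed_segment_in_region[OF t(2)] side(2) by blast
    from same[OF t(1) this] show False by simp
  next
    case (long v' k c)
    obtain F G H where t: "Thick v' F G H \<in> P" "rhomb_region (Thick v' F G H) = parallelogram v' k (z\<^sup>2 * k)"
      using long(1) by (rule thick_at_rhomb)
    have "p \<in> rhomb_region (Thick v' F G H)" unfolding t(2) parallelogram_def long(5) using long(3,4) by blast
    from same[OF t(1) this] show False by simp
  qed
qed

lemma pool_point_in_thick:
  assumes "thick_at s v k" "p = v + (of_real a * k + of_real b * (s\<^sup>2 * k))" "0 < a" "a < 1" "0 < b" "b < 1"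
    "S \<in> edge_pool" "p \<in> S"
  shows "a = b \<and> S = closed_segment v (v + (k + s\<^sup>2 * k))"
proof -
  obtain F G H where r: "Thick v F G H \<in> P" "inner (Thick v F G H) = open_parallelogram v k (s\<^sup>2 * k)" "G = v + (k + s\<^sup>2 * k)"
    using assms(1) by (rule thick_at_rhomb)
  have inn: "p \<in> inner (Thick v F G H)" unfolding r(2) open_parallelogram_def assms(2) using assms(3-6) by blast
  note same = inner_region_eq[OF r(1) _ inn]
  from assms(7,8) show ?thesis
  proof (cases rule: edge_pool_cases)
    case (short v' d' c)
    obtain A' B' C' D' where r': "Thin A' B' C' D' \<in> P" "rhomb_region (Thin A' B' C' D') = parallelogram v' d' (z * d')"
      using short(1) by (rule thin_at_rhomb)
    have "p \<in> rhomb_region (Thin A' B' C' D')" unfolding r'(2) short(4) by (rule boxI) (use short(2,3) in auto)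
    from same[OF r'(1) this] show ?thesis by simp
  next
    case (side v' d')
    obtain F' G' H' where t: "Thick v' F' G' H' \<in> P" "arrow (Thick v' F' G' H') False (v' + z * d') (v' + (z * d' + z\<^sup>2 * (z * d')))"
      using side(1) by (rule thick_side_edge)
    have "p \<in> rhomb_region (Thick v' F' G' H')" using closed_segment_in_region[OF t(2)] side(2) by blast
    from same[OF t(1) this] have "p \<notin> inner (Thick v F G H)" using edge_point_not_inner[OF t side(2)] by simp
    thus ?thesis using inn by blast
  next
    case (long v' k' c)
    obtain F' G' H' where t: "Thick v' F' G' H' \<in> P" "rhomb_region (Thick v' F' G' H') = parallelogram v' k' (z\<^sup>2 * k')" "G' = v' + (k' + z\<^sup>2 * k')"
      using long(1) by (rule thick_at_rhomb)
    have "p \<in> rhomb_region (Thick v' F' G' H')" unfolding t(2) parallelogram_def long(5) using long(3,4) by blast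
    from same[OF t(1) this] have eq: "v' = v" "k' + z\<^sup>2 * k' = k + s\<^sup>2 * k" using r(3) t(3) by auto
    have "p = v' + of_real c * (k' + z\<^sup>2 * k')" unfolding long(5) by (simp add: distrib_left)
    also have "\<dots> = v + (of_real c * k + of_real c * (s\<^sup>2 * k))" unfolding eq by (simp add: distrib_left)
    finally have "of_real a * k + of_real b * (s\<^sup>2 * k) = of_real c * k + of_real c * (s\<^sup>2 * k)" unfolding assms(2) by simp
    moreover have "cross k (s\<^sup>2 * k) \<noteq> 0"
      using cross_pos_form[OF sense_cases(2)[OF disjI2[OF disjI1[OF assms(1)]]]] thick_at_norm[OF assms(1)] golden_gt_1 by simp
    ultimately have "a = c \<and> b = c" by (rule coordinates_unique[rotated])
    thus ?thesis unfolding long(2) eq by simp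
  qed
qed

lemma open_thick_half_avoids_pool:
  assumes "thick_at s v k" "p \<in> open_triangle v k (k + s\<^sup>2 * k)" "S \<in> edge_pool"
  shows "p \<notin> S"
proof
  assume "p \<in> S"
  obtain \<alpha> \<beta> where p: "p = v + (of_real \<alpha> * k + of_real \<beta> * (k + s\<^sup>2 * k))" and ab: "0 < \<alpha>" "0 < \<beta>" "\<alpha> + \<beta> < 1"
    using assms(2) unfolding open_triangle_def by blast
  have "p = v + (of_real (\<alpha> + \<beta>) * k + of_real \<beta> * (s\<^sup>2 * k))" unfolding p by (simp add: algebra_simps)
  from pool_point_in_thick[OF assms(1) this _ _ _ _ assms(3) \<open>p \<in> S\<close>] show False using ab by simp
qed

text \<open>The only edges that run along a segment of the pool are the edges \<open>FG\<close> of thick rhombs with a thin rhomb across \<open>EF\<close>.\<close>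

lemma midpoint_in_pool:
  assumes "r \<in> P" "arrow r e x y" "S \<in> edge_pool" "midpoint x y \<in> S"
  shows "\<not> e \<and> (\<exists>v d. thin_at z v d \<and> x = v + z * d \<and> y = v + (z * d + z\<^sup>2 * (z * d)))"
  using assms(3,4)
proof (cases rule: edge_pool_cases)
  case (short v d c)
  have mem: "midpoint x y \<in> closed_segment x y" by simp
  obtain A B C D where t: "Thin A B C D \<in> P" "rhomb_region (Thin A B C D) = parallelogram v d (z * d)"
    "inner (Thin A B C D) = open_parallelogram v d (z * d)" "B = v + z * d" "D = v + d"
    using short(1) by (rule thin_at_rhomb)
  have "midpoint x y \<in> rhomb_region (Thin A B C D)" unfolding t(2) short(4) by (rule boxI) (use short(2,3) in auto)
  hence a: "arrow (Thin A B C D) e x y" by (rule midpoint_arrow[OF assms(1) t(1) assms(2)])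
  have "c \<noteq> 0" using midpoint_not_vertex[OF t(1) a] short(4) t(5) by auto
  moreover have "c \<noteq> 1" using midpoint_not_vertex[OF t(1) a] short(4) t(4) by auto
  ultimately have c: "0 < c" "c < 1" using short(2,3) by simp_all
  have "midpoint x y \<in> inner (Thin A B C D)" unfolding t(3) short(4) by (rule open_boxI) (use c in auto)
  thus ?thesis using edge_point_not_inner[OF t(1) a mem] by blast
next
  case (side v d)
  obtain F G H where t: "Thick v F G H \<in> P" "arrow (Thick v F G H) False (v + z * d) (v + (z * d + z\<^sup>2 * (z * d)))"
    using side(1) by (rule thick_side_edge)
  from midpoint_edge_unique[OF assms(1) t(1) assms(2) t(2) side(2)] show ?thesis using side(1) by blast
next
  case (long v k c)
  have mem: "midpoint x y \<in> closed_segment x y" by simp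
  obtain F G H where t: "Thick v F G H \<in> P" "rhomb_region (Thick v F G H) = parallelogram v k (z\<^sup>2 * k)"
    "inner (Thick v F G H) = open_parallelogram v k (z\<^sup>2 * k)" "G = v + (k + z\<^sup>2 * k)"
    using long(1) by (rule thick_at_rhomb)
  have "midpoint x y \<in> rhomb_region (Thick v F G H)" unfolding t(2) parallelogram_def long(5) using long(3,4) by blast
  hence a: "arrow (Thick v F G H) e x y" by (rule midpoint_arrow[OF assms(1) t(1) assms(2)])
  have "c \<noteq> 0" using midpoint_not_vertex[OF t(1) a] long(5) by auto
  moreover have "c \<noteq> 1" using midpoint_not_vertex[OF t(1) a] long(5) t(4) by auto
  ultimately have c: "0 < c" "c < 1" using long(3,4) by simp_all
  have "midpoint x y \<in> inner (Thick v F G H)" unfolding t(3) open_parallelogram_def long(5) using c by blast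
  thus ?thesis using edge_point_not_inner[OF t(1) a mem] by blast
qed

text \<open>If \<open>d\<close> were an edge \<open>FG\<close> with a thin rhomb across \<open>EF\<close>, its other side would belong to the thin rhomb at hand, so
  that \<open>F\<close> would be a full turn; but there the rhomb across \<open>EF\<close> is thick.\<close>

lemma base_midpoint_avoids_pool:
  assumes "thin_at s v d" "S \<in> edge_pool"
  shows "midpoint v (v + d) \<notin> S"
proof
  assume m: "midpoint v (v + d) \<in> S"
  obtain r where r: "r \<in> P" "arrow r False v (v + d)" using thin_at_arrows[OF assms(1)] by blast
  obtain w k0 where w: "thin_at z w k0" "v = w + z * k0" "v + d = w + (z * k0 + z\<^sup>2 * (z * k0))"
    using midpoint_in_pool[OF r assms(2) m] by blast
  define k where "k = z * k0"
  have d: "d = z\<^sup>2 * k" using w(2,3) by (simp add: k_def)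
  have k0: "k0 = cnj z * k" unfolding k_def by (rule cnj_cancel(1)[OF z, symmetric])
  have "has_corner kE w k" using thin_imp_thick[OF w(1)] unfolding thick_at_z k_def .
  hence F: "has_corner kF v d" unfolding w(2) d k_def by (simp only: corner_shift(5))
  have no_C: "\<not> thin_at z v d"
  proof
    assume "thin_at z v d"
    hence C: "has_corner kC v d" unfolding thin_at_z .
    from common_sector(1)[OF C F, of 0 0] show False by simp
  qed
  hence s: "s = cnj z" using sense_cases(1)[OF disjI1[OF assms(1)]] assms(1) by blast
  have "\<not> thin_at (cnj s) v d" using no_C unfolding s by simp
  hence "turn_at s v d" using thin_mate[OF assms(1)] by blast
  hence "turn_at z v ((cnj z) ^ 4 * d)" using turn_at_sym unfolding s by force
  moreover have "(cnj z) ^ 4 * d = (cnj z)\<^sup>2 * k" unfolding d pow_identities z_pow_mult by simp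
  moreover have "v = w + k" unfolding w(2) k_def ..
  ultimately have "turn_at z (w + k) ((cnj z)\<^sup>2 * k)" by simp
  thus False using thick_partner_no_turn w(1) unfolding k0 by blast
qed

text \<open>The segments \<open>DG\<close> end at corners \<open>D\<close> and \<open>G\<close>, the segments \<open>EG\<close> at corners \<open>E\<close> and \<open>G\<close>. Of these only a corner \<open>E\<close>
  occurs at a full turn, and it has the diagonal direction \<open>z\<^sup>2 * d\<close>.\<close>

lemma pool_segment_at_full_turn:
  assumes ft: "full_turn v d" and S: "closed_segment v (v + of_real golden * (z ^ n * d)) \<in> edge_pool"
  shows "n mod 10 = 2"
proof -
  have g0: "complex_of_real golden \<noteq> 0" using golden_gt_1 by simp
  have no: "(\<kappa>, q mod 10) \<in> {(kC, 0), (kE, 1), (kA, 3), (kF, 4), (kH, 7)}" if "has_corner \<kappa> v (z ^ q * d)" for \<kappa> q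
    by (rule full_turn_corners[OF ft that])
  from S consider
    v' d' where "thin_at z v' d'" "closed_segment v (v + of_real golden * (z ^ n * d)) = closed_segment (v' + d') (v' + of_real golden * (z\<^sup>2 * d'))" |
    v' k where "thick_at z v' k" "closed_segment v (v + of_real golden * (z ^ n * d)) = closed_segment v' (v' + (k + z\<^sup>2 * k))"
    unfolding edge_pool_def by blast
  thus ?thesis
  proof cases
    case (1 v' d')
    have diff: "(v' + of_real golden * (z\<^sup>2 * d')) - (v' + d') = of_real golden * (z ^ 3 * d')" using golden_side[OF z] by simp
    have C: "has_corner kC v' d'" using 1(1) unfolding thin_at_z .
    from 1(2) consider "v = v' + d'" "v + of_real golden * (z ^ n * d) = v' + of_real golden * (z\<^sup>2 * d')" |
      "v = v' + of_real golden * (z\<^sup>2 * d')" "v + of_real golden * (z ^ n * d) = v' + d'"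
      unfolding closed_segment_eq doubleton_eq_iff by blast
    thus ?thesis
    proof cases
      case 1
      hence "of_real golden * (z ^ n * d) = of_real golden * (z ^ 3 * d')" using diff by (simp add: algebra_simps)
      hence "z ^ n * d = z ^ 3 * d'" using g0 by simp
      hence "z ^ 8 * (z ^ n * d) = z ^ 8 * (z ^ 3 * d')" by simp
      hence "z * d' = z ^ ((8 + n) mod 10) * d" unfolding z_pow_mult by simp
      moreover have "has_corner kD v (z * d')" using C unfolding 1(1) corner_shift(4) .
      ultimately show ?thesis using no by fastforce
    next
      case 2
      have "of_real golden * (z ^ n * d) = (v + of_real golden * (z ^ n * d)) - v" by simp
      also have "\<dots> = - ((v' + of_real golden * (z\<^sup>2 * d')) - (v' + d'))" unfolding 2(2) unfolding 2(1) by simp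
      finally have "of_real golden * (z ^ n * d) = - (of_real golden * (z ^ 3 * d'))" unfolding diff .
      hence "z ^ n * d = - (z ^ 3 * d')" using g0 by (metis mult_cancel_left mult_minus_right)
      hence "z ^ n * d = z ^ 5 * (z ^ 3 * d')" unfolding z_pow_6_7(1) .
      hence "z ^ 8 * (z ^ n * d) = z ^ 8 * (z ^ 5 * (z ^ 3 * d'))" by simp
      hence e: "z ^ 5 * (z * d') = z ^ ((8 + n) mod 10) * d" unfolding z_pow_mult using z_pow_mult(2)[of 0 d'] z_pow_mult(1)[of 5 1 d'] by simp
      have "has_corner kE v' (z * d')" by (rule after_C[OF C])
      hence "has_corner kG (v' + (z * d' + z\<^sup>2 * (z * d'))) (z ^ 5 * (z * d'))" unfolding corner_shift(6) .
      moreover have "v' + (z * d' + z\<^sup>2 * (z * d')) = v"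
        using sum_side[OF z, of "z * d'"] 2(1) by (simp add: power2_eq_square mult.assoc)
      ultimately have "has_corner kG v (z ^ ((8 + n) mod 10) * d)" unfolding e by simp
      thus ?thesis using no by fastforce
    qed
  next
    case (2 v' k)
    have E: "has_corner kE v' k" using 2(1) unfolding thick_at_z .
    have g: "k + z\<^sup>2 * k = of_real golden * (z * k)" by (rule sum_side[OF z])
    from 2(2) consider "v = v'" "v + of_real golden * (z ^ n * d) = v' + (k + z\<^sup>2 * k)" |
      "v = v' + (k + z\<^sup>2 * k)" "v + of_real golden * (z ^ n * d) = v'"
      unfolding closed_segment_eq doubleton_eq_iff by blast
    thus ?thesis
    proof cases
      case 1
      hence "z ^ n * d = z * k" unfolding g using g0 by simp
      hence "z ^ 9 * (z ^ n * d) = z ^ 9 * (z ^ 1 * k)" by simp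
      hence "k = z ^ ((9 + n) mod 10) * d" unfolding z_pow_mult by simp
      hence "has_corner kE v (z ^ ((9 + n) mod 10) * d)" using E 1(1) by simp
      from no[OF this] have "(9 + n) mod 10 = 1" by simp
      thus ?thesis by presburger
    next
      case 2
      hence "of_real golden * (z ^ n * d) = - (of_real golden * (z * k))" unfolding g by (simp add: add_eq_0_iff)
      hence "z ^ n * d = - (z * k)" using g0 by (metis mult_cancel_left mult_minus_right)
      hence "z ^ n * d = z ^ 5 * (z ^ 1 * k)" unfolding z_pow_6_7(1) by simp
      hence "z ^ 9 * (z ^ n * d) = z ^ 9 * (z ^ 5 * (z ^ 1 * k))" by simp
      hence e: "z ^ 5 * k = z ^ ((9 + n) mod 10) * d" unfolding z_pow_mult by simp
      have "has_corner kG v (z ^ 5 * k)" using E unfolding 2(1) corner_shift(6) .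
      thus ?thesis unfolding e using no by fastforce
    qed
  qed
qed

end

context rhomb_tiling
begin

text \<open>A rhomb with an edge from \<open>v\<close> has a second edge at \<open>v\<close> in another direction, which would be a second segment of
  the pool ending at \<open>v\<close>.\<close>

lemma finer_edge_at_full_turn:
  assumes R: "rhomb_tiling R y L"
    and edges: "\<And>r e a b. r \<in> R \<Longrightarrow> arrow r e a b \<Longrightarrow> closed_segment a b \<in> edge_pool"
    and ft: "full_turn v d" and r: "r \<in> R" "arrow r e a b"
  shows "closed_segment a b \<noteq> closed_segment v (v + of_real golden * (z\<^sup>2 * d))"
proof
  interpret R: rhomb_tiling R y L by (rule R)
  define w where "w = of_real golden * (z\<^sup>2 * d)"
  assume "closed_segment a b = closed_segment v (v + of_real golden * (z\<^sup>2 * d))"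
  hence "{a, b} = {v, v + w}" unfolding closed_segment_eq w_def .
  hence "directed_arrow r (e, True) v (v + w) \<or> directed_arrow r (e, False) v (v + w)"
    using r(2) by (auto simp: directed_arrow_def doubleton_eq_iff)
  then obtain e' where "directed_arrow r e' v (v + w)" by blast
  then obtain \<kappa> u where k: "r = rhomb_at y \<kappa> v u" "R.has_corner \<kappa> v u" and
    w: "v + w = v + u \<or> v + w = v + y ^ width \<kappa> * u"
    using R.directed_arrow_corner[OF r(1)] by blast
  have pool: "closed_segment v x \<in> edge_pool" if "directed_arrow r e'' v x" for e'' x
    using edges[OF r(1)] that closed_segment_commute[of v x] unfolding directed_arrow_def by (metis (full_types))
  have y10: "y ^ (10 - width \<kappa>) * (y ^ width \<kappa> * u) = u"
    using z_pow10[OF R.z] width_bounds[of \<kappa>] by (simp flip: mult.assoc power_add)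
  obtain q where q: "1 \<le> q" "q \<le> 9" "closed_segment v (v + y ^ q * w) \<in> edge_pool"
  proof -
    from w show thesis
    proof
      assume "v + w = v + u"
      hence "closed_segment v (v + y ^ width \<kappa> * w) \<in> edge_pool"
        using pool directed_arrow_last[of y \<kappa> v u] unfolding k(1) by simp
      thus thesis using that width_bounds[of \<kappa>] by simp
    next
      assume "v + w = v + y ^ width \<kappa> * u"
      hence "y ^ (10 - width \<kappa>) * w = u" using y10 by simp
      hence "closed_segment v (v + y ^ (10 - width \<kappa>) * w) \<in> edge_pool"
        using pool directed_arrow_first[of y \<kappa> v u] unfolding k(1) by simp
      thus thesis using that[of "10 - width \<kappa>"] width_bounds[of \<kappa>] by simp
    qed
  qed
  have "y = z \<or> y = cnj z" using z R.z by (auto simp: decagonal_def cis_cnj)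
  then obtain m where m: "y ^ q = z ^ m" using cnj_z_pow by blast
  have "z ^ m \<noteq> 1" using z_pow_eq_1[OF R.z, of q] q m by auto
  have e: "y ^ q * w = of_real golden * (z ^ ((m + 2) mod 10) * d)"
    unfolding m w_def z_pow_mult(1)[symmetric] by (rule mult.left_commute)
  have "(m + 2) mod 10 mod 10 = 2" by (rule pool_segment_at_full_turn[OF ft q(3)[unfolded e]])
  hence "(m + 2) mod 10 = 2" by simp
  hence m0: "m mod 10 = 0" by presburger
  have "z ^ m = z ^ (m mod 10)" by (simp only: z_pow_mod[OF z])
  also have "\<dots> = 1" unfolding m0 by simp
  finally have "z ^ m = 1" .
  thus False using \<open>z ^ m \<noteq> 1\<close> by contradiction
qed

text \<open>The open half rhombs avoid the segments of the pool, and so do the midpoints of the segments along which the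
  halves are glued, except for the long diagonal in the middle of a composed thick rhomb; this diagonal is
  no edge of \<open>R\<close>, because it ends at a full turn. So every composed rhomb is contained in one rhomb of \<open>R\<close>,
  and it fills it since the sides have the same length. Conversely, the centre of a rhomb of \<open>R\<close> lies in a
  composed rhomb, which is then this rhomb.\<close>

lemma composition_of_coarser_tiling:
  assumes R: "rhomb_tiling R y (l * golden)"
    and edges: "\<And>r e a b. r \<in> R \<Longrightarrow> arrow r e a b \<Longrightarrow> closed_segment a b \<in> edge_pool"
  shows "penrose_composition_twice l P = rhomb_region ` R"
proof -
  interpret R: rhomb_tiling R y "l * golden" by (rule R)
  let ?E = "\<lambda>p. \<exists>r\<in>R. \<exists>e a b. arrow r e a b \<and> p \<in> closed_segment a b"
  have pool: "\<exists>S\<in>edge_pool. p \<in> S" if "?E p" for p using that edges by blast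
  have triangle: "\<exists>r\<in>R. convex hull {v, v + a, v + b} \<subseteq> rhomb_region r"
    if "\<And>p S. p \<in> open_triangle v a b \<Longrightarrow> S \<in> edge_pool \<Longrightarrow> p \<notin> S" for v a b
  proof -
    have "0 < (1/3 :: real)" "(1/3 :: real) + 1/3 < 1" by simp_all
    hence "v + (of_real (1/3) * a + of_real (1/3) * b) \<in> open_triangle v a b"
      unfolding open_triangle_def by blast
    hence ne: "open_triangle v a b \<noteq> {}" by blast
    have "\<exists>r\<in>R. open_triangle v a b \<subseteq> inner r"
    proof (rule R.connected_in_one_rhomb[OF convex_connected[OF convex_open_triangle] ne])
      fix r e x y assume "r \<in> R" "arrow r e x y"
      hence "closed_segment x y \<in> edge_pool" by (rule edges)
      thus "open_triangle v a b \<inter> closed_segment x y = {}" using that by blast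
    qed
    then obtain r where r: "r \<in> R" "open_triangle v a b \<subseteq> inner r" by blast
    have "closure (open_triangle v a b) \<subseteq> rhomb_region r"
      using r R.inner_subset[OF r(1)] R.closed_region by (intro closure_minimal) auto
    thus ?thesis using triangle_subset_closure r(1) by blast
  qed
  have thin: "\<exists>r\<in>R. thin_half s v d \<subseteq> rhomb_region r" if "thin_at s v d" for s v d
    unfolding thin_half_def by (rule triangle) (rule open_thin_half_avoids_pool[OF that])
  have thick: "\<exists>r\<in>R. thick_half s v k \<subseteq> rhomb_region r" if "thick_at s v k" for s v k
    unfolding thick_half_def by (rule triangle) (rule open_thick_half_avoids_pool[OF that])
  have glue: "\<exists>r\<in>R. X \<union> Y \<subseteq> rhomb_region r"
    if X: "\<exists>r\<in>R. X \<subseteq> rhomb_region r" and Y: "\<exists>r\<in>R. Y \<subseteq> rhomb_region r" and m: "m \<in> X" "m \<in> Y" "\<not> ?E m" for X Y m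
  proof -
    obtain r1 r2 where r: "r1 \<in> R" "X \<subseteq> rhomb_region r1" "r2 \<in> R" "Y \<subseteq> rhomb_region r2" using X Y by blast
    have "m \<in> inner r1" using R.boundary_on_edge[OF r(1)] r(1,2) m by blast
    hence "r1 = r2" using R.inner_region_eq[OF r(1,3)] r(4) m(2) by blast
    thus ?thesis using r by blast
  qed
  have l1: "\<exists>r\<in>R. large1 s v d \<subseteq> rhomb_region r" if t: "thin_at s v d" for s v d
  proof -
    note s = sense_cases(2)[OF disjI1[OF t]]
    obtain r where r: "r \<in> P" "arrow r True v (v + s * d)" using thin_at_arrows[OF t] by blast
    have "midpoint v (v + s * d) \<in> thin_half s v d \<inter> thick_half s v (s * d)"
      unfolding first_Int[OF s thin_at_norm[OF t, THEN conjunct2]] by simp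
    moreover have "\<not> ?E (midpoint v (v + s * d))" using pool midpoint_in_pool[OF r] by blast
    ultimately show ?thesis unfolding first_union[OF s, symmetric]
      by (intro glue[OF thin[OF t] thick[OF thin_imp_thick[OF t]]]) auto
  qed
  have base: "\<not> ?E (midpoint v (v + d))" if "thin_at s v d" for s v d
    using pool base_midpoint_avoids_pool[OF that] by blast
  have l2: "\<exists>r\<in>R. large2 s v d \<subseteq> rhomb_region r" if t: "turn_at s v d" for s v d
  proof -
    note s = sense_cases(2)[OF disjI2[OF disjI2[OF t]]]
    note td = turn_imp(1)[OF t]
    have "thick_half (cnj s) (v - s\<^sup>2 * d) (s\<^sup>2 * d) = small1 s v d"
      unfolding small1_def thick_half_def cnj_cancel[OF s] by simp
    hence sm: "\<exists>r\<in>R. small1 s v d \<subseteq> rhomb_region r" using thick[OF turn_imp(2)[OF t]] by simp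
    have "midpoint v (v + d) \<in> small1 s v d \<inter> large1 s v d"
      unfolding second_Int[OF s thin_at_norm[OF td, THEN conjunct2]] by simp
    thus ?thesis unfolding second_union[OF s, symmetric]
      by (intro glue[OF sm l1[OF td] _ _ base[OF td]]) auto
  qed
  have centre: "\<not> ?E (v + of_real (1/2) * (of_real golden * (s\<^sup>2 * d)))" if t: "turn_at s v d" for s v d
  proof
    note s = sense_cases(2)[OF disjI2[OF disjI2[OF t]]]
    define w where "w = of_real golden * (s\<^sup>2 * d)"
    have sw: "s * d + s\<^sup>2 * (s * d) = w"
      using sum_side[OF s, of "s * d"] by (simp add: w_def power2_eq_square mult.assoc)
    assume "?E (v + of_real (1/2) * (of_real golden * (s\<^sup>2 * d)))"
    then obtain r e a b where r: "r \<in> R" "arrow r e a b" "v + of_real (1/2) * w \<in> closed_segment a b" unfolding w_def by blast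
    have "v + of_real (1/2) * w = v + (of_real (1/2) * (s * d) + of_real (1/2) * (s\<^sup>2 * (s * d)))"
      unfolding sw[symmetric] by (simp add: distrib_left)
    from pool_point_in_thick[OF thin_imp_thick[OF turn_imp(1)[OF t]] this _ _ _ _ edges[OF r(1,2)] r(3)]
    have eq: "closed_segment a b = closed_segment v (v + w)" unfolding sw by simp
    have "\<exists>d'. full_turn v d' \<and> w = of_real golden * (z\<^sup>2 * d')"
      using sense_cases(1)[OF disjI2[OF disjI2[OF t]]]
    proof
      assume "s = z" thus ?thesis using t unfolding w_def by (auto simp: turn_at_z)
    next
      assume s: "s = cnj z"
      have "full_turn v (z ^ 6 * d)" using t unfolding s turn_at_cnj .
      moreover have "s\<^sup>2 * d = z\<^sup>2 * (z ^ 6 * d)" unfolding s pow_identities z_pow_mult by simp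
      ultimately show ?thesis unfolding w_def by metis
    qed
    then obtain d' where d': "full_turn v d'" "w = of_real golden * (z\<^sup>2 * d')" by blast
    have "closed_segment a b \<noteq> closed_segment v (v + of_real golden * (z\<^sup>2 * d'))"
      by (rule finer_edge_at_full_turn[OF R _ d'(1) r(1,2)]) (rule edges)
    thus False using eq unfolding d'(2) by contradiction
  qed
  have rhomb: "W \<in> rhomb_region ` R"
    if W: "\<exists>r\<in>R. W \<subseteq> rhomb_region r" "W = parallelogram p a b" "norm a = l * golden" "norm b = l * golden" for W p a b
  proof -
    obtain r where r: "r \<in> R" "W \<subseteq> rhomb_region r" using W(1) by blast
    obtain \<kappa> q u where k: "r = rhomb_at y \<kappa> q u" using r(1) by (meson R.rhomb_corner_E)
    have c: "R.has_corner \<kappa> q u" using r(1) unfolding k R.has_corner_def .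
    have u: "norm u = l * golden" by (rule R.corner_length[OF c])
    have "norm (y ^ width \<kappa> * u) = l * golden" using norm_pow_mult[OF R.z] u by simp
    hence "parallelogram p a b = parallelogram q u (y ^ width \<kappa> * u)"
      using r(2) W(2-4) u R.corner_cross[OF c] unfolding k rhomb_region_at by (intro rhomb_in_rhomb) auto
    hence "W = rhomb_region r" unfolding W(2) k rhomb_region_at .
    thus ?thesis using r(1) by blast
  qed
  have sub: "W \<in> rhomb_region ` R" if "W \<in> penrose_composition_twice l P" for W
  proof -
    from that consider
      s v d where "W = large1 s v d \<union> large1 (cnj s) v d" "thin_at s v d" "thin_at (cnj s) v d" |
      s v d where "W = large2 s v d \<union> large2 (cnj s) v (s ^ 4 * d)" "turn_at s v d"
      unfolding penrose_composition_twice_eq by blast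
    thus ?thesis
    proof cases
      case (1 s v d)
      note s = sense_cases(2)[OF disjI1[OF 1(2)]]
      have "midpoint v (v + d) \<in> large1 s v d \<inter> large1 (cnj s) v d"
        unfolding thin_base_Int[OF s thin_at_norm[OF 1(2), THEN conjunct2]] by simp
      hence "\<exists>r\<in>R. W \<subseteq> rhomb_region r" unfolding 1(1)
        by (intro glue[OF l1[OF 1(2)] l1[OF 1(3)] _ _ base[OF 1(2)]]) auto
      moreover have "norm (of_real golden * (s\<^sup>2 * d)) = l * golden" "norm (of_real golden * ((cnj s)\<^sup>2 * d)) = l * golden"
        unfolding norm_mult[of "of_real golden"] norm_pow_mult[OF s] norm_pow_mult[OF decagonal_cnj[OF s]]
        using thin_at_norm[OF 1(2)] golden_gt_1 by simp_all
      ultimately show ?thesis using rhomb[OF _ trans[OF 1(1) large1_pair_box[OF s]]] by blast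
    next
      case (2 s v d)
      note s = sense_cases(2)[OF disjI2[OF disjI2[OF 2(2)]]]
      have n: "norm d = l" "d \<noteq> 0" using thin_at_norm[OF turn_imp(1)[OF 2(2)]] by blast+
      define m where "m = v + of_real (1/2) * (of_real golden * (s\<^sup>2 * d))"
      have "m \<in> closed_segment v (v + of_real golden * (s\<^sup>2 * d))"
        unfolding m_def closed_segment_def mem_Collect_eq
        by (intro exI[of _ "1/2"]) (simp add: scaleR_conv_of_real algebra_simps)
      moreover have "v \<in> closed_segment (v - s\<^sup>2 * d) (v + of_real golden * (s\<^sup>2 * d))"
      proof -
        have "v = (1 - (2 - golden)) *\<^sub>R (v - s\<^sup>2 * d) + (2 - golden) *\<^sub>R (v + of_real golden * (s\<^sup>2 * d))"
        proof -
          have "(1 - (2 - golden)) *\<^sub>R (v - s\<^sup>2 * d) + (2 - golden) *\<^sub>R (v + of_real golden * (s\<^sup>2 * d)) =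
            v + ((2 - of_real golden) * (of_real golden * (s\<^sup>2 * d)) - (of_real golden - 1) * (s\<^sup>2 * d))"
            by (simp add: scaleR_conv_of_real algebra_simps)
          thus ?thesis unfolding golden_complex_reciprocal by simp
        qed
        moreover have "0 \<le> 2 - golden" "2 - golden \<le> 1" using golden_gt_1 golden_less_2 by simp_all
        ultimately show ?thesis unfolding closed_segment_def by blast
      qed
      hence "closed_segment v (v + of_real golden * (s\<^sup>2 * d)) \<subseteq> closed_segment (v - s\<^sup>2 * d) (v + of_real golden * (s\<^sup>2 * d))"
        by (simp add: subset_closed_segment)
      ultimately have "m \<in> large2 s v d \<inter> large2 (cnj s) v (s ^ 4 * d)"
        unfolding thick_base_Int[OF s n(2)] by blast
      hence "\<exists>r\<in>R. W \<subseteq> rhomb_region r" unfolding 2(1)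
        using centre[OF 2(2)] by (intro glue[OF l2[OF 2(2)] l2[OF turn_at_sym[OF 2(2)]], of m]) (auto simp: m_def)
      moreover have "norm (of_real golden * (s ^ n * d)) = l * golden" for n
        unfolding norm_mult[of "of_real golden"] norm_pow_mult[OF s] using n golden_gt_1 by simp
      from this[of 1] this[of 3] have "norm (of_real golden * (s * d)) = l * golden" "norm (of_real golden * (s ^ 3 * d)) = l * golden"
        by simp_all
      ultimately show ?thesis using rhomb[OF _ trans[OF 2(1) large2_pair_box[OF s]]] by blast
    qed
  qed
  moreover have "rhomb_region r \<in> penrose_composition_twice l P" if rR: "r \<in> R" for r
  proof -
    obtain \<kappa> q u where k: "r = rhomb_at y \<kappa> q u" using rR by (meson R.rhomb_corner_E)
    have c: "R.has_corner \<kappa> q u" using rR unfolding k R.has_corner_def .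
    define p where "p = q + (of_real (1/2) * u + of_real (1/2) * (y ^ width \<kappa> * u))"
    have p: "p \<in> inner r" unfolding k inner_rhomb_at p_def by (rule open_boxI) auto
    obtain W where W: "W \<in> penrose_composition_twice l P" "p \<in> W" using composition_covers by blast
    obtain r' where r': "r' \<in> R" "W = rhomb_region r'" using sub[OF W(1)] by blast
    have "r = r'" using R.inner_region_eq[OF rR r'(1) p] W(2) r'(2) by blast
    thus ?thesis using W(1) r'(2) by simp
  qed
  ultimately show ?thesis by blast
qed

end

section \<open>Polygons and isometries\<close>

text \<open>Every join of paths halves the remaining interval of parameters.\<close>

lemma polyline_at:
  "Suc k < length vs \<Longrightarrow> polyline vs (1 - 1 / 2 ^ k) = vs ! k"
proof (induction vs arbitrary: k rule: polyline.induct)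
  case (1 x y z' vs)
  show ?case
  proof (cases k)
    case 0
    thus ?thesis by (simp add: joinpaths_def linepath_def)
  next
    case (Suc m)
    have step: "polyline (y # z' # vs) (1 - 1 / 2 ^ m) = (y # z' # vs) ! m" using 1 Suc by simp
    show ?thesis
    proof (cases m)
      case 0
      thus ?thesis using Suc by (simp add: joinpaths_def linepath_def)
    next
      case (Suc i)
      have "\<not> 1 - 1 / (2 :: real) ^ k \<le> 1 / 2"
      proof -
        have "(1::real) \<le> 2 ^ i" by simp
        hence "\<not> 2 * 2 ^ i \<le> (1::real)" by linarith
        thus ?thesis unfolding \<open>k = Suc m\<close> Suc by (simp add: field_simps)
      qed
      moreover have "2 * (1 - 1 / (2 :: real) ^ k) - 1 = 1 - 1 / 2 ^ m"
        unfolding \<open>k = Suc m\<close> by (simp add: field_simps)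
      ultimately show ?thesis using step \<open>k = Suc m\<close> by (simp add: joinpaths_def)
    qed
  qed
qed (auto simp: linepath_def)

lemma simple_polygon_distinct:
  assumes "simple_path (polygon_path vs)"
  shows "distinct vs"
  unfolding distinct_conv_nth
proof (intro allI impI)
  fix i j assume ij: "i < length vs" "j < length vs" "i \<noteq> j"
  define t where "t k = 1 - 1 / (2 :: real) ^ k" for k :: nat
  have at: "polygon_path vs (t k) = vs ! k" if "k < length vs" for k
    using polyline_at[of k "vs @ [hd vs]"] that unfolding polygon_path_def t_def by (simp add: nth_append)
  have t01: "0 \<le> t k" "t k < 1" for k by (simp_all add: t_def)
  have "t i \<noteq> t j" using ij(3) by (simp add: t_def)
  show "vs ! i \<noteq> vs ! j"
  proof
    assume "vs ! i = vs ! j"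
    hence "polygon_path vs (t i) = polygon_path vs (t j)" using at ij by simp
    moreover have "t i \<in> {0..1}" "t j \<in> {0..1}" using t01[of i] t01[of j] by auto
    moreover have "loop_free (polygon_path vs)" using assms by (simp add: simple_path_def)
    ultimately have "t i = t j \<or> t i = 0 \<and> t j = 1 \<or> t i = 1 \<and> t j = 0" unfolding loop_free_def by blast
    thus False using \<open>t i \<noteq> t j\<close> t01[of i] t01[of j] by simp
  qed
qed

lemma isometry_decomposition:
  assumes "isometry f"
  obtains h where "orthogonal_transformation h" "\<And>x. f x = f 0 + h x"
proof -
  have "orthogonal_transformation (\<lambda>x. f x - f 0)"
    using assms unfolding orthogonal_transformation_isometry isometry_def by (simp add: dist_norm)
  thus thesis using that[of "\<lambda>x. f x - f 0"] by simp
qed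

lemma isometry_dist: "isometry f \<Longrightarrow> dist (f x) (f y) = dist x y"
  by (simp add: isometry_def)

lemma isometry_inj: "isometry f \<Longrightarrow> f x = f y \<longleftrightarrow> x = y"
  by (metis isometry_dist dist_eq_0_iff)

lemma isometry_surj:
  assumes "isometry f" shows "surj f"
proof -
  obtain h where h: "orthogonal_transformation h" "\<And>x. f x = f 0 + h x" using isometry_decomposition[OF assms] by blast
  have "surj h" using h(1) by (rule orthogonal_transformation_surj)
  show ?thesis
  proof (rule surjI)
    fix y
    have "f (inv h (y - f 0)) = f 0 + h (inv h (y - f 0))" by (rule h(2))
    thus "f (inv h (y - f 0)) = y" by (simp add: surj_f_inv_f[OF \<open>surj h\<close>])
  qed
qed

lemma isometry_continuous: "isometry f \<Longrightarrow> continuous_on S f"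
  by (rule continuous_onI) (auto simp: isometry_dist intro: less_imp_le)

lemma isometry_inv:
  assumes "isometry f" shows "isometry (inv f)"
  unfolding isometry_def
proof (intro allI)
  fix x y
  have "dist (f (inv f x)) (f (inv f y)) = dist (inv f x) (inv f y)" by (rule isometry_dist[OF assms])
  thus "dist (inv f x) (inv f y) = dist x y" using surj_f_inv_f[OF isometry_surj[OF assms]] by simp
qed

lemma isometry_closed_segment:
  assumes "isometry f" shows "f ` closed_segment x y = closed_segment (f x) (f y)"
proof -
  obtain h where h: "orthogonal_transformation h" "\<And>x. f x = f 0 + h x" using isometry_decomposition[OF assms] by blast
  have "linear h" using h(1) by (simp add: orthogonal_transformation_def)
  have "f ` closed_segment x y = (\<lambda>w. f 0 + w) ` h ` closed_segment x y"
    unfolding image_image by (rule image_cong[OF refl h(2)])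
  also have "h ` closed_segment x y = closed_segment (h x) (h y)"
    using closed_segment_linear_image[OF \<open>linear h\<close>] by simp
  also have "(\<lambda>w. f 0 + w) ` closed_segment (h x) (h y) = closed_segment (f 0 + h x) (f 0 + h y)"
    by (rule closed_segment_translation[symmetric])
  also have "\<dots> = closed_segment (f x) (f y)" by (simp only: h(2)[of x, symmetric] h(2)[of y, symmetric])
  finally show ?thesis .
qed

lemma polyline_image:
  assumes "isometry f" "vs \<noteq> []"
  shows "path_image (polyline (map f vs)) = f ` path_image (polyline vs)"
proof -
  have start: "pathstart (polyline (x # ws)) = x" for x :: complex and ws
    by (cases "x # ws" rule: polyline.cases) (auto simp: pathstart_join)
  show ?thesis using assms(2)
  proof (induction vs rule: polyline.induct)
    case (1 x y z' vs)
    have "path_image (polyline (x # y # z' # vs)) = closed_segment x y \<union> path_image (polyline (y # z' # vs))"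
      "path_image (polyline (map f (x # y # z' # vs))) = closed_segment (f x) (f y) \<union> path_image (polyline (map f (y # z' # vs)))"
      by (simp_all add: path_image_join start)
    thus ?case using 1 isometry_closed_segment[OF assms(1)] by (simp add: image_Un)
  qed (auto simp: isometry_closed_segment[OF assms(1)])
qed

lemma inside_isometry_subset:
  assumes "isometry f" shows "f ` inside S \<subseteq> inside (f ` S)"
proof
  fix y assume "y \<in> f ` inside S"
  then obtain x where x: "y = f x" "x \<notin> S" "bounded (connected_component_set (- S) x)"
    unfolding inside_def by blast
  let ?g = "inv f"
  have gf: "?g (f w) = w" for w using isometry_inj[OF assms] by (simp add: inj_def inv_f_f)
  have fg: "f (?g w) = w" for w by (rule surj_f_inv_f[OF isometry_surj[OF assms]])
  have "connected_component_set (- (f ` S)) y \<subseteq> f ` connected_component_set (- S) x"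
  proof
    fix w assume "w \<in> connected_component_set (- (f ` S)) y"
    then obtain C where C: "connected C" "C \<subseteq> - (f ` S)" "y \<in> C" "w \<in> C" by (auto simp: connected_component_def)
    have "connected (?g ` C)" by (rule connected_continuous_image[OF isometry_continuous[OF isometry_inv[OF assms]] C(1)])
    moreover have "?g ` C \<subseteq> - S"
    proof (intro image_subsetI ComplI)
      fix w' assume w': "w' \<in> C" "?g w' \<in> S"
      hence "f (?g w') \<in> f ` S" by blast
      thus False using C(2) w'(1) fg by auto
    qed
    moreover have "x = ?g y" using gf x(1) by simp
    hence "x \<in> ?g ` C" using C(3) by blast
    moreover have "?g w \<in> ?g ` C" using C(4) by blast
    ultimately have "connected_component (- S) x (?g w)" unfolding connected_component_def by blast
    thus "w \<in> f ` connected_component_set (- S) x" using fg by (metis imageI mem_Collect_eq)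
  qed
  moreover have "bounded (f ` connected_component_set (- S) x)"
  proof -
    obtain c e where "\<forall>w\<in>connected_component_set (- S) x. dist c w \<le> e" using x(3) unfolding bounded_def by blast
    hence "\<forall>w\<in>f ` connected_component_set (- S) x. dist (f c) w \<le> e" using isometry_dist[OF assms] by auto
    thus ?thesis unfolding bounded_def by blast
  qed
  ultimately have "bounded (connected_component_set (- (f ` S)) y)" by (rule bounded_subset[rotated])
  moreover have "y \<notin> f ` S" using x isometry_inj[OF assms] by auto
  ultimately show "y \<in> inside (f ` S)" unfolding inside_def by blast
qed

lemma inside_isometry:
  assumes "isometry f" shows "inside (f ` S) = f ` inside S"
proof
  show "f ` inside S \<subseteq> inside (f ` S)" by (rule inside_isometry_subset[OF assms])
  have gf: "inv f (f w) = w" for w using isometry_inj[OF assms] by (simp add: inj_def inv_f_f)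
  have fg: "f (inv f w) = w" for w by (rule surj_f_inv_f[OF isometry_surj[OF assms]])
  have "inv f ` inside (f ` S) \<subseteq> inside (inv f ` f ` S)" by (rule inside_isometry_subset[OF isometry_inv[OF assms]])
  also have "inv f ` f ` S = S" using gf by (simp add: image_image)
  finally have "f ` inv f ` inside (f ` S) \<subseteq> f ` inside S" by blast
  moreover have "f ` inv f ` inside (f ` S) = inside (f ` S)" using fg by (simp add: image_image)
  ultimately show "inside (f ` S) \<subseteq> f ` inside S" by simp
qed

lemma polygon_region_isometry:
  assumes "isometry f" "vs \<noteq> []" shows "polygon_region (map f vs) = f ` polygon_region vs"
proof -
  have "map f vs @ [hd (map f vs)] = map f (vs @ [hd vs])" using assms(2) by (simp add: hd_map)
  hence "path_image (polygon_path (map f vs)) = f ` path_image (polygon_path vs)"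
    unfolding polygon_path_def using polyline_image[OF assms(1), of "vs @ [hd vs]"] by simp
  thus ?thesis unfolding polygon_region_def using inside_isometry[OF assms(1)] by (simp add: image_Un)
qed

lemma tile_region_isometry:
  assumes "isometry f" shows "tile_region (map_ammann_tile f t) = f ` tile_region t"
proof -
  have "tile_vertices (map_ammann_tile f t) = map f (tile_vertices t)" "tile_vertices t \<noteq> []" by (cases t; simp)+
  thus ?thesis using polygon_region_isometry[OF assms] by simp
qed

section \<open>Tiles of an Ammann tiling\<close>

lemma ammann_tiling_prototiles:
  assumes "ammann_tiling a b d j T"
  obtains v1 v2 v3 v4 v5 v6 v7 v8 v9 v10 v11 v12 v13 v14 v15 v16 \<S> where
    "\<S> = {TileA v1 v2 v3 v4 v5, TileB v6 v7 v8 v9 v10 v11, TileC v12 v13 v14 v15 v16}"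
    "card (tile_region ` \<S>) = 3" "admits (tile_region ` \<S>) (tile_region ` T)"
    "\<forall>t\<in>T. \<exists>s\<in>\<S>. \<exists>f. isometry f \<and> t = map_ammann_tile f s"
    "distinct [v1, v2, v3, v4, v5]" "distinct [v6, v7, v8, v9, v10, v11]" "distinct [v12, v13, v14, v15, v16]"
    "dist v5 v1 = a" "dist v2 v3 = a" "dist v4 v5 = a" "dist v11 v6 = a" "dist v6 v7 = a" "dist v13 v14 = a"
    "dist v1 v2 = b" "dist v7 v8 = b" "dist v8 v9 = b" "dist v14 v15 = b"
    "dist v9 v10 = j" "dist v10 v11 = j" "dist v16 v12 = j" "dist v12 v13 = j"
    "dist v3 v4 = d" "dist v15 v16 = d"
proof -
  obtain \<S> where S: "ammann_prototiles a b d j \<S>" "card (tile_region ` \<S>) = 3" "admits (tile_region ` \<S>) (tile_region ` T)"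
    "\<forall>t\<in>T. \<exists>s\<in>\<S>. \<exists>f. isometry f \<and> t = map_ammann_tile f s"
    using assms unfolding ammann_tiling_def by blast
  obtain v1 v2 v3 v4 v5 v6 v7 v8 v9 v10 v11 v12 v13 v14 v15 v16 ccw where
    p: "\<S> = {TileA v1 v2 v3 v4 v5, TileB v6 v7 v8 v9 v10 v11, TileC v12 v13 v14 v15 v16}"
    "\<forall>t\<in>\<S>. simple_path (polygon_path (tile_vertices t)) \<and> counterclockwise (tile_vertices t) = ccw"
    "\<forall>x\<in>{dist v5 v1, dist v2 v3, dist v4 v5, dist v11 v6, dist v6 v7, dist v13 v14}. x = a"
    "\<forall>x\<in>{dist v1 v2, dist v7 v8, dist v8 v9, dist v14 v15}. x = b"
    "\<forall>x\<in>{dist v9 v10, dist v10 v11, dist v16 v12, dist v12 v13}. x = j"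
    "\<forall>x\<in>{dist v3 v4, dist v15 v16}. x = d"
    using S(1) unfolding ammann_prototiles_def by (elim exE conjE)
  have "distinct (tile_vertices t)" if "t \<in> \<S>" for t using p(2) that simple_polygon_distinct by blast
  from this[of "TileA v1 v2 v3 v4 v5"] this[of "TileB v6 v7 v8 v9 v10 v11"] this[of "TileC v12 v13 v14 v15 v16"]
  have dist: "distinct [v1, v2, v3, v4, v5]" "distinct [v6, v7, v8, v9, v10, v11]" "distinct [v12, v13, v14, v15, v16]"
    unfolding p(1) tile_vertices.simps by blast+
  show thesis
    by (rule that[OF p(1) S(2-4) dist]) (use p(3-6) in simp_all)
qed

lemma tile_A:
  assumes "ammann_tiling a b d j T" "TileA v1 v2 v3 v4 v5 \<in> T"
  shows "distinct [v1, v2, v3, v4, v5]" "dist v5 v1 = a" "dist v2 v3 = a" "dist v4 v5 = a" "dist v1 v2 = b" "dist v3 v4 = d"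
proof -
  from assms(1) have "distinct [v1, v2, v3, v4, v5] \<and> dist v5 v1 = a \<and> dist v2 v3 = a \<and> dist v4 v5 = a \<and> dist v1 v2 = b \<and> dist v3 v4 = d"
  proof (rule ammann_tiling_prototiles)
    fix u1 u2 u3 u4 u5 u6 u7 u8 u9 u10 u11 u12 u13 u14 u15 u16 \<S>
    assume S: "\<S> = {TileA u1 u2 u3 u4 u5, TileB u6 u7 u8 u9 u10 u11, TileC u12 u13 u14 u15 u16}"
      "\<forall>t\<in>T. \<exists>s\<in>\<S>. \<exists>f. isometry f \<and> t = map_ammann_tile f s"
      and *: "distinct [u1, u2, u3, u4, u5]" "dist u5 u1 = a" "dist u2 u3 = a" "dist u4 u5 = a" "dist u1 u2 = b" "dist u3 u4 = d"
    from S(2) assms(2) obtain s f where sf: "s \<in> \<S>" "isometry f" "TileA v1 v2 v3 v4 v5 = map_ammann_tile f s" by blast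
    hence "[v1, v2, v3, v4, v5] = map f [u1, u2, u3, u4, u5]" unfolding S(1) by auto
    thus ?thesis using * by (simp add: isometry_dist[OF sf(2)] isometry_inj[OF sf(2)])
  qed
  thus "distinct [v1, v2, v3, v4, v5]" "dist v5 v1 = a" "dist v2 v3 = a" "dist v4 v5 = a" "dist v1 v2 = b" "dist v3 v4 = d"
    by blast+
qed

lemma tile_B:
  assumes "ammann_tiling a b d j T" "TileB v6 v7 v8 v9 v10 v11 \<in> T"
  shows "distinct [v6, v7, v8, v9, v10, v11]" "dist v11 v6 = a" "dist v6 v7 = a" "dist v7 v8 = b" "dist v8 v9 = b"
    "dist v9 v10 = j" "dist v10 v11 = j"
proof -
  from assms(1) have "distinct [v6, v7, v8, v9, v10, v11] \<and> dist v11 v6 = a \<and> dist v6 v7 = a \<and> dist v7 v8 = b \<and> dist v8 v9 = b \<and> dist v9 v10 = j \<and> dist v10 v11 = j"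
  proof (rule ammann_tiling_prototiles)
    fix u1 u2 u3 u4 u5 u6 u7 u8 u9 u10 u11 u12 u13 u14 u15 u16 \<S>
    assume S: "\<S> = {TileA u1 u2 u3 u4 u5, TileB u6 u7 u8 u9 u10 u11, TileC u12 u13 u14 u15 u16}"
      "\<forall>t\<in>T. \<exists>s\<in>\<S>. \<exists>f. isometry f \<and> t = map_ammann_tile f s"
      and *: "distinct [u6, u7, u8, u9, u10, u11]" "dist u11 u6 = a" "dist u6 u7 = a" "dist u7 u8 = b" "dist u8 u9 = b" "dist u9 u10 = j" "dist u10 u11 = j"
    from S(2) assms(2) obtain s f where sf: "s \<in> \<S>" "isometry f" "TileB v6 v7 v8 v9 v10 v11 = map_ammann_tile f s" by blast
    hence "[v6, v7, v8, v9, v10, v11] = map f [u6, u7, u8, u9, u10, u11]" unfolding S(1) by auto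
    thus ?thesis using * by (simp add: isometry_dist[OF sf(2)] isometry_inj[OF sf(2)])
  qed
  thus "distinct [v6, v7, v8, v9, v10, v11]" "dist v11 v6 = a" "dist v6 v7 = a" "dist v7 v8 = b" "dist v8 v9 = b"
    "dist v9 v10 = j" "dist v10 v11 = j" by blast+
qed

lemma tile_C:
  assumes "ammann_tiling a b d j T" "TileC v12 v13 v14 v15 v16 \<in> T"
  shows "distinct [v12, v13, v14, v15, v16]" "dist v13 v14 = a" "dist v14 v15 = b" "dist v15 v16 = d" "dist v16 v12 = j" "dist v12 v13 = j"
proof -
  from assms(1) have "distinct [v12, v13, v14, v15, v16] \<and> dist v13 v14 = a \<and> dist v14 v15 = b \<and> dist v15 v16 = d \<and> dist v16 v12 = j \<and> dist v12 v13 = j"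
  proof (rule ammann_tiling_prototiles)
    fix u1 u2 u3 u4 u5 u6 u7 u8 u9 u10 u11 u12 u13 u14 u15 u16 \<S>
    assume S: "\<S> = {TileA u1 u2 u3 u4 u5, TileB u6 u7 u8 u9 u10 u11, TileC u12 u13 u14 u15 u16}"
      "\<forall>t\<in>T. \<exists>s\<in>\<S>. \<exists>f. isometry f \<and> t = map_ammann_tile f s"
      and *: "distinct [u12, u13, u14, u15, u16]" "dist u13 u14 = a" "dist u14 u15 = b" "dist u15 u16 = d" "dist u16 u12 = j" "dist u12 u13 = j"
    from S(2) assms(2) obtain s f where sf: "s \<in> \<S>" "isometry f" "TileC v12 v13 v14 v15 v16 = map_ammann_tile f s" by blast
    hence "[v12, v13, v14, v15, v16] = map f [u12, u13, u14, u15, u16]" unfolding S(1) by auto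
    thus ?thesis using * by (simp add: isometry_dist[OF sf(2)] isometry_inj[OF sf(2)])
  qed
  thus "distinct [v12, v13, v14, v15, v16]" "dist v13 v14 = a" "dist v14 v15 = b" "dist v15 v16 = d" "dist v16 v12 = j" "dist v12 v13 = j"
    by blast+
qed

text \<open>A tile congruent to one prototile cannot be the image of another, since it is congruent to only one of their
  regions.\<close>

lemma all_kinds_of_tiles:
  assumes "ammann_tiling a b d j T"
  shows "\<exists>v1 v2 v3 v4 v5. TileA v1 v2 v3 v4 v5 \<in> T" "\<exists>v6 v7 v8 v9 v10 v11. TileB v6 v7 v8 v9 v10 v11 \<in> T"
    "\<exists>v12 v13 v14 v15 v16. TileC v12 v13 v14 v15 v16 \<in> T"
proof -
  from assms have "(\<exists>v1 v2 v3 v4 v5. TileA v1 v2 v3 v4 v5 \<in> T) \<and> (\<exists>v6 v7 v8 v9 v10 v11. TileB v6 v7 v8 v9 v10 v11 \<in> T) \<and>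
    (\<exists>v12 v13 v14 v15 v16. TileC v12 v13 v14 v15 v16 \<in> T)"
  proof (rule ammann_tiling_prototiles)
    fix u1 u2 u3 u4 u5 u6 u7 u8 u9 u10 u11 u12 u13 u14 u15 u16 \<S>
    assume S: "\<S> = {TileA u1 u2 u3 u4 u5, TileB u6 u7 u8 u9 u10 u11, TileC u12 u13 u14 u15 u16}"
      "card (tile_region ` \<S>) = 3" "admits (tile_region ` \<S>) (tile_region ` T)"
      "\<forall>t\<in>T. \<exists>s\<in>\<S>. \<exists>f. isometry f \<and> t = map_ammann_tile f s"
    have "card \<S> = 3" "finite \<S>" unfolding S(1) by simp_all
    hence inj: "inj_on tile_region \<S>" using S(2) by (simp add: eq_card_imp_inj_on)
    have ex: "\<exists>f. map_ammann_tile f s \<in> T" if s: "s \<in> \<S>" for s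
    proof -
      obtain X where X: "X \<in> tile_region ` T" "congruent (tile_region s) X"
        using S(3)[unfolded admits_def, THEN conjunct2, THEN bspec, OF imageI[OF s]] by blast
      then obtain t where t: "t \<in> T" "X = tile_region t" by blast
      obtain s' f where s': "s' \<in> \<S>" "isometry f" "t = map_ammann_tile f s'" using S(4) t(1) by blast
      have "X = f ` tile_region s'" unfolding t(2) s'(3) by (rule tile_region_isometry[OF s'(2)])
      hence 1: "tile_region s' \<in> tile_region ` \<S> \<and> congruent (tile_region s') X"
        unfolding congruent_def using s'(1,2) by blast
      have 2: "tile_region s \<in> tile_region ` \<S> \<and> congruent (tile_region s) X" using X(2) s by simp
      have ex1: "\<exists>!U. U \<in> tile_region ` \<S> \<and> congruent U X"
        using S(3)[unfolded admits_def, THEN conjunct1, THEN bspec, OF X(1)] .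
      have "tile_region s' = tile_region s"
        using the1_equality[OF ex1 1] the1_equality[OF ex1 2] by (simp only:)
      from inj_onD[OF inj this s'(1) s] have "s' = s" .
      thus ?thesis using t(1) s'(3) by blast
    qed
    have "TileA u1 u2 u3 u4 u5 \<in> \<S>" "TileB u6 u7 u8 u9 u10 u11 \<in> \<S>" "TileC u12 u13 u14 u15 u16 \<in> \<S>"
      unfolding S(1) by simp_all
    from ex[OF this(1)] ex[OF this(2)] ex[OF this(3)] show ?thesis
      unfolding ammann_tile.map by blast
  qed
  thus "\<exists>v1 v2 v3 v4 v5. TileA v1 v2 v3 v4 v5 \<in> T" "\<exists>v6 v7 v8 v9 v10 v11. TileB v6 v7 v8 v9 v10 v11 \<in> T"
    "\<exists>v12 v13 v14 v15 v16. TileC v12 v13 v14 v15 v16 \<in> T" by blast+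
qed

section \<open>The points of the recomposition\<close>

datatype kind = Kind_Q | Kind_R | Kind_S

text \<open>The number \<open>q\<close> is the position of the chosen point in a thin rhomb with \<open>A = 0\<close>, \<open>B = 1\<close> and \<open>D = z\<close>; it lies in
  the triangle \<open>ABD\<close> and is none of its vertices.\<close>

locale recomposed_tiling = rhomb_tiling +
  fixes q :: complex and x y :: real
  assumes q: "q = of_real x + of_real y * z" and x0: "0 \<le> x" and y0: "0 \<le> y" and xy1: "x + y \<le> 1"
    and q_not_0: "q \<noteq> 0" and q_not_1: "q \<noteq> 1" and q_not_z: "q \<noteq> z"
begin

definition Q_point :: "complex \<Rightarrow> complex \<Rightarrow> complex \<Rightarrow> bool" where
  "Q_point v w n \<longleftrightarrow> has_corner kA v w \<and> n = v + q * w"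

definition R_point :: "complex \<Rightarrow> complex \<Rightarrow> complex \<Rightarrow> bool" where
  "R_point v w n \<longleftrightarrow> has_corner kE v w \<and> n = v + q * w"

text \<open>The isometry taking \<open>D, A\<close> to \<open>G, H\<close> differs from the one taking \<open>A, B\<close> to \<open>E, F\<close> by the rotation \<open>cnj z\<close>, so that
  \<open>S - H = cnj z * q * w\<close>.\<close>

definition S_point :: "complex \<Rightarrow> complex \<Rightarrow> complex \<Rightarrow> bool" where
  "S_point v w n \<longleftrightarrow> has_corner kE v w \<and> n = v + (z\<^sup>2 + cnj z * q) * w"

lemma xy_cases: "\<not> (x = 0 \<and> y = 0)" "\<not> (x = 1 \<and> y = 0)" "\<not> (x = 0 \<and> y = 1)"
  using q_not_0 q_not_1 q_not_z q by auto

lemma z_coordinates: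
  "z * w = of_real (golden - 1) * w + of_real (golden - 1) * (z\<^sup>2 * w)"
  "cnj z * w = w - of_real (golden - 1) * (z\<^sup>2 * w)"
proof -
  have g: "(of_real golden - 1) * (of_real golden * (z * w)) = z * w" by (rule golden_complex_reciprocal(2))
  have s: "of_real golden * (z * w) = w + z\<^sup>2 * w" by (rule sum_side[OF z, symmetric])
  show 1: "z * w = of_real (golden - 1) * w + of_real (golden - 1) * (z\<^sup>2 * w)"
    using g unfolding s by (simp add: distrib_left)
  have "cnj z * w = of_real golden * w - z * w" unfolding z_cnj_eq[OF z] by (simp add: algebra_simps)
  also have "\<dots> = w - of_real (golden - 1) * (z\<^sup>2 * w)" unfolding 1 by (simp add: algebra_simps)
  finally show "cnj z * w = w - of_real (golden - 1) * (z\<^sup>2 * w)" .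
qed

lemma Q_coordinates: "v + q * w = v + (of_real x * w + of_real y * (z * w))"
  unfolding q by (simp add: algebra_simps)

lemma R_coordinates: "v + q * w = v + (of_real (x + (golden - 1) * y) * w + of_real ((golden - 1) * y) * (z\<^sup>2 * w))"
  unfolding Q_coordinates z_coordinates(1)[of w] by (simp add: algebra_simps)

lemma S_coordinates:
  "v + (z\<^sup>2 + cnj z * q) * w = v + (of_real (x + y) * w + of_real (1 - (golden - 1) * x) * (z\<^sup>2 * w))"
proof -
  have "(z\<^sup>2 + cnj z * q) * w = z\<^sup>2 * w + of_real x * (cnj z * w) + of_real y * (cnj z * (z * w))"
    unfolding q by (simp add: algebra_simps)
  also have "\<dots> = z\<^sup>2 * w + of_real x * (w - of_real (golden - 1) * (z\<^sup>2 * w)) + of_real y * w"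
    unfolding cnj_cancel(1)[OF z] z_coordinates(2)[of w] ..
  finally show ?thesis by (simp add: algebra_simps)
qed

lemma golden_fraction: "0 < golden - 1" "golden - 1 < 1"
  using golden_gt_1 golden_less_2 by simp_all

lemma product_bounds: "0 \<le> (golden - 1) * x" "(golden - 1) * x \<le> x" "0 \<le> (golden - 1) * y" "(golden - 1) * y \<le> y"
  using golden_fraction x0 y0 by (simp_all add: mult_right_le_one_le mult_left_le_one_le)

lemma strict_product: "0 < t \<Longrightarrow> (golden - 1) * t < t" for t :: real
  using golden_fraction by simp

lemma product_zero: "(golden - 1) * t = 0 \<longleftrightarrow> t = 0" for t :: real
  using golden_fraction by simp

lemma product_neq_1: "(golden - 1) * y \<noteq> 1" "(golden - 1) * x \<noteq> 1" "x + (golden - 1) * y \<noteq> 1"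
  "x + (golden - 1) * y \<noteq> 0" "x + y \<noteq> 0"
proof -
  have *: "(golden - 1) * t \<noteq> 1" if "0 \<le> t" "t \<le> 1" for t :: real
  proof -
    have "(golden - 1) * t \<le> (golden - 1) * 1" using golden_fraction that by (intro mult_left_mono) auto
    also have "\<dots> < 1" using golden_fraction by simp
    finally show ?thesis by simp
  qed
  show "(golden - 1) * y \<noteq> 1" "(golden - 1) * x \<noteq> 1" using * x0 y0 xy1 by auto
  show "x + y \<noteq> 0" using x0 y0 xy_cases(1) by linarith
  show "x + (golden - 1) * y \<noteq> 0"
    using x0 product_bounds(3) xy_cases(1) product_zero[of y] by linarith
  show "x + (golden - 1) * y \<noteq> 1"
  proof (cases "y = 0")
    case False
    hence "(golden - 1) * y < y" using y0 by (intro strict_product) simp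
    thus ?thesis using xy1 by linarith
  qed (use xy_cases in simp)
qed

lemma vertex_coordinates:
  assumes "has_corner \<kappa> v w" "v + (of_real \<alpha> * w + of_real \<beta> * (z ^ width \<kappa> * w)) \<in> rhomb_vertices (rhomb_at z \<kappa> v w)"
  shows "(\<alpha> = 0 \<or> \<alpha> = 1) \<and> (\<beta> = 0 \<or> \<beta> = 1)"
proof -
  define u where "u = z ^ width \<kappa> * w"
  have c: "cross w u \<noteq> 0" using corner_cross[OF assms(1)] by (simp add: u_def)
  have "of_real \<alpha> * w + of_real \<beta> * u = of_real 0 * w + of_real 0 * u \<or>
    of_real \<alpha> * w + of_real \<beta> * u = of_real 1 * w + of_real 0 * u \<or>
    of_real \<alpha> * w + of_real \<beta> * u = of_real 1 * w + of_real 1 * u \<or>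
    of_real \<alpha> * w + of_real \<beta> * u = of_real 0 * w + of_real 1 * u"
    using assms(2) unfolding rhomb_vertices_at u_def by simp
  thus ?thesis using coordinates_unique[OF c] by metis
qed

lemma not_vertex:
  assumes "has_corner \<kappa> v w" "n = v + (of_real \<alpha> * w + of_real \<beta> * (z ^ width \<kappa> * w))"
    "0 \<le> \<alpha>" "\<alpha> \<le> 1" "0 \<le> \<beta>" "\<beta> \<le> 1" "\<not> ((\<alpha> = 0 \<or> \<alpha> = 1) \<and> (\<beta> = 0 \<or> \<beta> = 1))" "r \<in> P"
  shows "n \<notin> rhomb_vertices r"
proof
  assume n: "n \<in> rhomb_vertices r"
  have P: "rhomb_at z \<kappa> v w \<in> P" using assms(1) by (simp add: has_corner_def)
  have "n \<in> rhomb_region (rhomb_at z \<kappa> v w)"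
    unfolding rhomb_region_at assms(2) by (rule boxI) (use assms in auto)
  hence "n \<in> rhomb_vertices (rhomb_at z \<kappa> v w)" by (rule vertex_in_region[OF P assms(8) n])
  thus False using vertex_coordinates[OF assms(1)] assms(2,7) by blast
qed

text \<open>Two different rhombs meet in a vertex of both or in an edge of both.\<close>

lemma shared_point:
  assumes "has_corner \<kappa> v w" "n = v + (of_real \<alpha> * w + of_real \<beta> * (z ^ width \<kappa> * w))"
    "0 \<le> \<alpha>" "\<alpha> \<le> 1" "0 \<le> \<beta>" "\<beta> \<le> 1" "\<not> ((\<alpha> = 0 \<or> \<alpha> = 1) \<and> (\<beta> = 0 \<or> \<beta> = 1))"
    "s \<in> P" "n \<in> rhomb_region s" "s \<noteq> rhomb_at z \<kappa> v w"
  shows "\<exists>e a b. arrow (rhomb_at z \<kappa> v w) e a b \<and> arrow s e a b \<and> n \<in> closed_segment a b"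
proof -
  have P: "rhomb_at z \<kappa> v w \<in> P" using assms(1) by (simp add: has_corner_def)
  have "n \<in> rhomb_region (rhomb_at z \<kappa> v w)"
    unfolding rhomb_region_at assms(2) by (rule boxI) (use assms in auto)
  moreover have "n \<notin> rhomb_vertices (rhomb_at z \<kappa> v w)" by (rule not_vertex[OF assms(1-7) P])
  ultimately show ?thesis using arrow_meet[OF P assms(8) assms(10)[symmetric] _ assms(9)] by blast
qed

primrec kind_corner :: "kind \<Rightarrow> corner" where
  "kind_corner Kind_Q = kA" | "kind_corner Kind_R = kE" | "kind_corner Kind_S = kE"

primrec kind_coord1 :: "kind \<Rightarrow> real" where
  "kind_coord1 Kind_Q = x" | "kind_coord1 Kind_R = x + (golden - 1) * y" | "kind_coord1 Kind_S = x + y"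

primrec kind_coord2 :: "kind \<Rightarrow> real" where
  "kind_coord2 Kind_Q = y" | "kind_coord2 Kind_R = (golden - 1) * y" | "kind_coord2 Kind_S = 1 - (golden - 1) * x"

primrec point :: "kind \<Rightarrow> complex \<Rightarrow> complex \<Rightarrow> complex \<Rightarrow> bool" where
  "point Kind_Q v w n = Q_point v w n" | "point Kind_R v w n = R_point v w n" | "point Kind_S v w n = S_point v w n"

lemma point_coordinates:
  assumes "point i v w n"
  shows "has_corner (kind_corner i) v w"
    "n = v + (of_real (kind_coord1 i) * w + of_real (kind_coord2 i) * (z ^ width (kind_corner i) * w))"
  using assms Q_coordinates R_coordinates S_coordinates
  by (cases i; simp only: point.simps Q_point_def R_point_def S_point_def kind_corner.simps kind_coord1.simps kind_coord2.simps
      width.simps power_one_right)+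

lemma kind_coords:
  "0 \<le> kind_coord1 i" "kind_coord1 i \<le> 1" "0 \<le> kind_coord2 i" "kind_coord2 i \<le> 1"
  "\<not> ((kind_coord1 i = 0 \<or> kind_coord1 i = 1) \<and> (kind_coord2 i = 0 \<or> kind_coord2 i = 1))"
proof -
  note b = product_bounds x0 y0 xy1
  show "0 \<le> kind_coord1 i" "kind_coord1 i \<le> 1" "0 \<le> kind_coord2 i" "kind_coord2 i \<le> 1"
    using b by (cases i; simp; linarith?)+
  show "\<not> ((kind_coord1 i = 0 \<or> kind_coord1 i = 1) \<and> (kind_coord2 i = 0 \<or> kind_coord2 i = 1))"
  proof (cases i)
    case Kind_Q
    thus ?thesis using xy_cases b by auto
  next
    case Kind_R
    thus ?thesis using product_neq_1 xy_cases product_zero[of y] by auto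
  next
    case Kind_S
    thus ?thesis using product_neq_1 xy_cases product_zero[of x] by auto
  qed
qed

lemma point_not_vertex: "point i v w n \<Longrightarrow> r \<in> P \<Longrightarrow> n \<notin> rhomb_vertices r"
  using not_vertex[OF point_coordinates kind_coords] .

text \<open>For a point on an edge, the type of the edge and whether \<open>x = 0\<close> decide on which side of the directed edge its
  rhomb lies.\<close>

lemma point_on_edge:
  assumes "point i v w n" "arrow (rhomb_at z (kind_corner i) v w) e a b" "n \<in> closed_segment a b"
  shows "\<exists>\<kappa> u. has_corner \<kappa> a u \<and> rhomb_at z \<kappa> a u = rhomb_at z (kind_corner i) v w \<and>
    b = a + (if e \<or> x \<noteq> 0 then u else z ^ width \<kappa> * u) \<and>
    i = (case \<kappa> of kA \<Rightarrow> Kind_Q | kE \<Rightarrow> Kind_R | _ \<Rightarrow> Kind_S)"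
proof -
  note p = point_coordinates[OF assms(1)]
  define \<kappa>0 where "\<kappa>0 = kind_corner i"
  define w' where "w' = z ^ width \<kappa>0 * w"
  have c: "cross w w' \<noteq> 0" using corner_cross[OF p(1)] by (simp add: w'_def \<kappa>0_def)
  have e: "{a, b} = {v, v + w} \<and> kind_coord2 i = 0 \<or> {a, b} = {v + w, v + w + w'} \<and> kind_coord1 i = 1 \<or>
    {a, b} = {v, v + w'} \<and> kind_coord1 i = 0 \<or> {a, b} = {v + w', v + w + w'} \<and> kind_coord2 i = 1"
  proof -
    have "n = v + (of_real (kind_coord1 i) * w + of_real (kind_coord2 i) * w')"
      unfolding w'_def \<kappa>0_def by (rule p(2))
    with assms(3) have "v + (of_real (kind_coord1 i) * w + of_real (kind_coord2 i) * w') \<in> closed_segment a b" by simp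
    from edge_containing_point[OF assms(2)[folded \<kappa>0_def] w'_def c this] show ?thesis .
  qed
  have P: "rhomb_at z \<kappa>0 v w \<in> P" using p(1) by (simp add: has_corner_def \<kappa>0_def)
  note same = arrow_antisym[OF P assms(2)[folded \<kappa>0_def]]
  note b = product_bounds x0 y0 xy1 xy_cases
  show ?thesis
  proof (cases i)
    case Kind_Q
    have w': "w' = z * w" "\<kappa>0 = kA" using Kind_Q by (simp_all add: w'_def \<kappa>0_def)
    have "{a, b} = {v, v + w} \<and> y = 0 \<or> {a, b} = {v, v + w'} \<and> x = 0"
    proof -
      have "x \<noteq> 1" "y \<noteq> 1" using x0 y0 xy1 xy_cases by linarith+
      thus ?thesis using e[unfolded Kind_Q kind_coord1.simps kind_coord2.simps] by blast
    qed
    thus ?thesis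
    proof
      assume h: "{a, b} = {v, v + w} \<and> y = 0"
      have ar: "arrow (rhomb_at z \<kappa>0 v w) True v (v + w)" by (simp add: w'(2) arrow_def)
      from same[OF ar conjunct1[OF h]] have "e" "a = v" "b = v + w" by simp_all
      thus ?thesis using p(1) unfolding Kind_Q by (intro exI[of _ kA] exI[of _ w]) simp
    next
      assume h: "{a, b} = {v, v + w'} \<and> x = 0"
      have ar: "arrow (rhomb_at z \<kappa>0 v w) False v (v + w')" by (simp add: w' arrow_def)
      from same[OF ar conjunct1[OF h]] have "\<not> e" "a = v" "b = v + w'" by simp_all
      thus ?thesis using p(1) h unfolding Kind_Q by (intro exI[of _ kA] exI[of _ w]) (simp add: w')
    qed
  next
    case Kind_R
    have w': "w' = z\<^sup>2 * w" "\<kappa>0 = kE" using Kind_R by (simp_all add: w'_def \<kappa>0_def)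
    have "{a, b} = {v, v + w}"
      using e[unfolded Kind_R kind_coord1.simps kind_coord2.simps] product_neq_1(1,3,4) by blast
    moreover have ar: "arrow (rhomb_at z \<kappa>0 v w) True v (v + w)" by (simp add: w'(2) arrow_def)
    ultimately have "e" "a = v" "b = v + w" using same[OF ar] by simp_all
    thus ?thesis using p(1) unfolding Kind_R by (intro exI[of _ kE] exI[of _ w]) simp
  next
    case Kind_S
    have w': "w' = z\<^sup>2 * w" "\<kappa>0 = kE" using Kind_S by (simp_all add: w'_def \<kappa>0_def)
    have "{a, b} = {v + w, v + w + w'} \<and> x + y = 1 \<or> {a, b} = {v + w', v + w + w'} \<and> x = 0"
    proof -
      have "1 - (golden - 1) * x \<noteq> 0" "1 - (golden - 1) * x = 1 \<Longrightarrow> x = 0"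
        using product_neq_1(2) product_zero[of x] by linarith+
      thus ?thesis using e[unfolded Kind_S kind_coord1.simps kind_coord2.simps] product_neq_1(5) by blast
    qed
    thus ?thesis
    proof
      assume h: "{a, b} = {v + w, v + w + w'} \<and> x + y = 1"
      have ar: "arrow (rhomb_at z \<kappa>0 v w) False (v + w) (v + w + w')" by (simp add: w' arrow_def add.assoc)
      from same[OF ar conjunct1[OF h]] have ab: "\<not> e" "a = v + w" "b = v + w + w'" by simp_all
      have "x \<noteq> 0" using h b by auto
      have F: "has_corner kF (v + w) (z\<^sup>2 * w)" using p(1) corner_shift(5) unfolding Kind_S by simp
      have "rhomb_at z kF (v + w) (z\<^sup>2 * w) = rhomb_at z kE v w" by (rule rhomb_at_turn'(4)[symmetric])
      thus ?thesis using F ab \<open>x \<noteq> 0\<close> unfolding Kind_S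
        by (intro exI[of _ kF] exI[of _ "z\<^sup>2 * w"]) (simp add: w')
    next
      assume h: "{a, b} = {v + w', v + w + w'} \<and> x = 0"
      have ar: "arrow (rhomb_at z \<kappa>0 v w) False (v + w') (v + w + w')" by (simp add: w' arrow_def add.assoc)
      from same[OF ar conjunct1[OF h]] have ab: "\<not> e" "a = v + w'" "b = v + w + w'" by simp_all
      have H: "has_corner kH (v + z\<^sup>2 * w) (- (z\<^sup>2 * w))" using p(1) corner_shift(7) z_pow_6_7(3) unfolding Kind_S by simp
      have eq: "rhomb_at z kH (v + z\<^sup>2 * w) (- (z\<^sup>2 * w)) = rhomb_at z kE v w" by (rule rhomb_at_turn'(6)[symmetric])
      have "z ^ 3 * (- (z\<^sup>2 * w)) = w" using opposite_direction(4)[of w] by simp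
      thus ?thesis using H eq ab h unfolding Kind_S
        by (intro exI[of _ kH] exI[of _ "- (z\<^sup>2 * w)"]) (simp add: w' add_ac)
    qed
  qed
qed

lemma same_last_edge:
  assumes "has_corner \<kappa> v u" "has_corner \<kappa>' v u'" "z ^ width \<kappa> * u = z ^ width \<kappa>' * u'"
  shows "\<kappa> = \<kappa>'" "u = u'"
proof -
  have *: "z ^ n = z * z ^ (n - 1)" if "1 \<le> n" for n using that by (simp flip: power_Suc)
  have "z * (z ^ (width \<kappa> - 1) * u) = z * (z ^ (width \<kappa>' - 1) * u')"
    using assms(3) *[OF width_bounds(1)[of \<kappa>]] *[OF width_bounds(1)[of \<kappa>']] by (metis mult.assoc)
  hence "z ^ (width \<kappa> - 1) * u = z ^ (width \<kappa>' - 1) * u'" using z_nonzero[OF z] by simp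
  moreover have "width \<kappa> - 1 < width \<kappa>" "width \<kappa>' - 1 < width \<kappa>'"
    using width_bounds(1)[of \<kappa>] width_bounds(1)[of \<kappa>'] by linarith+
  ultimately show "\<kappa> = \<kappa>'" "u = u'" using common_sector[OF assms(1,2)] by blast+
qed

text \<open>The points of two different rhombs can only coincide on a common edge; by \<open>point_on_edge\<close> both rhombs would then
  lie on the same side of it.\<close>

lemma point_unique:
  assumes "point i v w n" "point i' v' w' n"
  shows "i = i'" "v = v'" "w = w'"
proof -
  note p = point_coordinates[OF assms(1)] and p' = point_coordinates[OF assms(2)]
  define r where "r = rhomb_at z (kind_corner i) v w"
  define r' where "r' = rhomb_at z (kind_corner i') v' w'"
  have rP: "r \<in> P" "r' \<in> P" using p(1) p'(1) by (simp_all add: has_corner_def r_def r'_def)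
  have vw: "v = v' \<and> w = w'" if "r = r'"
    using that by (cases i; cases i'; simp add: r_def r'_def)
  have "r = r' \<and> i = i'"
  proof (cases "r = r'")
    case True
    note vw = vw[OF True]
    have k: "kind_corner i = kind_corner i'" using True by (cases i; cases i'; simp add: r_def r'_def)
    have "cross w (z ^ width (kind_corner i) * w) \<noteq> 0" by (rule corner_cross[OF p(1)])
    moreover have "of_real (kind_coord1 i) * w + of_real (kind_coord2 i) * (z ^ width (kind_corner i) * w) =
      of_real (kind_coord1 i') * w + of_real (kind_coord2 i') * (z ^ width (kind_corner i) * w)"
      using p(2) p'(2) vw k by simp
    ultimately have co: "kind_coord1 i = kind_coord1 i' \<and> kind_coord2 i = kind_coord2 i'" by (rule coordinates_unique)
    have RS: "\<not> (x + (golden - 1) * y = x + y \<and> (golden - 1) * y = 1 - (golden - 1) * x)"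
    proof
      assume h: "x + (golden - 1) * y = x + y \<and> (golden - 1) * y = 1 - (golden - 1) * x"
      have "y = 0"
      proof (rule ccontr)
        assume "y \<noteq> 0"
        hence "(golden - 1) * y < y" using y0 by (intro strict_product) simp
        thus False using h by linarith
      qed
      thus False using h product_neq_1(2) by simp
    qed
    show ?thesis using True co k RS by (cases i; cases i') auto
  next
    case False
    have "n \<in> rhomb_region r'"
      unfolding r'_def rhomb_region_at p'(2) by (rule boxI) (use kind_coords in auto)
    then obtain e a b where e: "arrow r e a b" "arrow r' e a b" "n \<in> closed_segment a b"
      using shared_point[OF p kind_coords rP(2)] False unfolding r_def by blast
    obtain \<kappa> u where k: "has_corner \<kappa> a u" "rhomb_at z \<kappa> a u = r"
      "b = a + (if e \<or> x \<noteq> 0 then u else z ^ width \<kappa> * u)"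
      using point_on_edge[OF assms(1) e(1)[unfolded r_def] e(3)] unfolding r_def by blast
    obtain \<kappa>' u' where k': "has_corner \<kappa>' a u'" "rhomb_at z \<kappa>' a u' = r'"
      "b = a + (if e \<or> x \<noteq> 0 then u' else z ^ width \<kappa>' * u')"
      using point_on_edge[OF assms(2) e(2)[unfolded r'_def] e(3)] unfolding r'_def by blast
    have "\<kappa> = \<kappa>' \<and> u = u'"
    proof (cases "e \<or> x \<noteq> 0")
      case True
      hence "z ^ 0 * u = z ^ 0 * u'" using k(3) k'(3) by simp
      moreover have "0 < width \<kappa>" "0 < width \<kappa>'" using width_bounds(1)[of \<kappa>] width_bounds(1)[of \<kappa>'] by linarith+
      ultimately show ?thesis using common_sector[OF k(1) k'(1)] by blast
    next
      case F: False
      hence "z ^ width \<kappa> * u = z ^ width \<kappa>' * u'" using k(3) k'(3) by simp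
      thus ?thesis using same_last_edge[OF k(1) k'(1)] by blast
    qed
    hence "r = r'" using k(2) k'(2) by simp
    thus ?thesis using False by contradiction
  qed
  thus "i = i'" "v = v'" "w = w'" using vw by blast+
qed

end

section \<open>The edges of the recomposed tiling\<close>

context recomposed_tiling
begin

definition is_vertex :: "complex \<Rightarrow> bool" where
  "is_vertex p \<longleftrightarrow> (\<exists>r\<in>P. p \<in> rhomb_vertices r)"

definition is_point :: "complex \<Rightarrow> bool" where
  "is_point n \<longleftrightarrow> (\<exists>i v w. point i v w n)"

text \<open>The segments of the recomposition, each starting at the point \<open>Q\<close>, \<open>R\<close> or \<open>S\<close>: of length \<open>qa\<close> the segments \<open>QA\<close>,
  \<open>RE\<close> and \<open>SH\<close>, of length \<open>qb\<close> the segments \<open>QB\<close> and \<open>RF\<close>, of length \<open>qj\<close> the segments \<open>QD\<close> and \<open>SG\<close>, and of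
  length \<open>qd\<close> the segments \<open>RS\<close>.\<close>

definition a_rel :: "complex \<Rightarrow> complex \<Rightarrow> bool" where
  "a_rel n p \<longleftrightarrow> (\<exists>v w. Q_point v w n \<and> p = v \<or> R_point v w n \<and> p = v \<or> S_point v w n \<and> p = v + z\<^sup>2 * w)"

definition b_rel :: "complex \<Rightarrow> complex \<Rightarrow> bool" where
  "b_rel n p \<longleftrightarrow> (\<exists>v w. Q_point v w n \<and> p = v + w \<or> R_point v w n \<and> p = v + w)"

definition j_rel :: "complex \<Rightarrow> complex \<Rightarrow> bool" where
  "j_rel n p \<longleftrightarrow> (\<exists>v w. Q_point v w n \<and> p = v + z * w \<or> S_point v w n \<and> p = v + (w + z\<^sup>2 * w))"

definition d_rel :: "complex \<Rightarrow> complex \<Rightarrow> bool" where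
  "d_rel n n' \<longleftrightarrow> (\<exists>v w. R_point v w n \<and> S_point v w n')"

lemma QRS_unique:
  "Q_point v w n \<Longrightarrow> Q_point v' w' n \<Longrightarrow> v' = v \<and> w' = w"
  "R_point v w n \<Longrightarrow> R_point v' w' n \<Longrightarrow> v' = v \<and> w' = w"
  "S_point v w n \<Longrightarrow> S_point v' w' n \<Longrightarrow> v' = v \<and> w' = w"
  "Q_point v w n \<Longrightarrow> R_point v' w' n \<Longrightarrow> False"
  "Q_point v w n \<Longrightarrow> S_point v' w' n \<Longrightarrow> False"
  "R_point v w n \<Longrightarrow> S_point v' w' n \<Longrightarrow> False"
proof -
  show "Q_point v w n \<Longrightarrow> Q_point v' w' n \<Longrightarrow> v' = v \<and> w' = w" using point_unique(2,3)[of Kind_Q v w n Kind_Q v' w'] by simp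
  show "R_point v w n \<Longrightarrow> R_point v' w' n \<Longrightarrow> v' = v \<and> w' = w" using point_unique(2,3)[of Kind_R v w n Kind_R v' w'] by simp
  show "S_point v w n \<Longrightarrow> S_point v' w' n \<Longrightarrow> v' = v \<and> w' = w" using point_unique(2,3)[of Kind_S v w n Kind_S v' w'] by simp
  show "Q_point v w n \<Longrightarrow> R_point v' w' n \<Longrightarrow> False" using point_unique(1)[of Kind_Q v w n Kind_R v' w'] by simp
  show "Q_point v w n \<Longrightarrow> S_point v' w' n \<Longrightarrow> False" using point_unique(1)[of Kind_Q v w n Kind_S v' w'] by simp
  show "R_point v w n \<Longrightarrow> S_point v' w' n \<Longrightarrow> False" using point_unique(1)[of Kind_R v w n Kind_S v' w'] by simp
qed

lemma QRS_points: "Q_point v w n \<Longrightarrow> is_point n" "R_point v w n \<Longrightarrow> is_point n" "S_point v w n \<Longrightarrow> is_point n"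
  unfolding is_point_def by (metis point.simps)+

lemma point_or_vertex: "is_point n \<Longrightarrow> \<not> is_vertex n"
  unfolding is_point_def is_vertex_def using point_not_vertex by blast

lemma corner_is_vertex: "has_corner \<kappa> v w \<Longrightarrow> is_vertex v \<and> is_vertex (v + w) \<and> is_vertex (v + (w + z ^ width \<kappa> * w)) \<and> is_vertex (v + z ^ width \<kappa> * w)"
  unfolding is_vertex_def has_corner_def using rhomb_vertices_at by blast

lemma Q_vertices: "Q_point v w n \<Longrightarrow> is_vertex v \<and> is_vertex (v + w) \<and> is_vertex (v + z * w)"
  using corner_is_vertex[of kA v w] by (simp add: Q_point_def)

lemma RS_vertices:
  "R_point v w n \<Longrightarrow> is_vertex v \<and> is_vertex (v + w)"
  "S_point v w n \<Longrightarrow> is_vertex (v + z\<^sup>2 * w) \<and> is_vertex (v + (w + z\<^sup>2 * w))"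
  using corner_is_vertex[of kE v w] by (simp_all add: R_point_def S_point_def)

lemma rel_types:
  "a_rel n p \<Longrightarrow> is_point n \<and> is_vertex p" "b_rel n p \<Longrightarrow> is_point n \<and> is_vertex p" "j_rel n p \<Longrightarrow> is_point n \<and> is_vertex p"
  "d_rel n n' \<Longrightarrow> is_point n \<and> is_point n'"
  unfolding a_rel_def b_rel_def j_rel_def d_rel_def using QRS_points Q_vertices RS_vertices by blast+

lemma rel_functional:
  "a_rel n p \<Longrightarrow> a_rel n p' \<Longrightarrow> p = p'" "b_rel n p \<Longrightarrow> b_rel n p' \<Longrightarrow> p = p'" "j_rel n p \<Longrightarrow> j_rel n p' \<Longrightarrow> p = p'"
  unfolding a_rel_def b_rel_def j_rel_def using QRS_unique by metis+

lemma rel_intros: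
  "Q_point v w n \<Longrightarrow> a_rel n v" "R_point v w n \<Longrightarrow> a_rel n v" "S_point v w n \<Longrightarrow> a_rel n (v + z\<^sup>2 * w)"
  "Q_point v w n \<Longrightarrow> b_rel n (v + w)" "R_point v w n \<Longrightarrow> b_rel n (v + w)"
  "Q_point v w n \<Longrightarrow> j_rel n (v + z * w)" "S_point v w n \<Longrightarrow> j_rel n (v + (w + z\<^sup>2 * w))"
  unfolding a_rel_def b_rel_def j_rel_def by blast+

lemma RS_ends:
  "R_point v w n \<Longrightarrow> a_rel n p \<Longrightarrow> p = v" "R_point v w n \<Longrightarrow> b_rel n p \<Longrightarrow> p = v + w"
  "S_point v w n \<Longrightarrow> a_rel n p \<Longrightarrow> p = v + z\<^sup>2 * w" "S_point v w n \<Longrightarrow> j_rel n p \<Longrightarrow> p = v + (w + z\<^sup>2 * w)"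
proof -
  show "R_point v w n \<Longrightarrow> a_rel n p \<Longrightarrow> p = v" using rel_functional(1) rel_intros(2) by blast
  show "R_point v w n \<Longrightarrow> b_rel n p \<Longrightarrow> p = v + w" by (rule rel_functional(2)[OF _ rel_intros(5)])
  show "S_point v w n \<Longrightarrow> a_rel n p \<Longrightarrow> p = v + z\<^sup>2 * w" by (rule rel_functional(1)[OF _ rel_intros(3)])
  show "S_point v w n \<Longrightarrow> j_rel n p \<Longrightarrow> p = v + (w + z\<^sup>2 * w)" by (rule rel_functional(3)[OF _ rel_intros(7)])
qed

lemma S_of_R: "R_point v w n \<Longrightarrow> S_point v w n' \<Longrightarrow> S_point v w n'' \<Longrightarrow> n' = n''"
  "S_point v w n \<Longrightarrow> R_point v w n' \<Longrightarrow> R_point v w n'' \<Longrightarrow> n' = n''"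
  by (simp_all add: R_point_def S_point_def)

lemma d_rel_functional:
  "d_rel n p \<Longrightarrow> d_rel n p' \<Longrightarrow> p = p'" "d_rel p n \<Longrightarrow> d_rel p' n \<Longrightarrow> p = p'" "d_rel n p \<Longrightarrow> d_rel p' n \<Longrightarrow> False"
  unfolding d_rel_def using QRS_unique S_of_R by metis+

lemma thin_arrows: "has_corner kA v w \<Longrightarrow> \<exists>r\<in>P. arrow r True v (v + w) \<and> arrow r False v (v + z * w)"
  unfolding has_corner_def by (rule bexI) (auto simp: arrow_def)

lemma thick_arrows: "has_corner kE v w \<Longrightarrow> \<exists>r\<in>P. arrow r True v (v + w) \<and> arrow r True v (v + z\<^sup>2 * w) \<and>
    arrow r False (v + w) (v + (w + z\<^sup>2 * w)) \<and> arrow r False (v + z\<^sup>2 * w) (v + (w + z\<^sup>2 * w))"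
  unfolding has_corner_def by (rule bexI) (auto simp: arrow_def)

lemma arrow_ab:
  assumes "a_rel n p" "b_rel n p'"
  shows "\<exists>v w. p = v \<and> p' = v + w \<and> (Q_point v w n \<or> R_point v w n)"
  using assms QRS_unique unfolding a_rel_def b_rel_def by metis

lemma arrow_aj:
  assumes "a_rel n p" "j_rel n p'"
  shows "\<exists>v w. Q_point v w n \<and> p = v \<and> p' = v + z * w \<or> S_point v w n \<and> p = v + z\<^sup>2 * w \<and> p' = v + (w + z\<^sup>2 * w)"
  using assms QRS_unique unfolding a_rel_def j_rel_def by metis

lemma arrow_ab_exists: "a_rel n p \<Longrightarrow> b_rel n p' \<Longrightarrow> \<exists>r\<in>P. arrow r True p p'"
  using arrow_ab thin_arrows thick_arrows unfolding Q_point_def R_point_def by metis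

lemma arrow_aj_exists: "a_rel n p \<Longrightarrow> j_rel n p' \<Longrightarrow> \<exists>r\<in>P. arrow r False p p'"
  using arrow_aj thin_arrows thick_arrows unfolding Q_point_def S_point_def by metis

lemma same_arrow_ab:
  assumes "a_rel n p" "b_rel n p'" "a_rel m p" "b_rel m p'"
  shows "n = m"
proof -
  obtain v w where 1: "p = v" "p' = v + w" "Q_point v w n \<or> R_point v w n" using arrow_ab[OF assms(1,2)] by blast
  obtain v' w' where 2: "p = v'" "p' = v' + w'" "Q_point v' w' m \<or> R_point v' w' m" using arrow_ab[OF assms(3,4)] by blast
  have eq: "v' = v" "w' = w" using 1 2 by simp_all
  have "\<not> (has_corner kA v w \<and> has_corner kE v w)" using common_sector(1)[of kA v w kE w 0 0] by auto
  thus ?thesis using 1(3) 2(3) unfolding eq Q_point_def R_point_def by blast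
qed

definition qa :: real where "qa = l * norm q"
definition qb :: real where "qb = l * norm (q - 1)"
definition qj :: real where "qj = l * norm (q - z)"
definition qd :: real where "qd = l * norm (q - (z\<^sup>2 + cnj z * q))"

lemma rel_lengths:
  "a_rel n p \<Longrightarrow> dist n p = qa" "b_rel n p \<Longrightarrow> dist n p = qb" "j_rel n p \<Longrightarrow> dist n p = qj" "d_rel n p \<Longrightarrow> dist n p = qd"
proof -
  have d: "dist (v + c * w) (v + e * w) = l * norm (c - e)" if "has_corner \<kappa> v w" for \<kappa> v w c e
  proof -
    have "(v + c * w) - (v + e * w) = (c - e) * w" by (simp add: algebra_simps)
    thus ?thesis using corner_length[OF that] by (simp only: dist_norm norm_mult mult.commute)
  qed
  have S: "norm ((z\<^sup>2 + cnj z * q) - z\<^sup>2) = norm q" using z_norm[OF z] by (simp add: norm_mult)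
  have S': "norm ((z\<^sup>2 + cnj z * q) - (1 + z\<^sup>2)) = norm (q - z)"
  proof -
    have "(z\<^sup>2 + cnj z * q) - (1 + z\<^sup>2) = cnj z * (q - z)" using z_cnj(1)[OF z] by (simp add: algebra_simps)
    thus ?thesis using z_norm[OF z] by (simp add: norm_mult)
  qed
  show "a_rel n p \<Longrightarrow> dist n p = qa"
    using d[of _ _ _ q 0] d[of _ _ _ "z\<^sup>2 + cnj z * q" "z\<^sup>2"] S
    unfolding a_rel_def Q_point_def R_point_def S_point_def qa_def by auto
  show "b_rel n p \<Longrightarrow> dist n p = qb"
    using d[of _ _ _ q 1] unfolding b_rel_def Q_point_def R_point_def qb_def by auto
  show "j_rel n p \<Longrightarrow> dist n p = qj"
    using d[of _ _ _ q z] d[of _ _ _ "z\<^sup>2 + cnj z * q" "1 + z\<^sup>2"] S'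
    unfolding j_rel_def Q_point_def S_point_def qj_def by (auto simp: distrib_right)
  show "d_rel n p \<Longrightarrow> dist n p = qd"
    using d[of _ _ _ q "z\<^sup>2 + cnj z * q"] unfolding d_rel_def R_point_def S_point_def qd_def by auto
qed

definition seg :: "complex \<Rightarrow> complex \<Rightarrow> bool" where
  "seg n p \<longleftrightarrow> a_rel n p \<or> b_rel n p \<or> j_rel n p \<or> d_rel n p"

definition linked :: "real \<Rightarrow> complex \<Rightarrow> complex \<Rightarrow> bool" where
  "linked c n p \<longleftrightarrow> (seg n p \<or> seg p n) \<and> dist n p = c"

lemma symmetric_lengths:
  "a_rel n p \<or> a_rel p n \<Longrightarrow> dist n p = qa" "b_rel n p \<or> b_rel p n \<Longrightarrow> dist n p = qb"
  "j_rel n p \<or> j_rel p n \<Longrightarrow> dist n p = qj" "d_rel n p \<or> d_rel p n \<Longrightarrow> dist n p = qd"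
  by (metis rel_lengths dist_commute)+

lemma linked_range: "linked c n p \<Longrightarrow> c \<in> {qa, qb, qj, qd}"
  using symmetric_lengths[of n p] unfolding linked_def seg_def by auto

end

locale recomposed_distinct = recomposed_tiling +
  assumes distinct_lengths: "distinct [qa, qb, qj, qd]"
begin

lemma linked_cases:
  "linked qa n p \<Longrightarrow> a_rel n p \<or> a_rel p n" "linked qb n p \<Longrightarrow> b_rel n p \<or> b_rel p n"
  "linked qj n p \<Longrightarrow> j_rel n p \<or> j_rel p n" "linked qd n p \<Longrightarrow> d_rel n p \<or> d_rel p n"
  using distinct_lengths symmetric_lengths[of n p] unfolding linked_def seg_def by auto

lemma linked_sym: "linked c n p \<Longrightarrow> linked c p n"
  by (auto simp: linked_def dist_commute)

text \<open>From every point \<open>Q\<close>, \<open>R\<close> or \<open>S\<close> starts at most one segment of each kind, and the segments \<open>RS\<close> have no common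
  ends. So two segments of the same kind can only meet in a vertex of a rhomb.\<close>

lemma two_links:
  assumes "linked c p n" "linked c p m" "n \<noteq> m"
  shows "c \<noteq> qd \<and> is_vertex p \<and> is_point n \<and> is_point m"
proof -
  have V: "\<not> (is_point k \<and> is_vertex k)" for k using point_or_vertex by blast
  consider "c = qa" | "c = qb" | "c = qj" | "c = qd" using linked_range[OF assms(1)] by blast
  thus ?thesis
  proof cases
    case 1
    hence "a_rel p n \<or> a_rel n p" "a_rel p m \<or> a_rel m p" using linked_cases(1) assms by blast+
    hence "a_rel n p" "a_rel m p" using rel_types(1) rel_functional(1) assms(3) V by blast+
    thus ?thesis using rel_types(1)[of n p] rel_types(1)[of m p] distinct_lengths 1 by auto
  next
    case 2
    hence "b_rel p n \<or> b_rel n p" "b_rel p m \<or> b_rel m p" using linked_cases(2) assms by blast+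
    hence "b_rel n p" "b_rel m p" using rel_types(2) rel_functional(2) assms(3) V by blast+
    thus ?thesis using rel_types(2)[of n p] rel_types(2)[of m p] distinct_lengths 2 by auto
  next
    case 3
    hence "j_rel p n \<or> j_rel n p" "j_rel p m \<or> j_rel m p" using linked_cases(3) assms by blast+
    hence "j_rel n p" "j_rel m p" using rel_types(3) rel_functional(3) assms(3) V by blast+
    thus ?thesis using rel_types(3)[of n p] rel_types(3)[of m p] distinct_lengths 3 by auto
  next
    case 4
    hence "d_rel p n \<or> d_rel n p" "d_rel p m \<or> d_rel m p" using linked_cases(4) assms by blast+
    thus ?thesis using d_rel_functional assms(3) by blast
  qed
qed

lemma link_from_vertex:
  "is_vertex p \<Longrightarrow> linked qa p n \<Longrightarrow> a_rel n p" "is_vertex p \<Longrightarrow> linked qb p n \<Longrightarrow> b_rel n p" "is_vertex p \<Longrightarrow> linked qj p n \<Longrightarrow> j_rel n p"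
  using linked_cases rel_types point_or_vertex by blast+

lemma link_from_point:
  "is_point n \<Longrightarrow> linked qa n p \<Longrightarrow> a_rel n p" "is_point n \<Longrightarrow> linked qb n p \<Longrightarrow> b_rel n p" "is_point n \<Longrightarrow> linked qj n p \<Longrightarrow> j_rel n p"
  using linked_cases rel_types point_or_vertex by blast+

lemma R_no_j: "R_point v w n \<Longrightarrow> j_rel n p \<Longrightarrow> False" and S_no_b: "S_point v w n \<Longrightarrow> b_rel n p \<Longrightarrow> False"
  unfolding j_rel_def b_rel_def using QRS_unique(4,5,6) by blast+

subsection \<open>The vertices of the tiles\<close>

context
  fixes a b d j :: real
begin

definition A_links :: "complex \<Rightarrow> complex \<Rightarrow> complex \<Rightarrow> complex \<Rightarrow> complex \<Rightarrow> bool" where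
  "A_links v1 v2 v3 v4 v5 \<longleftrightarrow> distinct [v1, v2, v3, v4, v5] \<and> linked a v5 v1 \<and> linked a v2 v3 \<and> linked a v4 v5 \<and> linked b v1 v2 \<and> linked d v3 v4"

definition B_links :: "complex \<Rightarrow> complex \<Rightarrow> complex \<Rightarrow> complex \<Rightarrow> complex \<Rightarrow> complex \<Rightarrow> bool" where
  "B_links v6 v7 v8 v9 v10 v11 \<longleftrightarrow> distinct [v6, v7, v8, v9, v10, v11] \<and> linked a v11 v6 \<and> linked a v6 v7 \<and>
     linked b v7 v8 \<and> linked b v8 v9 \<and> linked j v9 v10 \<and> linked j v10 v11"

definition C_links :: "complex \<Rightarrow> complex \<Rightarrow> complex \<Rightarrow> complex \<Rightarrow> complex \<Rightarrow> bool" where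
  "C_links v12 v13 v14 v15 v16 \<longleftrightarrow> distinct [v12, v13, v14, v15, v16] \<and> linked a v13 v14 \<and> linked b v14 v15 \<and>
     linked d v15 v16 \<and> linked j v16 v12 \<and> linked j v12 v13"

text \<open>Each of \<open>a\<close>, \<open>b\<close> and \<open>j\<close>, but not \<open>|RS|\<close>, is the length of two consecutive edges of a tile.\<close>

lemma d_is_qd:
  assumes "{a, b, j, d} = {qa, qb, qj, qd}" "A_links v1 v2 v3 v4 v5" "B_links v6 v7 v8 v9 v10 v11"
  shows "d = qd"
proof -
  have "linked a v5 v1" "linked a v5 v4" "v1 \<noteq> v4" using assms(2) by (auto simp: A_links_def linked_sym)
  hence 1: "a \<noteq> qd" using two_links by blast
  have "linked b v8 v7" "linked b v8 v9" "v7 \<noteq> v9" using assms(3) by (auto simp: B_links_def linked_sym)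
  hence 2: "b \<noteq> qd" using two_links by blast
  have "linked j v10 v9" "linked j v10 v11" "v9 \<noteq> v11" using assms(3) by (auto simp: B_links_def linked_sym)
  hence 3: "j \<noteq> qd" using two_links by blast
  have "qd \<in> {a, b, j, d}" using assms(1) by simp
  thus ?thesis using 1 2 3 by blast
qed

text \<open>The edge \<open>(3,4)\<close> of an \<open>A\<close> tile is a segment \<open>RS\<close> with edges of length \<open>a\<close> at both ends, whereas \<open>R\<close> is not joined
  to a vertex at distance \<open>qj\<close> and \<open>S\<close> is not joined to one at distance \<open>qb\<close>. If \<open>b\<close> and \<open>j\<close> were exchanged,
  the vertices 14 and 12 of a \<open>C\<close> tile would be \<open>G\<close> and \<open>F\<close> with a type 1 arrow from \<open>G\<close> to \<open>F\<close>.\<close>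

lemma lengths_identified:
  assumes "{a, b, j, d} = {qa, qb, qj, qd}" "distinct [a, b, d, j]"
    and A: "A_links v1 v2 v3 v4 v5" and B: "B_links v6 v7 v8 v9 v10 v11" and C: "C_links v12 v13 v14 v15 v16"
  shows "a = qa \<and> b = qb \<and> j = qj \<and> d = qd"
proof -
  have d: "d = qd" by (rule d_is_qd[OF assms(1) A B])
  have range: "a \<in> {qa, qb, qj}" "b \<in> {qa, qb, qj}" "j \<in> {qa, qb, qj}"
  proof -
    have "a \<in> {qa, qb, qj, qd}" "b \<in> {qa, qb, qj, qd}" "j \<in> {qa, qb, qj, qd}" using assms(1) by blast+
    moreover have "a \<noteq> qd" "b \<noteq> qd" "j \<noteq> qd" using assms(2) d by auto
    ultimately show "a \<in> {qa, qb, qj}" "b \<in> {qa, qb, qj}" "j \<in> {qa, qb, qj}" by blast+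
  qed
  have R: "c \<noteq> qj" if "R_point v w n" "linked c n p" for c v w n p
    using link_from_point(3) QRS_points(2) R_no_j that by blast
  have S: "c \<noteq> qb" if "S_point v w n" "linked c n p" for c v w n p
    using link_from_point(2) QRS_points(3) S_no_b that by blast
  have "d_rel v3 v4 \<or> d_rel v4 v3" using A[unfolded A_links_def] linked_cases(4) unfolding d by blast
  then obtain v w where "R_point v w v3 \<and> S_point v w v4 \<or> R_point v w v4 \<and> S_point v w v3" unfolding d_rel_def by blast
  moreover have "linked a v3 v2" "linked a v4 v5" using A by (auto simp: A_links_def linked_sym)
  ultimately have "a \<noteq> qj \<and> a \<noteq> qb" using R S by blast
  hence a: "a = qa" using range by blast
  have bj: "b = qb \<and> j = qj \<or> b = qj \<and> j = qb" using range assms(2) a by auto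
  have "\<not> (b = qj \<and> j = qb)"
  proof
    assume h: "b = qj \<and> j = qb"
    have L: "linked qa v13 v14" "linked qj v15 v14" "linked qb v16 v12" "linked qb v12 v16" "linked qb v12 v13"
      using C[unfolded C_links_def] h unfolding a by (auto simp: linked_sym)
    have "v13 \<noteq> v16" using C by (auto simp: C_links_def)
    hence 12: "is_vertex v12" "is_point v13" using two_links[OF L(5,4)] by blast+
    have "d_rel v15 v16 \<or> d_rel v16 v15" using C[unfolded C_links_def] linked_cases(4) unfolding d by blast
    then obtain v w where vw: "R_point v w v15 \<and> S_point v w v16 \<or> R_point v w v16 \<and> S_point v w v15" unfolding d_rel_def by blast
    hence RS: "R_point v w v16" "S_point v w v15" using R L(2) by blast+
    have j15: "j_rel v15 v14" using link_from_point(3)[OF QRS_points(3)[OF RS(2)] L(2)] .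
    have 14: "v14 = v + (w + z\<^sup>2 * w)" by (rule RS_ends(4)[OF RS(2) j15])
    have b16: "b_rel v16 v12" using link_from_point(2)[OF QRS_points(2)[OF RS(1)] L(3)] .
    have e12: "v12 = v + w" by (rule RS_ends(2)[OF RS(1) b16])
    have "a_rel v13 v14" "b_rel v13 v12" using link_from_point(1)[OF 12(2) L(1)] link_from_vertex(2)[OF 12(1) L(5)] by blast+
    then obtain r where r: "r \<in> P" "arrow r True v14 v12" using arrow_ab_exists by blast
    have "has_corner kE v w" using RS(1) by (simp add: R_point_def)
    then obtain t where t: "t \<in> P" "arrow t False v12 v14" using thick_arrows unfolding e12 14 by blast
    have "{v14, v12} = {v12, v14}" by blast
    from arrows_consistent(1)[OF r(1) t(1) r(2) t(2) this] show False by simp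
  qed
  thus ?thesis using a bj d by blast
qed

text \<open>The edge \<open>(15,16)\<close> is a segment \<open>RS\<close>, and 15 is the end with a link of length \<open>qb\<close>.\<close>

lemma C_tile_points:
  assumes "a = qa \<and> b = qb \<and> j = qj \<and> d = qd" and C: "C_links v12 v13 v14 v15 v16"
  shows "\<exists>v w. R_point v w v15 \<and> v12 = v + (w + z\<^sup>2 * w)"
proof -
  have L: "linked qb v15 v14" "linked qd v15 v16" "linked qj v16 v12" using C assms(1) unfolding C_links_def by (auto simp: linked_sym)
  have "d_rel v15 v16 \<or> d_rel v16 v15" using L linked_cases(4) by blast
  then obtain v w where vw: "R_point v w v15 \<and> S_point v w v16 \<or> R_point v w v16 \<and> S_point v w v15" unfolding d_rel_def by blast
  hence RS: "R_point v w v15" "S_point v w v16"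
    using link_from_point(2)[OF QRS_points(3) L(1)] S_no_b by blast+
  have j16: "j_rel v16 v12" using link_from_point(3)[OF QRS_points(3)[OF RS(2)] L(3)] .
  have "v12 = v + (w + z\<^sup>2 * w)" by (rule RS_ends(4)[OF RS(2) j16])
  thus ?thesis using RS by blast
qed

text \<open>The edge \<open>(3,4)\<close> is a segment \<open>RS\<close>. If 4 were \<open>S\<close>, then 5 and 2 would be \<open>H\<close> and \<open>E\<close> with a type 1 arrow
  from \<open>H\<close> to \<open>E\<close>.\<close>

lemma A_tile_points:
  assumes "a = qa \<and> b = qb \<and> j = qj \<and> d = qd" and A: "A_links v1 v2 v3 v4 v5"
  shows "\<exists>w. R_point v5 w v4"
proof -
  have L: "linked qa v5 v1" "linked qa v5 v4" "linked qa v3 v2" "linked qb v1 v2" "linked qd v3 v4" "v1 \<noteq> v4"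
    using A assms(1) unfolding A_links_def by (auto simp: linked_sym)
  have 5: "is_vertex v5" "is_point v1" "is_point v4" using two_links[OF L(1,2,6)] by blast+
  have a45: "a_rel v4 v5" "a_rel v1 v5" using link_from_vertex(1)[OF 5(1)] L by blast+
  have "d_rel v3 v4 \<or> d_rel v4 v3" using L linked_cases(4) by blast
  then obtain v w where vw: "R_point v w v4 \<or> R_point v w v3 \<and> S_point v w v4" unfolding d_rel_def by blast
  have "\<not> (R_point v w v3 \<and> S_point v w v4)"
  proof
    assume RS: "R_point v w v3 \<and> S_point v w v4"
    hence "v5 = v + z\<^sup>2 * w" using RS_ends(3) a45(1) by blast
    moreover have "a_rel v3 v2" using link_from_point(1)[OF QRS_points(2) L(3)] RS by blast
    hence "v2 = v" using RS RS_ends(1) by blast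
    moreover have "b_rel v1 v2" by (rule link_from_point(2)[OF 5(2) L(4)])
    then obtain r where r: "r \<in> P" "arrow r True v5 v2" using arrow_ab_exists a45(2) by blast
    ultimately have r': "arrow r True (v + z\<^sup>2 * w) v" by simp
    have "has_corner kE v w" using RS by (simp add: R_point_def)
    then obtain t where t: "t \<in> P" "arrow t True v (v + z\<^sup>2 * w)" using thick_arrows by blast
    have "{v + z\<^sup>2 * w, v} = {v, v + z\<^sup>2 * w}" by blast
    from arrows_consistent(2)[OF r(1) t(1) r' t(2) this] have "z\<^sup>2 * w = 0" by simp
    thus False using \<open>has_corner kE v w\<close> corner_nonzero z_nonzero[OF z] by auto
  qed
  hence R: "R_point v w v4" using vw by blast
  hence "v5 = v" using RS_ends(1) a45(1) by blast
  thus ?thesis using R by blast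
qed

lemma rhomb_fourth_vertex:
  assumes "has_corner kA v w" "dist p (v + w) = l" "dist p (v + z * w) = l"
  shows "p = v \<or> p = v + (w + z * w)"
proof -
  have w: "norm w = l" "w \<noteq> 0" using corner_length[OF assms(1)] corner_nonzero[OF assms(1)] by blast+
  have c: "cross 1 z \<noteq> 0" using z_Im[OF z] by (simp add: cross_def)
  obtain \<alpha> \<beta> where ab: "(p - v) / w = of_real \<alpha> * 1 + of_real \<beta> * z" using coordinates_exist[OF c] by blast
  have p: "p = v + (of_real \<alpha> + of_real \<beta> * z) * w" using ab w by (simp add: field_simps)
  have n: "(norm (of_real s + of_real t * z))\<^sup>2 = s\<^sup>2 + t\<^sup>2 + golden * (s * t)" for s t
  proof -
    have "(Re z)\<^sup>2 + (Im z)\<^sup>2 = 1" using z_norm[OF z] cmod_power2[of z] by simp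
    hence "t\<^sup>2 * ((Re z)\<^sup>2 + (Im z)\<^sup>2) = t\<^sup>2" by simp
    moreover have "(norm (of_real s + of_real t * z))\<^sup>2 = s\<^sup>2 + t\<^sup>2 * ((Re z)\<^sup>2 + (Im z)\<^sup>2) + (2 * Re z) * (s * t)"
      unfolding cmod_power2 by (simp add: power2_eq_square algebra_simps)
    ultimately show ?thesis unfolding z_Re[OF z] by simp
  qed
  have unit: "(norm (c - e))\<^sup>2 = 1" if "dist (v + c * w) (v + e * w) = l" for c e
  proof -
    have "(v + c * w) - (v + e * w) = (c - e) * w" by (simp add: algebra_simps)
    hence "norm (c - e) * l = l" using that w by (simp add: dist_norm norm_mult)
    thus ?thesis using l_pos by simp
  qed
  have "(norm (of_real (\<alpha> - 1) + of_real \<beta> * z))\<^sup>2 = 1"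
    using unit[of "of_real \<alpha> + of_real \<beta> * z" 1] assms(2) unfolding p by (simp add: algebra_simps)
  hence 1: "(\<alpha> - 1)\<^sup>2 + \<beta>\<^sup>2 + golden * ((\<alpha> - 1) * \<beta>) = 1" unfolding n .
  have "(norm (of_real \<alpha> + of_real (\<beta> - 1) * z))\<^sup>2 = 1"
    using unit[of "of_real \<alpha> + of_real \<beta> * z" z] assms(3) unfolding p by (simp add: algebra_simps)
  hence 2: "\<alpha>\<^sup>2 + (\<beta> - 1)\<^sup>2 + golden * (\<alpha> * (\<beta> - 1)) = 1" unfolding n .
  have "(golden - 2) * (\<alpha> - \<beta>) = 0" using 1 2 by (simp add: power2_eq_square algebra_simps)
  hence ab: "\<alpha> = \<beta>" using golden_less_2 by simp
  have "(golden + 2) * (\<beta> * (\<beta> - 1)) = 0" using 1 unfolding ab by (simp add: power2_eq_square algebra_simps)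
  hence "\<beta> = 0 \<or> \<beta> = 1" using golden_gt_1 by simp
  thus ?thesis unfolding p ab by (auto simp: algebra_simps)
qed

text \<open>The vertices 6, 8 and 10 lie on two equal edges each and are vertices of rhombs. So 9 is a point \<open>Q\<close>, while 8
  and 10 are \<open>B\<close> and \<open>D\<close> in its thin rhomb. At distance \<open>l\<close> from both, 6 is \<open>A\<close> or \<open>C\<close>; if it were \<open>A\<close>, then
  7 would be 9. At \<open>C\<close> the next corner is the vertex \<open>E\<close> of the thick rhomb with the point \<open>R\<close> at 7.\<close>

lemma B_tile_points:
  assumes "a = qa \<and> b = qb \<and> j = qj \<and> d = qd" and B: "B_links v6 v7 v8 v9 v10 v11"
  shows "\<exists>v e. thin_at z v e \<and> v10 = v + e \<and> R_point v (z * e) v7"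
proof -
  have L: "linked qa v6 v11" "linked qa v6 v7" "linked qb v8 v7" "linked qb v8 v9" "linked qj v10 v9" "linked qj v10 v11"
    "v11 \<noteq> v7" "v7 \<noteq> v9" "v9 \<noteq> v11"
    using B assms(1) unfolding B_links_def by (auto simp: linked_sym)
  have V: "is_vertex v6" "is_vertex v8" "is_vertex v10"
    using two_links[OF L(1,2,7)] two_links[OF L(3,4,8)] two_links[OF L(5,6,9)] by blast+
  have r: "a_rel v11 v6" "a_rel v7 v6" "b_rel v7 v8" "b_rel v9 v8" "j_rel v9 v10" "j_rel v11 v10"
    using link_from_vertex[OF V(1)] link_from_vertex[OF V(2)] link_from_vertex[OF V(3)] L by blast+
  obtain v w where Q: "Q_point v w v9" "v8 = v + w" "v10 = v + z * w"
    using r(4,5) QRS_unique unfolding b_rel_def j_rel_def by metis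
  have A: "has_corner kA v w" using Q(1) by (simp add: Q_point_def)
  obtain r1 where r1: "r1 \<in> P" "arrow r1 True v6 v8" using arrow_ab_exists r by blast
  obtain r2 where r2: "r2 \<in> P" "arrow r2 False v6 v10" using arrow_aj_exists r by blast
  have len: "dist p p' = l" if r: "r \<in> P" and ar: "arrow r e p p'" for r e p p'
  proof -
    obtain \<kappa> u where k: "r = rhomb_at z \<kappa> p u" "has_corner \<kappa> p u" "p' = p + u \<or> p' = p + z ^ width \<kappa> * u"
      using arrow_corner[OF r ar] by blast
    thus ?thesis using corner_length[OF k(2)] norm_pow_mult[OF z] by (auto simp: dist_norm)
  qed
  have "v6 = v \<or> v6 = v + (w + z * w)"
    using rhomb_fourth_vertex[OF A] len[OF r1] len[OF r2] unfolding Q(2,3) by blast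
  moreover have "v6 \<noteq> v"
  proof
    assume v6: "v6 = v"
    have "a_rel v9 v" using Q(1) unfolding a_rel_def by blast
    hence "v9 = v7" using same_arrow_ab r v6 by blast
    thus False using L(8) by simp
  qed
  ultimately have v6: "v6 = v + (w + z * w)" by blast
  have "rhomb_at z kA v w = rhomb_at z kC (v + (w + z * w)) (- w)" by (rule rhomb_at_turn'(2))
  hence C: "has_corner kC v6 (- w)" using A unfolding has_corner_def v6 by simp
  have e: "v10 = v6 + (- w)" "v8 = v6 + z * (- w)" unfolding v6 Q by simp_all
  obtain v' w' where 7: "v6 = v'" "v8 = v' + w'" "Q_point v' w' v7 \<or> R_point v' w' v7" using arrow_ab[OF r(2,3)] by blast
  have w': "v' = v6" "w' = z * (- w)" using 7 e by simp_all
  have E: "has_corner kE v6 (z * (- w))" by (rule after_C[OF C])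
  have "\<not> has_corner kA v6 (z * (- w))" using common_sector(1)[OF E, of kA "z * (- w)" 0 0] by auto
  hence "R_point v6 (z * (- w)) v7" using 7(3) unfolding w' Q_point_def by blast
  moreover have "thin_at z v6 (- w)" using C unfolding thin_at_z .
  ultimately show ?thesis using e(1) by blast
qed

end

end

section \<open>Recomposition and iteration\<close>

lemma recomposition_segmentsI:
  "Thin A B C D \<in> P \<Longrightarrow> directly_congruent_points [A0, B0, D0, Q0] [A, B, D, Q] \<Longrightarrow>
     {closed_segment Q A, closed_segment Q B, closed_segment Q D} \<subseteq> recomposition_segments P A0 B0 D0 Q0"
  "Thick E F G H \<in> P \<Longrightarrow> directly_congruent_points [A0, B0, Q0] [E, F, R] \<Longrightarrow> directly_congruent_points [D0, A0, Q0] [G, H, S] \<Longrightarrow>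
     {closed_segment R E, closed_segment R F, closed_segment R S, closed_segment S G, closed_segment S H}
       \<subseteq> recomposition_segments P A0 B0 D0 Q0"
  unfolding recomposition_segments_def
  by (rule subset_trans[OF Union_upper Un_upper1], rule CollectI, (intro exI conjI; (rule refl | assumption)))
    (rule subset_trans[OF Union_upper Un_upper2], rule CollectI, (intro exI conjI; (rule refl | assumption)))

lemma recomposition_segmentsE:
  assumes "X \<in> recomposition_segments P A0 B0 D0 Q0"
  obtains (thin) A B C D Q where "Thin A B C D \<in> P" "directly_congruent_points [A0, B0, D0, Q0] [A, B, D, Q]"
      "X \<in> {closed_segment Q A, closed_segment Q B, closed_segment Q D}"
    | (thick) E F G H R S where "Thick E F G H \<in> P" "directly_congruent_points [A0, B0, Q0] [E, F, R]"
      "directly_congruent_points [D0, A0, Q0] [G, H, S]"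
      "X \<in> {closed_segment R E, closed_segment R F, closed_segment R S, closed_segment S G, closed_segment S H}"
  using assms unfolding recomposition_segments_def
proof (elim UnE UnionE CollectE exE conjE)
  fix Y A B C D Q
  assume "X \<in> Y" "Y = {closed_segment Q A, closed_segment Q B, closed_segment Q D}" "Thin A B C D \<in> P"
    "directly_congruent_points [A0, B0, D0, Q0] [A, B, D, Q]"
  thus thesis by (intro thin[of A B C D Q]) simp_all
next
  fix Y E F G H R S
  assume "X \<in> Y" "Y = {closed_segment R E, closed_segment R F, closed_segment R S, closed_segment S G, closed_segment S H}"
    "Thick E F G H \<in> P" "directly_congruent_points [A0, B0, Q0] [E, F, R]" "directly_congruent_points [D0, A0, Q0] [G, H, S]"
  thus thesis by (intro thick[of E F G H R S]) simp_all
qed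

lemma directly_congruent_triangle:
  assumes "norm w0 = norm w" "w0 \<noteq> 0"
  shows "directly_congruent_points [A0, A0 + w0, A0 + c * w0] [A, A + w, X] \<longleftrightarrow> X = A + c * w"
    "directly_congruent_points [A0, A0 + w0, A0 + e * w0, A0 + c * w0] [A, A + w, A + e * w, X] \<longleftrightarrow> X = A + c * w"
proof -
  have "norm w \<noteq> 0" using assms by (metis norm_eq_zero)
  hence n: "norm (w / w0) = 1" using assms(1) by (simp add: norm_divide)
  have i: "A + t * w = w / w0 * (A0 + t * w0) + (A - w / w0 * A0)" for t using assms(2) by (simp add: field_simps)
  have i1: "A = w / w0 * A0 + (A - w / w0 * A0)" "A + w = w / w0 * (A0 + w0) + (A - w / w0 * A0)"
    using i[of 0] i[of 1] by simp_all
  have conv: "X = A + c * w" if "A = u * A0 + k" "A + w = u * (A0 + w0) + k" "X = u * (A0 + c * w0) + k" for u k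
  proof -
    have "w = u * w0" using that(1,2) by (simp add: algebra_simps)
    thus ?thesis using that(1,3) by (simp add: algebra_simps)
  qed
  have I: "directly_congruent_points xs ys" if "ys = map (\<lambda>p. w / w0 * p + (A - w / w0 * A0)) xs" for xs ys
    unfolding directly_congruent_points_def using n that by blast
  show "directly_congruent_points [A0, A0 + w0, A0 + c * w0] [A, A + w, X] \<longleftrightarrow> X = A + c * w"
  proof
    assume "X = A + c * w"
    hence "[A, A + w, X] = map (\<lambda>p. w / w0 * p + (A - w / w0 * A0)) [A0, A0 + w0, A0 + c * w0]"
      using i[of c] i1 by simp
    thus "directly_congruent_points [A0, A0 + w0, A0 + c * w0] [A, A + w, X]"
      by (rule I)
  next
    assume "directly_congruent_points [A0, A0 + w0, A0 + c * w0] [A, A + w, X]"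
    then obtain u k where uk: "[A, A + w, X] = map (\<lambda>p. u * p + k) [A0, A0 + w0, A0 + c * w0]"
      unfolding directly_congruent_points_def by (elim exE conjE) (rule that)
    show "X = A + c * w" using uk unfolding list.map list.inject by (elim conjE) (rule conv; assumption)
  qed
  show "directly_congruent_points [A0, A0 + w0, A0 + e * w0, A0 + c * w0] [A, A + w, A + e * w, X] \<longleftrightarrow> X = A + c * w"
  proof
    assume "X = A + c * w"
    hence "[A, A + w, A + e * w, X] = map (\<lambda>p. w / w0 * p + (A - w / w0 * A0)) [A0, A0 + w0, A0 + e * w0, A0 + c * w0]"
      using i[of c] i[of e] i1 by simp
    thus "directly_congruent_points [A0, A0 + w0, A0 + e * w0, A0 + c * w0] [A, A + w, A + e * w, X]"
      by (rule I)
  next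
    assume "directly_congruent_points [A0, A0 + w0, A0 + e * w0, A0 + c * w0] [A, A + w, A + e * w, X]"
    then obtain u k where uk: "[A, A + w, A + e * w, X] = map (\<lambda>p. u * p + k) [A0, A0 + w0, A0 + e * w0, A0 + c * w0]"
      unfolding directly_congruent_points_def by (elim exE conjE) (rule that)
    show "X = A + c * w" using uk unfolding list.map list.inject by (elim conjE) (rule conv; assumption)
  qed
qed

definition proper_segment :: "real set \<Rightarrow> complex set \<Rightarrow> bool" where
  "proper_segment L X \<longleftrightarrow> (\<exists>u v. u \<noteq> v \<and> dist u v \<in> L \<and> X = closed_segment u v)"

lemma proper_segmentI: "u \<noteq> v \<Longrightarrow> dist u v \<in> L \<Longrightarrow> proper_segment L (closed_segment u v)"
  unfolding proper_segment_def by blast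

lemma proper_segment_ends:
  assumes "proper_segment L (closed_segment u v)"
  shows "u \<noteq> v" "dist u v \<in> L"
proof -
  obtain x y where xy: "x \<noteq> y" "dist x y \<in> L" "closed_segment u v = closed_segment x y"
    using assms unfolding proper_segment_def by blast
  have "u = x \<and> v = y \<or> u = y \<and> v = x" using xy(3) unfolding closed_segment_eq by (simp add: doubleton_eq_iff)
  thus "u \<noteq> v" "dist u v \<in> L" using xy by (auto simp: dist_commute)
qed

lemma tile_edges_proper:
  assumes T: "ammann_tiling a b d j T" and t: "t \<in> T" and X: "X \<in> tile_edges t"
  shows "proper_segment {a, b, j, d} X"
proof (cases t)
  case (TileA v1 v2 v3 v4 v5)
  note g = tile_A[OF T t[unfolded TileA]]
  have "X = closed_segment v5 v1 \<or> X = closed_segment v2 v3 \<or> X = closed_segment v4 v5 \<or> X = closed_segment v1 v2 \<or> X = closed_segment v3 v4"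
    using X unfolding TileA tile_edges_def by simp blast
  thus ?thesis by (elim disjE; simp only:; intro proper_segmentI) (use g in auto)
next
  case (TileB v6 v7 v8 v9 v10 v11)
  note g = tile_B[OF T t[unfolded TileB]]
  have "X = closed_segment v11 v6 \<or> X = closed_segment v6 v7 \<or> X = closed_segment v7 v8 \<or> X = closed_segment v8 v9 \<or>
      X = closed_segment v9 v10 \<or> X = closed_segment v10 v11"
    using X unfolding TileB tile_edges_def by simp blast
  thus ?thesis by (elim disjE; simp only:; intro proper_segmentI) (use g in auto)
next
  case (TileC v12 v13 v14 v15 v16)
  note g = tile_C[OF T t[unfolded TileC]]
  have "X = closed_segment v13 v14 \<or> X = closed_segment v14 v15 \<or> X = closed_segment v15 v16 \<or> X = closed_segment v16 v12 \<or>
      X = closed_segment v12 v13"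
    using X unfolding TileC tile_edges_def by simp blast
  thus ?thesis by (elim disjE; simp only:; intro proper_segmentI) (use g in auto)
qed

lemma tile_lengths_occur:
  assumes T: "ammann_tiling a b d j T" and c: "c \<in> {a, b, j, d}"
  shows "\<exists>t\<in>T. \<exists>u v. closed_segment u v \<in> tile_edges t \<and> dist u v = c"
proof -
  obtain v1 v2 v3 v4 v5 where A: "TileA v1 v2 v3 v4 v5 \<in> T" using all_kinds_of_tiles(1)[OF T] by blast
  obtain v6 v7 v8 v9 v10 v11 where B: "TileB v6 v7 v8 v9 v10 v11 \<in> T" using all_kinds_of_tiles(2)[OF T] by blast
  have "closed_segment v5 v1 \<in> tile_edges (TileA v1 v2 v3 v4 v5)" "closed_segment v1 v2 \<in> tile_edges (TileA v1 v2 v3 v4 v5)"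
    "closed_segment v3 v4 \<in> tile_edges (TileA v1 v2 v3 v4 v5)" "closed_segment v9 v10 \<in> tile_edges (TileB v6 v7 v8 v9 v10 v11)"
    by (simp_all add: tile_edges_def)
  moreover have "c = dist v5 v1 \<or> c = dist v1 v2 \<or> c = dist v3 v4 \<or> c = dist v9 v10"
    using c tile_A[OF T A] tile_B[OF T B] by auto
  ultimately show ?thesis using A B by blast
qed

lemma (in rhomb_tiling) edge_pool_length:
  assumes "closed_segment u v \<in> edge_pool" shows "dist u v = l * golden"
proof -
  have pairs: "dist u v = dist n p" if "closed_segment u v = closed_segment n p" for n p
  proof -
    have "u = n \<and> v = p \<or> u = p \<and> v = n" using that unfolding closed_segment_eq by (simp add: doubleton_eq_iff)
    thus ?thesis by (auto simp: dist_commute)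
  qed
  from assms consider (thin) x d where "thin_at z x d" "closed_segment u v = closed_segment (x + d) (x + of_real golden * (z\<^sup>2 * d))"
    | (thick) x k where "thick_at z x k" "closed_segment u v = closed_segment x (x + (k + z\<^sup>2 * k))"
    unfolding edge_pool_def by blast
  thus ?thesis
  proof cases
    case thin
    have "norm d = l" using corner_length thin(1) unfolding thin_at_z by blast
    thus ?thesis using pairs[OF thin(2)] golden_dists(5)[OF z] by simp
  next
    case thick
    have "norm k = l" using corner_length thick(1) unfolding thick_at_z by blast
    hence "dist x (x + (k + z\<^sup>2 * k)) = l * golden"
      unfolding sum_side[OF z] using golden_gt_1 z_norm[OF z] by (simp add: dist_norm norm_mult)
    thus ?thesis using pairs[OF thick(2)] by simp
  qed
qed

context recomposed_tiling
begin

lemma thin_corner: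
  assumes "Thin A B C D \<in> P"
  shows "has_corner kA A (B - A)" "B = A + (B - A)" "D = A + z * (B - A)"
proof -
  note s = thin_shape[OF assms]
  show D: "D = A + z * (B - A)" using s by (simp add: algebra_simps)
  have "C = B + (D - A)" using s by simp
  hence "C = B + z * (B - A)" unfolding conjunct1[OF conjunct2[OF s]] .
  hence "rhomb_at z kA A (B - A) = Thin A B C D" unfolding D by (simp add: algebra_simps)
  thus "has_corner kA A (B - A)" using assms by (simp add: has_corner_def)
  show "B = A + (B - A)" by simp
qed

lemma thick_corner:
  assumes "Thick E F G H \<in> P"
  shows "has_corner kE E (F - E)" "F = E + (F - E)" "H = E + z\<^sup>2 * (F - E)" "G = E + ((F - E) + z\<^sup>2 * (F - E))"
proof -
  note s = thick_shape[OF assms]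
  show H: "H = E + z\<^sup>2 * (F - E)" using s by (simp add: algebra_simps)
  have "G = F + (H - E)" using s by simp
  hence "G = F + z\<^sup>2 * (F - E)" unfolding conjunct1[OF conjunct2[OF s]] .
  thus G: "G = E + ((F - E) + z\<^sup>2 * (F - E))" by (simp add: algebra_simps)
  have "rhomb_at z kE E (F - E) = Thick E F G H" unfolding G H by (simp add: algebra_simps)
  thus "has_corner kE E (F - E)" using assms by (simp add: has_corner_def)
  show "F = E + (F - E)" by simp
qed

text \<open>For \<open>S\<close> the congruence starts from the edge \<open>DA\<close>, so its coordinate along that edge is \<open>1 - cnj z * q\<close>.\<close>

lemma congruent_points:
  assumes "norm w0 = norm w" "w0 \<noteq> 0"
  shows "directly_congruent_points [A0, A0 + w0, A0 + z * w0, A0 + q * w0] [v, v + w, v + z * w, n] \<longleftrightarrow> n = v + q * w"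
    "directly_congruent_points [A0, A0 + w0, A0 + q * w0] [v, v + w, n] \<longleftrightarrow> n = v + q * w"
    "directly_congruent_points [A0 + z * w0, A0, A0 + q * w0] [v + (w + z\<^sup>2 * w), v + z\<^sup>2 * w, n] \<longleftrightarrow>
       n = v + (z\<^sup>2 + cnj z * q) * w"
proof -
  show "directly_congruent_points [A0, A0 + w0, A0 + z * w0, A0 + q * w0] [v, v + w, v + z * w, n] \<longleftrightarrow> n = v + q * w"
    "directly_congruent_points [A0, A0 + w0, A0 + q * w0] [v, v + w, n] \<longleftrightarrow> n = v + q * w"
    by (rule directly_congruent_triangle[OF assms])+
  have zz: "z * cnj z = 1" using z_cnj(1)[OF z] by (simp add: mult.commute)
  have "norm (- (z * w0)) = norm (- w)" "- (z * w0) \<noteq> 0" using assms z_norm[OF z] z_nonzero[OF z] by (simp_all add: norm_mult)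
  note * = directly_congruent_triangle(1)[OF this, of "A0 + z * w0" "1 - cnj z * q" "v + (w + z\<^sup>2 * w)" n]
  have "(z * w0) * (cnj z * q) = q * w0" using zz by (simp add: algebra_simps)
  hence 1: "A0 + z * w0 + (1 - cnj z * q) * - (z * w0) = A0 + q * w0" by (simp add: algebra_simps)
  have 2: "v + (w + z\<^sup>2 * w) + (1 - cnj z * q) * - w = v + (z\<^sup>2 + cnj z * q) * w" by (simp add: algebra_simps)
  have 3: "A0 + z * w0 + - (z * w0) = A0" "v + (w + z\<^sup>2 * w) + - w = v + z\<^sup>2 * w" by simp_all
  show "directly_congruent_points [A0 + z * w0, A0, A0 + q * w0] [v + (w + z\<^sup>2 * w), v + z\<^sup>2 * w, n] \<longleftrightarrow>
       n = v + (z\<^sup>2 + cnj z * q) * w"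
    using * unfolding 1 2 3 .
qed

lemma recomposition_segments_eq:
  assumes A0: "Thin A0 B0 C0 D0 \<in> P" and Q0: "Q0 = A0 + q * (B0 - A0)"
  shows "recomposition_segments P A0 B0 D0 Q0 = {closed_segment n p | n p. seg n p}"
proof -
  define w0 where "w0 = B0 - A0"
  have w0: "norm w0 = l" "w0 \<noteq> 0" using corner_length[OF thin_corner(1)[OF A0]] corner_nonzero[OF thin_corner(1)[OF A0]] by (simp_all add: w0_def)
  have e: "B0 = A0 + w0" "D0 = A0 + z * w0" "Q0 = A0 + q * w0" using thin_corner[OF A0] Q0 by (simp_all add: w0_def)
  let ?S = "recomposition_segments P A0 B0 D0 Q0"
  have Q: "closed_segment n v \<in> ?S \<and> closed_segment n (v + w) \<in> ?S \<and> closed_segment n (v + z * w) \<in> ?S" if "Q_point v w n" for v w n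
  proof -
    have c: "has_corner kA v w" and n: "n = v + q * w" using that by (simp_all add: Q_point_def)
    have T: "Thin v (v + w) (v + (w + z * w)) (v + z * w) \<in> P" using c by (simp add: has_corner_def)
    have "directly_congruent_points [A0, B0, D0, Q0] [v, v + w, v + z * w, n]"
      unfolding e congruent_points(1)[OF trans[OF w0(1) corner_length[OF c, symmetric]] w0(2)] by (rule n)
    hence "{closed_segment n v, closed_segment n (v + w), closed_segment n (v + z * w)} \<subseteq> ?S"
      by (rule recomposition_segmentsI(1)[OF T])
    thus ?thesis by simp
  qed
  have RS: "closed_segment n v \<in> ?S \<and> closed_segment n (v + w) \<in> ?S \<and> closed_segment n m \<in> ?S \<and>
      closed_segment m (v + (w + z\<^sup>2 * w)) \<in> ?S \<and> closed_segment m (v + z\<^sup>2 * w) \<in> ?S" if "R_point v w n" "S_point v w m" for v w n m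
  proof -
    have c: "has_corner kE v w" and n: "n = v + q * w" "m = v + (z\<^sup>2 + cnj z * q) * w" using that by (simp_all add: R_point_def S_point_def)
    have T: "Thick v (v + w) (v + (w + z\<^sup>2 * w)) (v + z\<^sup>2 * w) \<in> P" using c by (simp add: has_corner_def)
    note l = trans[OF w0(1) corner_length[OF c, symmetric]]
    have "directly_congruent_points [A0, B0, Q0] [v, v + w, n]" unfolding e congruent_points(2)[OF l w0(2)] by (rule n)
    moreover have "directly_congruent_points [D0, A0, Q0] [v + (w + z\<^sup>2 * w), v + z\<^sup>2 * w, m]"
      unfolding e congruent_points(3)[OF l w0(2)] by (rule n)
    ultimately have "{closed_segment n v, closed_segment n (v + w), closed_segment n m,
       closed_segment m (v + (w + z\<^sup>2 * w)), closed_segment m (v + z\<^sup>2 * w)} \<subseteq> ?S"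
      by (rule recomposition_segmentsI(2)[OF T])
    thus ?thesis by simp
  qed
  have R: "\<exists>m. S_point v w m" if "R_point v w n" for v w n using that by (simp add: R_point_def S_point_def)
  have S: "\<exists>m. R_point v w m" if "S_point v w n" for v w n using that by (simp add: R_point_def S_point_def)
  show ?thesis
  proof (intro subset_antisym subsetI)
    fix X assume "X \<in> {closed_segment n p | n p. seg n p}"
    then obtain n p where X: "X = closed_segment n p" and "seg n p" by blast
    moreover have "closed_segment n p \<in> ?S" if "a_rel n p" using that unfolding a_rel_def by (elim exE disjE conjE) (use Q RS R S in blast)+
    moreover have "closed_segment n p \<in> ?S" if "b_rel n p" using that unfolding b_rel_def by (elim exE disjE conjE) (use Q RS R S in blast)+
    moreover have "closed_segment n p \<in> ?S" if "j_rel n p" using that unfolding j_rel_def by (elim exE disjE conjE) (use Q RS R S in blast)+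
    moreover have "closed_segment n p \<in> ?S" if "d_rel n p" using that unfolding d_rel_def by (elim exE disjE conjE) (use RS in blast)
    ultimately have "closed_segment n p \<in> ?S" unfolding seg_def by blast
    thus "X \<in> ?S" using X by simp
  next
    fix X assume "X \<in> ?S"
    thus "X \<in> {closed_segment n p | n p. seg n p}"
    proof (cases rule: recomposition_segmentsE)
      case (thin A B C D Q)
      define w where "w = B - A"
      note t = thin_corner[OF thin(1), folded w_def]
      have "Q_point A w Q"
        using thin(2) t(1) unfolding t(2,3) e congruent_points(1)[OF trans[OF w0(1) corner_length[OF t(1), symmetric]] w0(2)] Q_point_def by blast
      hence "seg Q A" "seg Q B" "seg Q D" using rel_intros unfolding t(2,3) seg_def by blast+
      thus ?thesis using thin(3) by blast
    next
      case (thick E F G H R S)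
      define w where "w = F - E"
      note t = thick_corner[OF thick(1), folded w_def]
      note l = trans[OF w0(1) corner_length[OF t(1), symmetric]]
      have RS': "R_point E w R" "S_point E w S"
        using thick(2,3) t(1) unfolding t(2,3,4) e congruent_points(2,3)[OF l w0(2)] R_point_def S_point_def by blast+
      hence "d_rel R S" unfolding d_rel_def by blast
      hence "seg R E" "seg R F" "seg R S" "seg S G" "seg S H"
        using rel_intros(2,5)[OF RS'(1)] rel_intros(3,7)[OF RS'(2)] unfolding t(2,3,4) seg_def by simp_all
      thus ?thesis using thick(4) by blast
    qed
  qed
qed

lemma all_lengths_occur:
  assumes A0: "Thin A0 B0 C0 D0 \<in> P" and c: "c \<in> {qa, qb, qj, qd}"
  shows "\<exists>n p. seg n p \<and> dist n p = c"
proof -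
  define w where "w = B0 - A0"
  have k: "has_corner kA A0 w" unfolding w_def by (rule thin_corner(1)[OF A0])
  have Q: "Q_point A0 w (A0 + q * w)" using k by (simp add: Q_point_def)
  have "rhomb_at z kA A0 w = rhomb_at z kC (A0 + (w + z * w)) (- w)" by (rule rhomb_at_turn'(2))
  hence "has_corner kC (A0 + (w + z * w)) (- w)" using k unfolding has_corner_def by simp
  from after_C[OF this] obtain v u where E: "has_corner kE v u" by blast
  hence d: "d_rel (v + q * u) (v + (z\<^sup>2 + cnj z * q) * u)" unfolding d_rel_def R_point_def S_point_def by blast
  from c consider "c = qa" | "c = qb" | "c = qj" | "c = qd" by blast
  thus ?thesis
  proof cases
    case 1 thus ?thesis using rel_intros(1)[OF Q] rel_lengths(1) unfolding seg_def by blast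
  next
    case 2 thus ?thesis using rel_intros(4)[OF Q] rel_lengths(2) unfolding seg_def by blast
  next
    case 3 thus ?thesis using rel_intros(6)[OF Q] rel_lengths(3) unfolding seg_def by blast
  next
    case 4 thus ?thesis using d rel_lengths(4) unfolding seg_def by blast
  qed
qed

subsection \<open>The iterated tiling\<close>

text \<open>The segments of kinds (1), (2) and (3) of the iteration, all starting at a point \<open>R\<close>: the segments \<open>RG\<close>; the
  segments \<open>RD\<close> with \<open>D\<close> in the thin rhomb that meets the thick rhomb of \<open>R\<close> in its edge \<open>CB = EF\<close>; and the
  segments \<open>RE\<close>.\<close>

definition a_rel' :: "complex \<Rightarrow> complex \<Rightarrow> bool" where
  "a_rel' n p \<longleftrightarrow> (\<exists>v w. R_point v w n \<and> p = v + (w + z\<^sup>2 * w))"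

definition b_rel' :: "complex \<Rightarrow> complex \<Rightarrow> bool" where
  "b_rel' n p \<longleftrightarrow> (\<exists>v e. thin_at z v e \<and> R_point v (z * e) n \<and> p = v + e)"

definition j_rel' :: "complex \<Rightarrow> complex \<Rightarrow> bool" where
  "j_rel' n p \<longleftrightarrow> (\<exists>w. R_point p w n)"

lemma rel'_types:
  "a_rel' n p \<Longrightarrow> is_point n \<and> is_vertex p" "b_rel' n p \<Longrightarrow> is_point n \<and> is_vertex p" "j_rel' n p \<Longrightarrow> is_point n \<and> is_vertex p"
proof -
  have G: "is_vertex (v + (w + z\<^sup>2 * w))" if "R_point v w n" for v w n
    using corner_is_vertex[of kE v w] that by (simp add: R_point_def)
  have D: "is_vertex (v + e)" if "thin_at z v e" for v e
    using corner_is_vertex[of kC v e] that unfolding thin_at_z by blast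
  show "a_rel' n p \<Longrightarrow> is_point n \<and> is_vertex p" unfolding a_rel'_def using G QRS_points(2) by blast
  show "b_rel' n p \<Longrightarrow> is_point n \<and> is_vertex p" unfolding b_rel'_def using D QRS_points(2) by blast
  show "j_rel' n p \<Longrightarrow> is_point n \<and> is_vertex p" unfolding j_rel'_def using RS_vertices(1) QRS_points(2) by blast
qed

lemma rel'_functional: "a_rel' n p \<Longrightarrow> a_rel' n p' \<Longrightarrow> p = p'" "j_rel' n p \<Longrightarrow> j_rel' n p' \<Longrightarrow> p = p'"
proof -
  assume "a_rel' n p" "a_rel' n p'"
  then obtain v w v' w' where "R_point v w n" "p = v + (w + z\<^sup>2 * w)" "R_point v' w' n" "p' = v' + (w' + z\<^sup>2 * w')"
    unfolding a_rel'_def by blast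
  thus "p = p'" using QRS_unique(2)[of v w n v' w'] by simp
next
  assume "j_rel' n p" "j_rel' n p'"
  thus "p = p'" unfolding j_rel'_def using QRS_unique(2) by blast
qed

text \<open>Again at most one segment of each kind starts at a point.\<close>

lemma centre_of_two:
  assumes "n \<noteq> m"
  shows "a_rel' n p \<or> a_rel' p n \<Longrightarrow> a_rel' m p \<or> a_rel' p m \<Longrightarrow> a_rel' n p \<and> a_rel' m p"
    "j_rel' n p \<or> j_rel' p n \<Longrightarrow> j_rel' m p \<or> j_rel' p m \<Longrightarrow> j_rel' n p \<and> j_rel' m p"
  using rel'_types rel'_functional point_or_vertex assms by blast+

lemma from_point':
  assumes "is_point n"
  shows "a_rel' n p \<or> a_rel' p n \<Longrightarrow> a_rel' n p" "b_rel' n p \<or> b_rel' p n \<Longrightarrow> b_rel' n p" "j_rel' n p \<or> j_rel' p n \<Longrightarrow> j_rel' n p"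
  using rel'_types point_or_vertex assms by blast+

text \<open>The point \<open>R\<close> determines its thick rhomb, so that the ends \<open>G\<close> and \<open>D\<close>, or \<open>G\<close> and \<open>E\<close>, belong together as in
  \<open>edge_pool\<close>.\<close>

lemma diagonals_in_pool:
  "a_rel' n p \<Longrightarrow> b_rel' n p' \<Longrightarrow> closed_segment p' p \<in> edge_pool"
  "a_rel' n p \<Longrightarrow> j_rel' n p' \<Longrightarrow> closed_segment p' p \<in> edge_pool"
proof -
  assume "a_rel' n p"
  then obtain v w where R: "R_point v w n" "p = v + (w + z\<^sup>2 * w)" unfolding a_rel'_def by blast
  show "closed_segment p' p \<in> edge_pool" if br: "b_rel' n p'"
  proof -
    obtain v' e where e: "thin_at z v' e" "R_point v' (z * e) n" "p' = v' + e" using br unfolding b_rel'_def by blast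
    have vw: "v' = v" "z * e = w" using QRS_unique(2)[OF R(1) e(2)] by blast+
    have "p = v + of_real golden * (z\<^sup>2 * e)"
      using sum_side[OF z, of "z * e"] unfolding R(2) vw(2)[symmetric] by (simp add: power2_eq_square mult.assoc)
    thus ?thesis unfolding edge_pool_def e(3) vw(1) using e(1)[unfolded vw(1)] by blast
  qed
  show "closed_segment p' p \<in> edge_pool" if jr: "j_rel' n p'"
  proof -
    obtain w' where w': "R_point p' w' n" using jr unfolding j_rel'_def by blast
    have "v = p'" "w = w'" using QRS_unique(2)[OF w' R(1)] by blast+
    moreover have "thick_at z v w" using R(1) unfolding R_point_def thick_at_z by blast
    ultimately show ?thesis unfolding edge_pool_def R(2) by blast
  qed
qed

text \<open>The vertices 5, 6 and 12 lie on two equal edges each, so they are vertices of rhombs, and the neighbouring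
  vertices of the tile are points \<open>R\<close>; the second edge at such a point leads to the other end of the diagonal.\<close>

lemma iterated_diagonals_in_pool:
  assumes T': "ammann_tiling a' b' d' j' T'" and t: "t \<in> T'"
    and a: "\<And>t. t \<in> T' \<Longrightarrow> a_edges t \<subseteq> {closed_segment p n | n p. a_rel' n p}"
    and b: "\<And>t. t \<in> T' \<Longrightarrow> b_edges t \<subseteq> {closed_segment n p | n p. b_rel' n p}"
    and j: "\<And>t. t \<in> T' \<Longrightarrow> j_edges t \<subseteq> {closed_segment n p | n p. j_rel' n p}"
  shows "tile_diagonals t \<subseteq> edge_pool"
proof -
  have pairs: "u = n \<and> v = p \<or> u = p \<and> v = n" if "closed_segment u v = closed_segment n p" for u v n p :: complex
    using that unfolding closed_segment_eq by (simp add: doubleton_eq_iff)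
  have a': "a_rel' u v \<or> a_rel' v u" if "closed_segment u v \<in> a_edges t" for u v using a[OF t] that pairs by blast
  have b'': "b_rel' u v \<or> b_rel' v u" if "closed_segment u v \<in> b_edges t" for u v using b[OF t] that pairs by blast
  have j'': "j_rel' u v \<or> j_rel' v u" if "closed_segment u v \<in> j_edges t" for u v using j[OF t] that pairs by blast
  show ?thesis
  proof (cases t)
    case (TileA v1 v2 v3 v4 v5)
    have "v1 \<noteq> v4" using tile_A(1)[OF T' t[unfolded TileA]] by simp
    hence 1: "a_rel' v1 v5" using centre_of_two(1) a'[of v5 v1] a'[of v4 v5] unfolding TileA by auto
    have "b_rel' v1 v2" using from_point'(2) rel'_types(1)[OF 1] b''[of v1 v2] unfolding TileA by auto
    thus ?thesis using diagonals_in_pool(1)[OF 1] unfolding TileA by simp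
  next
    case (TileB v6 v7 v8 v9 v10 v11)
    have "v7 \<noteq> v11" using tile_B(1)[OF T' t[unfolded TileB]] by simp
    hence 1: "a_rel' v7 v6" "a_rel' v11 v6" using centre_of_two(1)[of v7 v11 v6] a'[of v11 v6] a'[of v6 v7] unfolding TileB by auto
    have "b_rel' v7 v8" using from_point'(2) rel'_types(1)[OF 1(1)] b''[of v7 v8] unfolding TileB by auto
    moreover have "j_rel' v11 v10" using from_point'(3) rel'_types(1)[OF 1(2)] j''[of v10 v11] unfolding TileB by auto
    ultimately show ?thesis using diagonals_in_pool(1)[OF 1(1)] diagonals_in_pool(2)[OF 1(2)]
      unfolding TileB by (simp add: closed_segment_commute[of v6])
  next
    case (TileC v12 v13 v14 v15 v16)
    have "v13 \<noteq> v16" using tile_C(1)[OF T' t[unfolded TileC]] by simp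
    hence 1: "j_rel' v13 v12" using centre_of_two(2)[of v13 v16 v12] j''[of v16 v12] j''[of v12 v13] unfolding TileC by auto
    have "a_rel' v13 v14" using from_point'(1) rel'_types(3)[OF 1] a'[of v13 v14] unfolding TileC by auto
    thus ?thesis using diagonals_in_pool(2) 1 unfolding TileC by simp
  qed
qed

lemma linked_edge:
  assumes E: "(\<Union>t\<in>T. tile_edges t) = {closed_segment n p | n p. seg n p}"
    and "t \<in> T" "closed_segment u v \<in> tile_edges t" "dist u v = c"
  shows "linked c u v"
proof -
  have "closed_segment u v \<in> {closed_segment n p | n p. seg n p}" using assms by blast
  then obtain n p where np: "closed_segment u v = closed_segment n p" "seg n p" by blast
  have "u = n \<and> v = p \<or> u = p \<and> v = n" using np(1) unfolding closed_segment_eq by (simp add: doubleton_eq_iff)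
  thus ?thesis using np(2) assms(4) unfolding linked_def by blast
qed

text \<open>Both are the set of the lengths of all edges of \<open>T\<close>.\<close>

lemma lengths_agree:
  assumes T: "ammann_tiling a b d j T"
    and E: "(\<Union>t\<in>T. tile_edges t) = {closed_segment n p | n p. seg n p}" and A0: "Thin A0 B0 C0 D0 \<in> P"
  shows "{a, b, j, d} = {qa, qb, qj, qd}"
proof (intro subset_antisym subsetI)
  fix c assume "c \<in> {a, b, j, d}"
  then obtain t u v where t: "t \<in> T" "closed_segment u v \<in> tile_edges t" "dist u v = c" using tile_lengths_occur[OF T] by blast
  have "linked c u v" by (rule linked_edge[OF E t])
  thus "c \<in> {qa, qb, qj, qd}" by (rule linked_range)
next
  fix c assume "c \<in> {qa, qb, qj, qd}"
  then obtain n p where np: "seg n p" "dist n p = c" using all_lengths_occur[OF A0] by blast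
  have "closed_segment n p \<in> (\<Union>t\<in>T. tile_edges t)" unfolding E using np(1) by blast
  then obtain t where "t \<in> T" "closed_segment n p \<in> tile_edges t" by blast
  from proper_segment_ends(2)[OF tile_edges_proper[OF T this]] show "c \<in> {a, b, j, d}" using np(2) by simp
qed

end

context recomposed_distinct
begin

lemma iteration_segments_at_points:
  assumes T: "ammann_tiling a b d j T" and dist: "distinct [a, b, d, j]"
    and E: "(\<Union>t\<in>T. tile_edges t) = {closed_segment n p | n p. seg n p}" and A0: "Thin A0 B0 C0 D0 \<in> P"
  shows "iteration_segments1 T \<subseteq> {closed_segment p n | n p. a_rel' n p}"
    "iteration_segments2 T \<subseteq> {closed_segment n p | n p. b_rel' n p}"
    "iteration_segments3 T \<subseteq> {closed_segment n p | n p. j_rel' n p}"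
proof -
  have A: "A_links a b d v1 v2 v3 v4 v5" if "TileA v1 v2 v3 v4 v5 \<in> T" for v1 v2 v3 v4 v5
    unfolding A_links_def using tile_A[OF T that]
    by (intro conjI linked_edge[OF E that]) (simp_all add: tile_edges_def)
  have B: "B_links a b j v6 v7 v8 v9 v10 v11" if "TileB v6 v7 v8 v9 v10 v11 \<in> T" for v6 v7 v8 v9 v10 v11
    unfolding B_links_def using tile_B[OF T that]
    by (intro conjI linked_edge[OF E that]) (simp_all add: tile_edges_def)
  have C: "C_links a b d j v12 v13 v14 v15 v16" if "TileC v12 v13 v14 v15 v16 \<in> T" for v12 v13 v14 v15 v16
    unfolding C_links_def using tile_C[OF T that]
    by (intro conjI linked_edge[OF E that]) (simp_all add: tile_edges_def)
  obtain v1 v2 v3 v4 v5 where a: "TileA v1 v2 v3 v4 v5 \<in> T" using all_kinds_of_tiles(1)[OF T] by blast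
  obtain v6 v7 v8 v9 v10 v11 where b: "TileB v6 v7 v8 v9 v10 v11 \<in> T" using all_kinds_of_tiles(2)[OF T] by blast
  obtain v12 v13 v14 v15 v16 where c: "TileC v12 v13 v14 v15 v16 \<in> T" using all_kinds_of_tiles(3)[OF T] by blast
  note len = lengths_identified[OF lengths_agree[OF T E A0] dist A[OF a] B[OF b] C[OF c]]
  show "iteration_segments1 T \<subseteq> {closed_segment p n | n p. a_rel' n p}"
    unfolding iteration_segments1_def a_rel'_def using C_tile_points[OF len C] by blast
  show "iteration_segments2 T \<subseteq> {closed_segment n p | n p. b_rel' n p}"
    unfolding iteration_segments2_def b_rel'_def using B_tile_points[OF len B] by blast
  show "iteration_segments3 T \<subseteq> {closed_segment n p | n p. j_rel' n p}"
    unfolding iteration_segments3_def j_rel'_def using A_tile_points[OF len A] by blast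
qed

end

text \<open>The chosen point is none of \<open>A, B, D\<close> because it is joined to them by edges of tiles, and the four lengths are
  distinct because they form the same set as the four edge lengths of \<open>T\<close>.\<close>

lemma recomposition_parameters:
  assumes T: "ammann_tiling a b d j T" and dist: "distinct [a, b, d, j]"
    and rt: "rhomb_tiling P z l" and rec: "arises_by_recomposition P T"
  obtains q x y A0 B0 C0 D0 where "recomposed_distinct P z l q x y" "Thin A0 B0 C0 D0 \<in> P"
    "(\<Union>t\<in>T. tile_edges t) = {closed_segment n p | n p. recomposed_tiling.seg P z q n p}"
proof -
  interpret rhomb_tiling P z l by (rule rt)
  from rec obtain A0 B0 C0 D0 Q0 where A0: "Thin A0 B0 C0 D0 \<in> P" and Q0: "Q0 \<in> convex hull {A0, B0, D0}"
    and E: "(\<Union>t\<in>T. tile_edges t) = recomposition_segments P A0 B0 D0 Q0"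
    unfolding arises_by_recomposition_def by (elim exE conjE) (rule that; assumption)
  have sh: "dist A0 B0 = l" "D0 - A0 = z * (B0 - A0)" using thin_shape[OF A0] by blast+
  have w0: "B0 - A0 \<noteq> 0" using sh(1) l_pos by auto
  obtain x y where xy: "0 \<le> x" "0 \<le> y" "x + y \<le> 1" "Q0 = A0 + x *\<^sub>R (B0 - A0) + y *\<^sub>R (D0 - A0)"
    using Q0 unfolding convex_hull_3_alt by blast
  define q where "q = complex_of_real x + of_real y * z"
  have Qq: "Q0 = A0 + q * (B0 - A0)" unfolding xy(4) sh(2) q_def by (simp add: scaleR_conv_of_real algebra_simps)
  have "directly_congruent_points [A0, B0, D0, Q0] [A0, B0, D0, Q0]"
    unfolding directly_congruent_points_def by (rule exI[of _ 1], rule exI[of _ 0]) simp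
  hence "{closed_segment Q0 A0, closed_segment Q0 B0, closed_segment Q0 D0} \<subseteq> (\<Union>t\<in>T. tile_edges t)"
    unfolding E by (rule recomposition_segmentsI(1)[OF A0])
  moreover have "Q0 \<noteq> v" if v: "closed_segment Q0 v \<in> (\<Union>t\<in>T. tile_edges t)" for v
  proof -
    obtain t where "t \<in> T" "closed_segment Q0 v \<in> tile_edges t" using v by (elim UN_E)
    from proper_segment_ends(1)[OF tile_edges_proper[OF T this]] show ?thesis .
  qed
  ultimately have ne: "Q0 \<noteq> A0" "Q0 \<noteq> B0" "Q0 \<noteq> D0" by simp_all
  have "q \<noteq> 0" using ne(1) Qq by auto
  moreover have "q \<noteq> 1" using ne(2) Qq by auto
  moreover have "q \<noteq> z"
  proof
    assume "q = z"
    hence "Q0 = A0 + (D0 - A0)" using Qq sh(2) by simp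
    thus False using ne(3) by simp
  qed
  ultimately interpret recomposed_tiling P z l q x y by unfold_locales (use q_def xy in auto)
  have E': "(\<Union>t\<in>T. tile_edges t) = {closed_segment n p | n p. seg n p}"
    unfolding E by (rule recomposition_segments_eq[OF A0 Qq])
  have "set [qa, qb, qj, qd] = set [a, b, d, j]" using lengths_agree[OF T E' A0] by auto
  hence "distinct [qa, qb, qj, qd]" using distinct_card[OF dist] by (intro card_distinct) simp
  hence "recomposed_distinct P z l q x y" by unfold_locales
  thus ?thesis by (rule that[OF _ A0 E'])
qed

lemma iteration_diagonals:
  assumes T: "ammann_tiling a b d j T" and dist: "distinct [a, b, d, j]"
    and rt: "rhomb_tiling P z l" and rec: "arises_by_recomposition P T"
    and T': "ammann_tiling a' b' d' j' T'" and it: "ammann_iteration T T'" and t: "t \<in> T'"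
    and X: "X \<in> tile_diagonals t"
  shows "X \<in> rhomb_tiling.edge_pool P z"
proof -
  obtain q x y A0 B0 C0 D0 where D: "recomposed_distinct P z l q x y" and A0: "Thin A0 B0 C0 D0 \<in> P"
    and E: "(\<Union>t\<in>T. tile_edges t) = {closed_segment n p | n p. recomposed_tiling.seg P z q n p}"
    by (rule recomposition_parameters[OF T dist rt rec])
  interpret recomposed_distinct P z l q x y by (rule D)
  note segs = iteration_segments_at_points[OF T dist E A0]
  have e: "(\<Union>t\<in>T'. a_edges t) = iteration_segments1 T" "(\<Union>t\<in>T'. b_edges t) = iteration_segments2 T"
    "(\<Union>t\<in>T'. j_edges t) = iteration_segments3 T"
    using it by (simp_all only: ammann_iteration_def)
  have sub: "a_edges t \<subseteq> {closed_segment p n | n p. a_rel' n p}" "b_edges t \<subseteq> {closed_segment n p | n p. b_rel' n p}"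
    "j_edges t \<subseteq> {closed_segment n p | n p. j_rel' n p}" if "t \<in> T'" for t
    using order_trans[OF UN_upper[OF that, of a_edges, unfolded e] segs(1)] order_trans[OF UN_upper[OF that, of b_edges, unfolded e] segs(2)]
      order_trans[OF UN_upper[OF that, of j_edges, unfolded e] segs(3)] by simp_all
  have "tile_diagonals t \<subseteq> edge_pool"
    by (rule iterated_diagonals_in_pool[OF T' t sub])
  thus "X \<in> edge_pool" using X by blast
qed

theorem theorem5p3:
  fixes T T' :: "complex ammann_tile set"
    and P R :: "complex rhomb set"
    and a b d j a' b' d' j' l l' :: real
  assumes "ammann_tiling a b d j T"
    and "distinct [a, b, d, j]"
    and "underlying_penrose_tiling l P T"
    and "ammann_tiling a' b' d' j' T'"
    and "ammann_iteration T T'"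
    and "underlying_penrose_tiling l' R T'"
  shows "penrose_composition_twice l P = rhomb_region ` R"
proof -
  obtain z where Pz: "rhomb_tiling P z l"
    using penrose_tiling_imp_rhomb_tiling[OF conjunct1[OF assms(3)[unfolded underlying_penrose_tiling_def]]] by (elim exE)
  obtain y where Ry: "rhomb_tiling R y l'"
    using penrose_tiling_imp_rhomb_tiling[OF conjunct1[OF assms(6)[unfolded underlying_penrose_tiling_def]]] by (elim exE)
  interpret rhomb_tiling P z l by (rule Pz)
  interpret R: rhomb_tiling R y l' by (rule Ry)
  have rec: "arises_by_recomposition P T" using assms(3) unfolding underlying_penrose_tiling_def by (elim conjE)
  have E: "(\<Union>r\<in>R. rhomb_edges r) = (\<Union>t\<in>T'. tile_diagonals t)"
    using assms(6) unfolding underlying_penrose_tiling_def by (elim conjE)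
  have pool: "closed_segment u v \<in> edge_pool" if "r \<in> R" "arrow r e u v" for r e u v
  proof -
    have "(u, v) \<in> arrows1 r \<union> arrows2 r" using that(2) by (auto simp: arrow_def split: if_splits)
    hence "closed_segment u v \<in> rhomb_edges r" unfolding rhomb_edges_def by force
    hence "closed_segment u v \<in> (\<Union>t\<in>T'. tile_diagonals t)" unfolding E[symmetric] by (rule UN_I[OF that(1)])
    then obtain t where "t \<in> T'" "closed_segment u v \<in> tile_diagonals t" by (elim UN_E)
    from iteration_diagonals[OF assms(1,2) Pz rec assms(4,5) this] show ?thesis .
  qed
  obtain r where r: "r \<in> R" using R.cover[of 0] by blast
  have "\<exists>u v. arrow r True u v \<and> dist u v = l'"
  proof (cases r)
    case (Thin A B C D)
    hence "arrow r True A B" "dist A B = l'" using R.thin_shape[of A B C D] r by (simp_all add: arrow_def)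
    thus ?thesis by blast
  next
    case (Thick E F G H)
    hence "arrow r True E F" "dist E F = l'" using R.thick_shape[of E F G H] r by (simp_all add: arrow_def)
    thus ?thesis by blast
  qed
  then obtain u v where uv: "arrow r True u v" "dist u v = l'" by blast
  have l': "l' = l * golden" using edge_pool_length[OF pool[OF r uv(1)]] uv(2) by simp
  show ?thesis by (rule composition_of_coarser_tiling[OF Ry[unfolded l'] pool])
qed

end
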